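(* For $k\in\mathbb{Z}$ with $k\equiv 2\pmod 8$, let $W_k\subset\mathbb{P}^1\times\mathbb{P}^1\times\mathbb{P}^1$ be the surface over $\mathbb{Q}$ defined by the $(2,2,2)$-form with affine equation $$F_2(x,y,z) = x^2+y^2+z^2-4(x^2y^2+y^2z^2+z^2x^2)+16x^2y^2z^2-k = 0,$$ let $U_k \subset W_k$ be the affine surface over $\mathbb{Q}$ given by $F_2=0$ in $\mathbb{A}^3$, and let $\mathcal{U}_k$ be the integral model of $U_k$ over $\mathbb{Z}$ defined by the same equation. If $\mathcal{U}_k(\mathbb{Z})\neq\emptyset$, then there is a Brauer--Manin obstruction to strong approximation on $\mathcal{U}_k$ with respect to the element $\mathcal{A}_1=(4x^2-1,k)$, i.e. $\mathcal{U}_k(\mathbf{A}_{\mathbb{Z}})^{\mathcal{A}_1}\neq\mathcal{U}_k(\mathbf{A}_{\mathbb{Z}})$.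
   Context: Let $[x:r],[y:s],[z:t]$ be homogeneous coordinates on the three factors of $\mathbb{P}^1\times\mathbb{P}^1\times\mathbb{P}^1$; $W_k$ is the closed subscheme defined by the trihomogenization (of tridegree $(2,2,2)$) of $F_2$, and $U_k = W_k \setminus \{rst=0\} = \mathrm{Spec}\,\mathbb{Q}[x,y,z]/(F_2)$, $\mathcal{U}_k = \mathrm{Spec}\,\mathbb{Z}[x,y,z]/(F_2)$. The symbol $(f,g)$ denotes the class of the quaternion algebra attached to $f,g$ in the Brauer group of the function field; the one considered here comes from $\mathrm{Br}\,U_k=\mathrm{H}^2_{\text{ét}}(U_k,\mathbb{G}_m)$. $\mathcal{U}_k(\mathbf{A}_{\mathbb{Z}}) = \prod_{p\le\infty}\mathcal{U}_k(\mathbb{Z}_p)$ with $\mathbb{Z}_\infty=\mathbb{R}$ (by abuse of notation the real factor may be replaced by its set of connected components $\pi_0(U_k(\mathbb{R}))$, the pairing below being locally constant). There is a pairing $\mathcal{U}_k(\mathbf{A}_{\mathbb{Z}})\times \mathrm{Br}\,U_k\to\mathbb{Q}/\mathbb{Z}$, $((P_p)_p,\mathcal{B})\mapsto \sum_{p\le\infty}\mathrm{inv}_p\,\mathcal{B}(P_p)$, where $\mathrm{inv}_p:\mathrm{Br}\,\mathbb{Q}_p\to\mathbb{Q}/\mathbb{Z}$ is the local invariant map (with $\mathbb{Q}_\infty = \mathbb{R}$). $\mathcal{U}_k(\mathbf{A}_{\mathbb{Z}})^{\mathcal{A}_1}$ is the set of points pairing to $0$ with $\mathcal{A}_1$. 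*)

theory Defs
  imports
    Complex_Main
    "HOL-Algebra.Algebra"
    "HOL-Algebra.Algebraic_Closure_Type"
    "HOL-Number_Theory.Cong"
begin

section \<open>The group of rationals modulo integers\<close>

quotient_type rat_mod_int = rat / "\<lambda>x y :: rat. x - y \<in> \<int>"
proof (rule equivpI)
  show "reflp (\<lambda>x y :: rat. x - y \<in> \<int>)"
    by (rule reflpI) simp
  show "symp (\<lambda>x y :: rat. x - y \<in> \<int>)"
    by (rule sympI) (metis Ints_minus minus_diff_eq)
  show "transp (\<lambda>x y :: rat. x - y \<in> \<int>)"
  proof (rule transpI)
    fix x y z :: rat
    assume "x - y \<in> \<int>" "y - z \<in> \<int>"
    then have "(x - y) + (y - z) \<in> \<int>" by (rule Ints_add)
    then show "x - z \<in> \<int>" by simp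
  qed
qed

lift_definition mod_int :: "rat \<Rightarrow> rat_mod_int" is "\<lambda>x. x" .

instantiation rat_mod_int :: ab_group_add
begin

lift_definition zero_rat_mod_int :: rat_mod_int is 0 .

lift_definition plus_rat_mod_int :: "rat_mod_int \<Rightarrow> rat_mod_int \<Rightarrow> rat_mod_int" is "(+)"
proof -
  fix a b c d :: rat
  assume "a - b \<in> \<int>" "c - d \<in> \<int>"
  then have "(a - b) + (c - d) \<in> \<int>" by (rule Ints_add)
  then show "a + c - (b + d) \<in> \<int>" by (simp add: algebra_simps)
qed

lift_definition uminus_rat_mod_int :: "rat_mod_int \<Rightarrow> rat_mod_int" is uminus
proof -
  fix a b :: rat
  assume "a - b \<in> \<int>"
  then have "- (a - b) \<in> \<int>" by (rule Ints_minus)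
  then show "- a - - b \<in> \<int>" by simp
qed

lift_definition minus_rat_mod_int :: "rat_mod_int \<Rightarrow> rat_mod_int \<Rightarrow> rat_mod_int" is "(-)"
proof -
  fix a b c d :: rat
  assume "a - b \<in> \<int>" "c - d \<in> \<int>"
  then have "(a - b) - (c - d) \<in> \<int>" by (rule Ints_diff)
  then show "a - c - (b - d) \<in> \<int>" by (simp add: algebra_simps)
qed

instance
  by standard (transfer, simp add: algebra_simps)+

end


section \<open>The p-adic numbers\<close>

definition padic_abs :: "nat \<Rightarrow> rat \<Rightarrow> real" where
  "padic_abs p q =
     (if q = 0 then 0
      else real p powi (int (multiplicity (int p) (snd (quotient_of q)))
                        - int (multiplicity (int p) (fst (quotient_of q)))))"

definition padic_cauchy :: "nat \<Rightarrow> (nat \<Rightarrow> rat) ring" where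
  "padic_cauchy p =
     \<lparr>carrier = {s. \<forall>e>0. \<exists>N. \<forall>m\<ge>N. \<forall>n\<ge>N. padic_abs p (s m - s n) < e},
      monoid.mult = (\<lambda>s t n. s n * t n), monoid.one = (\<lambda>n. 1),
      ring.zero = (\<lambda>n. 0), ring.add = (\<lambda>s t n. s n + t n)\<rparr>"

definition padic_null :: "nat \<Rightarrow> (nat \<Rightarrow> rat) set" where
  "padic_null p = {s. (\<lambda>n. padic_abs p (s n)) \<longlonglongrightarrow> 0}"

type_synonym padic = "(nat \<Rightarrow> rat) set"

text \<open>\<open>Qp p\<close> is the completion of the rationals for the p-adic absolute value (Cauchy
  sequences modulo null sequences), and \<open>Zp p\<close> is its closed unit ball, as a ring.\<close>

definition Qp :: "nat \<Rightarrow> padic ring" where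
  "Qp p = padic_cauchy p Quot padic_null p"

definition Zp :: "nat \<Rightarrow> padic ring" where
  "Zp p = (Qp p)\<lparr>carrier := {x \<in> carrier (Qp p). \<exists>s\<in>x. \<forall>n. padic_abs p (s n) \<le> 1}\<rparr>"

abbreviation real_field :: "real ring" where
  "real_field \<equiv> ring_of_type_algebra"


section \<open>Algebras over a field and Brauer equivalence\<close>

text \<open>A (not necessarily commutative) algebra over \<open>K\<close> is represented by a
  \<^typ>\<open>('a, 'b) module\<close> record, which carries both the ring operations and the scalar
  multiplication. (The library locale \<^locale>\<open>algebra\<close> covers commutative algebras only.)\<close>

definition algebra_iso ::
  "('a, 'c) ring_scheme \<Rightarrow> ('a, 'b, 'd) module_scheme \<Rightarrow> ('a, 'e, 'f) module_scheme \<Rightarrow> ('b \<Rightarrow> 'e) set"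
where
  "algebra_iso K A B =
     {h \<in> ring_iso A B. \<forall>c\<in>carrier K. \<forall>x\<in>carrier A. h (c \<odot>\<^bsub>A\<^esub> x) = c \<odot>\<^bsub>B\<^esub> h x}"

definition base_algebra :: "('a, 'c) ring_scheme \<Rightarrow> ('a, 'a) module" where
  "base_algebra K =
     \<lparr>carrier = carrier K, monoid.mult = monoid.mult K, monoid.one = monoid.one K,
      ring.zero = ring.zero K, ring.add = ring.add K,
      module.smult = monoid.mult K\<rparr>"

definition matrix_algebra ::
  "nat \<Rightarrow> ('a, 'b, 'c) module_scheme \<Rightarrow> ('a, nat \<times> nat \<Rightarrow> 'b) module"
where
  "matrix_algebra n A =
     \<lparr>carrier = ({..<n} \<times> {..<n}) \<rightarrow>\<^sub>E carrier A,
      monoid.mult = (\<lambda>M N. \<lambda>(i, j)\<in>{..<n} \<times> {..<n}. \<Oplus>\<^bsub>A\<^esub>l\<in>{..<n}. M (i, l) \<otimes>\<^bsub>A\<^esub> N (l, j)),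
      monoid.one = (\<lambda>(i, j)\<in>{..<n} \<times> {..<n}. if i = j then \<one>\<^bsub>A\<^esub> else \<zero>\<^bsub>A\<^esub>),
      ring.zero = (\<lambda>(i, j)\<in>{..<n} \<times> {..<n}. \<zero>\<^bsub>A\<^esub>),
      ring.add = (\<lambda>M N. \<lambda>(i, j)\<in>{..<n} \<times> {..<n}. M (i, j) \<oplus>\<^bsub>A\<^esub> N (i, j)),
      module.smult = (\<lambda>c M. \<lambda>(i, j)\<in>{..<n} \<times> {..<n}. c \<odot>\<^bsub>A\<^esub> M (i, j))\<rparr>"

text \<open>Two central simple algebras have the same class in the Brauer group of \<open>K\<close> iff they
  are equivalent in the following sense.\<close>

definition brauer_equiv ::
  "('a, 'c) ring_scheme \<Rightarrow> ('a, 'b, 'd) module_scheme \<Rightarrow> ('a, 'e, 'f) module_scheme \<Rightarrow> bool"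
where
  "brauer_equiv K A B \<longleftrightarrow>
     (\<exists>m>0. \<exists>n>0. algebra_iso K (matrix_algebra m A) (matrix_algebra n B) \<noteq> {})"

text \<open>The quaternion algebra \<open>(a, b)\<close> over \<open>K\<close>: the tuple \<open>(x0, x1, x2, x3)\<close> stands for
  \<open>x0 + x1 i + x2 j + x3 ij\<close>, where \<open>i\<^sup>2 = a\<close>, \<open>j\<^sup>2 = b\<close> and \<open>ji = - ij\<close>.\<close>

definition quaternion_algebra ::
  "('a, 'c) ring_scheme \<Rightarrow> 'a \<Rightarrow> 'a \<Rightarrow> ('a, 'a \<times> 'a \<times> 'a \<times> 'a) module"
where
  "quaternion_algebra K a b =
     \<lparr>carrier = carrier K \<times> carrier K \<times> carrier K \<times> carrier K,
      monoid.mult = (\<lambda>(x0, x1, x2, x3) (y0, y1, y2, y3).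
        (x0 \<otimes>\<^bsub>K\<^esub> y0 \<oplus>\<^bsub>K\<^esub> a \<otimes>\<^bsub>K\<^esub> x1 \<otimes>\<^bsub>K\<^esub> y1 \<oplus>\<^bsub>K\<^esub> b \<otimes>\<^bsub>K\<^esub> x2 \<otimes>\<^bsub>K\<^esub> y2
           \<ominus>\<^bsub>K\<^esub> a \<otimes>\<^bsub>K\<^esub> b \<otimes>\<^bsub>K\<^esub> x3 \<otimes>\<^bsub>K\<^esub> y3,
         x0 \<otimes>\<^bsub>K\<^esub> y1 \<oplus>\<^bsub>K\<^esub> x1 \<otimes>\<^bsub>K\<^esub> y0 \<ominus>\<^bsub>K\<^esub> b \<otimes>\<^bsub>K\<^esub> x2 \<otimes>\<^bsub>K\<^esub> y3 \<oplus>\<^bsub>K\<^esub> b \<otimes>\<^bsub>K\<^esub> x3 \<otimes>\<^bsub>K\<^esub> y2,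
         x0 \<otimes>\<^bsub>K\<^esub> y2 \<oplus>\<^bsub>K\<^esub> x2 \<otimes>\<^bsub>K\<^esub> y0 \<oplus>\<^bsub>K\<^esub> a \<otimes>\<^bsub>K\<^esub> x1 \<otimes>\<^bsub>K\<^esub> y3 \<ominus>\<^bsub>K\<^esub> a \<otimes>\<^bsub>K\<^esub> x3 \<otimes>\<^bsub>K\<^esub> y1,
         x0 \<otimes>\<^bsub>K\<^esub> y3 \<oplus>\<^bsub>K\<^esub> x3 \<otimes>\<^bsub>K\<^esub> y0 \<oplus>\<^bsub>K\<^esub> x1 \<otimes>\<^bsub>K\<^esub> y2 \<ominus>\<^bsub>K\<^esub> x2 \<otimes>\<^bsub>K\<^esub> y1)),
      monoid.one = (\<one>\<^bsub>K\<^esub>, \<zero>\<^bsub>K\<^esub>, \<zero>\<^bsub>K\<^esub>, \<zero>\<^bsub>K\<^esub>),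
      ring.zero = (\<zero>\<^bsub>K\<^esub>, \<zero>\<^bsub>K\<^esub>, \<zero>\<^bsub>K\<^esub>, \<zero>\<^bsub>K\<^esub>),
      ring.add = (\<lambda>(x0, x1, x2, x3) (y0, y1, y2, y3).
        (x0 \<oplus>\<^bsub>K\<^esub> y0, x1 \<oplus>\<^bsub>K\<^esub> y1, x2 \<oplus>\<^bsub>K\<^esub> y2, x3 \<oplus>\<^bsub>K\<^esub> y3)),
      module.smult = (\<lambda>c (x0, x1, x2, x3). (c \<otimes>\<^bsub>K\<^esub> x0, c \<otimes>\<^bsub>K\<^esub> x1, c \<otimes>\<^bsub>K\<^esub> x2, c \<otimes>\<^bsub>K\<^esub> x3))\<rparr>"

text \<open>The cyclic algebra \<open>(L/K, \<sigma>, a)\<close> of degree \<open>n\<close>: the direct sum of the \<open>L u\<^sup>i\<close> for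
  \<open>i < n\<close>, where \<open>u x = \<sigma>(x) u\<close> for \<open>x\<close> in \<open>L\<close> and \<open>u\<^sup>n = a\<close>. The function \<open>f\<close> stands for
  the sum of the \<open>f(i) u\<^sup>i\<close>.\<close>

definition cyclic_algebra ::
  "('a, 'b, 'c) module_scheme \<Rightarrow> nat \<Rightarrow> ('b \<Rightarrow> 'b) \<Rightarrow> 'b \<Rightarrow> ('a, nat \<Rightarrow> 'b) module"
where
  "cyclic_algebra L n \<sigma> a =
     \<lparr>carrier = {..<n} \<rightarrow>\<^sub>E carrier L,
      monoid.mult = (\<lambda>f g. \<lambda>m\<in>{..<n}.
        finsum L
          (\<lambda>(i, j). f i \<otimes>\<^bsub>L\<^esub> (\<sigma> ^^ i) (g j) \<otimes>\<^bsub>L\<^esub> (if i + j < n then \<one>\<^bsub>L\<^esub> else a))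
          {(i, j). i < n \<and> j < n \<and> (i + j) mod n = m}),
      monoid.one = (\<lambda>m\<in>{..<n}. if m = 0 then \<one>\<^bsub>L\<^esub> else \<zero>\<^bsub>L\<^esub>),
      ring.zero = (\<lambda>m\<in>{..<n}. \<zero>\<^bsub>L\<^esub>),
      ring.add = (\<lambda>f g. \<lambda>m\<in>{..<n}. f m \<oplus>\<^bsub>L\<^esub> g m),
      module.smult = (\<lambda>c f. \<lambda>m\<in>{..<n}. c \<odot>\<^bsub>L\<^esub> f m)\<rparr>"


section \<open>Unramified extensions of the p-adic numbers\<close>

definition scalars :: "('a, 'b, 'c) module_scheme \<Rightarrow> 'a set \<Rightarrow> 'b set" where
  "scalars L S = (\<lambda>c. c \<odot>\<^bsub>L\<^esub> \<one>\<^bsub>L\<^esub>) ` S"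

text \<open>The integral closure of \<open>Zp p\<close> in \<open>L\<close>. In the HOL-Algebra representation of polynomials
  the leading coefficient comes first, so \<open>hd f = \<one>\<close> says that \<open>f\<close> is monic.\<close>

definition integer_ring :: "nat \<Rightarrow> (padic, 'b) module \<Rightarrow> (padic, 'b) module" where
  "integer_ring p L =
     L\<lparr>carrier := {x \<in> carrier L. \<exists>f. f \<noteq> [] \<and> set f \<subseteq> scalars L (carrier (Zp p)) \<and>
                     hd f = \<one>\<^bsub>L\<^esub> \<and> ring.eval L f x = \<zero>\<^bsub>L\<^esub>}\<rparr>"

definition prime_ideal_over :: "nat \<Rightarrow> (padic, 'b) module \<Rightarrow> 'b set" where
  "prime_ideal_over p L = PIdl\<^bsub>integer_ring p L\<^esub> ([p] \<cdot>\<^bsub>L\<^esub> \<one>\<^bsub>L\<^esub>)"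

definition unramified_extension :: "nat \<Rightarrow> nat \<Rightarrow> (padic, 'b) module \<Rightarrow> bool" where
  "unramified_extension p n L \<longleftrightarrow>
     algebra (Qp p) L \<and> field L \<and>
     ring.dimension L n (scalars L (carrier (Qp p))) (carrier L) \<and>
     maximalideal (prime_ideal_over p L) (integer_ring p L)"

definition is_frobenius :: "nat \<Rightarrow> (padic, 'b) module \<Rightarrow> ('b \<Rightarrow> 'b) \<Rightarrow> bool" where
  "is_frobenius p L \<sigma> \<longleftrightarrow>
     \<sigma> \<in> algebra_iso (Qp p) L L \<and>
     (\<forall>x\<in>carrier (integer_ring p L). \<sigma> x \<ominus>\<^bsub>L\<^esub> x [^]\<^bsub>L\<^esub> p \<in> prime_ideal_over p L)"


section \<open>Local invariants\<close>

text \<open>A central simple algebra over \<open>Qp p\<close> is Brauer equivalent to a cyclic algebra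
  \<open>(L/Qp p, \<sigma>, p\<^sup>r)\<close> with \<open>L\<close> the unramified extension of some degree \<open>n\<close> and \<open>\<sigma>\<close> its
  Frobenius automorphism; \<open>r/n\<close> modulo integers depends only on the Brauer class and is its
  invariant. The type \<^typ>\<open>nat \<Rightarrow> padic\<close> contains a copy of every finite extension of
  \<open>Qp p\<close>, via a basis.\<close>

definition local_inv :: "nat \<Rightarrow> (padic, 'b) module \<Rightarrow> rat_mod_int" where
  "local_inv p A =
     (SOME t. \<exists>n r. \<exists>L :: (padic, nat \<Rightarrow> padic) module. \<exists>\<sigma>.
        n > 0 \<and> unramified_extension p n L \<and> is_frobenius p L \<sigma> \<and>
        brauer_equiv (Qp p) A (cyclic_algebra L n \<sigma> ([(p ^ r)] \<cdot>\<^bsub>L\<^esub> \<one>\<^bsub>L\<^esub>)) \<and>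
        t = mod_int (of_nat r / of_nat n))"

text \<open>The Brauer group of the reals has order two.\<close>

definition real_inv :: "(real, 'b) module \<Rightarrow> rat_mod_int" where
  "real_inv A =
     (if brauer_equiv real_field A (base_algebra real_field) then 0 else mod_int (1 / 2))"


section \<open>The surface and its Brauer--Manin pairing\<close>

text \<open>\<open>U_points k R\<close> is the set of \<open>R\<close>-points of the affine scheme \<open>F2 = 0\<close> over the
  integers.\<close>

definition F2 :: "('a, 'c) ring_scheme \<Rightarrow> int \<Rightarrow> 'a \<Rightarrow> 'a \<Rightarrow> 'a \<Rightarrow> 'a" where
  "F2 R k x y z =
     x [^]\<^bsub>R\<^esub> (2::nat) \<oplus>\<^bsub>R\<^esub> y [^]\<^bsub>R\<^esub> (2::nat) \<oplus>\<^bsub>R\<^esub> z [^]\<^bsub>R\<^esub> (2::nat)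
     \<ominus>\<^bsub>R\<^esub> [(4::int)] \<cdot>\<^bsub>R\<^esub> (x [^]\<^bsub>R\<^esub> (2::nat) \<otimes>\<^bsub>R\<^esub> y [^]\<^bsub>R\<^esub> (2::nat) \<oplus>\<^bsub>R\<^esub>
         y [^]\<^bsub>R\<^esub> (2::nat) \<otimes>\<^bsub>R\<^esub> z [^]\<^bsub>R\<^esub> (2::nat) \<oplus>\<^bsub>R\<^esub>
         z [^]\<^bsub>R\<^esub> (2::nat) \<otimes>\<^bsub>R\<^esub> x [^]\<^bsub>R\<^esub> (2::nat))
     \<oplus>\<^bsub>R\<^esub> [(16::int)] \<cdot>\<^bsub>R\<^esub> (x [^]\<^bsub>R\<^esub> (2::nat) \<otimes>\<^bsub>R\<^esub> y [^]\<^bsub>R\<^esub> (2::nat) \<otimes>\<^bsub>R\<^esub> z [^]\<^bsub>R\<^esub> (2::nat))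
     \<ominus>\<^bsub>R\<^esub> [k] \<cdot>\<^bsub>R\<^esub> \<one>\<^bsub>R\<^esub>"

definition U_points :: "int \<Rightarrow> ('a, 'c) ring_scheme \<Rightarrow> ('a \<times> 'a \<times> 'a) set" where
  "U_points k R =
     {(x, y, z) \<in> carrier R \<times> carrier R \<times> carrier R. F2 R k x y z = \<zero>\<^bsub>R\<^esub>}"

text \<open>The value at a \<open>K\<close>-point of the class \<open>(4 x\<^sup>2 - 1, k)\<close>. On the surface
  \<open>(4 x\<^sup>2 - 1) (4 y\<^sup>2 - 1) (4 z\<^sup>2 - 1) = 4 k - 1\<close>, so for \<open>k \<noteq> 0\<close> both entries are
  invertible functions on the surface over the rationals; the quaternion algebra is therefore
  an Azumaya algebra on all of it, and its value at a point is obtained by specializing the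
  entries.\<close>

definition A1_at ::
  "int \<Rightarrow> ('a, 'c) ring_scheme \<Rightarrow> 'a \<times> 'a \<times> 'a \<Rightarrow> ('a, 'a \<times> 'a \<times> 'a \<times> 'a) module"
where
  "A1_at k K = (\<lambda>(x, y, z).
     quaternion_algebra K ([(4::int)] \<cdot>\<^bsub>K\<^esub> (x [^]\<^bsub>K\<^esub> (2::nat)) \<ominus>\<^bsub>K\<^esub> \<one>\<^bsub>K\<^esub>) ([k] \<cdot>\<^bsub>K\<^esub> \<one>\<^bsub>K\<^esub>))"

type_synonym adelic_point = "(nat \<Rightarrow> padic \<times> padic \<times> padic) \<times> (real \<times> real \<times> real)"

definition adelic_points :: "int \<Rightarrow> adelic_point set" where
  "adelic_points k = (\<Pi>\<^sub>E p\<in>{p. Factorial_Ring.prime p}. U_points k (Zp p)) \<times> U_points k real_field"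

text \<open>Only finitely many local invariants are nonzero; the sum is restricted to these because
  a sum over an infinite index set is zero by convention.\<close>

definition A1_pairing :: "int \<Rightarrow> adelic_point \<Rightarrow> rat_mod_int" where
  "A1_pairing k = (\<lambda>(P, P_inf).
     (\<Sum>p | Factorial_Ring.prime p \<and> local_inv p (A1_at k (Qp p) (P p)) \<noteq> 0.
        local_inv p (A1_at k (Qp p) (P p)))
     + real_inv (A1_at k real_field P_inf))"

definition A1_orthogonal :: "int \<Rightarrow> adelic_point set" where
  "A1_orthogonal k = {P \<in> adelic_points k. A1_pairing k P = 0}"

end

theory Submission imports Defs "HOL-Number_Theory.Residues" begin

text \<open>The equation is symmetric in the coordinates, and modulo 4 it reads \<open>x\<^sup>2 + y\<^sup>2 +
  z\<^sup>2 = 2\<close>. So an integral point has both even and odd coordinates, and after a permutation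
  \<open>x\<close> is even and \<open>y\<close> is odd. Consider the adelic point \<open>P\<close> given
  by \<open>(x, y, z)\<close> at all places, and the adelic point \<open>P'\<close> that differs from it
  only at the prime 2, where it is \<open>(y, x, z)\<close>. If \<open>P\<close> and \<open>P'\<close>
  both paired to zero, then the classes \<open>(4 x\<^sup>2 - 1, k)\<close> and \<open>(4 y\<^sup>2 - 1,
  k)\<close> would have the same invariant at 2. They do not.

  For even \<open>x\<close> the entry \<open>a = 4 x\<^sup>2 - 1\<close> satisfies \<open>a + k \<equiv>
  1\<close> modulo 8. Hence \<open>a + k\<close> is a dyadic square \<open>w\<^sup>2\<close> and \<open>k = w\<^sup>2 - a\<close>
  is a norm from \<open>K(\<surd>a)\<close>: the quaternion algebra splits and its invariant is zero
  (\<open>local_inv_dyadic_split\<close>). For odd \<open>y\<close> the entry \<open>a = 4 y\<^sup>2 -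
  1\<close> is 3 modulo 8. Then \<open>(a, k)\<close> is isomorphic to \<open>(a (1 - k), k)\<close>,
  where \<open>a (1 - k) \<equiv> 5\<close> modulo 8 has an unramified square root and \<open>k\<close>
  is twice a unit, thus twice a norm. So the algebra is the cyclic algebra of degree 2 over the
  unramified quadratic extension with \<open>u\<^sup>2 = 2\<close>, and its invariant is not zero
  (\<open>local_inv_quat_dyadic\<close>). At an odd prime that divides neither entry the invariant
  vanishes, because the form \<open>P\<^sup>2 - a R\<^sup>2\<close> represents \<open>k\<close>
  (\<open>local_inv_unit_entries\<close>). This makes the sums over the places finite, so that they can
  be compared term by term.\<close>

text \<open>The invariant is an arbitrary choice among the fractions \<open>r/n\<close> that arise from
  presentations of the class by a cyclic algebra \<open>(L, \<sigma>, p\<^sup>r)\<close> of degree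
  \<open>n\<close>. To evaluate it, the possible presentations have to be constrained; what is needed is
  that the class is split if and only if \<open>n\<close> divides \<open>r\<close>. An algebra of degree
  \<open>d\<close>, that is of dimension \<open>d\<^sup>2\<close>, is called split here if it has a
  module of dimension \<open>d\<close> that is a left ideal. Brauer equivalence preserves this up to the
  passage to a matrix algebra (\<open>brauer_equiv_transfer_module\<close>). A cyclic algebra of degree
  \<open>n\<close> has the field \<open>L\<close> of dimension \<open>n\<close> inside, so a module of
  dimension \<open>n\<close> is a line over \<open>L\<close>. There \<open>u\<close> acts semilinearly
  by some \<open>x\<close> in \<open>L\<close> whose norm must be \<open>p\<^sup>r\<close>
  (\<open>minimal_module_imp_dvd\<close>). But the valuation of a norm from an unramified extension of
  degree \<open>n\<close> is divisible by \<open>n\<close> (\<open>norm_p_power_dvd\<close>). This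
  elementary argument replaces the determination of the Brauer group of a local field.\<close>

section \<open>The p-adic absolute value on the rationals\<close>

locale rational_prime =
  fixes p :: nat
  assumes prime_p: "Factorial_Ring.prime p"
begin

lemma p_gt_1: "p > 1" and p_pos: "p > 0"
  using prime_p prime_gt_1_nat prime_gt_0_nat by auto

lemma prime_int_p: "Factorial_Ring.prime (int p)"
  using prime_p by simp

abbreviation vabs :: "rat \<Rightarrow> real" where "vabs \<equiv> padic_abs p"

lemma vabs_0 [simp]: "vabs 0 = 0"
  by (simp add: padic_abs_def)

lemma vabs_fract:
  assumes "a \<noteq> 0" "b \<noteq> 0"
  shows "vabs (of_int a / of_int b) =
    real p powi (int (multiplicity (int p) b) - int (multiplicity (int p) a))"
proof -
  obtain c d where cd: "quotient_of (of_int a / of_int b) = (c, d)"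
    by (cases "quotient_of (of_int a / of_int b :: rat)") auto
  have d: "d > 0" using quotient_of_denom_pos[OF cd] .
  have eq: "(of_int a / of_int b :: rat) = of_int c / of_int d" using quotient_of_div[OF cd] .
  then have "(of_int (a * d) :: rat) = of_int (c * b)"
    using assms d by (simp add: field_simps)
  then have ad: "a * d = c * b" by (simp only: of_int_eq_iff)
  then have c: "c \<noteq> 0" using assms d by auto
  have pe: "prime_elem (int p)" using prime_int_p by auto
  have "multiplicity (int p) a + multiplicity (int p) d = multiplicity (int p) c + multiplicity (int p) b"
    using ad prime_elem_multiplicity_mult_distrib[OF pe assms(1), of d]
      prime_elem_multiplicity_mult_distrib[OF pe c assms(2)] d by auto
  moreover have "(of_int a / of_int b :: rat) \<noteq> 0" using assms by simp
  ultimately show ?thesis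
    unfolding padic_abs_def cd by (auto intro!: arg_cong[where f="\<lambda>n. real p powi n"])
qed

lemma rat_fract_cases:
  obtains a b where "b \<noteq> 0" "(q::rat) = of_int a / of_int b"
  by (metis Fract_of_int_quotient Rat_cases less_irrefl)

lemma vabs_eq_0_iff [simp]: "vabs q = 0 \<longleftrightarrow> q = 0"
  using p_pos by (simp add: padic_abs_def)

lemma vabs_nonneg [simp]: "vabs q \<ge> 0"
  by (simp add: padic_abs_def)

lemma vabs_pos: "q \<noteq> 0 \<Longrightarrow> vabs q > 0"
  using vabs_nonneg[of q] vabs_eq_0_iff[of q] by linarith

lemma vabs_mult: "vabs (q * r) = vabs q * vabs r"
proof (cases "q = 0 \<or> r = 0")
  case False
  obtain a b where ab: "b \<noteq> 0" "q = of_int a / of_int b" by (rule rat_fract_cases)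
  obtain c d where cd: "d \<noteq> 0" "r = of_int c / of_int d" by (rule rat_fract_cases)
  have ac: "a \<noteq> 0" "c \<noteq> 0" using False ab cd by auto
  have pe: "prime_elem (int p)" using prime_int_p by auto
  have "q * r = of_int (a * c) / of_int (b * d)" by (simp add: ab cd)
  then have "vabs (q * r) = real p powi (int (multiplicity (int p) (b * d)) - int (multiplicity (int p) (a * c)))"
    using vabs_fract[of "a * c" "b * d"] ac ab(1) cd(1) by simp
  also have "\<dots> = real p powi ((int (multiplicity (int p) b) - int (multiplicity (int p) a)) +
     (int (multiplicity (int p) d) - int (multiplicity (int p) c)))"
    using ac ab(1) cd(1) by (simp add: prime_elem_multiplicity_mult_distrib[OF pe] algebra_simps)
  also have "\<dots> = vabs q * vabs r"
    using p_pos vabs_fract[OF ac(1) ab(1)] vabs_fract[OF ac(2) cd(1)]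
    by (simp add: power_int_add ab(2) cd(2))
  finally show ?thesis .
qed auto

lemma vabs_1 [simp]: "vabs 1 = 1"
  using vabs_mult[of 1 1] vabs_eq_0_iff[of 1] by auto

lemma vabs_minus [simp]: "vabs (- q) = vabs q"
proof -
  have "vabs (-1) * vabs (-1) = 1" using vabs_mult[of "-1" "-1"] by simp
  then have "vabs (-1) = 1"
    using vabs_nonneg[of "-1"] by (metis abs_of_nonneg real_sqrt_abs2 real_sqrt_one)
  then show ?thesis using vabs_mult[of "-1" q] by simp
qed

lemma vabs_minus_commute: "vabs (q - r) = vabs (r - q)"
  using vabs_minus[of "q - r"] by simp

lemma vabs_inverse: "vabs (inverse q) = inverse (vabs q)"
proof (cases "q = 0")
  case False
  then have "vabs q * vabs (inverse q) = 1" by (simp flip: vabs_mult)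
  then show ?thesis by (simp add: inverse_unique)
qed auto

lemma vabs_divide: "vabs (q / r) = vabs q / vabs r"
  by (simp only: divide_inverse vabs_mult vabs_inverse)

lemma vabs_power: "vabs (q ^ n) = vabs q ^ n"
  by (induction n) (auto simp: vabs_mult)

lemma vabs_p: "vabs (of_nat p) = 1 / real p"
proof -
  have "multiplicity (int p) (int p) = 1"
    using prime_int_p p_gt_1 by (intro multiplicity_self) auto
  then show ?thesis
    using vabs_fract[of "int p" 1] p_gt_1 by (simp add: power_int_minus field_simps)
qed

lemma vabs_of_int_le_1: "vabs (of_int a) \<le> 1"
proof (cases "a = 0")
  case False
  then have "vabs (of_int a) = real p powi (- int (multiplicity (int p) a))"
    using vabs_fract[of a 1] by simp
  also have "\<dots> = inverse (real p ^ multiplicity (int p) a)"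
    by (simp add: power_int_minus)
  also have "\<dots> \<le> 1"
    using p_gt_1 by (intro inverse_le_1_iff[THEN iffD2] disjI2) simp
  finally show ?thesis .
qed auto

lemma vabs_of_int_lt_1_iff: "vabs (of_int a) < 1 \<longleftrightarrow> int p dvd a"
proof (cases "a = 0")
  case False
  have pe: "prime_elem (int p)" using prime_int_p by auto
  have "vabs (of_int a) = inverse (real p ^ multiplicity (int p) a)"
    using vabs_fract[of a 1] False by (simp add: power_int_minus)
  moreover have "inverse (real p ^ multiplicity (int p) a) < 1 \<longleftrightarrow> multiplicity (int p) a > 0"
    using p_gt_1 one_less_power[of "real p" "multiplicity (int p) a"]
    by (cases "multiplicity (int p) a = 0") (auto simp: inverse_less_1_iff)
  moreover have "multiplicity (int p) a > 0 \<longleftrightarrow> int p dvd a"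
    using prime_multiplicity_gt_zero_iff[OF pe False] .
  ultimately show ?thesis by simp
qed auto

lemma vabs_of_int_coprime: "\<not> int p dvd a \<Longrightarrow> vabs (of_int a) = 1"
  using vabs_of_int_lt_1_iff[of a] vabs_of_int_le_1[of a] by linarith

lemma vabs_discrete: "q \<noteq> 0 \<Longrightarrow> \<exists>v. vabs q = real p powi v"
  unfolding padic_abs_def by auto

text \<open>Division by the larger of the two terms reduces the ultrametric inequality to the
  integrality of \<open>1 + t\<close> for integral \<open>t\<close>.\<close>

lemma vabs_add_max: "vabs (q + r) \<le> max (vabs q) (vabs r)"
proof -
  have key: "vabs (1 + t) \<le> 1" if t: "vabs t \<le> 1" for t
  proof -
    obtain a b where "quotient_of t = (a, b)" by (cases "quotient_of t") auto
    then have ab: "b > 0" "coprime a b" "t = of_int a / of_int b"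
      using quotient_of_denom_pos quotient_of_coprime quotient_of_div by auto
    have "\<not> int p dvd b"
    proof
      assume pb: "int p dvd b"
      then have "\<not> int p dvd a" using ab(2) prime_int_p
        by (metis coprime_common_divisor not_prime_unit)
      then have "a \<noteq> 0" "vabs (of_int a) = 1" using vabs_of_int_coprime by auto
      then have "vabs t = inverse (vabs (of_int b))"
        by (simp add: ab(3) divide_inverse vabs_mult vabs_inverse)
      moreover have "vabs (of_int b) < 1" "vabs (of_int b) > 0"
        using pb vabs_of_int_lt_1_iff[of b] ab(1) vabs_pos[of "of_int b"] by auto
      ultimately show False using t by (simp add: inverse_le_1_iff)
    qed
    then have b: "vabs (of_int b) = 1" by (rule vabs_of_int_coprime)
    have "1 + t = of_int (a + b) * inverse (of_int b)"
      using ab(1) by (simp add: ab(3) field_simps)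
    then have "vabs (1 + t) = vabs (of_int (a + b))"
      by (simp only: vabs_mult vabs_inverse b) simp
    then show ?thesis using vabs_of_int_le_1 by metis
  qed
  have *: "vabs (q + r) \<le> vabs q" if "vabs r \<le> vabs q" for q r
  proof (cases "q = 0")
    case False
    have "q + r = q * (1 + r / q)" using False by (simp add: field_simps)
    then have "vabs (q + r) = vabs q * vabs (1 + r / q)" by (simp only: vabs_mult)
    moreover have "vabs (r / q) \<le> 1"
      using that vabs_pos[OF False]
      by (simp add: vabs_divide)
    ultimately show ?thesis using key[of "r / q"] vabs_nonneg[of q]
      by (metis mult.right_neutral mult_left_mono)
  qed (use that in \<open>auto simp: antisym\<close>)
  show ?thesis
    using *[of r q] *[of q r] by (cases "vabs r \<le> vabs q") (auto simp: max_def add.commute)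
qed

lemma vabs_add_le: "vabs q \<le> e \<Longrightarrow> vabs r \<le> e \<Longrightarrow> vabs (q + r) \<le> e"
  using vabs_add_max[of q r] by linarith

lemma vabs_add_less: "vabs q < e \<Longrightarrow> vabs r < e \<Longrightarrow> vabs (q + r) < e"
  using vabs_add_max[of q r] by linarith

lemma vabs_diff_less: "vabs q < e \<Longrightarrow> vabs r < e \<Longrightarrow> vabs (q - r) < e"
  using vabs_add_less[of q e "- r"] by simp

lemma vabs_triangle: "vabs (q + r) \<le> vabs q + vabs r"
  using vabs_add_max[of q r] vabs_nonneg[of q] vabs_nonneg[of r] by linarith

lemma vabs_reverse_triangle: "\<bar>vabs q - vabs r\<bar> \<le> vabs (q - r)"
  using vabs_triangle[of "q - r" r] vabs_triangle[of "r - q" q] vabs_minus_commute[of q r] by simp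

lemma vabs_eq_of_diff_less: "vabs (q - r) < vabs r \<Longrightarrow> vabs q = vabs r"
  using vabs_add_max[of "q - r" r] vabs_add_max[of "r - q" q] vabs_minus_commute[of q r]
  by (auto simp: max_def split: if_splits)

text \<open>The value group is discrete.\<close>

lemma vabs_less_1_iff: "vabs q < 1 \<longleftrightarrow> vabs q \<le> 1 / real p"
proof (cases "q = 0")
  case False
  obtain v where v: "vabs q = real p powi v" using vabs_discrete[OF False] by blast
  show ?thesis
  proof
    assume "vabs q < 1"
    then have "v < 0" using v p_gt_1
      by (metis not_less of_nat_1 of_nat_less_iff one_le_power_int order_less_imp_le)
    then have "real p powi v \<le> real p powi (-1)"
      using p_gt_1 by (intro power_int_increasing) auto
    then show "vabs q \<le> 1 / real p" using v by (simp add: power_int_minus field_simps)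
  next
    assume "vabs q \<le> 1 / real p"
    also have "\<dots> < 1" using p_gt_1 by simp
    finally show "vabs q < 1" .
  qed
qed (use p_pos in auto)

section \<open>The field of p-adic numbers\<close>

abbreviation is_cauchy :: "(nat \<Rightarrow> rat) \<Rightarrow> bool" where
  "is_cauchy s \<equiv> s \<in> carrier (padic_cauchy p)"

lemma is_cauchyI:
  assumes "\<And>e. e > 0 \<Longrightarrow> \<exists>N. \<forall>m\<ge>N. \<forall>n\<ge>N. vabs (s m - s n) < e"
  shows "is_cauchy s"
  using assms by (simp add: padic_cauchy_def)

lemma is_cauchyD:
  assumes "is_cauchy s" "e > 0"
  obtains N where "\<And>m n. m \<ge> N \<Longrightarrow> n \<ge> N \<Longrightarrow> vabs (s m - s n) < e"
  using assms unfolding padic_cauchy_def by simp blast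

lemma is_cauchy_const [simp]: "is_cauchy (\<lambda>n. q)"
  by (rule is_cauchyI) auto

lemma is_cauchy_add [simp]:
  assumes "is_cauchy s" "is_cauchy t"
  shows "is_cauchy (\<lambda>n. s n + t n)"
proof (rule is_cauchyI)
  fix e :: real assume e: "e > 0"
  obtain M where M: "\<And>m n. m \<ge> M \<Longrightarrow> n \<ge> M \<Longrightarrow> vabs (s m - s n) < e"
    using is_cauchyD[OF assms(1) e] by blast
  obtain N where N: "\<And>m n. m \<ge> N \<Longrightarrow> n \<ge> N \<Longrightarrow> vabs (t m - t n) < e"
    using is_cauchyD[OF assms(2) e] by blast
  have "vabs (s m + t m - (s n + t n)) < e" if "m \<ge> max M N" "n \<ge> max M N" for m n
    using vabs_add_less[of "s m - s n" e "t m - t n"] M[of m n] N[of m n] that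
    by (simp add: algebra_simps)
  then show "\<exists>N. \<forall>m\<ge>N. \<forall>n\<ge>N. vabs (s m + t m - (s n + t n)) < e" by blast
qed

lemma is_cauchy_bounded:
  assumes "is_cauchy s"
  obtains B where "B > 0" "\<And>n. vabs (s n) \<le> B"
proof -
  obtain N where N: "\<And>m n. m \<ge> N \<Longrightarrow> n \<ge> N \<Longrightarrow> vabs (s m - s n) < 1"
    using is_cauchyD[OF assms, of 1] by auto
  define B where "B = Max (insert (vabs (s N) + 1) (vabs ` s ` {..N}))"
  have "vabs (s n) \<le> B" for n
  proof (cases "n \<le> N")
    case False
    then have "vabs (s n) \<le> vabs (s N) + 1"
      using N[of n N] vabs_reverse_triangle[of "s n" "s N"] by auto
    then show ?thesis unfolding B_def by (auto simp: Max_ge_iff)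
  qed (auto simp: B_def intro!: max.coboundedI2 Max_ge)
  moreover have "B > 0"
    using vabs_nonneg[of "s N"] unfolding B_def by (subst Max_gr_iff) (auto intro: add_nonneg_pos)
  ultimately show ?thesis using that by blast
qed

lemma is_cauchy_mult [simp]:
  assumes "is_cauchy s" "is_cauchy t"
  shows "is_cauchy (\<lambda>n. s n * t n)"
proof (rule is_cauchyI)
  fix e :: real assume e: "e > 0"
  obtain B where B: "B > 0" "\<And>n. vabs (s n) \<le> B" using is_cauchy_bounded[OF assms(1)] by blast
  obtain C where C: "C > 0" "\<And>n. vabs (t n) \<le> C" using is_cauchy_bounded[OF assms(2)] by blast
  have eB: "e / B > 0" "e / C > 0" using e B C by auto
  obtain M where M: "\<And>m n. m \<ge> M \<Longrightarrow> n \<ge> M \<Longrightarrow> vabs (s m - s n) < e / C"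
    using is_cauchyD[OF assms(1) eB(2)] by blast
  obtain N where N: "\<And>m n. m \<ge> N \<Longrightarrow> n \<ge> N \<Longrightarrow> vabs (t m - t n) < e / B"
    using is_cauchyD[OF assms(2) eB(1)] by blast
  have "vabs (s m * t m - s n * t n) < e" if "m \<ge> max M N" "n \<ge> max M N" for m n
  proof -
    have "vabs (s m * (t m - t n)) \<le> B * vabs (t m - t n)"
      using B(2)[of m] by (simp add: vabs_mult mult_right_mono)
    also have "\<dots> < B * (e / B)" using N[of m n] that B(1) by (intro mult_strict_left_mono) auto
    finally have 1: "vabs (s m * (t m - t n)) < e" using B(1) by simp
    have "vabs ((s m - s n) * t n) \<le> vabs (s m - s n) * C"
      using C(2)[of n] by (simp add: vabs_mult mult_left_mono)
    also have "\<dots> < (e / C) * C" using M[of m n] that C(1) by (intro mult_strict_right_mono) auto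
    finally have 2: "vabs ((s m - s n) * t n) < e" using C(1) by simp
    have "s m * t m - s n * t n = s m * (t m - t n) + (s m - s n) * t n"
      by (simp add: algebra_simps)
    then show ?thesis using vabs_add_less[OF 1 2] by simp
  qed
  then show "\<exists>N. \<forall>m\<ge>N. \<forall>n\<ge>N. vabs (s m * t m - s n * t n) < e" by blast
qed

lemma is_cauchy_minus [simp]: "is_cauchy s \<Longrightarrow> is_cauchy (\<lambda>n. - s n)"
  using is_cauchy_mult[of "\<lambda>n. -1" s] by simp

lemma is_cauchy_diff [simp]: "is_cauchy s \<Longrightarrow> is_cauchy t \<Longrightarrow> is_cauchy (\<lambda>n. s n - t n)"
  using is_cauchy_add[of s "\<lambda>n. - t n"] by simp

lemma cauchy_ring_simps [simp]:
  "s \<otimes>\<^bsub>padic_cauchy p\<^esub> t = (\<lambda>n. s n * t n)" "s \<oplus>\<^bsub>padic_cauchy p\<^esub> t = (\<lambda>n. s n + t n)"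
  "\<one>\<^bsub>padic_cauchy p\<^esub> = (\<lambda>n. 1)" "\<zero>\<^bsub>padic_cauchy p\<^esub> = (\<lambda>n. 0)"
  by (simp_all add: padic_cauchy_def)

lemma cring_cauchy: "cring (padic_cauchy p)"
proof (rule cringI)
  show "abelian_group (padic_cauchy p)"
  proof (rule abelian_groupI)
    fix s assume "is_cauchy s"
    then have "is_cauchy (\<lambda>n. - s n)" "(\<lambda>n. - s n) \<oplus>\<^bsub>padic_cauchy p\<^esub> s = \<zero>\<^bsub>padic_cauchy p\<^esub>"
      by auto
    then show "\<exists>t\<in>carrier (padic_cauchy p). t \<oplus>\<^bsub>padic_cauchy p\<^esub> s = \<zero>\<^bsub>padic_cauchy p\<^esub>" by blast
  qed (auto simp: algebra_simps)
  show "Group.comm_monoid (padic_cauchy p)"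
    by (rule comm_monoidI) (auto simp: algebra_simps)
qed (auto simp: algebra_simps)

sublocale cauchy: cring "padic_cauchy p" by (rule cring_cauchy)

lemma null_iff: "s \<in> padic_null p \<longleftrightarrow> (\<forall>e>0. \<exists>N. \<forall>n\<ge>N. vabs (s n) < e)"
  by (auto simp: padic_null_def LIMSEQ_def)

lemma null_is_cauchy:
  assumes "s \<in> padic_null p" shows "is_cauchy s"
proof (rule is_cauchyI)
  fix e :: real assume "e > 0"
  then obtain N where "\<And>n. n \<ge> N \<Longrightarrow> vabs (s n) < e" using assms by (auto simp: null_iff)
  then have "\<forall>m\<ge>N. \<forall>n\<ge>N. vabs (s m - s n) < e" by (auto intro: vabs_diff_less)
  then show "\<exists>N. \<forall>m\<ge>N. \<forall>n\<ge>N. vabs (s m - s n) < e" by blast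
qed

lemma null_add:
  assumes "s \<in> padic_null p" "t \<in> padic_null p" shows "(\<lambda>n. s n + t n) \<in> padic_null p"
  unfolding null_iff
proof (intro allI impI)
  fix e :: real assume e: "e > 0"
  obtain M where "\<And>n. n \<ge> M \<Longrightarrow> vabs (s n) < e" using assms(1) e by (auto simp: null_iff)
  moreover obtain N where "\<And>n. n \<ge> N \<Longrightarrow> vabs (t n) < e" using assms(2) e by (auto simp: null_iff)
  ultimately have "\<forall>n\<ge>max M N. vabs (s n + t n) < e" by (auto intro: vabs_add_less)
  then show "\<exists>N. \<forall>n\<ge>N. vabs (s n + t n) < e" by blast
qed

lemma null_mult:
  assumes "s \<in> padic_null p" "is_cauchy t" shows "(\<lambda>n. t n * s n) \<in> padic_null p"
  unfolding null_iff
proof (intro allI impI)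
  fix e :: real assume e: "e > 0"
  obtain B where B: "B > 0" "\<And>n. vabs (t n) \<le> B" using is_cauchy_bounded[OF assms(2)] by blast
  then have "e / B > 0" using e by simp
  then obtain N where N: "\<And>n. n \<ge> N \<Longrightarrow> vabs (s n) < e / B" using assms(1) by (auto simp: null_iff)
  have "vabs (t n * s n) < e" if "n \<ge> N" for n
  proof -
    have "vabs (t n * s n) \<le> B * vabs (s n)" using B(2)[of n] by (simp add: vabs_mult mult_right_mono)
    also have "\<dots> < B * (e / B)" using N[OF that] B(1) by (intro mult_strict_left_mono) auto
    finally show ?thesis using B(1) by simp
  qed
  then show "\<exists>N. \<forall>n\<ge>N. vabs (t n * s n) < e" by blast
qed

lemma cauchy_a_inv: "is_cauchy s \<Longrightarrow> \<ominus>\<^bsub>padic_cauchy p\<^esub> s = (\<lambda>n. - s n)"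
  by (rule cauchy.minus_equality) auto

lemma cauchy_a_minus:
  "is_cauchy s \<Longrightarrow> is_cauchy t \<Longrightarrow> s \<ominus>\<^bsub>padic_cauchy p\<^esub> t = (\<lambda>n. s n - t n)"
  by (simp add: a_minus_def cauchy_a_inv)

lemma ideal_null: "ideal (padic_null p) (padic_cauchy p)"
proof (rule idealI[OF cauchy.ring_axioms])
  show "subgroup (padic_null p) (add_monoid (padic_cauchy p))"
  proof (rule cauchy.add.subgroupI)
    show "padic_null p \<subseteq> carrier (padic_cauchy p)" using null_is_cauchy by blast
    have "(\<lambda>n. 0) \<in> padic_null p" by (simp add: null_iff)
    then show "padic_null p \<noteq> {}" by blast
    fix s assume s: "s \<in> padic_null p"
    then show "\<ominus>\<^bsub>padic_cauchy p\<^esub> s \<in> padic_null p"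
      using null_mult[OF s, of "\<lambda>n. -1"] by (simp add: cauchy_a_inv null_is_cauchy)
    fix t assume "t \<in> padic_null p"
    then show "s \<oplus>\<^bsub>padic_cauchy p\<^esub> t \<in> padic_null p" using null_add[OF s] by simp
  qed
next
  fix a x assume "a \<in> padic_null p" "is_cauchy x"
  then show "x \<otimes>\<^bsub>padic_cauchy p\<^esub> a \<in> padic_null p" "a \<otimes>\<^bsub>padic_cauchy p\<^esub> x \<in> padic_null p"
    using null_mult[of a x] by (auto simp: mult.commute)
qed

sublocale null: ideal "padic_null p" "padic_cauchy p" by (rule ideal_null)

definition cls :: "(nat \<Rightarrow> rat) \<Rightarrow> padic" where
  "cls s = padic_null p +>\<^bsub>padic_cauchy p\<^esub> s"

lemma cring_Qp: "cring (Qp p)"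
  unfolding Qp_def by (rule null.quotient_is_cring[OF cring_cauchy])

sublocale Q: cring "Qp p" by (rule cring_Qp)

lemma cls_hom: "cls \<in> ring_hom (padic_cauchy p) (Qp p)"
  unfolding Qp_def cls_def by (rule null.rcos_ring_hom)

lemma cls_closed [simp]: "is_cauchy s \<Longrightarrow> cls s \<in> carrier (Qp p)"
  using cls_hom by (rule ring_hom_closed)

lemma cls_mult: "is_cauchy s \<Longrightarrow> is_cauchy t \<Longrightarrow> cls s \<otimes>\<^bsub>Qp p\<^esub> cls t = cls (\<lambda>n. s n * t n)"
  using ring_hom_mult[OF cls_hom] by simp

lemma cls_add: "is_cauchy s \<Longrightarrow> is_cauchy t \<Longrightarrow> cls s \<oplus>\<^bsub>Qp p\<^esub> cls t = cls (\<lambda>n. s n + t n)"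
  using ring_hom_add[OF cls_hom] by simp

lemma cls_one: "\<one>\<^bsub>Qp p\<^esub> = cls (\<lambda>n. 1)"
  using ring_hom_one[OF cls_hom] by simp

lemma cls_zero: "\<zero>\<^bsub>Qp p\<^esub> = cls (\<lambda>n. 0)"
  using ring_hom_zero[OF cls_hom cauchy.ring_axioms Q.ring_axioms] by simp

lemma cls_a_inv: "is_cauchy s \<Longrightarrow> \<ominus>\<^bsub>Qp p\<^esub> cls s = cls (\<lambda>n. - s n)"
  by (rule Q.minus_equality) (auto simp: cls_add cls_zero)

lemma cls_a_minus: "is_cauchy s \<Longrightarrow> is_cauchy t \<Longrightarrow> cls s \<ominus>\<^bsub>Qp p\<^esub> cls t = cls (\<lambda>n. s n - t n)"
  by (simp add: a_minus_def cls_a_inv cls_add)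

text \<open>Every p-adic number is the class of a Cauchy sequence. These rules thus reduce a ring
  identity between p-adic numbers to the same identity between rational numbers, where simplification
  decides it. The polynomial identities in quadratic extensions and in quaternion algebras are all
  proved in this way.\<close>

lemmas cls_simps = cls_mult cls_add cls_one cls_zero cls_a_inv cls_a_minus

lemma cls_eq_iff:
  "is_cauchy s \<Longrightarrow> is_cauchy t \<Longrightarrow> cls s = cls t \<longleftrightarrow> (\<lambda>n. s n - t n) \<in> padic_null p"
  unfolding cls_def using cauchy.quotient_eq_iff_same_a_r_cos[OF ideal_null, of s t]
  by (simp add: cauchy_a_minus)

lemma mem_cls_iff: "is_cauchy s \<Longrightarrow> t \<in> cls s \<longleftrightarrow> is_cauchy t \<and> cls t = cls s"
  unfolding cls_def
  by (metis null.a_rcos_self null.a_repr_independence' null.a_elemrcos_carrier)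

lemma Qp_cases:
  assumes "x \<in> carrier (Qp p)"
  obtains s where "is_cauchy s" "x = cls s"
  using assms unfolding Qp_def FactRing_def cls_def A_RCOSETS_def' by auto

subsection \<open>The norm\<close>

text \<open>Away from null sequences, the absolute value of a Cauchy sequence is eventually constant.
  This is what makes the completion a field and its norm discretely valued.\<close>

lemma cauchy_vabs_eventually_const:
  assumes "is_cauchy s" "s \<notin> padic_null p"
  obtains N where "\<And>n. n \<ge> N \<Longrightarrow> vabs (s n) = vabs (s N)" "s N \<noteq> 0"
proof -
  obtain e where e: "e > 0" "\<And>N. \<exists>n\<ge>N. vabs (s n) \<ge> e"
    using assms(2) by (auto simp: null_iff not_less)
  obtain N where N: "\<And>m n. m \<ge> N \<Longrightarrow> n \<ge> N \<Longrightarrow> vabs (s m - s n) < e"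
    using is_cauchyD[OF assms(1) e(1)] by blast
  obtain M where M: "M \<ge> N" "vabs (s M) \<ge> e" using e(2) by blast
  have "vabs (s n) = vabs (s M)" if "n \<ge> M" for n
    using N[of n M] M that by (intro vabs_eq_of_diff_less) auto
  moreover have "s M \<noteq> 0" using M(2) e(1) by auto
  ultimately show ?thesis using that by blast
qed

text \<open>The sequences in one class differ by null sequences, so the limit does not depend on the
  chosen representative.\<close>

definition qnorm :: "padic \<Rightarrow> real" where
  "qnorm x = lim (\<lambda>n. vabs ((SOME s. s \<in> x) n))"

lemma qnorm_cls:
  assumes "is_cauchy s"
  shows "(\<lambda>n. vabs (s n)) \<longlonglongrightarrow> qnorm (cls s)"
proof -
  have conv: "\<exists>l. (\<lambda>n. vabs (s n)) \<longlonglongrightarrow> l"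
  proof (cases "s \<in> padic_null p")
    case False
    obtain N where N: "\<And>n. n \<ge> N \<Longrightarrow> vabs (s n) = vabs (s N)"
      using cauchy_vabs_eventually_const[OF assms False] by blast
    then have "eventually (\<lambda>n. vabs (s n) = vabs (s N)) sequentially"
      using eventually_sequentially by blast
    then have "(\<lambda>n. vabs (s n)) \<longlonglongrightarrow> vabs (s N)" by (rule tendsto_eventually)
    then show ?thesis ..
  qed (auto simp: padic_null_def)
  then obtain l where l: "(\<lambda>n. vabs (s n)) \<longlonglongrightarrow> l" ..
  define t where "t = (SOME t. t \<in> cls s)"
  have "s \<in> cls s" using assms by (simp add: mem_cls_iff)
  then have "t \<in> cls s" unfolding t_def by (rule someI[of "\<lambda>t. t \<in> cls s"])
  then have t: "is_cauchy t" "cls t = cls s" using assms by (auto simp: mem_cls_iff)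
  then have "(\<lambda>n. t n - s n) \<in> padic_null p" using cls_eq_iff[OF t(1) assms] by simp
  then have 0: "(\<lambda>n. vabs (t n - s n)) \<longlonglongrightarrow> 0" by (simp add: padic_null_def)
  have "(\<lambda>n. vabs (t n) - vabs (s n)) \<longlonglongrightarrow> 0"
    by (rule tendsto_0_le[OF 0, of _ 1]) (auto intro!: always_eventually simp: vabs_reverse_triangle)
  from tendsto_add[OF this l] have "(\<lambda>n. vabs (t n)) \<longlonglongrightarrow> l" by simp
  then have "qnorm (cls s) = l" unfolding qnorm_def t_def[symmetric] by (rule limI)
  then show ?thesis using l by simp
qed

lemma qnorm_unique:
  "is_cauchy s \<Longrightarrow> (\<lambda>n. vabs (s n)) \<longlonglongrightarrow> l \<Longrightarrow> qnorm (cls s) = l"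
  using qnorm_cls LIMSEQ_unique by blast

lemma qnorm_const [simp]: "qnorm (cls (\<lambda>n. q)) = vabs q"
  by (rule qnorm_unique) auto

lemma qnorm_0 [simp]: "qnorm \<zero>\<^bsub>Qp p\<^esub> = 0" and qnorm_1 [simp]: "qnorm \<one>\<^bsub>Qp p\<^esub> = 1"
  by (simp_all add: cls_simps)

lemma qnorm_nonneg: "x \<in> carrier (Qp p) \<Longrightarrow> qnorm x \<ge> 0"
  by (erule Qp_cases) (auto intro!: LIMSEQ_le_const[OF qnorm_cls])

lemma qnorm_mult:
  assumes "x \<in> carrier (Qp p)" "y \<in> carrier (Qp p)"
  shows "qnorm (x \<otimes>\<^bsub>Qp p\<^esub> y) = qnorm x * qnorm y"
proof -
  obtain s where s: "is_cauchy s" "x = cls s" using assms(1) by (rule Qp_cases)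
  obtain t where t: "is_cauchy t" "y = cls t" using assms(2) by (rule Qp_cases)
  have "(\<lambda>n. vabs (s n * t n)) \<longlonglongrightarrow> qnorm x * qnorm y"
    unfolding vabs_mult s(2) t(2) by (intro tendsto_mult qnorm_cls s t)
  then show ?thesis using s t by (simp add: cls_simps qnorm_unique)
qed

lemma qnorm_add_max:
  assumes "x \<in> carrier (Qp p)" "y \<in> carrier (Qp p)"
  shows "qnorm (x \<oplus>\<^bsub>Qp p\<^esub> y) \<le> max (qnorm x) (qnorm y)"
proof -
  obtain s where s: "is_cauchy s" "x = cls s" using assms(1) by (rule Qp_cases)
  obtain t where t: "is_cauchy t" "y = cls t" using assms(2) by (rule Qp_cases)
  have "(\<lambda>n. vabs (s n + t n)) \<longlonglongrightarrow> qnorm (x \<oplus>\<^bsub>Qp p\<^esub> y)"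
    using s t qnorm_cls[of "\<lambda>n. s n + t n"] by (simp add: cls_simps)
  moreover have "(\<lambda>n. max (vabs (s n)) (vabs (t n))) \<longlonglongrightarrow> max (qnorm x) (qnorm y)"
    unfolding s(2) t(2) by (intro tendsto_max qnorm_cls s t)
  ultimately show ?thesis by (rule LIMSEQ_le) (use vabs_add_max in blast)
qed

lemma qnorm_minus [simp]: "x \<in> carrier (Qp p) \<Longrightarrow> qnorm (\<ominus>\<^bsub>Qp p\<^esub> x) = qnorm x"
  by (erule Qp_cases) (auto simp: cls_simps intro!: qnorm_unique qnorm_cls)

lemma qnorm_eventually:
  assumes "is_cauchy s" "cls s \<noteq> \<zero>\<^bsub>Qp p\<^esub>"
  obtains N where "\<And>n. n \<ge> N \<Longrightarrow> vabs (s n) = qnorm (cls s)" "qnorm (cls s) \<noteq> 0"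
proof -
  have "s \<notin> padic_null p" using assms cls_eq_iff[of s "\<lambda>n. 0"] by (simp add: cls_zero)
  then obtain N where N: "\<And>n. n \<ge> N \<Longrightarrow> vabs (s n) = vabs (s N)" "s N \<noteq> 0"
    using cauchy_vabs_eventually_const[OF assms(1)] by blast
  then have "eventually (\<lambda>n. vabs (s n) = vabs (s N)) sequentially"
    using eventually_sequentially by blast
  then have q: "qnorm (cls s) = vabs (s N)"
    using assms(1) by (intro qnorm_unique tendsto_eventually)
  show ?thesis
  proof (rule that)
    show "vabs (s n) = qnorm (cls s)" if "n \<ge> N" for n using N(1)[OF that] q by simp
    show "qnorm (cls s) \<noteq> 0" using N(2) q by simp
  qed
qed

lemma qnorm_attained:
  assumes "x \<in> carrier (Qp p)" "x \<noteq> \<zero>\<^bsub>Qp p\<^esub>"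
  obtains q where "q \<noteq> 0" "qnorm x = vabs q"
proof -
  obtain s where s: "is_cauchy s" "x = cls s" using assms(1) by (rule Qp_cases)
  obtain N where N: "\<And>n. n \<ge> N \<Longrightarrow> vabs (s n) = qnorm x" "qnorm x \<noteq> 0"
    using qnorm_eventually[of s] s assms(2) by blast
  have "vabs (s N) = qnorm x" by (rule N(1)) simp
  then show ?thesis using N(2) by (intro that[of "s N"]) auto
qed

lemma qnorm_eq_0_iff:
  assumes "x \<in> carrier (Qp p)"
  shows "qnorm x = 0 \<longleftrightarrow> x = \<zero>\<^bsub>Qp p\<^esub>"
proof
  assume "qnorm x = 0"
  then show "x = \<zero>\<^bsub>Qp p\<^esub>" using qnorm_attained[OF assms] vabs_eq_0_iff by metis
qed simp

lemma qnorm_discrete: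
  assumes "x \<in> carrier (Qp p)" "x \<noteq> \<zero>\<^bsub>Qp p\<^esub>"
  obtains v where "qnorm x = real p powi v"
proof -
  obtain q where "q \<noteq> 0" "qnorm x = vabs q" using qnorm_attained[OF assms] .
  then show ?thesis using vabs_discrete[of q] that by auto
qed

lemma qnorm_less_1_iff:
  assumes "x \<in> carrier (Qp p)"
  shows "qnorm x < 1 \<longleftrightarrow> qnorm x \<le> 1 / real p"
proof (cases "x = \<zero>\<^bsub>Qp p\<^esub>")
  case False
  obtain q where "qnorm x = vabs q" using qnorm_attained[OF assms False] .
  then show ?thesis using vabs_less_1_iff[of q] by simp
qed (use p_pos in auto)

text \<open>A representative of a nonzero class is eventually of constant nonzero absolute value, so its
  termwise inverse is a Cauchy sequence as well.\<close>

lemma field_Qp: "field (Qp p)"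
proof (rule Q.cring_fieldI2)
  show "\<zero>\<^bsub>Qp p\<^esub> \<noteq> \<one>\<^bsub>Qp p\<^esub>" using qnorm_0 qnorm_1 by force
  fix x assume "x \<in> carrier (Qp p)" and x0: "x \<noteq> \<zero>\<^bsub>Qp p\<^esub>"
  then obtain s where s: "is_cauchy s" "x = cls s" by (auto elim: Qp_cases)
  obtain N where N: "\<And>n. n \<ge> N \<Longrightarrow> vabs (s n) = qnorm x" "qnorm x \<noteq> 0"
    using qnorm_eventually[of s] s x0 by blast
  have q: "qnorm x > 0" using N(2) qnorm_nonneg[of x] s by auto
  have s0: "s n \<noteq> 0" if "n \<ge> N" for n using N(1)[OF that] N(2) by auto
  have t: "is_cauchy (\<lambda>n. inverse (s n))"
  proof (rule is_cauchyI)
    fix e :: real assume "e > 0"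
    then have "e * (qnorm x * qnorm x) > 0" using q by simp
    then obtain M where M: "\<And>m n. m \<ge> M \<Longrightarrow> n \<ge> M \<Longrightarrow> vabs (s m - s n) < e * (qnorm x * qnorm x)"
      using is_cauchyD[OF s(1)] by blast
    have "vabs (inverse (s m) - inverse (s n)) < e" if mn: "m \<ge> max M N" "n \<ge> max M N" for m n
    proof -
      have "inverse (s m) - inverse (s n) = (s n - s m) / (s m * s n)"
        using s0[of m] s0[of n] mn by (simp add: field_simps)
      then have "vabs (inverse (s m) - inverse (s n)) = vabs (s n - s m) / (qnorm x * qnorm x)"
        using N(1)[of m] N(1)[of n] mn by (simp add: vabs_divide vabs_mult)
      also have "\<dots> < e" using M[of n m] mn q by (simp add: pos_divide_less_eq)
      finally show ?thesis .
    qed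
    then show "\<exists>N. \<forall>m\<ge>N. \<forall>n\<ge>N. vabs (inverse (s m) - inverse (s n)) < e" by blast
  qed
  have "(\<lambda>n. s n * inverse (s n) - 1) \<in> padic_null p"
    unfolding null_iff using s0 by (auto intro!: exI[of _ N])
  then have "x \<otimes>\<^bsub>Qp p\<^esub> cls (\<lambda>n. inverse (s n)) = \<one>\<^bsub>Qp p\<^esub>"
    using s t by (simp add: cls_simps cls_eq_iff)
  then show "\<exists>b\<in>carrier (Qp p). x \<otimes>\<^bsub>Qp p\<^esub> b = \<one>\<^bsub>Qp p\<^esub>"
    using cls_closed[OF t] by (rule bexI)
qed

sublocale Q: field "Qp p" by (rule field_Qp)

end

context rational_prime begin

subsection \<open>The ring of p-adic integers\<close>

text \<open>A p-adic integer has a representative all of whose terms are integral, whereas the norm of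
  its class only controls the terms from some index on. Dropping an initial segment does not change the
  class.\<close>

lemma is_cauchy_shift: "is_cauchy s \<Longrightarrow> is_cauchy (\<lambda>n. s (n + k))"
proof (rule is_cauchyI)
  fix e :: real assume "is_cauchy s" "e > 0"
  then obtain N where N: "\<And>m n. m \<ge> N \<Longrightarrow> n \<ge> N \<Longrightarrow> vabs (s m - s n) < e"
    using is_cauchyD by blast
  then have "\<forall>m\<ge>N. \<forall>n\<ge>N. vabs (s (m + k) - s (n + k)) < e" by auto
  then show "\<exists>N. \<forall>m\<ge>N. \<forall>n\<ge>N. vabs (s (m + k) - s (n + k)) < e" by blast
qed

lemma cls_shift:
  assumes "is_cauchy s" shows "cls (\<lambda>n. s (n + k)) = cls s"
proof -
  have "(\<lambda>n. s (n + k) - s n) \<in> padic_null p"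
    unfolding null_iff
  proof (intro allI impI)
    fix e :: real assume "e > 0"
    then obtain N where N: "\<And>m n. m \<ge> N \<Longrightarrow> n \<ge> N \<Longrightarrow> vabs (s m - s n) < e"
      using is_cauchyD[OF assms] by blast
    then have "\<forall>n\<ge>N. vabs (s (n + k) - s n) < e" by auto
    then show "\<exists>N. \<forall>n\<ge>N. vabs (s (n + k) - s n) < e" by blast
  qed
  then show ?thesis using assms is_cauchy_shift[OF assms] by (simp add: cls_eq_iff)
qed

lemma Zp_simps [simp]:
  "monoid.mult (Zp p) = monoid.mult (Qp p)" "ring.add (Zp p) = ring.add (Qp p)"
  "\<one>\<^bsub>Zp p\<^esub> = \<one>\<^bsub>Qp p\<^esub>" "\<zero>\<^bsub>Zp p\<^esub> = \<zero>\<^bsub>Qp p\<^esub>"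
  by (simp_all add: Zp_def)

lemma Zp_eq: "Zp p = (Qp p)\<lparr>carrier := carrier (Zp p)\<rparr>"
  by (simp add: Zp_def)

lemma Zp_repr:
  assumes "x \<in> carrier (Zp p)"
  obtains s where "is_cauchy s" "x = cls s" "\<And>n. vabs (s n) \<le> 1"
proof -
  have xQ: "x \<in> carrier (Qp p)" using assms by (simp add: Zp_def)
  obtain s where s: "s \<in> x" "\<And>n. vabs (s n) \<le> 1" using assms by (auto simp: Zp_def)
  obtain t where t: "is_cauchy t" "x = cls t" using xQ by (rule Qp_cases)
  have "is_cauchy s" "x = cls s" using s(1) t by (auto simp: mem_cls_iff)
  then show ?thesis using s(2) that by blast
qed

lemma Zp_iff: "x \<in> carrier (Zp p) \<longleftrightarrow> x \<in> carrier (Qp p) \<and> qnorm x \<le> 1"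
proof safe
  assume x: "x \<in> carrier (Zp p)"
  then show xQ: "x \<in> carrier (Qp p)" by (simp add: Zp_def)
  obtain s where "is_cauchy s" "x = cls s" "\<And>n. vabs (s n) \<le> 1" using Zp_repr[OF x] by blast
  then show "qnorm x \<le> 1" by (auto intro!: LIMSEQ_le_const2[OF qnorm_cls])
next
  assume x: "x \<in> carrier (Qp p)" "qnorm x \<le> 1"
  obtain s where s: "is_cauchy s" "x = cls s" using x(1) by (rule Qp_cases)
  have "\<exists>s. is_cauchy s \<and> x = cls s \<and> (\<forall>n. vabs (s n) \<le> 1)"
  proof (cases "x = \<zero>\<^bsub>Qp p\<^esub>")
    case True
    then show ?thesis by (intro exI[of _ "\<lambda>n. 0"]) (auto simp: cls_zero)
  next
    case False
    then obtain N where N: "\<And>n. n \<ge> N \<Longrightarrow> vabs (s n) = qnorm x"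
      using qnorm_eventually[of s] s by blast
    then show ?thesis using s x(2)
      by (intro exI[of _ "\<lambda>n. s (n + N)"]) (auto simp: cls_shift is_cauchy_shift)
  qed
  then show "x \<in> carrier (Zp p)" using x(1) by (auto simp: Zp_def mem_cls_iff)
qed

lemma Zp_closed [simp]: "x \<in> carrier (Zp p) \<Longrightarrow> x \<in> carrier (Qp p)"
  and Zp_norm: "x \<in> carrier (Zp p) \<Longrightarrow> qnorm x \<le> 1"
  and ZpI: "x \<in> carrier (Qp p) \<Longrightarrow> qnorm x \<le> 1 \<Longrightarrow> x \<in> carrier (Zp p)"
  by (simp_all add: Zp_iff)

lemma subring_Zp: "subring (carrier (Zp p)) (Qp p)"
proof (rule Q.subringI)
  fix x y assume xy: "x \<in> carrier (Zp p)" "y \<in> carrier (Zp p)"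
  have "qnorm x * qnorm y \<le> 1 * 1"
    using xy by (intro mult_mono) (auto simp: Zp_norm qnorm_nonneg)
  then show "x \<otimes>\<^bsub>Qp p\<^esub> y \<in> carrier (Zp p)" using xy by (intro ZpI) (auto simp: qnorm_mult)
  have "qnorm (x \<oplus>\<^bsub>Qp p\<^esub> y) \<le> 1"
    using qnorm_add_max[of x y] xy Zp_norm[of x] Zp_norm[of y] by auto
  then show "x \<oplus>\<^bsub>Qp p\<^esub> y \<in> carrier (Zp p)" using xy by (intro ZpI) auto
next
  show "carrier (Zp p) \<subseteq> carrier (Qp p)" by auto
  show "\<one>\<^bsub>Qp p\<^esub> \<in> carrier (Zp p)" by (rule ZpI) auto
  fix x assume "x \<in> carrier (Zp p)"
  then have "x \<in> carrier (Qp p)" "qnorm x \<le> 1" by (rule Zp_closed, rule Zp_norm)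
  then show "\<ominus>\<^bsub>Qp p\<^esub> x \<in> carrier (Zp p)"
    by (intro ZpI) simp_all
qed

lemmas Zp_add = subringE(7)[OF subring_Zp] and Zp_mult = subringE(6)[OF subring_Zp]
  and Zp_a_inv = subringE(5)[OF subring_Zp] and Zp_zero = subringE(2)[OF subring_Zp]
  and Zp_one = subringE(3)[OF subring_Zp]

lemma Zp_minus: "x \<in> carrier (Zp p) \<Longrightarrow> y \<in> carrier (Zp p) \<Longrightarrow> x \<ominus>\<^bsub>Qp p\<^esub> y \<in> carrier (Zp p)"
  by (simp add: a_minus_def Zp_add Zp_a_inv)

lemma Zp_pow:
  assumes "x \<in> carrier (Zp p)" shows "x [^]\<^bsub>Qp p\<^esub> (n::nat) \<in> carrier (Zp p)"
proof (induction n)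
  case 0
  show ?case using Zp_one by simp
next
  case (Suc n)
  then show ?case using Zp_mult[OF Suc assms] by simp
qed

lemma cring_Zp: "cring (Zp p)"
proof -
  have "ring (Zp p)" using Q.subring_is_ring[OF subring_Zp] by (simp only: Zp_eq[symmetric])
  then interpret Z: ring "Zp p" .
  show ?thesis by unfold_locales (simp add: Q.m_comm)
qed

lemma qnorm_inv:
  assumes "x \<in> carrier (Qp p)" "x \<noteq> \<zero>\<^bsub>Qp p\<^esub>"
  shows "qnorm (inv\<^bsub>Qp p\<^esub> x) = inverse (qnorm x)"
proof -
  have u: "x \<in> Units (Qp p)" using assms by (simp add: Q.field_Units)
  then have "qnorm x * qnorm (inv\<^bsub>Qp p\<^esub> x) = 1"
    using assms qnorm_mult[of x "inv\<^bsub>Qp p\<^esub> x"] by simp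
  then show ?thesis by (simp add: inverse_unique)
qed

subsection \<open>Rational numbers inside the p-adic numbers\<close>

definition emb :: "rat \<Rightarrow> padic" where "emb q = cls (\<lambda>n. q)"

lemma emb_closed [simp]: "emb q \<in> carrier (Qp p)"
  by (simp add: emb_def)

lemma qnorm_emb [simp]: "qnorm (emb q) = vabs q"
  by (simp add: emb_def)

lemma emb_add: "emb (q + r) = emb q \<oplus>\<^bsub>Qp p\<^esub> emb r"
  and emb_mult: "emb (q * r) = emb q \<otimes>\<^bsub>Qp p\<^esub> emb r"
  and emb_minus: "emb (- q) = \<ominus>\<^bsub>Qp p\<^esub> emb q"
  and emb_diff: "emb (q - r) = emb q \<ominus>\<^bsub>Qp p\<^esub> emb r"
  and emb_1: "emb 1 = \<one>\<^bsub>Qp p\<^esub>" and emb_0: "emb 0 = \<zero>\<^bsub>Qp p\<^esub>"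
  by (simp_all add: emb_def cls_simps)

lemma emb_power: "emb (q ^ n) = emb q [^]\<^bsub>Qp p\<^esub> n"
  by (induction n) (simp_all add: emb_1 emb_mult Q.m_comm)

lemma emb_eq_0_iff [simp]: "emb q = \<zero>\<^bsub>Qp p\<^esub> \<longleftrightarrow> q = 0"
  using qnorm_eq_0_iff[of "emb q"] by simp

lemma emb_eq_iff [simp]: "emb q = emb r \<longleftrightarrow> q = r"
proof
  assume "emb q = emb r"
  then have "emb (q - r) = \<zero>\<^bsub>Qp p\<^esub>" by (simp add: emb_diff)
  then show "q = r" by simp
qed simp

lemma add_pow_nat_emb: "[(n::nat)] \<cdot>\<^bsub>Qp p\<^esub> emb q = emb (of_nat n * q)"
  by (induction n) (simp_all add: emb_0 emb_add ring_distribs Q.a_comm)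

lemma add_pow_int_emb: "[(k::int)] \<cdot>\<^bsub>Qp p\<^esub> emb q = emb (of_int k * q)"
proof (cases "k \<ge> 0")
  case True
  then show ?thesis by (simp add: add_pow_int_ge add_pow_nat_emb)
next
  case False
  then show ?thesis by (simp add: add_pow_int_lt add_pow_nat_emb flip: emb_minus)
qed

lemma emb_of_int_Zp [simp]: "emb (of_int a) \<in> carrier (Zp p)"
  by (intro ZpI) (auto simp: vabs_of_int_le_1)

lemma emb_of_nat_Zp [simp]: "emb (of_nat a) \<in> carrier (Zp p)"
  using emb_of_int_Zp[of "int a"] by simp

lemma qnorm_less_1_dvd:
  assumes "x \<in> carrier (Qp p)"
  shows "qnorm x < 1 \<longleftrightarrow> (\<exists>y\<in>carrier (Zp p). x = emb (of_nat p) \<otimes>\<^bsub>Qp p\<^esub> y)"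
proof safe
  assume x: "qnorm x < 1"
  define y where "y = emb (1 / of_nat p) \<otimes>\<^bsub>Qp p\<^esub> x"
  have "vabs (1 / of_nat p) = real p" by (simp add: vabs_divide vabs_p)
  then have "qnorm y = real p * qnorm x" using assms by (simp add: y_def qnorm_mult)
  also have "\<dots> \<le> 1" using x p_pos by (simp add: qnorm_less_1_iff[OF assms] field_simps)
  finally have "y \<in> carrier (Zp p)" using assms by (intro ZpI) (auto simp: y_def)
  moreover have "emb (of_nat p) \<otimes>\<^bsub>Qp p\<^esub> y = x"
    using assms p_pos by (simp add: y_def emb_1 flip: Q.m_assoc emb_mult)
  ultimately show "\<exists>y\<in>carrier (Zp p). x = emb (of_nat p) \<otimes>\<^bsub>Qp p\<^esub> y" by metis
next
  fix y assume y: "y \<in> carrier (Zp p)" "x = emb (of_nat p) \<otimes>\<^bsub>Qp p\<^esub> y"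
  then have "qnorm x \<le> 1 / real p"
    using p_pos Zp_norm[OF y(1)] by (simp add: qnorm_mult vabs_p field_simps)
  then show "qnorm (emb (of_nat p) \<otimes>\<^bsub>Qp p\<^esub> y) < 1"
    using y qnorm_less_1_iff[OF assms] by simp
qed

lemma qnorm_less_1_add:
  "x \<in> carrier (Qp p) \<Longrightarrow> y \<in> carrier (Qp p) \<Longrightarrow> qnorm x < 1 \<Longrightarrow> qnorm y < 1 \<Longrightarrow> qnorm (x \<oplus>\<^bsub>Qp p\<^esub> y) < 1"
  using qnorm_add_max[of x y] by auto

lemma qnorm_less_1_minus:
  "x \<in> carrier (Qp p) \<Longrightarrow> y \<in> carrier (Qp p) \<Longrightarrow> qnorm x < 1 \<Longrightarrow> qnorm y < 1 \<Longrightarrow> qnorm (x \<ominus>\<^bsub>Qp p\<^esub> y) < 1"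
  unfolding a_minus_def by (rule qnorm_less_1_add) auto

lemma qnorm_less_1_mult:
  "x \<in> carrier (Zp p) \<Longrightarrow> y \<in> carrier (Qp p) \<Longrightarrow> qnorm y < 1 \<Longrightarrow> qnorm (x \<otimes>\<^bsub>Qp p\<^esub> y) < 1"
  using mult_right_mono[of "qnorm x" 1 "qnorm y"] qnorm_nonneg[of y] Zp_norm[of x]
  by (auto simp: qnorm_mult)

text \<open>The residue field is the prime field.\<close>

lemma vabs_le_1_residue:
  assumes "vabs q \<le> 1" shows "\<exists>a::int. vabs (q - of_int a) < 1"
proof -
  obtain a b where "quotient_of q = (a, b)" by (cases "quotient_of q") auto
  then have ab: "b > 0" "coprime a b" "q = of_int a / of_int b"
    using quotient_of_denom_pos quotient_of_coprime quotient_of_div by auto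
  have "\<not> int p dvd b"
  proof
    assume pb: "int p dvd b"
    then have "\<not> int p dvd a" using ab(2) prime_int_p
      by (metis coprime_common_divisor not_prime_unit)
    then have "vabs (of_int a) = 1" by (rule vabs_of_int_coprime)
    moreover have "vabs (of_int b) < 1" "vabs (of_int b) > 0"
      using pb vabs_of_int_lt_1_iff[of b] ab(1) vabs_pos[of "of_int b"] by auto
    ultimately show False using assms by (simp add: ab(3) vabs_divide)
  qed
  then have "coprime b (int p)"
    using prime_imp_coprime[OF prime_int_p] by (simp add: coprime_commute)
  then obtain c where c: "[b * c = 1] (mod int p)"
    using coprime_iff_invertible_int by blast
  have "int p dvd a - a * c * b"
    using cong_scalar_left[OF c, of a] by (metis cong_iff_dvd_diff cong_sym mult.assoc mult.commute mult.right_neutral)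
  then have 1: "vabs (of_int (a - a * c * b)) < 1" by (simp only: vabs_of_int_lt_1_iff)
  have "q - of_int (a * c) = of_int (a - a * c * b) / of_int b"
    using ab(1) by (simp add: ab(3) field_simps)
  then have "vabs (q - of_int (a * c)) < 1"
    using 1 vabs_of_int_coprime[OF \<open>\<not> int p dvd b\<close>] by (simp only: vabs_divide)
  then show ?thesis ..
qed

lemma Zp_residue:
  assumes "x \<in> carrier (Zp p)"
  shows "\<exists>a::int. qnorm (x \<ominus>\<^bsub>Qp p\<^esub> emb (of_int a)) < 1"
proof -
  have xQ: "x \<in> carrier (Qp p)" using assms by simp
  obtain s where sx: "is_cauchy s" "x = cls s" and s: "\<And>n. vabs (s n) \<le> 1"
    using Zp_repr[OF assms] by blast
  obtain N where N: "\<And>m n. m \<ge> N \<Longrightarrow> n \<ge> N \<Longrightarrow> vabs (s m - s n) < 1"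
    using is_cauchyD[OF sx(1), of 1] by auto
  obtain a where a: "vabs (s N - of_int a) < 1" using vabs_le_1_residue[OF s] by blast
  have le: "vabs (s n - of_int a) \<le> 1 / real p" if "n \<ge> N" for n
    using vabs_add_less[OF N[OF that order_refl] a] by (simp flip: vabs_less_1_iff)
  have "qnorm (x \<ominus>\<^bsub>Qp p\<^esub> emb (of_int a)) \<le> 1 / real p"
    unfolding sx(2) emb_def
    using LIMSEQ_le_const2[OF qnorm_cls[of "\<lambda>n. s n - of_int a"], of "1 / real p"] le sx(1)
    by (auto simp: cls_simps)
  then show ?thesis using xQ by (auto simp: qnorm_less_1_iff)
qed

lemma qnorm_less_1_mult_right:
  "x \<in> carrier (Qp p) \<Longrightarrow> y \<in> carrier (Zp p) \<Longrightarrow> qnorm x < 1 \<Longrightarrow> qnorm (x \<otimes>\<^bsub>Qp p\<^esub> y) < 1"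
  using qnorm_less_1_mult[of y x] by (simp add: Q.m_comm)

lemma qnorm_pow_diff_less_1:
  assumes "x \<in> carrier (Zp p)" "y \<in> carrier (Zp p)" "qnorm (x \<ominus>\<^bsub>Qp p\<^esub> y) < 1"
  shows "qnorm (x [^]\<^bsub>Qp p\<^esub> (n::nat) \<ominus>\<^bsub>Qp p\<^esub> y [^]\<^bsub>Qp p\<^esub> n) < 1"
proof (induction n)
  case 0
  show ?case by (simp add: a_minus_def Q.r_neg)
next
  case (Suc n)
  let ?u = "x [^]\<^bsub>Qp p\<^esub> n" and ?v = "y [^]\<^bsub>Qp p\<^esub> n"
  have Z: "?u \<in> carrier (Zp p)" "?v \<in> carrier (Zp p)" using assms Zp_pow by auto
  have "?u \<otimes>\<^bsub>Qp p\<^esub> x \<ominus>\<^bsub>Qp p\<^esub> ?v \<otimes>\<^bsub>Qp p\<^esub> y =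
      ?u \<otimes>\<^bsub>Qp p\<^esub> (x \<ominus>\<^bsub>Qp p\<^esub> y) \<oplus>\<^bsub>Qp p\<^esub> (?u \<ominus>\<^bsub>Qp p\<^esub> ?v) \<otimes>\<^bsub>Qp p\<^esub> y"
    using Z[THEN Zp_closed] assms(1,2)[THEN Zp_closed] by algebra
  moreover have "qnorm \<dots> < 1"
    using assms Z Suc by (intro qnorm_less_1_add qnorm_less_1_mult qnorm_less_1_mult_right) auto
  ultimately show ?case using assms by simp
qed

text \<open>Powers respect residue classes, so this reduces to an integer in the same class and to
  Fermat's little theorem. It makes the identity a Frobenius automorphism of the trivial extension.\<close>

lemma Zp_fermat:
  assumes x: "x \<in> carrier (Zp p)"
  shows "qnorm (x \<ominus>\<^bsub>Qp p\<^esub> x [^]\<^bsub>Qp p\<^esub> p) < 1"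
proof -
  obtain a :: int where a: "qnorm (x \<ominus>\<^bsub>Qp p\<^esub> emb (of_int a)) < 1" using Zp_residue[OF x] ..
  define y where "y = emb (of_int a)"
  have y: "y \<in> carrier (Zp p)" by (simp add: y_def)
  have "[a ^ p = a] (mod int p)"
  proof (cases "int p dvd a")
    case True
    then have "int p dvd a ^ p - a" using p_pos by (auto simp: dvd_power_same intro!: dvd_diff dvd_trans[OF _ dvd_power])
    then show ?thesis by (simp add: cong_iff_dvd_diff)
  next
    case False
    define b where "b = nat (a mod int p)"
    have b: "[a = int b] (mod int p)" using p_pos by (simp add: b_def cong_def)
    then have "\<not> p dvd b" using False by (metis cong_dvd_iff int_dvd_int_iff)
    then have "[b ^ (p - 1) = 1] (mod p)" using fermat_theorem prime_p by blast
    then have "[b ^ (p - 1) * b = 1 * b] (mod p)" by (rule cong_scalar_right)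
    moreover have "b ^ (p - 1) * b = b ^ p" using p_pos by (metis Suc_diff_1 power_Suc2)
    ultimately have "[int b ^ p = int b] (mod int p)"
      by (metis cong_int_iff mult_1 of_nat_power)
    then show ?thesis using b by (metis cong_pow cong_trans cong_sym)
  qed
  then have "int p dvd a - a ^ p" by (metis cong_iff_dvd_diff cong_sym)
  then have "vabs (of_int (a - a ^ p)) < 1" by (simp only: vabs_of_int_lt_1_iff)
  then have 1: "qnorm (y \<ominus>\<^bsub>Qp p\<^esub> y [^]\<^bsub>Qp p\<^esub> p) < 1"
    unfolding y_def by (simp flip: emb_power emb_diff)
  have 2: "qnorm (x [^]\<^bsub>Qp p\<^esub> p \<ominus>\<^bsub>Qp p\<^esub> y [^]\<^bsub>Qp p\<^esub> p) < 1"
    using qnorm_pow_diff_less_1[OF x y] a y_def by simp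
  define u where "u = x [^]\<^bsub>Qp p\<^esub> p"
  define v where "v = y [^]\<^bsub>Qp p\<^esub> p"
  have uv: "u \<in> carrier (Qp p)" "v \<in> carrier (Qp p)" "x \<in> carrier (Qp p)" "y \<in> carrier (Qp p)"
    using x y by (auto simp: u_def v_def)
  have "x \<ominus>\<^bsub>Qp p\<^esub> u = ((x \<ominus>\<^bsub>Qp p\<^esub> y) \<oplus>\<^bsub>Qp p\<^esub> (y \<ominus>\<^bsub>Qp p\<^esub> v)) \<ominus>\<^bsub>Qp p\<^esub> (u \<ominus>\<^bsub>Qp p\<^esub> v)"
    using uv by algebra
  moreover have "qnorm \<dots> < 1"
    using uv 1 2 a unfolding y_def[symmetric] u_def[symmetric] v_def[symmetric]
    by (intro qnorm_less_1_minus[OF Q.add.m_closed Q.minus_closed] qnorm_less_1_add) auto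
  ultimately show ?thesis by (simp add: u_def)
qed

subsection \<open>A quadratic form of Hensel's lemma\<close>

text \<open>The map \<open>d \<mapsto> w * (e - d\<^sup>2)\<close> contracts the maximal ideal as soon
  as \<open>w\<close> is integral and \<open>e\<close> lies in the maximal ideal, so its iterates from 0
  converge to a fixed point. The choice \<open>w = 1\<close> solves \<open>d\<^sup>2 + d = e\<close>,
  and \<open>w = 1 / (2 q)\<close> gives \<open>(q + d)\<^sup>2 = q\<^sup>2 + e\<close>.\<close>

lemma hensel_quadratic:
  assumes w: "vabs w \<le> 1" and e: "vabs e < 1"
  obtains d where "d \<in> carrier (Zp p)" "qnorm d < 1"
    "d = emb w \<otimes>\<^bsub>Qp p\<^esub> (emb e \<ominus>\<^bsub>Qp p\<^esub> d \<otimes>\<^bsub>Qp p\<^esub> d)"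
proof -
  define s where "s = rec_nat 0 (\<lambda>_ d. w * (e - d * d))"
  have s0: "s 0 = 0" and sS: "\<And>n. s (Suc n) = w * (e - s n * s n)" by (simp_all add: s_def)
  have small: "vabs (s n) \<le> 1 / real p" for n
  proof (induction n)
    case (Suc n)
    have "vabs (s n) < 1" using Suc by (simp flip: vabs_less_1_iff)
    then have "vabs (s n * s n) < 1" using mult_strict_mono[of "vabs (s n)" 1 "vabs (s n)" 1] by (simp add: vabs_mult)
    then have "vabs (e - s n * s n) < 1" using e vabs_diff_less by blast
    then have "vabs (w * (e - s n * s n)) < 1"
      using w mult_right_mono[of "vabs w" 1 "vabs (e - s n * s n)"] by (simp add: vabs_mult)
    then show ?case by (simp add: sS flip: vabs_less_1_iff)
  qed (simp add: s0)
  have contract: "vabs (s (Suc n) - s n) \<le> (1 / real p) ^ n" for n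
  proof (induction n)
    case 0
    have "1 / real p \<le> 1" using p_gt_1 by simp
    then show ?case using order_trans[OF small[of 1]] by (simp add: s0)
  next
    case (Suc n)
    have "s (Suc (Suc n)) - s (Suc n) = (w * (s n - s (Suc n))) * (s n + s (Suc n))"
      by (simp only: sS[of "Suc n"] sS[of n]) (simp add: algebra_simps)
    then have "vabs (s (Suc (Suc n)) - s (Suc n)) =
        (vabs w * vabs (s n - s (Suc n))) * vabs (s n + s (Suc n))"
      by (simp only: vabs_mult)
    also have "\<dots> \<le> (1 * (1 / real p) ^ n) * (1 / real p)"
      using Suc w vabs_add_le[OF small[of n] small[of "Suc n"]]
      by (intro mult_mono) (auto simp: vabs_minus_commute)
    finally show ?case by (simp add: mult.commute)
  qed
  have tail: "vabs (s (N + j) - s N) \<le> (1 / real p) ^ N" for N j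
  proof (induction j)
    case (Suc j)
    have "(1 / real p) ^ (N + j) \<le> (1 / real p) ^ N"
      using p_gt_1 by (intro power_decreasing) auto
    then have "vabs (s (N + Suc j) - s (N + j)) \<le> (1 / real p) ^ N"
      using contract[of "N + j"] by simp
    from vabs_add_le[OF this Suc] show ?case by simp
  qed (use p_pos in auto)
  have cs: "is_cauchy s"
  proof (rule is_cauchyI)
    fix c :: real assume "c > 0"
    then obtain N where N: "(1 / real p) ^ N < c"
      using real_arch_pow_inv[of c "1 / real p"] p_gt_1 by auto
    have *: "vabs (s n - s N) < c" if "n \<ge> N" for n
      using tail[of N "n - N"] N that by simp
    have "vabs (s m - s n) < c" if "m \<ge> N" "n \<ge> N" for m n
      using vabs_diff_less[OF *[OF that(1)] *[OF that(2)]] by simp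
    then show "\<exists>N. \<forall>m\<ge>N. \<forall>n\<ge>N. vabs (s m - s n) < c" by blast
  qed
  have n: "qnorm (cls s) \<le> 1 / real p"
    using small by (intro LIMSEQ_le_const2[OF qnorm_cls[OF cs]]) auto
  then have n1: "qnorm (cls s) < 1" using cs by (simp add: qnorm_less_1_iff)
  have "cls s = cls (\<lambda>n. s (n + 1))" using cls_shift[OF cs, of 1] by simp
  also have "\<dots> = emb w \<otimes>\<^bsub>Qp p\<^esub> (emb e \<ominus>\<^bsub>Qp p\<^esub> cls s \<otimes>\<^bsub>Qp p\<^esub> cls s)"
    using cs by (simp add: sS emb_def cls_simps)
  finally show ?thesis using n1 cs by (intro that[of "cls s"] ZpI) auto
qed

end

section \<open>Algebras over a field\<close>

text \<open>Associativity and the unit laws are kept apart: for the cyclic algebra of an arbitrary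
  Frobenius automorphism they are inferred later from an isomorphism of matrix algebras.\<close>

locale pre_algebra = K: field K + abelian_group A
  for K :: "('a, 'd) ring_scheme" and A :: "('a, 'b, 'c) module_scheme" (structure) +
  assumes mult_closed [simp, intro]: "x \<in> carrier A \<Longrightarrow> y \<in> carrier A \<Longrightarrow> x \<otimes> y \<in> carrier A"
    and one_closed [simp, intro]: "\<one> \<in> carrier A"
    and one_neq_zero [simp]: "\<one> \<noteq> \<zero>"
    and mult_add_left: "\<lbrakk>x \<in> carrier A; y \<in> carrier A; z \<in> carrier A\<rbrakk> \<Longrightarrow> (x \<oplus> y) \<otimes> z = x \<otimes> z \<oplus> y \<otimes> z"
    and mult_add_right: "\<lbrakk>x \<in> carrier A; y \<in> carrier A; z \<in> carrier A\<rbrakk> \<Longrightarrow> z \<otimes> (x \<oplus> y) = z \<otimes> x \<oplus> z \<otimes> y"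
    and scale_closed [simp, intro]: "c \<in> carrier K \<Longrightarrow> x \<in> carrier A \<Longrightarrow> c \<odot> x \<in> carrier A"
    and scale_add_left: "\<lbrakk>c \<in> carrier K; d \<in> carrier K; x \<in> carrier A\<rbrakk> \<Longrightarrow> (c \<oplus>\<^bsub>K\<^esub> d) \<odot> x = c \<odot> x \<oplus> d \<odot> x"
    and scale_add_right: "\<lbrakk>c \<in> carrier K; x \<in> carrier A; y \<in> carrier A\<rbrakk> \<Longrightarrow> c \<odot> (x \<oplus> y) = c \<odot> x \<oplus> c \<odot> y"
    and scale_scale: "\<lbrakk>c \<in> carrier K; d \<in> carrier K; x \<in> carrier A\<rbrakk> \<Longrightarrow> (c \<otimes>\<^bsub>K\<^esub> d) \<odot> x = c \<odot> (d \<odot> x)"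
    and scale_one [simp]: "x \<in> carrier A \<Longrightarrow> \<one>\<^bsub>K\<^esub> \<odot> x = x"
    and scale_mult_left: "\<lbrakk>c \<in> carrier K; x \<in> carrier A; y \<in> carrier A\<rbrakk> \<Longrightarrow> (c \<odot> x) \<otimes> y = c \<odot> (x \<otimes> y)"
    and scale_mult_right: "\<lbrakk>c \<in> carrier K; x \<in> carrier A; y \<in> carrier A\<rbrakk> \<Longrightarrow> x \<otimes> (c \<odot> y) = c \<odot> (x \<otimes> y)"

locale assoc_algebra = pre_algebra K A
  for K :: "('a, 'd) ring_scheme" and A :: "('a, 'b, 'c) module_scheme" (structure) +
  assumes mult_assoc: "\<lbrakk>x \<in> carrier A; y \<in> carrier A; z \<in> carrier A\<rbrakk> \<Longrightarrow> (x \<otimes> y) \<otimes> z = x \<otimes> (y \<otimes> z)"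
    and one_mult: "x \<in> carrier A \<Longrightarrow> \<one> \<otimes> x = x"
    and mult_one: "x \<in> carrier A \<Longrightarrow> x \<otimes> \<one> = x"

lemma (in abelian_group) additive_zero:
  assumes "z \<in> carrier G" "z \<oplus> z = z" shows "z = \<zero>"
  using assms by (metis add.l_cancel_one')

context pre_algebra
begin

lemma mult_zero_left [simp]: "x \<in> carrier A \<Longrightarrow> \<zero> \<otimes> x = \<zero>"
  using mult_add_left[of \<zero> \<zero> x] by (auto intro!: additive_zero)

lemma mult_zero_right [simp]: "x \<in> carrier A \<Longrightarrow> x \<otimes> \<zero> = \<zero>"
  using mult_add_right[of \<zero> \<zero> x] by (auto intro!: additive_zero)

lemma scale_zero_right [simp]: "c \<in> carrier K \<Longrightarrow> c \<odot> \<zero> = \<zero>"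
  using scale_add_right[of c \<zero> \<zero>] by (auto intro!: additive_zero)

lemma scale_zero_left [simp]: "x \<in> carrier A \<Longrightarrow> \<zero>\<^bsub>K\<^esub> \<odot> x = \<zero>"
  using scale_add_left[of "\<zero>\<^bsub>K\<^esub>" "\<zero>\<^bsub>K\<^esub>" x] by (auto intro!: additive_zero)

end

lemma additive_finsum:
  fixes A (structure) and B (structure)
  assumes "abelian_monoid A" "abelian_monoid B" "finite S" "g \<in> S \<rightarrow> carrier A"
    and "\<And>x. x \<in> carrier A \<Longrightarrow> f x \<in> carrier B"
    and "\<And>x y. x \<in> carrier A \<Longrightarrow> y \<in> carrier A \<Longrightarrow> f (x \<oplus>\<^bsub>A\<^esub> y) = f x \<oplus>\<^bsub>B\<^esub> f y"
    and "f \<zero>\<^bsub>A\<^esub> = \<zero>\<^bsub>B\<^esub>"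
  shows "f (finsum A g S) = finsum B (\<lambda>i. f (g i)) S"
proof -
  interpret A: abelian_monoid A by fact
  interpret B: abelian_monoid B by fact
  show ?thesis using assms(3,4)
  proof (induction S)
    case (insert i S)
    then have g: "g i \<in> carrier A" "g \<in> S \<rightarrow> carrier A" by auto
    moreover have "(\<lambda>i. f (g i)) \<in> S \<rightarrow> carrier B" "f (g i) \<in> carrier B" using g assms(5) by auto
    ultimately show ?case
      using insert assms(6)[of "g i" "finsum A g S"] A.finsum_closed[OF g(2)]
      by (simp add: A.finsum_insert B.finsum_insert)
  qed (simp add: assms(7))
qed

lemma (in abelian_group) finsum_swap:
  assumes "finite S" "finite T" "\<And>i j. i \<in> S \<Longrightarrow> j \<in> T \<Longrightarrow> f i j \<in> carrier G"
  shows "(\<Oplus>i\<in>S. \<Oplus>j\<in>T. f i j) = (\<Oplus>j\<in>T. \<Oplus>i\<in>S. f i j)"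
  using assms(1,3)
proof (induction S)
  case empty
  then show ?case by (simp add: finsum_zero)
next
  case (insert k S)
  have "(\<Oplus>i\<in>insert k S. \<Oplus>j\<in>T. f i j) = (\<Oplus>j\<in>T. f k j) \<oplus> (\<Oplus>j\<in>T. \<Oplus>i\<in>S. f i j)"
    using insert by (subst finsum_insert) (auto intro!: finsum_closed)
  also have "\<dots> = (\<Oplus>j\<in>T. f k j \<oplus> (\<Oplus>i\<in>S. f i j))"
    using insert by (intro finsum_addf[symmetric]) (auto intro!: finsum_closed)
  also have "\<dots> = (\<Oplus>j\<in>T. \<Oplus>i\<in>insert k S. f i j)"
    using insert by (intro finsum_cong') (auto intro!: finsum_closed)
  finally show ?case .
qed

lemma (in abelian_group) finsum_delta:
  assumes "finite S" "i \<in> S" "x \<in> carrier G" "\<And>j. j \<in> S \<Longrightarrow> j \<noteq> i \<Longrightarrow> g j = \<zero>" "g i = x"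
  shows "finsum G g S = x"
proof -
  have "finsum G g S = (\<Oplus>j\<in>S. if i = j then x else \<zero>)"
    using assms by (intro finsum_cong') auto
  also have "\<dots> = x" using assms by (intro finsum_singleton) auto
  finally show ?thesis .
qed

subsection \<open>Matrix algebras\<close>

abbreviation square :: "nat \<Rightarrow> (nat \<times> nat) set" where "square n \<equiv> {..<n} \<times> {..<n}"

lemma matrix_simps [simp]:
  "carrier (matrix_algebra n A) = square n \<rightarrow>\<^sub>E carrier A"
  "M \<otimes>\<^bsub>matrix_algebra n A\<^esub> N = (\<lambda>(i, j)\<in>square n. \<Oplus>\<^bsub>A\<^esub>l\<in>{..<n}. M (i, l) \<otimes>\<^bsub>A\<^esub> N (l, j))"
  "\<one>\<^bsub>matrix_algebra n A\<^esub> = (\<lambda>(i, j)\<in>square n. if i = j then \<one>\<^bsub>A\<^esub> else \<zero>\<^bsub>A\<^esub>)"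
  "\<zero>\<^bsub>matrix_algebra n A\<^esub> = (\<lambda>(i, j)\<in>square n. \<zero>\<^bsub>A\<^esub>)"
  "M \<oplus>\<^bsub>matrix_algebra n A\<^esub> N = (\<lambda>(i, j)\<in>square n. M (i, j) \<oplus>\<^bsub>A\<^esub> N (i, j))"
  "c \<odot>\<^bsub>matrix_algebra n A\<^esub> M = (\<lambda>(i, j)\<in>square n. c \<odot>\<^bsub>A\<^esub> M (i, j))"
  by (simp_all add: matrix_algebra_def)

definition single :: "nat \<Rightarrow> ('a, 'b, 'c) module_scheme \<Rightarrow> nat \<Rightarrow> nat \<Rightarrow> 'b \<Rightarrow> nat \<times> nat \<Rightarrow> 'b" where
  "single n A i j x = (\<lambda>(k, l)\<in>square n. if k = i \<and> l = j then x else \<zero>\<^bsub>A\<^esub>)"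

lemma matrix_eqI:
  assumes "M \<in> square n \<rightarrow>\<^sub>E V" "N \<in> square n \<rightarrow>\<^sub>E Y" "\<And>i j. i < n \<Longrightarrow> j < n \<Longrightarrow> M (i, j) = N (i, j)"
  shows "M = N"
  using assms by (intro PiE_ext[of M "square n" "\<lambda>_. V \<union> Y"]) (auto simp: PiE_iff extensional_def)

context pre_algebra
begin

lemmas matrix_eq = matrix_eqI[where V="carrier A" and Y="carrier A"]

lemma entry_closed [simp]: "M \<in> square n \<rightarrow>\<^sub>E carrier A \<Longrightarrow> i < n \<Longrightarrow> j < n \<Longrightarrow> M (i, j) \<in> carrier A"
  by auto

lemma matrix_mult_closed:
  assumes "M \<in> square n \<rightarrow>\<^sub>E carrier A" "N \<in> square n \<rightarrow>\<^sub>E carrier A"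
  shows "M \<otimes>\<^bsub>matrix_algebra n A\<^esub> N \<in> square n \<rightarrow>\<^sub>E carrier A"
  using assms by (auto intro!: finsum_closed)

lemma matrix_mult_entry:
  assumes "i < n" "j < n" "M \<in> square n \<rightarrow>\<^sub>E carrier A" "N \<in> square n \<rightarrow>\<^sub>E carrier A"
    and "\<And>l. l < n \<Longrightarrow> g l = M (i, l) \<otimes> N (l, j)"
  shows "(M \<otimes>\<^bsub>matrix_algebra n A\<^esub> N) (i, j) = finsum A g {..<n}"
  using assms by simp (intro finsum_cong', auto)

lemma abelian_group_matrix: "abelian_group (matrix_algebra n A)"
proof (rule abelian_groupI)
  fix M assume M: "M \<in> carrier (matrix_algebra n A)"
  define N where "N = (\<lambda>(i, j)\<in>square n. \<ominus> M (i, j))"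
  have "N \<in> carrier (matrix_algebra n A)" using M by (auto simp: N_def)
  moreover have "N \<oplus>\<^bsub>matrix_algebra n A\<^esub> M = \<zero>\<^bsub>matrix_algebra n A\<^esub>"
    using M by (auto simp: N_def l_neg fun_eq_iff)
  ultimately show "\<exists>N\<in>carrier (matrix_algebra n A). N \<oplus>\<^bsub>matrix_algebra n A\<^esub> M = \<zero>\<^bsub>matrix_algebra n A\<^esub>" by blast
  show "\<zero>\<^bsub>matrix_algebra n A\<^esub> \<oplus>\<^bsub>matrix_algebra n A\<^esub> M = M"
    using M by (auto simp: fun_eq_iff PiE_iff extensional_def)
  fix N assume N: "N \<in> carrier (matrix_algebra n A)"
  show "M \<oplus>\<^bsub>matrix_algebra n A\<^esub> N \<in> carrier (matrix_algebra n A)" using M N by auto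
  show "M \<oplus>\<^bsub>matrix_algebra n A\<^esub> N = N \<oplus>\<^bsub>matrix_algebra n A\<^esub> M"
    using M N by (auto simp: fun_eq_iff a_comm)
  fix L assume L: "L \<in> carrier (matrix_algebra n A)"
  show "M \<oplus>\<^bsub>matrix_algebra n A\<^esub> N \<oplus>\<^bsub>matrix_algebra n A\<^esub> L = M \<oplus>\<^bsub>matrix_algebra n A\<^esub> (N \<oplus>\<^bsub>matrix_algebra n A\<^esub> L)"
    using M N L by (auto simp: fun_eq_iff a_assoc)
qed auto

lemma pre_algebra_matrix:
  assumes "n > 0" shows "pre_algebra K (matrix_algebra n A)"
proof -
  interpret M: abelian_group "matrix_algebra n A" by (rule abelian_group_matrix)
  show ?thesis
  proof (unfold_locales, goal_cases)
    case (1 x y)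
    then show ?case using matrix_mult_closed by simp
  next
    case 3
    have "\<one>\<^bsub>matrix_algebra n A\<^esub> (0, 0) \<noteq> \<zero>\<^bsub>matrix_algebra n A\<^esub> (0, 0)" using assms by simp
    then show ?case by metis
  next
    case (4 x y z)
    then have xyz: "x \<in> square n \<rightarrow>\<^sub>E carrier A" "y \<in> square n \<rightarrow>\<^sub>E carrier A" "z \<in> square n \<rightarrow>\<^sub>E carrier A"
      by simp_all
    note cl = M.a_closed[unfolded matrix_simps(1)] matrix_mult_closed
    show ?case
    proof (rule matrix_eq)
      fix i j assume ij: "i < n" "j < n"
      have "((x \<oplus>\<^bsub>matrix_algebra n A\<^esub> y) \<otimes>\<^bsub>matrix_algebra n A\<^esub> z) (i, j) =
          (\<Oplus>l\<in>{..<n}. x (i, l) \<otimes> z (l, j) \<oplus> y (i, l) \<otimes> z (l, j))"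
        using ij xyz by (intro matrix_mult_entry cl) (auto simp: mult_add_left)
      also have "\<dots> = (x \<otimes>\<^bsub>matrix_algebra n A\<^esub> z) (i, j) \<oplus> (y \<otimes>\<^bsub>matrix_algebra n A\<^esub> z) (i, j)"
        using ij xyz by (subst finsum_addf) (auto simp: Pi_def)
      finally show "((x \<oplus>\<^bsub>matrix_algebra n A\<^esub> y) \<otimes>\<^bsub>matrix_algebra n A\<^esub> z) (i, j) =
          (x \<otimes>\<^bsub>matrix_algebra n A\<^esub> z \<oplus>\<^bsub>matrix_algebra n A\<^esub> y \<otimes>\<^bsub>matrix_algebra n A\<^esub> z) (i, j)"
        using ij by simp
    qed (intro cl xyz)+
  next
    case (5 x y z)
    then have xyz: "x \<in> square n \<rightarrow>\<^sub>E carrier A" "y \<in> square n \<rightarrow>\<^sub>E carrier A" "z \<in> square n \<rightarrow>\<^sub>E carrier A"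
      by simp_all
    note cl = M.a_closed[unfolded matrix_simps(1)] matrix_mult_closed
    show ?case
    proof (rule matrix_eq)
      fix i j assume ij: "i < n" "j < n"
      have "(z \<otimes>\<^bsub>matrix_algebra n A\<^esub> (x \<oplus>\<^bsub>matrix_algebra n A\<^esub> y)) (i, j) =
          (\<Oplus>l\<in>{..<n}. z (i, l) \<otimes> x (l, j) \<oplus> z (i, l) \<otimes> y (l, j))"
        using ij xyz by (intro matrix_mult_entry cl) (auto simp: mult_add_right)
      also have "\<dots> = (z \<otimes>\<^bsub>matrix_algebra n A\<^esub> x) (i, j) \<oplus> (z \<otimes>\<^bsub>matrix_algebra n A\<^esub> y) (i, j)"
        using ij xyz by (subst finsum_addf) (auto simp: Pi_def)
      finally show "(z \<otimes>\<^bsub>matrix_algebra n A\<^esub> (x \<oplus>\<^bsub>matrix_algebra n A\<^esub> y)) (i, j) =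
          (z \<otimes>\<^bsub>matrix_algebra n A\<^esub> x \<oplus>\<^bsub>matrix_algebra n A\<^esub> z \<otimes>\<^bsub>matrix_algebra n A\<^esub> y) (i, j)"
        using ij by simp
    qed (intro cl xyz)+
  next
    case (7 c d x)
    then show ?case by (auto simp: fun_eq_iff scale_add_left)
  next
    case (8 c x y)
    then show ?case by (auto simp: fun_eq_iff scale_add_right)
  next
    case (9 c d x)
    then show ?case by (auto simp: fun_eq_iff scale_scale)
  next
    case (10 x)
    then show ?case by (auto simp: fun_eq_iff PiE_iff extensional_def)
  next
    case (11 c x y)
    then have c: "c \<in> carrier K" and xy: "x \<in> square n \<rightarrow>\<^sub>E carrier A" "y \<in> square n \<rightarrow>\<^sub>E carrier A"
      by simp_all
    have cl: "c \<odot>\<^bsub>matrix_algebra n A\<^esub> z \<in> square n \<rightarrow>\<^sub>E carrier A" if "z \<in> square n \<rightarrow>\<^sub>E carrier A" for z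
      using that c by auto
    show ?case
    proof (rule matrix_eq)
      fix i j assume ij: "i < n" "j < n"
      have "((c \<odot>\<^bsub>matrix_algebra n A\<^esub> x) \<otimes>\<^bsub>matrix_algebra n A\<^esub> y) (i, j) = (\<Oplus>l\<in>{..<n}. c \<odot> (x (i, l) \<otimes> y (l, j)))"
        using ij xy c by (intro matrix_mult_entry cl) (auto simp: scale_mult_left)
      also have "\<dots> = c \<odot> (x \<otimes>\<^bsub>matrix_algebra n A\<^esub> y) (i, j)"
        using ij xy c
        by (subst additive_finsum[of A A _ _ "\<lambda>z. c \<odot> z", symmetric])
          (auto intro!: abelian_monoid_axioms simp: scale_add_right)
      finally show "((c \<odot>\<^bsub>matrix_algebra n A\<^esub> x) \<otimes>\<^bsub>matrix_algebra n A\<^esub> y) (i, j) =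
          (c \<odot>\<^bsub>matrix_algebra n A\<^esub> (x \<otimes>\<^bsub>matrix_algebra n A\<^esub> y)) (i, j)"
        using ij by simp
    qed (intro cl matrix_mult_closed xy)+
  next
    case (12 c x y)
    then have c: "c \<in> carrier K" and xy: "x \<in> square n \<rightarrow>\<^sub>E carrier A" "y \<in> square n \<rightarrow>\<^sub>E carrier A"
      by simp_all
    have cl: "c \<odot>\<^bsub>matrix_algebra n A\<^esub> z \<in> square n \<rightarrow>\<^sub>E carrier A" if "z \<in> square n \<rightarrow>\<^sub>E carrier A" for z
      using that c by auto
    show ?case
    proof (rule matrix_eq)
      fix i j assume ij: "i < n" "j < n"
      have "(x \<otimes>\<^bsub>matrix_algebra n A\<^esub> (c \<odot>\<^bsub>matrix_algebra n A\<^esub> y)) (i, j) = (\<Oplus>l\<in>{..<n}. c \<odot> (x (i, l) \<otimes> y (l, j)))"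
        using ij xy c by (intro matrix_mult_entry cl) (auto simp: scale_mult_right)
      also have "\<dots> = c \<odot> (x \<otimes>\<^bsub>matrix_algebra n A\<^esub> y) (i, j)"
        using ij xy c
        by (subst additive_finsum[of A A _ _ "\<lambda>z. c \<odot> z", symmetric])
          (auto intro!: abelian_monoid_axioms simp: scale_add_right)
      finally show "(x \<otimes>\<^bsub>matrix_algebra n A\<^esub> (c \<odot>\<^bsub>matrix_algebra n A\<^esub> y)) (i, j) =
          (c \<odot>\<^bsub>matrix_algebra n A\<^esub> (x \<otimes>\<^bsub>matrix_algebra n A\<^esub> y)) (i, j)"
        using ij by simp
    qed (intro cl matrix_mult_closed xy)+
  qed auto
qed

lemma single_closed [simp]: "x \<in> carrier A \<Longrightarrow> single n A i j x \<in> square n \<rightarrow>\<^sub>E carrier A"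
  by (auto simp: single_def)

lemma single_entry: "k < n \<Longrightarrow> l < n \<Longrightarrow> single n A i j x (k, l) = (if k = i \<and> l = j then x else \<zero>)"
  by (simp add: single_def)

lemma single_inj: "i < n \<Longrightarrow> j < n \<Longrightarrow> single n A i j x = single n A i j y \<Longrightarrow> x = y"
  by (drule fun_cong[of _ _ "(i, j)"]) (simp add: single_entry)

lemma single_mult_entry:
  assumes "M \<in> square n \<rightarrow>\<^sub>E carrier A" "x \<in> carrier A" "j < n" "k < n" "l < n"
  shows "(single n A i j x \<otimes>\<^bsub>matrix_algebra n A\<^esub> M) (k, l) = (if k = i then x \<otimes> M (j, l) else \<zero>)"
proof -
  have "(\<Oplus>a\<in>{..<n}. single n A i j x (k, a) \<otimes> M (a, l)) = (if k = i then x \<otimes> M (j, l) else \<zero>)"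
    using assms by (intro finsum_delta[of _ j]) (auto simp: single_entry)
  then show ?thesis using assms by simp
qed

lemma single_mult_single:
  assumes "x \<in> carrier A" "y \<in> carrier A" "j < n" "k < n"
  shows "single n A i j x \<otimes>\<^bsub>matrix_algebra n A\<^esub> single n A k l y =
    (if j = k then single n A i l (x \<otimes> y) else single n A i l \<zero>)"
proof (rule matrix_eq)
  show "single n A i j x \<otimes>\<^bsub>matrix_algebra n A\<^esub> single n A k l y \<in> square n \<rightarrow>\<^sub>E carrier A"
    using assms by (intro matrix_mult_closed) auto
  show "(if j = k then single n A i l (x \<otimes> y) else single n A i l \<zero>) \<in> square n \<rightarrow>\<^sub>E carrier A"
    using assms by auto
  fix a b assume "a < n" "b < n"
  then show "(single n A i j x \<otimes>\<^bsub>matrix_algebra n A\<^esub> single n A k l y) (a, b) =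
      (if j = k then single n A i l (x \<otimes> y) else single n A i l \<zero>) (a, b)"
    using assms by (subst single_mult_entry) (auto simp: single_entry)
qed

lemma single_add:
  assumes "x \<in> carrier A" "y \<in> carrier A"
  shows "single n A i j (x \<oplus> y) = single n A i j x \<oplus>\<^bsub>matrix_algebra n A\<^esub> single n A i j y"
  using assms by (auto simp: single_def fun_eq_iff)

lemma single_scale:
  assumes "x \<in> carrier A" "c \<in> carrier K"
  shows "single n A i j (c \<odot> x) = c \<odot>\<^bsub>matrix_algebra n A\<^esub> single n A i j x"
  using assms by (auto simp: single_def fun_eq_iff)

lemma single_zero: "single n A i j \<zero> = \<zero>\<^bsub>matrix_algebra n A\<^esub>"
  by (auto simp: single_def fun_eq_iff)

text \<open>The embedding at the matrix position \<open>(0, 0)\<close> is injective and multiplicative,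
  so associativity descends. The unit laws descend because the entry of a product with the unit matrix
  is a product with the unit.\<close>

lemma assoc_algebra_corner:
  assumes "n > 0" "assoc_algebra K (matrix_algebra n A)"
  shows "assoc_algebra K A"
proof -
  interpret M: assoc_algebra K "matrix_algebra n A" by fact
  let ?s = "single n A 0 0"
  have mul: "?s (x \<otimes> y) = ?s x \<otimes>\<^bsub>matrix_algebra n A\<^esub> ?s y" if "x \<in> carrier A" "y \<in> carrier A" for x y
    using that assms(1) by (subst single_mult_single) auto
  have s: "?s x \<in> carrier (matrix_algebra n A)" if "x \<in> carrier A" for x using that by simp
  have inj: "x = y" if "?s x = ?s y" for x y using single_inj[OF assms(1) assms(1) that] .
  show ?thesis
  proof unfold_locales
    fix x y z assume xyz: "x \<in> carrier A" "y \<in> carrier A" "z \<in> carrier A"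
    have "?s ((x \<otimes> y) \<otimes> z) = ?s (x \<otimes> (y \<otimes> z))"
      using xyz M.mult_assoc[OF s s s, of x y z] by (simp only: mul mult_closed)
    then show "(x \<otimes> y) \<otimes> z = x \<otimes> (y \<otimes> z)" by (rule inj)
  next
    fix x assume x: "x \<in> carrier A"
    have "(\<one>\<^bsub>matrix_algebra n A\<^esub> \<otimes>\<^bsub>matrix_algebra n A\<^esub> ?s x) (0, 0) = \<one> \<otimes> x"
      using assms(1) x by simp (intro finsum_delta[of _ 0], auto simp: single_entry)
    then show "\<one> \<otimes> x = x" using M.one_mult[OF s[OF x]] assms(1) by (simp only: single_entry) simp
    have "(?s x \<otimes>\<^bsub>matrix_algebra n A\<^esub> \<one>\<^bsub>matrix_algebra n A\<^esub>) (0, 0) = x \<otimes> \<one>"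
      using assms(1) x by simp (intro finsum_delta[of _ 0], auto simp: single_entry)
    then show "x \<otimes> \<one> = x" using M.mult_one[OF s[OF x]] assms(1) by (simp only: single_entry) simp
  qed
qed

end

lemma (in assoc_algebra) assoc_algebra_matrix:
  assumes "n > 0" shows "assoc_algebra K (matrix_algebra n A)"
proof -
  interpret M: pre_algebra K "matrix_algebra n A" by (rule pre_algebra_matrix[OF assms])
  show ?thesis
  proof unfold_locales
    fix x y z assume "x \<in> carrier (matrix_algebra n A)" "y \<in> carrier (matrix_algebra n A)"
      "z \<in> carrier (matrix_algebra n A)"
    then have xyz: "x \<in> square n \<rightarrow>\<^sub>E carrier A" "y \<in> square n \<rightarrow>\<^sub>E carrier A" "z \<in> square n \<rightarrow>\<^sub>E carrier A"
      by auto
    have "(\<Oplus>l\<in>{..<n}. (\<Oplus>k\<in>{..<n}. x (i, k) \<otimes> y (k, l)) \<otimes> z (l, j)) =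
        (\<Oplus>k\<in>{..<n}. x (i, k) \<otimes> (\<Oplus>l\<in>{..<n}. y (k, l) \<otimes> z (l, j)))" if ij: "i < n" "j < n" for i j
    proof -
      have "(\<Oplus>l\<in>{..<n}. (\<Oplus>k\<in>{..<n}. x (i, k) \<otimes> y (k, l)) \<otimes> z (l, j)) =
          (\<Oplus>l\<in>{..<n}. \<Oplus>k\<in>{..<n}. (x (i, k) \<otimes> y (k, l)) \<otimes> z (l, j))"
        using xyz ij
        by (intro finsum_cong' additive_finsum[where f="\<lambda>t. t \<otimes> z (_, j)"])
          (auto intro!: finsum_closed abelian_monoid_axioms simp: mult_add_left)
      also have "\<dots> = (\<Oplus>k\<in>{..<n}. \<Oplus>l\<in>{..<n}. (x (i, k) \<otimes> y (k, l)) \<otimes> z (l, j))"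
        using xyz ij by (intro finsum_swap) auto
      also have "\<dots> = (\<Oplus>k\<in>{..<n}. \<Oplus>l\<in>{..<n}. x (i, k) \<otimes> (y (k, l) \<otimes> z (l, j)))"
        using xyz ij by (intro finsum_cong') (auto intro!: finsum_closed mult_assoc)
      also have "\<dots> = (\<Oplus>k\<in>{..<n}. x (i, k) \<otimes> (\<Oplus>l\<in>{..<n}. y (k, l) \<otimes> z (l, j)))"
        using xyz ij
        by (intro finsum_cong' additive_finsum[where f="\<lambda>t. x (i, _) \<otimes> t", symmetric])
          (auto intro!: finsum_closed abelian_monoid_axioms simp: mult_add_right)
      finally show ?thesis .
    qed
    note entries = this
    show "x \<otimes>\<^bsub>matrix_algebra n A\<^esub> y \<otimes>\<^bsub>matrix_algebra n A\<^esub> z =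
        x \<otimes>\<^bsub>matrix_algebra n A\<^esub> (y \<otimes>\<^bsub>matrix_algebra n A\<^esub> z)"
    proof (rule matrix_eq)
      show "x \<otimes>\<^bsub>matrix_algebra n A\<^esub> y \<otimes>\<^bsub>matrix_algebra n A\<^esub> z \<in> square n \<rightarrow>\<^sub>E carrier A"
        by (intro matrix_mult_closed xyz)
      show "x \<otimes>\<^bsub>matrix_algebra n A\<^esub> (y \<otimes>\<^bsub>matrix_algebra n A\<^esub> z) \<in> square n \<rightarrow>\<^sub>E carrier A"
        by (intro matrix_mult_closed xyz)
      fix i j assume ij: "i < n" "j < n"
      have "(x \<otimes>\<^bsub>matrix_algebra n A\<^esub> y \<otimes>\<^bsub>matrix_algebra n A\<^esub> z) (i, j) =
          (\<Oplus>l\<in>{..<n}. (\<Oplus>k\<in>{..<n}. x (i, k) \<otimes> y (k, l)) \<otimes> z (l, j))"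
        using ij xyz by simp (intro finsum_cong', auto intro!: finsum_closed)
      also have "\<dots> = (x \<otimes>\<^bsub>matrix_algebra n A\<^esub> (y \<otimes>\<^bsub>matrix_algebra n A\<^esub> z)) (i, j)"
        using ij xyz by (simp add: entries) (intro finsum_cong', auto intro!: finsum_closed)
      finally show "(x \<otimes>\<^bsub>matrix_algebra n A\<^esub> y \<otimes>\<^bsub>matrix_algebra n A\<^esub> z) (i, j) =
          (x \<otimes>\<^bsub>matrix_algebra n A\<^esub> (y \<otimes>\<^bsub>matrix_algebra n A\<^esub> z)) (i, j)" .
    qed
  next
    fix x assume "x \<in> carrier (matrix_algebra n A)"
    then have x: "x \<in> square n \<rightarrow>\<^sub>E carrier A" by simp
    have I: "\<one>\<^bsub>matrix_algebra n A\<^esub> \<in> square n \<rightarrow>\<^sub>E carrier A" by auto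
    show "\<one>\<^bsub>matrix_algebra n A\<^esub> \<otimes>\<^bsub>matrix_algebra n A\<^esub> x = x"
    proof (rule matrix_eq)
      fix i j assume ij: "i < n" "j < n"
      have "(\<one>\<^bsub>matrix_algebra n A\<^esub> \<otimes>\<^bsub>matrix_algebra n A\<^esub> x) (i, j) =
          (\<Oplus>l\<in>{..<n}. (if i = l then \<one> else \<zero>) \<otimes> x (l, j))"
        using ij x I by (intro matrix_mult_entry) auto
      also have "\<dots> = x (i, j)" using x ij by (intro finsum_delta[of _ i]) (auto simp: one_mult)
      finally show "(\<one>\<^bsub>matrix_algebra n A\<^esub> \<otimes>\<^bsub>matrix_algebra n A\<^esub> x) (i, j) = x (i, j)" .
    qed (intro matrix_mult_closed I x)+
    show "x \<otimes>\<^bsub>matrix_algebra n A\<^esub> \<one>\<^bsub>matrix_algebra n A\<^esub> = x"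
    proof (rule matrix_eq)
      fix i j assume ij: "i < n" "j < n"
      have "(x \<otimes>\<^bsub>matrix_algebra n A\<^esub> \<one>\<^bsub>matrix_algebra n A\<^esub>) (i, j) =
          (\<Oplus>l\<in>{..<n}. x (i, l) \<otimes> (if l = j then \<one> else \<zero>))"
        using ij x I by (intro matrix_mult_entry) auto
      also have "\<dots> = x (i, j)" using x ij by (intro finsum_delta[of _ j]) (auto simp: mult_one)
      finally show "(x \<otimes>\<^bsub>matrix_algebra n A\<^esub> \<one>\<^bsub>matrix_algebra n A\<^esub>) (i, j) = x (i, j)" .
    qed (intro matrix_mult_closed I x)+
  qed
qed

subsection \<open>Dimension\<close>

text \<open>Dimension over the copy of \<open>K\<close> inside \<open>A\<close> that consists of the
  multiples of the unit.\<close>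

definition alg_dim :: "('a, 'd) ring_scheme \<Rightarrow> ('a, 'b, 'c) module_scheme \<Rightarrow> nat \<Rightarrow> 'b set \<Rightarrow> bool" where
  "alg_dim K A n V \<longleftrightarrow> ring.dimension A n (scalars A (carrier K)) V"

definition is_subspace :: "('a, 'd) ring_scheme \<Rightarrow> ('a, 'b, 'c) module_scheme \<Rightarrow> 'b set \<Rightarrow> bool" where
  "is_subspace K A V \<longleftrightarrow> V \<subseteq> carrier A \<and> \<zero>\<^bsub>A\<^esub> \<in> V \<and> (\<forall>x\<in>V. \<forall>y\<in>V. x \<oplus>\<^bsub>A\<^esub> y \<in> V) \<and>
     (\<forall>c\<in>carrier K. \<forall>x\<in>V. c \<odot>\<^bsub>A\<^esub> x \<in> V)"

lemma is_subspaceI: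
  assumes "V \<subseteq> carrier A" "\<zero>\<^bsub>A\<^esub> \<in> V" "\<And>x y. x \<in> V \<Longrightarrow> y \<in> V \<Longrightarrow> x \<oplus>\<^bsub>A\<^esub> y \<in> V"
    "\<And>c x. c \<in> carrier K \<Longrightarrow> x \<in> V \<Longrightarrow> c \<odot>\<^bsub>A\<^esub> x \<in> V"
  shows "is_subspace K A V"
  using assms by (auto simp: is_subspace_def)

lemma is_subspaceD:
  assumes "is_subspace K A V"
  shows "x \<in> V \<Longrightarrow> x \<in> carrier A" "\<zero>\<^bsub>A\<^esub> \<in> V" "x \<in> V \<Longrightarrow> y \<in> V \<Longrightarrow> x \<oplus>\<^bsub>A\<^esub> y \<in> V"
    "c \<in> carrier K \<Longrightarrow> x \<in> V \<Longrightarrow> c \<odot>\<^bsub>A\<^esub> x \<in> V"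
  using assms by (auto simp: is_subspace_def)

context assoc_algebra
begin

lemma ring_A: "ring A"
proof (rule ringI)
  show "abelian_group A" by unfold_locales
  show "Group.monoid A" by unfold_locales (auto simp: mult_assoc one_mult mult_one)
qed (auto simp: mult_add_left mult_add_right)

sublocale ring A by (rule ring_A)

lemma scalar_hom: "ring_hom_ring K A (\<lambda>c. c \<odot> \<one>)"
proof (rule ring_hom_ringI)
  show "ring K" by (rule K.ring_axioms)
  show "ring A" by (rule ring_A)
  fix c d assume "c \<in> carrier K" "d \<in> carrier K"
  then show "c \<otimes>\<^bsub>K\<^esub> d \<odot> \<one> = (c \<odot> \<one>) \<otimes> (d \<odot> \<one>)"
    by (simp add: scale_scale scale_mult_left)
qed (auto simp: scale_add_left)

abbreviation S :: "'b set" where "S \<equiv> scalars A (carrier K)"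

lemma subfield_scalars: "subfield S A"
proof -
  interpret h: ring_hom_ring K A "\<lambda>c. c \<odot> \<one>" by (rule scalar_hom)
  show ?thesis
    using h.img_is_subfield(2)[OF K.carrier_is_subfield] by (simp add: scalars_def)
qed

lemma scalar_mult [simp]: "c \<in> carrier K \<Longrightarrow> x \<in> carrier A \<Longrightarrow> (c \<odot> \<one>) \<otimes> x = c \<odot> x"
  by (simp add: scale_mult_left one_mult)

lemma minus_scale: "x \<in> carrier A \<Longrightarrow> \<ominus> x = (\<ominus>\<^bsub>K\<^esub> \<one>\<^bsub>K\<^esub>) \<odot> x"
proof (rule minus_equality)
  assume x: "x \<in> carrier A"
  have "(\<ominus>\<^bsub>K\<^esub> \<one>\<^bsub>K\<^esub>) \<odot> x \<oplus> \<one>\<^bsub>K\<^esub> \<odot> x = (\<ominus>\<^bsub>K\<^esub> \<one>\<^bsub>K\<^esub> \<oplus>\<^bsub>K\<^esub> \<one>\<^bsub>K\<^esub>) \<odot> x"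
    using x by (simp only: scale_add_left K.a_inv_closed K.one_closed)
  then show "(\<ominus>\<^bsub>K\<^esub> \<one>\<^bsub>K\<^esub>) \<odot> x \<oplus> x = \<zero>" using x by (simp add: K.l_neg)
qed auto

lemma subspace_minus: "is_subspace K A V \<Longrightarrow> x \<in> V \<Longrightarrow> \<ominus> x \<in> V"
  using minus_scale is_subspaceD(1,4)[of K A V] by (metis K.a_inv_closed K.one_closed)

lemma subspace_diff: "is_subspace K A V \<Longrightarrow> x \<in> V \<Longrightarrow> y \<in> V \<Longrightarrow> x \<ominus> y \<in> V"
  unfolding a_minus_def by (meson subspace_minus is_subspaceD(3))

lemma subspace_subalgebra: "is_subspace K A V \<Longrightarrow> subalgebra S V A"
proof -
  assume V: "is_subspace K A V"
  have "subgroup V (add_monoid A)"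
    using is_subspaceD[OF V] subspace_minus[OF V] by (intro add.subgroupI) auto
  moreover have "k \<otimes> v \<in> V" if "k \<in> S" "v \<in> V" for k v
    using that is_subspaceD[OF V] by (auto simp: scalars_def)
  ultimately show ?thesis by (intro subalgebra.intro subalgebra_axioms.intro) auto
qed

lemma dim_subspace:
  assumes "alg_dim K A n V" shows "is_subspace K A V"
proof -
  note p = space_subgroup_props[OF subfield_scalars assms[unfolded alg_dim_def]]
  show ?thesis
  proof (rule is_subspaceI)
    fix c x assume cx: "c \<in> carrier K" "x \<in> V"
    then have "(c \<odot> \<one>) \<otimes> x \<in> V" by (intro p(5)) (auto simp: scalars_def)
    moreover have "x \<in> carrier A" using cx p(1) by auto
    ultimately show "c \<odot> x \<in> V" using cx by simp
  qed (use p in auto)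
qed

lemma dim_unique: "alg_dim K A n V \<Longrightarrow> alg_dim K A m V \<Longrightarrow> n = m"
  unfolding alg_dim_def by (rule dimension_is_inj[OF subfield_scalars])

lemma dim_of_subspace:
  assumes "alg_dim K A n V" "is_subspace K A W" "W \<subseteq> V"
  shows "\<exists>m. alg_dim K A m W"
  using subalbegra_incl_imp_finite_dimension[OF subfield_scalars _ subspace_subalgebra[OF assms(2)] assms(3)]
    assms(1) unfolding alg_dim_def finite_dimension_def by blast

lemma dim_full_subspace:
  assumes "alg_dim K A n V" "alg_dim K A n W" "W \<subseteq> V"
  shows "W = V"
proof -
  obtain Us where Us: "set Us \<subseteq> carrier A" "independent S Us" "length Us = n" "Span S Us = W"
    using exists_base[OF subfield_scalars assms(2)[unfolded alg_dim_def]] by blast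
  have "set Us \<subseteq> V" using Span_base_incl[OF subfield_scalars Us(1)] Us(4) assms(3) by auto
  then have "Span S Us = V"
    using independent_length_eq_dimension[OF subfield_scalars assms(1)[unfolded alg_dim_def] Us(2)] Us(3) by auto
  then show ?thesis using Us(4) by simp
qed

lemma dim_zero: "alg_dim K A 0 {\<zero>}"
  by (simp add: alg_dim_def)

lemma dim_line:
  assumes "v \<in> carrier A" "v \<noteq> \<zero>"
  shows "alg_dim K A 1 {c \<odot> v | c. c \<in> carrier K}"
proof -
  have "dimension (Suc 0) S (line_extension S v {\<zero>})"
    using assms by (intro Suc_dim) auto
  moreover have "line_extension S v {\<zero>} = {c \<odot> v | c. c \<in> carrier K}"
    using assms(1) by (auto simp: line_extension_mem_iff scalars_def)
  ultimately show ?thesis by (simp add: alg_dim_def)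
qed

lemma dim_add:
  assumes "alg_dim K A n V" "alg_dim K A m W" "V \<inter> W = {\<zero>}"
  shows "alg_dim K A (n + m) (V <+>\<^bsub>A\<^esub> W)"
  using dimension_direct_sum_space[OF subfield_scalars] assms unfolding alg_dim_def by blast

text \<open>The projections \<open>\<pi> i\<close> show that the sum of the \<open>W i\<close> is direct
  and that it exhausts \<open>V\<close>.\<close>

lemma dim_direct_sum:
  assumes fin: "finite I" and V: "is_subspace K A V"
    and dim: "\<And>i. i \<in> I \<Longrightarrow> alg_dim K A d (W i)" and sub: "\<And>i. i \<in> I \<Longrightarrow> W i \<subseteq> V"
    and proj: "\<And>i x. i \<in> I \<Longrightarrow> x \<in> V \<Longrightarrow> \<pi> i x \<in> W i"
    and add: "\<And>i x y. i \<in> I \<Longrightarrow> x \<in> V \<Longrightarrow> y \<in> V \<Longrightarrow> \<pi> i (x \<oplus> y) = \<pi> i x \<oplus> \<pi> i y"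
    and scale: "\<And>i c x. i \<in> I \<Longrightarrow> c \<in> carrier K \<Longrightarrow> x \<in> V \<Longrightarrow> \<pi> i (c \<odot> x) = c \<odot> \<pi> i x"
    and same: "\<And>i v. i \<in> I \<Longrightarrow> v \<in> W i \<Longrightarrow> \<pi> i v = v"
    and other: "\<And>i j v. i \<in> I \<Longrightarrow> j \<in> I \<Longrightarrow> i \<noteq> j \<Longrightarrow> v \<in> W j \<Longrightarrow> \<pi> i v = \<zero>"
    and faithful: "\<And>x. x \<in> V \<Longrightarrow> (\<And>i. i \<in> I \<Longrightarrow> \<pi> i x = \<zero>) \<Longrightarrow> x = \<zero>"
  shows "alg_dim K A (card I * d) V"
proof -
  note VD = is_subspaceD[OF V]
  have \<pi>V: "\<pi> i x \<in> V" if "i \<in> I" "x \<in> V" for i x using sub proj that by blast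
  have \<pi>0: "\<pi> i \<zero> = \<zero>" if "i \<in> I" for i
    using add[OF that VD(2) VD(2)] \<pi>V[OF that VD(2)] VD(1) by (auto intro!: additive_zero)
  have \<pi>minus: "\<pi> i (\<ominus> x) = \<ominus> \<pi> i x" if "i \<in> I" "x \<in> V" for i x
    using that scale[of i "\<ominus>\<^bsub>K\<^esub> \<one>\<^bsub>K\<^esub>" x] VD(1) \<pi>V by (simp add: minus_scale)
  have "alg_dim K A (card J * d) {x \<in> V. \<forall>i\<in>I - J. \<pi> i x = \<zero>}" if "finite J" "J \<subseteq> I" for J
    using that
  proof (induction J)
    case empty
    have "{x \<in> V. \<forall>i\<in>I - {}. \<pi> i x = \<zero>} = {\<zero>}" using faithful VD(2) \<pi>0 by auto
    then show ?case by (simp add: dim_zero)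
  next
    case (insert j J)
    let ?V = "\<lambda>J. {x \<in> V. \<forall>i\<in>I - J. \<pi> i x = \<zero>}"
    have j: "j \<in> I" using insert by auto
    have "alg_dim K A (d + card J * d) (W j <+>\<^bsub>A\<^esub> ?V J)"
    proof (rule dim_add)
      show "alg_dim K A d (W j)" using dim j .
      show "alg_dim K A (card J * d) (?V J)" using insert by auto
      have "x = \<zero>" if "x \<in> W j" "x \<in> ?V J" for x
      proof -
        have "\<pi> j x = \<zero>" using that(2) insert.hyps(2) j by auto
        then show ?thesis using same[OF j that(1)] by simp
      qed
      moreover have "\<zero> \<in> W j" using dim_subspace[OF dim[OF j]] is_subspaceD(2) by blast
      ultimately show "W j \<inter> ?V J = {\<zero>}" using VD(2) \<pi>0 by auto
    qed
    moreover have "W j <+>\<^bsub>A\<^esub> ?V J = ?V (insert j J)"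
    proof (intro equalityI subsetI)
      fix z assume "z \<in> W j <+>\<^bsub>A\<^esub> ?V J"
      then obtain w x where wx: "w \<in> W j" "x \<in> ?V J" "z = w \<oplus> x" unfolding set_add_def' by auto
      have wV: "w \<in> V" using wx(1) sub j by auto
      have "\<pi> i z = \<zero>" if "i \<in> I - insert j J" for i
        using that wx wV add[of i w x] other[of i j w] j by auto
      moreover have "z \<in> V" using wx wV VD(3) by auto
      ultimately show "z \<in> ?V (insert j J)" by auto
    next
      fix z assume z: "z \<in> ?V (insert j J)"
      then have zV: "z \<in> V" by simp
      have pV: "\<pi> j z \<in> V" using \<pi>V[OF j zV] .
      define x where "x = z \<ominus> \<pi> j z"
      have xV: "x \<in> V" unfolding x_def using subspace_diff[OF V zV pV] .
      have px: "\<pi> i x = \<pi> i z \<ominus> \<pi> i (\<pi> j z)" if "i \<in> I" for i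
        unfolding x_def a_minus_def
        using add[OF that zV subspace_minus[OF V pV]] \<pi>minus[OF that pV] by simp
      have "\<pi> i x = \<zero>" if "i \<in> I - J" for i
      proof (cases "i = j")
        case True
        have "\<pi> j x = \<pi> j z \<ominus> \<pi> j z" using px[OF j] same[OF j proj[OF j zV]] by simp
        then show ?thesis using True VD(1)[OF pV] by (simp add: r_neg a_minus_def)
      next
        case False
        then show ?thesis using that px[of i] z other[of i j "\<pi> j z"] proj[OF j zV] j
          by (simp add: a_minus_def)
      qed
      moreover have "z = \<pi> j z \<oplus> x"
        unfolding x_def using VD(1)[OF zV] VD(1)[OF pV] by (simp add: a_minus_def a_lcomm r_neg)
      ultimately show "z \<in> W j <+>\<^bsub>A\<^esub> ?V J" unfolding set_add_def' using proj[OF j zV] xV by blast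
    qed
    ultimately show ?case using insert by simp
  qed
  from this[OF fin order_refl] show ?thesis by simp
qed

end

lemma dim_image:
  assumes "assoc_algebra K A" "assoc_algebra K B" "alg_dim K A n V"
    and "\<And>x. x \<in> V \<Longrightarrow> f x \<in> carrier B"
    and "\<And>x y. x \<in> V \<Longrightarrow> y \<in> V \<Longrightarrow> f (x \<oplus>\<^bsub>A\<^esub> y) = f x \<oplus>\<^bsub>B\<^esub> f y"
    and "\<And>c x. c \<in> carrier K \<Longrightarrow> x \<in> V \<Longrightarrow> f (c \<odot>\<^bsub>A\<^esub> x) = c \<odot>\<^bsub>B\<^esub> f x"
    and "inj_on f V"
  shows "alg_dim K B n (f ` V)"
proof -
  interpret A: assoc_algebra K A by fact
  interpret B: assoc_algebra K B by fact
  show ?thesis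
    using assms(3-)
  proof (induction n arbitrary: V)
    case 0
    then have V: "V = {\<zero>\<^bsub>A\<^esub>}" using A.dimension_zero[OF A.subfield_scalars] by (simp add: alg_dim_def)
    then have "f \<zero>\<^bsub>A\<^esub> \<oplus>\<^bsub>B\<^esub> f \<zero>\<^bsub>A\<^esub> = f \<zero>\<^bsub>A\<^esub>" "f \<zero>\<^bsub>A\<^esub> \<in> carrier B"
      using "0.prems"(2)[of "\<zero>\<^bsub>A\<^esub>"] "0.prems"(3)[of "\<zero>\<^bsub>A\<^esub>" "\<zero>\<^bsub>A\<^esub>"] by auto
    then have "f \<zero>\<^bsub>A\<^esub> = \<zero>\<^bsub>B\<^esub>" by (intro B.additive_zero)
    then show ?case using V B.dim_zero by simp
  next
    case (Suc n)
    obtain v E where vE: "v \<in> carrier A" "A.dimension n A.S E" "v \<notin> E" "V = A.line_extension A.S v E"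
      using A.dimension_backwards[OF A.subfield_scalars] Suc.prems(1) unfolding alg_dim_def by blast
    have E: "alg_dim K A n E" using vE by (simp add: alg_dim_def)
    note ED = is_subspaceD[OF A.dim_subspace[OF E]]
    have V_iff: "z \<in> V \<longleftrightarrow> (\<exists>c\<in>carrier K. \<exists>e\<in>E. z = c \<odot>\<^bsub>A\<^esub> v \<oplus>\<^bsub>A\<^esub> e)" for z
      using vE(1) unfolding vE(4) A.line_extension_mem_iff by (auto simp: scalars_def)
    have EV: "e \<in> V" if "e \<in> E" for e
      unfolding V_iff using that ED(1) vE(1) by (intro bexI[of _ "\<zero>\<^bsub>K\<^esub>"] bexI[of _ e]) auto
    have cV: "c \<odot>\<^bsub>A\<^esub> v \<in> V" if "c \<in> carrier K" for c
      unfolding V_iff using that ED(2) vE(1) by (intro bexI[of _ c] bexI[of _ "\<zero>\<^bsub>A\<^esub>"]) auto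
    have vV: "v \<in> V" using cV[OF A.K.one_closed] vE(1) by simp
    have "alg_dim K B n (f ` E)"
      using EV Suc.prems(2-4) inj_on_subset[OF Suc.prems(5), of E] by (intro Suc.IH[OF E]) auto
    then have "B.dimension n B.S (f ` E)" by (simp add: alg_dim_def)
    moreover have "f v \<notin> f ` E" using vE(3) EV vV Suc.prems(5) by (auto dest: inj_onD)
    ultimately have "B.dimension (Suc n) B.S (B.line_extension B.S (f v) (f ` E))"
      using Suc.prems(2)[OF vV] by (intro B.Suc_dim)
    moreover have "B.line_extension B.S (f v) (f ` E) = f ` V"
    proof -
      have f_lin: "f (c \<odot>\<^bsub>A\<^esub> v \<oplus>\<^bsub>A\<^esub> e) = c \<odot>\<^bsub>B\<^esub> f v \<oplus>\<^bsub>B\<^esub> f e" if "c \<in> carrier K" "e \<in> E" for c e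
        using that Suc.prems(3)[OF cV EV] Suc.prems(4)[OF _ vV] by simp
      have "z \<in> B.line_extension B.S (f v) (f ` E) \<longleftrightarrow>
          (\<exists>c\<in>carrier K. \<exists>e\<in>E. z = c \<odot>\<^bsub>B\<^esub> f v \<oplus>\<^bsub>B\<^esub> f e)" for z
        using Suc.prems(2)[OF vV] unfolding B.line_extension_mem_iff by (auto simp: scalars_def)
      moreover have "z \<in> f ` V \<longleftrightarrow> (\<exists>c\<in>carrier K. \<exists>e\<in>E. z = c \<odot>\<^bsub>B\<^esub> f v \<oplus>\<^bsub>B\<^esub> f e)" for z
        unfolding image_iff using V_iff f_lin by (metis (no_types, lifting))
      ultimately show ?thesis by blast
    qed
    ultimately show ?case by (simp add: alg_dim_def)
  qed
qed

subsection \<open>Isomorphisms\<close>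

lemma algebra_isoD:
  assumes "h \<in> algebra_iso K A B"
  shows "bij_betw h (carrier A) (carrier B)"
    "x \<in> carrier A \<Longrightarrow> h x \<in> carrier B"
    "x \<in> carrier A \<Longrightarrow> y \<in> carrier A \<Longrightarrow> h (x \<otimes>\<^bsub>A\<^esub> y) = h x \<otimes>\<^bsub>B\<^esub> h y"
    "x \<in> carrier A \<Longrightarrow> y \<in> carrier A \<Longrightarrow> h (x \<oplus>\<^bsub>A\<^esub> y) = h x \<oplus>\<^bsub>B\<^esub> h y"
    "h \<one>\<^bsub>A\<^esub> = \<one>\<^bsub>B\<^esub>"
    "c \<in> carrier K \<Longrightarrow> x \<in> carrier A \<Longrightarrow> h (c \<odot>\<^bsub>A\<^esub> x) = c \<odot>\<^bsub>B\<^esub> h x"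
  using assms by (auto simp: algebra_iso_def ring_iso_def dest: ring_hom_closed ring_hom_mult ring_hom_add ring_hom_one)

lemma algebra_isoI:
  assumes "bij_betw h (carrier A) (carrier B)"
    "\<And>x y. x \<in> carrier A \<Longrightarrow> y \<in> carrier A \<Longrightarrow> h (x \<otimes>\<^bsub>A\<^esub> y) = h x \<otimes>\<^bsub>B\<^esub> h y"
    "\<And>x y. x \<in> carrier A \<Longrightarrow> y \<in> carrier A \<Longrightarrow> h (x \<oplus>\<^bsub>A\<^esub> y) = h x \<oplus>\<^bsub>B\<^esub> h y"
    "h \<one>\<^bsub>A\<^esub> = \<one>\<^bsub>B\<^esub>"
    "\<And>c x. c \<in> carrier K \<Longrightarrow> x \<in> carrier A \<Longrightarrow> h (c \<odot>\<^bsub>A\<^esub> x) = c \<odot>\<^bsub>B\<^esub> h x"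
  shows "h \<in> algebra_iso K A B"
  using assms by (auto simp: algebra_iso_def ring_iso_def ring_hom_def bij_betw_def)

lemma algebra_iso_comp:
  assumes "h \<in> algebra_iso K A B" "g \<in> algebra_iso K B C"
  shows "g \<circ> h \<in> algebra_iso K A C"
  using algebra_isoD[OF assms(1)] algebra_isoD[OF assms(2)]
  by (intro algebra_isoI) (auto intro: bij_betw_trans)

lemma (in pre_algebra) algebra_iso_inv:
  assumes h: "h \<in> algebra_iso K A B"
  shows "inv_into (carrier A) h \<in> algebra_iso K B A"
proof -
  let ?g = "inv_into (carrier A) h"
  note hD = algebra_isoD[OF h]
  have g: "?g x \<in> carrier A" "h (?g x) = x" if "x \<in> carrier B" for x
    using that hD(1) by (auto simp: bij_betw_def inv_into_into f_inv_into_f)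
  have gh: "?g (h x) = x" if "x \<in> carrier A" for x
    using that hD(1) by (simp add: bij_betw_def)
  show ?thesis
  proof (rule algebra_isoI)
    show "bij_betw ?g (carrier B) (carrier A)" by (rule bij_betw_inv_into[OF hD(1)])
    fix x y assume "x \<in> carrier B" "y \<in> carrier B"
    then show "?g (x \<otimes>\<^bsub>B\<^esub> y) = ?g x \<otimes> ?g y" "?g (x \<oplus>\<^bsub>B\<^esub> y) = ?g x \<oplus> ?g y"
      using gh[of "?g x \<otimes> ?g y"] gh[of "?g x \<oplus> ?g y"] hD(3,4) g by auto
  next
    show "?g \<one>\<^bsub>B\<^esub> = \<one>" using gh[of \<one>] hD(5) by simp
    fix c x assume "c \<in> carrier K" "x \<in> carrier B"
    then show "?g (c \<odot>\<^bsub>B\<^esub> x) = c \<odot> ?g x" using gh[of "c \<odot> ?g x"] hD(6) g by simp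
  qed
qed

lemma (in pre_algebra) assoc_algebra_iso:
  assumes "assoc_algebra K B" "h \<in> algebra_iso K B A"
  shows "assoc_algebra K A"
proof -
  interpret B: assoc_algebra K B by fact
  note hD = algebra_isoD[OF assms(2)]
  have ex: "\<exists>y\<in>carrier B. x = h y" if "x \<in> carrier A" for x
    using that hD(1) by (auto simp: bij_betw_def)
  show ?thesis
  proof unfold_locales
    fix x y z assume "x \<in> carrier A" "y \<in> carrier A" "z \<in> carrier A"
    then obtain a b c where "a \<in> carrier B" "x = h a" "b \<in> carrier B" "y = h b" "c \<in> carrier B" "z = h c"
      using ex by metis
    then show "x \<otimes> y \<otimes> z = x \<otimes> (y \<otimes> z)"
      using B.mult_assoc[of a b c] by (simp flip: hD(3))
  next
    fix x assume "x \<in> carrier A"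
    then obtain a where "a \<in> carrier B" "x = h a" using ex by metis
    then show "\<one> \<otimes> x = x" "x \<otimes> \<one> = x"
      using B.one_mult[of a] B.mult_one[of a] by (simp_all flip: hD(3,5))
  qed
qed

subsection \<open>Modules of minimal dimension are a Brauer invariant\<close>

context assoc_algebra
begin

lemma single_in: "x \<in> carrier A \<Longrightarrow> single n A i j x \<in> carrier (matrix_algebra n A)"
  by simp

lemma dim_matrix_algebra:
  assumes "n > 0" "alg_dim K A d (carrier A)"
  shows "alg_dim K (matrix_algebra n A) (n * n * d) (carrier (matrix_algebra n A))"
proof -
  interpret M: assoc_algebra K "matrix_algebra n A" by (rule assoc_algebra_matrix[OF assms(1)])
  define W where "W = (\<lambda>(i, j). single n A i j ` carrier A)"
  define \<pi> where "\<pi> = (\<lambda>(i, j) (M :: nat \<times> nat \<Rightarrow> 'b). single n A i j (M (i, j)))"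
  have "alg_dim K (matrix_algebra n A) (card (square n) * d) (carrier (matrix_algebra n A))"
  proof (rule M.dim_direct_sum[where W=W and \<pi>=\<pi>])
    show "is_subspace K (matrix_algebra n A) (carrier (matrix_algebra n A))"
      by (rule is_subspaceI) (auto simp del: matrix_simps)
    fix i assume "i \<in> square n"
    then obtain k l where i: "i = (k, l)" "k < n" "l < n" by auto
    show "alg_dim K (matrix_algebra n A) d (W i)"
      unfolding i(1) W_def prod.case
      by (rule dim_image[OF assoc_algebra_axioms M.assoc_algebra_axioms assms(2)])
        (auto simp: single_add single_scale single_in inj_on_def dest: single_inj[OF i(2,3)] simp del: matrix_simps)
    show "W i \<subseteq> carrier (matrix_algebra n A)" by (auto simp: W_def i single_in simp del: matrix_simps)
    show "\<pi> i v = v" if "v \<in> W i" for v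
      using that i by (auto simp: W_def \<pi>_def single_entry)
    show "\<pi> i v = \<zero>\<^bsub>matrix_algebra n A\<^esub>" if "j \<in> square n" "i \<noteq> j" "v \<in> W j" for j v
      using that i by (auto simp: W_def \<pi>_def single_entry single_zero simp del: matrix_simps(4))
    fix M assume M: "M \<in> carrier (matrix_algebra n A)"
    then show "\<pi> i M \<in> W i" using i by (auto simp: W_def \<pi>_def)
    show "\<pi> i (M \<oplus>\<^bsub>matrix_algebra n A\<^esub> N) = \<pi> i M \<oplus>\<^bsub>matrix_algebra n A\<^esub> \<pi> i N"
      if "N \<in> carrier (matrix_algebra n A)" for N
      using that M i by (auto simp: \<pi>_def single_def fun_eq_iff)
    show "\<pi> i (c \<odot>\<^bsub>matrix_algebra n A\<^esub> M) = c \<odot>\<^bsub>matrix_algebra n A\<^esub> \<pi> i M" if "c \<in> carrier K" for c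
      using that M i by (auto simp: \<pi>_def single_def fun_eq_iff)
  next
    fix M assume M: "M \<in> carrier (matrix_algebra n A)"
      and 0: "\<And>i. i \<in> square n \<Longrightarrow> \<pi> i M = \<zero>\<^bsub>matrix_algebra n A\<^esub>"
    show "M = \<zero>\<^bsub>matrix_algebra n A\<^esub>"
    proof (rule matrix_eq)
      fix i j assume ij: "i < n" "j < n"
      have "single n A i j (M (i, j)) = single n A i j \<zero>"
        using 0[of "(i, j)"] ij by (simp add: \<pi>_def single_zero del: matrix_simps)
      then show "M (i, j) = \<zero>\<^bsub>matrix_algebra n A\<^esub> (i, j)" using single_inj[OF ij] ij by simp
    qed (use M in auto)
  qed auto
  then show ?thesis by (simp add: card_cartesian_product)
qed

text \<open>The matrices whose first column has entries in a left ideal and whose other columns vanish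
  form a left ideal, which consists of one copy of the given ideal for each row.\<close>

lemma dim_left_ideal_of_corner:
  assumes n: "n > 0" and I: "alg_dim K A d I" "\<And>a x. a \<in> carrier A \<Longrightarrow> x \<in> I \<Longrightarrow> a \<otimes> x \<in> I"
  defines "J \<equiv> {M \<in> carrier (matrix_algebra n A). \<forall>i<n. M (i, 0) \<in> I \<and> (\<forall>j<n. j \<noteq> 0 \<longrightarrow> M (i, j) = \<zero>)}"
  shows "alg_dim K (matrix_algebra n A) (n * d) J"
    and "\<And>M N. M \<in> carrier (matrix_algebra n A) \<Longrightarrow> N \<in> J \<Longrightarrow> M \<otimes>\<^bsub>matrix_algebra n A\<^esub> N \<in> J"
proof -
  interpret M: assoc_algebra K "matrix_algebra n A" by (rule assoc_algebra_matrix[OF n])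
  note ID = is_subspaceD[OF dim_subspace[OF I(1)]]
  have J: "is_subspace K (matrix_algebra n A) J"
    by (rule is_subspaceI) (use n ID in \<open>auto simp: J_def\<close>)
  define \<pi> where "\<pi> = (\<lambda>i (M :: nat \<times> nat \<Rightarrow> 'b). single n A i 0 (M (i, 0)))"
  have "alg_dim K (matrix_algebra n A) (card {..<n} * d) J"
  proof (rule M.dim_direct_sum[where W="\<lambda>i. single n A i 0 ` I" and \<pi>=\<pi>, OF _ J])
    fix i assume "i \<in> {..<n}"
    then have i: "i < n" by simp
    show "alg_dim K (matrix_algebra n A) d (single n A i 0 ` I)"
      by (rule dim_image[OF assoc_algebra_axioms M.assoc_algebra_axioms I(1)])
        (auto simp: single_add single_scale single_in inj_on_def ID(1) dest: single_inj[OF i n] simp del: matrix_simps)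
    show "single n A i 0 ` I \<subseteq> J"
      using ID(1,2) n i single_in by (auto simp: J_def single_entry simp del: matrix_simps)
    show "\<pi> i v = v" if "v \<in> single n A i 0 ` I" for v
      using that i n by (auto simp: \<pi>_def single_entry)
    show "\<pi> i v = \<zero>\<^bsub>matrix_algebra n A\<^esub>" if "j \<in> {..<n}" "i \<noteq> j" "v \<in> single n A j 0 ` I" for j v
      using that i n by (auto simp: \<pi>_def single_entry single_zero simp del: matrix_simps(4))
    fix M assume M: "M \<in> J"
    then show "\<pi> i M \<in> single n A i 0 ` I" using i by (auto simp: J_def \<pi>_def)
    show "\<pi> i (M \<oplus>\<^bsub>matrix_algebra n A\<^esub> N) = \<pi> i M \<oplus>\<^bsub>matrix_algebra n A\<^esub> \<pi> i N"
      if "N \<in> J" for N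
      using that M i n by (auto simp: J_def \<pi>_def single_def fun_eq_iff)
    show "\<pi> i (c \<odot>\<^bsub>matrix_algebra n A\<^esub> M) = c \<odot>\<^bsub>matrix_algebra n A\<^esub> \<pi> i M" if "c \<in> carrier K" for c
      using that M i n by (auto simp: J_def \<pi>_def single_def fun_eq_iff)
  next
    fix M assume M: "M \<in> J" and 0: "\<And>i. i \<in> {..<n} \<Longrightarrow> \<pi> i M = \<zero>\<^bsub>matrix_algebra n A\<^esub>"
    show "M = \<zero>\<^bsub>matrix_algebra n A\<^esub>"
    proof (rule matrix_eq)
      fix i j assume ij: "i < n" "j < n"
      have "single n A i 0 (M (i, 0)) = single n A i 0 \<zero>"
        using 0[of i] ij by (simp add: \<pi>_def single_zero del: matrix_simps)
      then have "M (i, 0) = \<zero>" using single_inj[OF ij(1) n] by simp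
      then show "M (i, j) = \<zero>\<^bsub>matrix_algebra n A\<^esub> (i, j)"
        using M ij by (cases "j = 0") (auto simp: J_def)
    qed (use M in \<open>auto simp: J_def\<close>)
  qed auto
  then show "alg_dim K (matrix_algebra n A) (n * d) J" by simp
  fix M N assume M: "M \<in> carrier (matrix_algebra n A)" and N: "N \<in> J"
  have NC: "N \<in> square n \<rightarrow>\<^sub>E carrier A" and MC: "M \<in> square n \<rightarrow>\<^sub>E carrier A" using M N by (auto simp: J_def)
  have "finsum A g T \<in> I" if "finite T" "g \<in> T \<rightarrow> I" for g and T :: "nat set"
    using that by (induction T) (use ID in \<open>auto simp: Pi_def finsum_insert\<close>)
  then have "(M \<otimes>\<^bsub>matrix_algebra n A\<^esub> N) (i, 0) \<in> I" if "i < n" for i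
    using that n M N I(2) by (auto simp: J_def)
  moreover have "(M \<otimes>\<^bsub>matrix_algebra n A\<^esub> N) (i, j) = \<zero>" if "i < n" "j < n" "j \<noteq> 0" for i j
  proof -
    have "(M \<otimes>\<^bsub>matrix_algebra n A\<^esub> N) (i, j) = (\<Oplus>l\<in>{..<n}. \<zero>)"
      using that N MC NC by (intro matrix_mult_entry) (auto simp: J_def)
    then show ?thesis by simp
  qed
  ultimately show "M \<otimes>\<^bsub>matrix_algebra n A\<^esub> N \<in> J"
    using matrix_mult_closed[OF MC NC] unfolding J_def by (simp del: matrix_simps(2))
qed

text \<open>The matrix unit at \<open>(i, 0)\<close> carries the part of a left ideal that is supported
  in row 0 isomorphically to the part in row \<open>i\<close>. The left ideal is the direct sum of these
  parts.\<close>

lemma dim_corner_of_left_ideal: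
  assumes n: "n > 0"
    and J: "alg_dim K (matrix_algebra n A) N J"
      "\<And>M x. M \<in> carrier (matrix_algebra n A) \<Longrightarrow> x \<in> J \<Longrightarrow> M \<otimes>\<^bsub>matrix_algebra n A\<^esub> x \<in> J"
  obtains d where "N = n * d" "alg_dim K (matrix_algebra n A) d
      {x \<in> J. single n A 0 0 \<one> \<otimes>\<^bsub>matrix_algebra n A\<^esub> x = x}"
proof -
  interpret M: assoc_algebra K "matrix_algebra n A" by (rule assoc_algebra_matrix[OF n])
  let ?R = "matrix_algebra n A"
  let ?e = "\<lambda>i j. single n A i j \<one>"
  define W where "W = {x \<in> J. ?e 0 0 \<otimes>\<^bsub>?R\<^esub> x = x}"
  note JS = M.dim_subspace[OF J(1)]
  note JD = is_subspaceD[OF JS]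
  have e: "?e i j \<in> carrier ?R" for i j by simp
  have ee: "?e i j \<otimes>\<^bsub>?R\<^esub> (?e k l \<otimes>\<^bsub>?R\<^esub> x) = (if j = k then ?e i l \<otimes>\<^bsub>?R\<^esub> x else \<zero>\<^bsub>?R\<^esub>)"
    if "j < n" "k < n" "x \<in> carrier ?R" for i j k l x
    using that e
    by (simp add: single_mult_single single_zero one_mult del: matrix_simps flip: M.mult_assoc)
  have W: "is_subspace K ?R W"
    by (rule is_subspaceI)
      (use JD M.mult_add_right[OF _ _ e] M.scale_mult_right[OF _ e] M.mult_zero_right[OF e] in
        \<open>auto simp: W_def simp del: matrix_simps\<close>)
  obtain d where d: "alg_dim K ?R d W"
    using M.dim_of_subspace[OF J(1) W] by (auto simp: W_def)
  have WD: "x \<in> J" "x \<in> carrier ?R" "?e 0 0 \<otimes>\<^bsub>?R\<^esub> x = x" if "x \<in> W" for x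
    using that JD(1) by (auto simp: W_def simp del: matrix_simps)
  have "alg_dim K ?R (card {..<n} * d) J"
  proof (rule M.dim_direct_sum[where W="\<lambda>i. (\<lambda>x. ?e i 0 \<otimes>\<^bsub>?R\<^esub> x) ` W" and \<pi>="\<lambda>i x. ?e i i \<otimes>\<^bsub>?R\<^esub> x", OF _ JS])
    fix i assume "i \<in> {..<n}"
    then have i: "i < n" by simp
    show "alg_dim K ?R d ((\<lambda>x. ?e i 0 \<otimes>\<^bsub>?R\<^esub> x) ` W)"
    proof (rule dim_image[OF M.assoc_algebra_axioms M.assoc_algebra_axioms d])
      show "inj_on (\<lambda>x. ?e i 0 \<otimes>\<^bsub>?R\<^esub> x) W"
      proof (rule inj_onI)
        fix x y assume xy: "x \<in> W" "y \<in> W" "?e i 0 \<otimes>\<^bsub>?R\<^esub> x = ?e i 0 \<otimes>\<^bsub>?R\<^esub> y"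
        have "?e 0 i \<otimes>\<^bsub>?R\<^esub> (?e i 0 \<otimes>\<^bsub>?R\<^esub> x) = ?e 0 i \<otimes>\<^bsub>?R\<^esub> (?e i 0 \<otimes>\<^bsub>?R\<^esub> y)" using xy(3) by simp
        then show "x = y" using xy(1,2) WD i by (simp add: ee del: matrix_simps)
      qed
    qed (use WD(2) e M.mult_add_right[OF _ _ e] M.scale_mult_right[OF _ e] in \<open>auto simp del: matrix_simps\<close>)
    show "(\<lambda>x. ?e i 0 \<otimes>\<^bsub>?R\<^esub> x) ` W \<subseteq> J" using WD(1) J(2)[OF e] by auto
    show "?e i i \<otimes>\<^bsub>?R\<^esub> v = v" if "v \<in> (\<lambda>x. ?e i 0 \<otimes>\<^bsub>?R\<^esub> x) ` W" for v
      using that ee[of i i _ i 0] i WD(2) by (auto simp del: matrix_simps)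
    show "?e i i \<otimes>\<^bsub>?R\<^esub> v = \<zero>\<^bsub>?R\<^esub>" if "j \<in> {..<n}" "i \<noteq> j" "v \<in> (\<lambda>x. ?e j 0 \<otimes>\<^bsub>?R\<^esub> x) ` W" for j v
      using that ee[of i j _ i 0] i WD(2) by (auto simp del: matrix_simps)
    fix x assume x: "x \<in> J"
    then have xR: "x \<in> carrier ?R" by (rule JD(1))
    have "?e 0 i \<otimes>\<^bsub>?R\<^esub> x \<in> W" using x J(2)[OF e] ee[of 0 0 x 0 i] xR n by (auto simp: W_def simp del: matrix_simps)
    moreover have "?e i i \<otimes>\<^bsub>?R\<^esub> x = ?e i 0 \<otimes>\<^bsub>?R\<^esub> (?e 0 i \<otimes>\<^bsub>?R\<^esub> x)" using ee[of 0 0 x i i] n xR by (simp del: matrix_simps)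
    ultimately show "?e i i \<otimes>\<^bsub>?R\<^esub> x \<in> (\<lambda>x. ?e i 0 \<otimes>\<^bsub>?R\<^esub> x) ` W" by blast
    show "?e i i \<otimes>\<^bsub>?R\<^esub> (x \<oplus>\<^bsub>?R\<^esub> y) = ?e i i \<otimes>\<^bsub>?R\<^esub> x \<oplus>\<^bsub>?R\<^esub> ?e i i \<otimes>\<^bsub>?R\<^esub> y" if "y \<in> J" for y
      using M.mult_add_right[OF xR JD(1)[OF that] e] .
    show "?e i i \<otimes>\<^bsub>?R\<^esub> (c \<odot>\<^bsub>?R\<^esub> x) = c \<odot>\<^bsub>?R\<^esub> (?e i i \<otimes>\<^bsub>?R\<^esub> x)" if "c \<in> carrier K" for c
      using M.scale_mult_right[OF that e xR] .
  next
    fix x assume x: "x \<in> J" and 0: "\<And>i. i \<in> {..<n} \<Longrightarrow> ?e i i \<otimes>\<^bsub>?R\<^esub> x = \<zero>\<^bsub>?R\<^esub>"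
    have xR: "x \<in> square n \<rightarrow>\<^sub>E carrier A" using JD(1)[OF x] by simp
    show "x = \<zero>\<^bsub>?R\<^esub>"
    proof (rule matrix_eq)
      fix i j assume ij: "i < n" "j < n"
      have "(?e i i \<otimes>\<^bsub>?R\<^esub> x) (i, j) = x (i, j)"
        using ij xR by (subst single_mult_entry) (auto simp: one_mult)
      then show "x (i, j) = \<zero>\<^bsub>?R\<^esub> (i, j)" using 0[of i] ij by (simp del: matrix_simps)
    qed (use xR in auto)
  qed auto
  then have "N = n * d" using M.dim_unique[OF J(1)] by simp
  then show ?thesis using that[of d] d unfolding W_def by blast
qed

end

text \<open>The degree of a central simple algebra is the square root of its dimension. If an algebra
  has a left ideal whose dimension equals its degree (that is, if it is split), then any algebra
  that is Brauer equivalent to it acts on a space whose dimension is its own degree. The left ideal \<open>I\<close> yields one of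
  dimension \<open>m * \<alpha>\<close> in the matrix algebra. Comparing the dimensions of the two matrix algebras gives
  \<open>m * \<alpha> = q * \<beta>\<close>, so the corner of that ideal has dimension \<open>\<beta>\<close>.\<close>

theorem brauer_equiv_transfer_module:
  assumes A: "assoc_algebra K A" and B: "pre_algebra K B"
    and mq: "m > 0" "q > 0" and h: "h \<in> algebra_iso K (matrix_algebra m A) (matrix_algebra q B)"
    and dA: "alg_dim K A (\<alpha> * \<alpha>) (carrier A)"
    and dB: "assoc_algebra K B \<Longrightarrow> alg_dim K B (\<beta> * \<beta>) (carrier B)"
    and I: "alg_dim K A \<alpha> I" "\<And>a x. a \<in> carrier A \<Longrightarrow> x \<in> I \<Longrightarrow> a \<otimes>\<^bsub>A\<^esub> x \<in> I"
  obtains W where "assoc_algebra K B" "assoc_algebra K (matrix_algebra q B)"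
    "alg_dim K (matrix_algebra q B) \<beta> W"
    "\<And>b w. b \<in> carrier B \<Longrightarrow> w \<in> W \<Longrightarrow> single q B 0 0 b \<otimes>\<^bsub>matrix_algebra q B\<^esub> w \<in> W"
    "\<And>w. w \<in> W \<Longrightarrow> single q B 0 0 \<one>\<^bsub>B\<^esub> \<otimes>\<^bsub>matrix_algebra q B\<^esub> w = w"
proof -
  interpret A: assoc_algebra K A by fact
  interpret B0: pre_algebra K B by fact
  interpret MA: assoc_algebra K "matrix_algebra m A" by (rule A.assoc_algebra_matrix[OF mq(1)])
  interpret MB: assoc_algebra K "matrix_algebra q B"
    by (rule pre_algebra.assoc_algebra_iso[OF B0.pre_algebra_matrix[OF mq(2)] MA.assoc_algebra_axioms h])
  interpret B: assoc_algebra K B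
    by (rule B0.assoc_algebra_corner[OF mq(2) MB.assoc_algebra_axioms])
  let ?R = "matrix_algebra q B"
  note hD = algebra_isoD[OF h]
  define J where "J = {M \<in> carrier (matrix_algebra m A).
      \<forall>i<m. M (i, 0) \<in> I \<and> (\<forall>j<m. j \<noteq> 0 \<longrightarrow> M (i, j) = \<zero>\<^bsub>A\<^esub>)}"
  have J1: "alg_dim K (matrix_algebra m A) (m * \<alpha>) J"
    unfolding J_def by (rule A.dim_left_ideal_of_corner(1)[OF mq(1) I])
  have J2: "M \<otimes>\<^bsub>matrix_algebra m A\<^esub> N \<in> J" if "M \<in> carrier (matrix_algebra m A)" "N \<in> J" for M N
    using A.dim_left_ideal_of_corner(2)[OF mq(1) I(1), folded J_def] I(2) that by blast
  have JC: "x \<in> carrier (matrix_algebra m A)" if "x \<in> J" for x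
    using that unfolding J_def by blast
  have inj: "inj_on h (carrier (matrix_algebra m A))" and surj: "h ` carrier (matrix_algebra m A) = carrier ?R"
    using hD(1) unfolding bij_betw_def by blast+
  have dJ: "alg_dim K ?R (m * \<alpha>) (h ` J)"
  proof (rule dim_image[OF MA.assoc_algebra_axioms MB.assoc_algebra_axioms J1])
    show "inj_on h J" by (rule inj_on_subset[OF inj subsetI[OF JC]])
  qed (rule hD JC | assumption)+
  have clJ: "M \<otimes>\<^bsub>?R\<^esub> x \<in> h ` J" if M: "M \<in> carrier ?R" and x: "x \<in> h ` J" for M x
  proof -
    have Mi: "M \<in> h ` carrier (matrix_algebra m A)" using M by (simp only: surj)
    obtain M' where M': "M' \<in> carrier (matrix_algebra m A)" "M = h M'"
      using Mi by blast
    obtain x' where x': "x' \<in> J" "x = h x'" using x by blast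
    have "M \<otimes>\<^bsub>?R\<^esub> x = h (M' \<otimes>\<^bsub>matrix_algebra m A\<^esub> x')"
      unfolding M'(2) x'(2) by (rule hD(3)[OF M'(1) JC[OF x'(1)], symmetric])
    then show ?thesis using J2[OF M'(1) x'(1)] by blast
  qed
  obtain d where d: "m * \<alpha> = q * d"
    "alg_dim K ?R d {x \<in> h ` J. single q B 0 0 \<one>\<^bsub>B\<^esub> \<otimes>\<^bsub>?R\<^esub> x = x}"
    by (rule B.dim_corner_of_left_ideal[OF mq(2) dJ clJ])
  have "alg_dim K ?R (m * m * (\<alpha> * \<alpha>)) (h ` carrier (matrix_algebra m A))"
    by (rule dim_image[OF MA.assoc_algebra_axioms MB.assoc_algebra_axioms A.dim_matrix_algebra[OF mq(1) dA]])
      (rule hD(2,4,6) inj | assumption)+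
  moreover have "alg_dim K ?R (q * q * (\<beta> * \<beta>)) (carrier ?R)"
    by (rule B.dim_matrix_algebra[OF mq(2) dB[OF B.assoc_algebra_axioms]])
  ultimately have "m * m * (\<alpha> * \<alpha>) = q * q * (\<beta> * \<beta>)"
    unfolding surj by (rule MB.dim_unique)
  then have "(m * \<alpha>)\<^sup>2 = (q * \<beta>)\<^sup>2" by (simp add: power2_eq_square algebra_simps)
  then have "m * \<alpha> = q * \<beta>" by (rule power2_eq_imp_eq) auto
  then have "d = \<beta>" using d(1) mq(2) by simp
  let ?W = "{x \<in> h ` J. single q B 0 0 \<one>\<^bsub>B\<^esub> \<otimes>\<^bsub>?R\<^esub> x = x}"
  show ?thesis
  proof (rule that[of ?W])
    fix b w assume b: "b \<in> carrier B" and w: "w \<in> ?W"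
    have s: "single q B 0 0 b \<in> carrier ?R" "single q B 0 0 \<one>\<^bsub>B\<^esub> \<in> carrier ?R" using b by auto
    have w': "w \<in> h ` J" "w \<in> carrier ?R" using w JC hD(2) by blast+
    have "single q B 0 0 \<one>\<^bsub>B\<^esub> \<otimes>\<^bsub>?R\<^esub> (single q B 0 0 b \<otimes>\<^bsub>?R\<^esub> w) = single q B 0 0 b \<otimes>\<^bsub>?R\<^esub> w"
      using s w' b mq(2)
      by (simp add: B0.single_mult_single B.one_mult del: matrix_simps flip: MB.mult_assoc)
    then show "single q B 0 0 b \<otimes>\<^bsub>?R\<^esub> w \<in> ?W" using clJ[OF s(1) w'(1)] by simp
  next
    show "assoc_algebra K B" "assoc_algebra K ?R" by unfold_locales
    show "alg_dim K ?R \<beta> ?W" using d(2) \<open>d = \<beta>\<close> by simp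
    show "single q B 0 0 \<one>\<^bsub>B\<^esub> \<otimes>\<^bsub>?R\<^esub> w = w" if "w \<in> ?W" for w using that by blast
  qed
qed

section \<open>Unramified extensions of the p-adic numbers\<close>

lemma algebra_imp_assoc_algebra:
  assumes "field K" "algebra K L" "\<one>\<^bsub>L\<^esub> \<noteq> \<zero>\<^bsub>L\<^esub>"
  shows "assoc_algebra K L"
proof -
  interpret K: field K by fact
  interpret L: algebra K L by fact
  interpret LR: cring L by unfold_locales
  have comm: "x \<otimes>\<^bsub>L\<^esub> (c \<odot>\<^bsub>L\<^esub> y) = c \<odot>\<^bsub>L\<^esub> (x \<otimes>\<^bsub>L\<^esub> y)"
    if "c \<in> carrier K" "x \<in> carrier L" "y \<in> carrier L" for c x y
    using that L.smult_assoc2[of c y x] L.m_comm[of x "c \<odot>\<^bsub>L\<^esub> y"] L.m_comm[of x y] by simp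
  show ?thesis
    by unfold_locales
      (use assms(3) comm in \<open>simp_all add: L.l_distr L.r_distr L.m_assoc L.smult_l_distr
        L.smult_r_distr L.smult_assoc1 L.smult_assoc2\<close>)
qed

locale unramified = rational_prime p for p :: nat +
  fixes n :: nat and L :: "(padic, 'b) module" and \<sigma> :: "'b \<Rightarrow> 'b"
  assumes n_pos: "n > 0" and unram: "unramified_extension p n L" and frob: "is_frobenius p L \<sigma>"
begin

lemma algebra_L: "algebra (Qp p) L" and field_L: "field L"
  and dim_L': "ring.dimension L n (scalars L (carrier (Qp p))) (carrier L)"
  and maximal: "maximalideal (prime_ideal_over p L) (integer_ring p L)"
  using unram by (auto simp: unramified_extension_def)

sublocale L: field L by (rule field_L)

lemma assoc_L: "assoc_algebra (Qp p) L"
  by (rule algebra_imp_assoc_algebra[OF field_Qp algebra_L]) simp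

sublocale LA: assoc_algebra "Qp p" L by (rule assoc_L)

lemma dim_L: "alg_dim (Qp p) L n (carrier L)"
  using dim_L' by (simp add: alg_dim_def)

lemma \<sigma>_iso: "\<sigma> \<in> algebra_iso (Qp p) L L"
  using frob by (simp add: is_frobenius_def)

lemmas \<sigma>D = algebra_isoD[OF \<sigma>_iso]

lemma \<sigma>_zero [simp]: "\<sigma> \<zero>\<^bsub>L\<^esub> = \<zero>\<^bsub>L\<^esub>"
  using \<sigma>D(4)[of "\<zero>\<^bsub>L\<^esub>" "\<zero>\<^bsub>L\<^esub>"] \<sigma>D(2)[of "\<zero>\<^bsub>L\<^esub>"] by (intro L.additive_zero) auto

abbreviation OL :: "'b set" where "OL \<equiv> carrier (integer_ring p L)"
abbreviation PL :: "'b set" where "PL \<equiv> prime_ideal_over p L"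

definition rat_L :: "rat \<Rightarrow> 'b" where "rat_L q = emb q \<odot>\<^bsub>L\<^esub> \<one>\<^bsub>L\<^esub>"

lemma rat_L_closed [simp]: "rat_L q \<in> carrier L"
  by (simp add: rat_L_def)

lemma rat_L_mult: "rat_L (q * r) = rat_L q \<otimes>\<^bsub>L\<^esub> rat_L r"
  by (simp add: rat_L_def emb_mult LA.scale_scale)

lemma rat_L_add: "rat_L (q + r) = rat_L q \<oplus>\<^bsub>L\<^esub> rat_L r"
  by (simp add: rat_L_def emb_add LA.scale_add_left)

lemma rat_L_0 [simp]: "rat_L 0 = \<zero>\<^bsub>L\<^esub>" and rat_L_1 [simp]: "rat_L 1 = \<one>\<^bsub>L\<^esub>"
  by (simp_all add: rat_L_def emb_0 emb_1)

lemma rat_L_of_nat: "[(k::nat)] \<cdot>\<^bsub>L\<^esub> \<one>\<^bsub>L\<^esub> = rat_L (of_nat k)"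
  by (induction k) (simp_all add: rat_L_add L.a_comm)

lemma rat_L_neq_0: "q \<noteq> 0 \<Longrightarrow> rat_L q \<noteq> \<zero>\<^bsub>L\<^esub>"
  using rat_L_mult[of q "1/q"] by auto

lemma \<sigma>_rat_L: "\<sigma> (rat_L q) = rat_L q"
  by (simp add: rat_L_def \<sigma>D)

lemma integer_ring_simps [simp]:
  "monoid.mult (integer_ring p L) = monoid.mult L" "ring.add (integer_ring p L) = ring.add L"
  "\<one>\<^bsub>integer_ring p L\<^esub> = \<one>\<^bsub>L\<^esub>" "\<zero>\<^bsub>integer_ring p L\<^esub> = \<zero>\<^bsub>L\<^esub>"
  by (simp_all add: integer_ring_def)

lemma OL_iff: "x \<in> OL \<longleftrightarrow> x \<in> carrier L \<and> (\<exists>f. f \<noteq> [] \<and> set f \<subseteq> scalars L (carrier (Zp p)) \<and>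
    hd f = \<one>\<^bsub>L\<^esub> \<and> L.eval f x = \<zero>\<^bsub>L\<^esub>)"
  by (simp add: integer_ring_def)

lemma OL_closed: "x \<in> OL \<Longrightarrow> x \<in> carrier L"
  by (simp add: OL_iff)

sublocale O: maximalideal PL "integer_ring p L" by (rule maximal)

lemma cring_OL: "cring (integer_ring p L)"
  by unfold_locales (simp add: L.m_comm OL_closed)

lemma PL_prime: "primeideal PL (integer_ring p L)"
  using cring.maximalideal_prime[OF cring_OL maximal] .

lemma OL_mult: "x \<in> OL \<Longrightarrow> y \<in> OL \<Longrightarrow> x \<otimes>\<^bsub>L\<^esub> y \<in> OL"
  using O.m_closed by simp

lemma OL_one: "\<one>\<^bsub>L\<^esub> \<in> OL"
  using O.one_closed by simp

lemma PL_iff: "x \<in> PL \<longleftrightarrow> (\<exists>y\<in>OL. x = rat_L (of_nat p) \<otimes>\<^bsub>L\<^esub> y)"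
  unfolding prime_ideal_over_def cgenideal_def
  using OL_closed by (auto simp: rat_L_of_nat L.m_comm)

lemma one_notin_PL: "\<one>\<^bsub>L\<^esub> \<notin> PL"
  using O.one_imp_carrier O.I_notcarr by auto

lemma rat_L_p_OL: "rat_L (of_nat p ^ k) \<in> OL"
proof (induction k)
  case (Suc k)
  have "rat_L (of_nat p) \<in> PL" unfolding PL_iff using OL_one by (intro bexI[of _ "\<one>\<^bsub>L\<^esub>"]) auto
  then have "rat_L (of_nat p) \<in> OL" using O.a_subset by blast
  then show ?case using Suc by (simp add: rat_L_mult OL_mult)
qed (simp add: OL_one)

lemma rat_L_p_inv_notin_OL:
  assumes "k > 0" shows "rat_L (1 / of_nat p ^ k) \<notin> OL"
proof
  assume "rat_L (1 / of_nat p ^ k) \<in> OL"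
  then have "rat_L (of_nat p ^ (k - 1)) \<otimes>\<^bsub>L\<^esub> rat_L (1 / of_nat p ^ k) \<in> OL"
    using rat_L_p_OL OL_mult by blast
  then have "rat_L (of_nat p) \<otimes>\<^bsub>L\<^esub> (rat_L (of_nat p ^ (k - 1)) \<otimes>\<^bsub>L\<^esub> rat_L (1 / of_nat p ^ k)) \<in> PL"
    unfolding PL_iff by blast
  moreover have "(of_nat p :: rat) * (of_nat p ^ (k - 1) * (1 / of_nat p ^ k)) = 1"
    using assms p_pos by (cases k) auto
  ultimately show False
    using one_notin_PL by (simp only: rat_L_mult[symmetric] rat_L_1)
qed

lemma algebra_iso_OL:
  assumes \<tau>: "\<tau> \<in> algebra_iso (Qp p) L L" and x: "x \<in> OL"
  shows "\<tau> x \<in> OL"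
proof -
  note \<tau>D = algebra_isoD[OF \<tau>]
  obtain f where f: "f \<noteq> []" "set f \<subseteq> scalars L (carrier (Zp p))" "hd f = \<one>\<^bsub>L\<^esub>" "L.eval f x = \<zero>\<^bsub>L\<^esub>"
    and xL: "x \<in> carrier L" using x by (auto simp: OL_iff)
  interpret \<tau>: ring_hom_ring L L \<tau>
    by (rule ring_hom_ringI) (use \<tau>D L.ring_axioms in auto)
  have fixed: "\<tau> c = c" if "c \<in> scalars L (carrier (Zp p))" for c
    using that \<tau>D(5,6) by (auto simp: scalars_def)
  have "map \<tau> f = f" using f(2) fixed by (intro map_idI) auto
  moreover have "set f \<subseteq> carrier L" using f(2) by (auto simp: scalars_def)
  ultimately have "L.eval f (\<tau> x) = \<zero>\<^bsub>L\<^esub>" using \<tau>.eval_hom'[OF xL, of f] f(4) by simp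
  then show ?thesis unfolding OL_iff using f(1-3) \<tau>D(2)[OF xL] by blast
qed

lemma \<sigma>_OL: "x \<in> OL \<Longrightarrow> \<sigma> x \<in> OL"
  by (rule algebra_iso_OL[OF \<sigma>_iso])

lemma \<sigma>_notin_PL:
  assumes "x \<in> OL" "x \<notin> PL" shows "\<sigma> x \<notin> PL"
proof
  assume "\<sigma> x \<in> PL"
  then obtain y where y: "y \<in> OL" "\<sigma> x = rat_L (of_nat p) \<otimes>\<^bsub>L\<^esub> y" by (auto simp: PL_iff)
  let ?\<tau> = "inv_into (carrier L) \<sigma>"
  have \<tau>: "?\<tau> \<in> algebra_iso (Qp p) L L" by (rule LA.algebra_iso_inv[OF \<sigma>_iso])
  have "?\<tau> y \<in> OL" by (rule algebra_iso_OL[OF \<tau> y(1)])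
  moreover have "\<sigma> (?\<tau> y) = y"
    using \<sigma>D(1) OL_closed[OF y(1)] by (auto simp: bij_betw_def f_inv_into_f)
  then have "\<sigma> (rat_L (of_nat p) \<otimes>\<^bsub>L\<^esub> ?\<tau> y) = \<sigma> x"
    using y(2) \<sigma>D(3) OL_closed[OF \<open>?\<tau> y \<in> OL\<close>] by (simp add: \<sigma>_rat_L)
  then have "rat_L (of_nat p) \<otimes>\<^bsub>L\<^esub> ?\<tau> y = x"
  proof (rule inj_onD[OF bij_betw_imp_inj_on[OF \<sigma>D(1)]])
    show "rat_L (of_nat p) \<otimes>\<^bsub>L\<^esub> ?\<tau> y \<in> carrier L" using OL_closed[OF \<open>?\<tau> y \<in> OL\<close>] by simp
    show "x \<in> carrier L" by (rule OL_closed[OF assms(1)])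
  qed
  ultimately show False using assms(2) by (auto simp: PL_iff)
qed

text \<open>Substituting \<open>t * x\<close> for \<open>x\<close> in a polynomial multiplies the coefficients by successive powers of \<open>t\<close>.\<close>

primrec stretch :: "'b \<Rightarrow> 'b list \<Rightarrow> 'b list" where
  "stretch t [] = []"
| "stretch t (c # cs) = c # map (\<lambda>u. t \<otimes>\<^bsub>L\<^esub> u) (stretch t cs)"

lemma length_stretch [simp]: "length (stretch t f) = length f"
  by (induction f) auto

lemma stretch_closed: "t \<in> carrier L \<Longrightarrow> set f \<subseteq> carrier L \<Longrightarrow> set (stretch t f) \<subseteq> carrier L"
  by (induction f) auto

lemma eval_map_mult:
  assumes "t \<in> carrier L" "x \<in> carrier L" "set f \<subseteq> carrier L"
  shows "L.eval (map (\<lambda>u. t \<otimes>\<^bsub>L\<^esub> u) f) x = t \<otimes>\<^bsub>L\<^esub> L.eval f x"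
  using assms(3)
  by (induction f) (use assms(1,2) in \<open>auto simp: L.eval_in_carrier L.r_distr L.m_assoc\<close>)

lemma eval_stretch:
  assumes "t \<in> carrier L" "x \<in> carrier L" "set f \<subseteq> carrier L"
  shows "t \<otimes>\<^bsub>L\<^esub> L.eval (stretch t f) (t \<otimes>\<^bsub>L\<^esub> x) = t [^]\<^bsub>L\<^esub> length f \<otimes>\<^bsub>L\<^esub> L.eval f x"
  using assms(3)
proof (induction f)
  case (Cons c cs)
  let ?k = "length cs" and ?y = "t \<otimes>\<^bsub>L\<^esub> x"
  have cl: "c \<in> carrier L" "set cs \<subseteq> carrier L" "set (stretch t cs) \<subseteq> carrier L"
    using Cons.prems stretch_closed[OF assms(1)] by auto
  define e where "e = L.eval cs x"
  define e' where "e' = L.eval (stretch t cs) ?y"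
  have ecl: "e \<in> carrier L" "e' \<in> carrier L" "t [^]\<^bsub>L\<^esub> ?k \<in> carrier L" "x [^]\<^bsub>L\<^esub> ?k \<in> carrier L"
    using cl assms by (auto simp: e_def e'_def L.eval_in_carrier)
  have IH: "t \<otimes>\<^bsub>L\<^esub> e' = t [^]\<^bsub>L\<^esub> ?k \<otimes>\<^bsub>L\<^esub> e" using Cons cl by (simp add: e_def e'_def)
  have "L.eval (stretch t (c # cs)) ?y = c \<otimes>\<^bsub>L\<^esub> (t [^]\<^bsub>L\<^esub> ?k \<otimes>\<^bsub>L\<^esub> x [^]\<^bsub>L\<^esub> ?k) \<oplus>\<^bsub>L\<^esub> t \<otimes>\<^bsub>L\<^esub> e'"
    using cl assms by (simp add: eval_map_mult e'_def L.nat_pow_distrib)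
  also have "\<dots> = t [^]\<^bsub>L\<^esub> ?k \<otimes>\<^bsub>L\<^esub> (c \<otimes>\<^bsub>L\<^esub> x [^]\<^bsub>L\<^esub> ?k \<oplus>\<^bsub>L\<^esub> e)"
    unfolding IH using cl ecl by algebra
  finally have *: "L.eval (stretch t (c # cs)) ?y = t [^]\<^bsub>L\<^esub> ?k \<otimes>\<^bsub>L\<^esub> (c \<otimes>\<^bsub>L\<^esub> x [^]\<^bsub>L\<^esub> ?k \<oplus>\<^bsub>L\<^esub> e)" .
  have "t \<otimes>\<^bsub>L\<^esub> (t [^]\<^bsub>L\<^esub> ?k \<otimes>\<^bsub>L\<^esub> (c \<otimes>\<^bsub>L\<^esub> x [^]\<^bsub>L\<^esub> ?k \<oplus>\<^bsub>L\<^esub> e)) =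
      (t [^]\<^bsub>L\<^esub> ?k \<otimes>\<^bsub>L\<^esub> t) \<otimes>\<^bsub>L\<^esub> (c \<otimes>\<^bsub>L\<^esub> x [^]\<^bsub>L\<^esub> ?k \<oplus>\<^bsub>L\<^esub> e)"
    using cl ecl assms by algebra
  then show ?case unfolding * by (simp add: e_def)
qed (use assms in simp)

lemma scalars_Zp_mult:
  "x \<in> scalars L (carrier (Zp p)) \<Longrightarrow> y \<in> scalars L (carrier (Zp p)) \<Longrightarrow> x \<otimes>\<^bsub>L\<^esub> y \<in> scalars L (carrier (Zp p))"
  by (auto simp: scalars_def LA.scale_mult_left LA.one_mult Zp_mult simp flip: LA.scale_scale intro!: imageI)

text \<open>An element of \<open>L\<close> is a root of a monic polynomial over the p-adic numbers.
  Multiplying it by a high power of \<open>p\<close> multiplies the coefficients by such powers and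
  makes them integral.\<close>

lemma integral_multiple:
  assumes x: "x \<in> carrier L" shows "\<exists>k. rat_L (of_nat p ^ k) \<otimes>\<^bsub>L\<^esub> x \<in> OL"
proof -
  let ?S = "scalars L (carrier (Qp p))" and ?Z = "scalars L (carrier (Zp p))"
  have "L.finite_dimension ?S (carrier L)" using dim_L' by (rule L.finite_dimensionI)
  then have "(L.algebraic over ?S) x"
    using L.finite_dimension_imp_algebraic[OF LA.subfield_scalars L.carrier_is_subring _ x] by blast
  then obtain f where f: "f \<in> carrier (?S [X]\<^bsub>L\<^esub>)" "f \<noteq> []" "L.eval f x = \<zero>\<^bsub>L\<^esub>"
    using L.algebraicE[OF subfieldE(1)[OF LA.subfield_scalars] x] by blast
  then have fS: "set f \<subseteq> ?S" "hd f \<noteq> \<zero>\<^bsub>L\<^esub>" by (auto simp: univ_poly_def polynomial_def)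
  have SL: "?S \<subseteq> carrier L" by (auto simp: scalars_def)
  obtain c cs where c: "f = c # cs" using f(2) by (cases f) auto
  have cL: "c \<in> carrier L" "c \<noteq> \<zero>\<^bsub>L\<^esub>" "c \<in> ?S" using c fS SL by auto
  define d where "d = inv\<^bsub>L\<^esub> c"
  have "d \<in> ?S - {\<zero>\<^bsub>L\<^esub>}" unfolding d_def
    using L.subfield_m_inv(1)[OF LA.subfield_scalars] cL by auto
  then have d: "d \<in> ?S" "d \<in> carrier L" using SL by auto
  have dc: "d \<otimes>\<^bsub>L\<^esub> c = \<one>\<^bsub>L\<^esub>" unfolding d_def using cL by (simp add: L.field_Units)
  define g where "g = map (\<lambda>u. d \<otimes>\<^bsub>L\<^esub> u) cs"
  have gS: "set g \<subseteq> ?S" unfolding g_def using d c fS L.subring_props(6)[OF LA.subfield_scalars] by auto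
  have eg: "L.eval (\<one>\<^bsub>L\<^esub> # g) x = \<zero>\<^bsub>L\<^esub>"
  proof -
    have "L.eval (map (\<lambda>u. d \<otimes>\<^bsub>L\<^esub> u) f) x = \<zero>\<^bsub>L\<^esub>"
      using eval_map_mult[OF d(2) x, of f] f(3) fS SL d by auto
    then show ?thesis by (simp add: c g_def dc del: L.eval.simps)
  qed
  have "\<exists>k. \<forall>u\<in>set g. rat_L (of_nat p ^ k) \<otimes>\<^bsub>L\<^esub> u \<in> ?Z"
    using gS
  proof (induction g)
    case (Cons u us)
    then obtain k where k: "\<forall>u\<in>set us. rat_L (of_nat p ^ k) \<otimes>\<^bsub>L\<^esub> u \<in> ?Z" by auto
    obtain v where v: "v \<in> carrier (Qp p)" "u = v \<odot>\<^bsub>L\<^esub> \<one>\<^bsub>L\<^esub>" using Cons.prems by (auto simp: scalars_def)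
    obtain l where l: "qnorm v < real p ^ l"
      using real_arch_pow[of "real p" "qnorm v"] p_gt_1 by auto
    have "qnorm (emb (of_nat p ^ (k + l)) \<otimes>\<^bsub>Qp p\<^esub> v) \<le> 1"
    proof -
      have "qnorm (emb (of_nat p ^ (k + l)) \<otimes>\<^bsub>Qp p\<^esub> v) = (1 / real p) ^ k * ((1 / real p) ^ l * qnorm v)"
        using v by (simp add: qnorm_mult vabs_mult vabs_power vabs_p power_add)
      also have "\<dots> \<le> 1 * ((1 / real p) ^ l * real p ^ l)"
        using l p_gt_1 qnorm_nonneg[OF v(1)] by (intro mult_mono power_le_one mult_left_mono) auto
      also have "\<dots> = 1" using p_pos by (simp flip: power_mult_distrib)
      finally show ?thesis .
    qed
    then have "emb (of_nat p ^ (k + l)) \<otimes>\<^bsub>Qp p\<^esub> v \<in> carrier (Zp p)" using v by (intro ZpI) auto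
    then have "rat_L (of_nat p ^ (k + l)) \<otimes>\<^bsub>L\<^esub> u \<in> ?Z"
      using v unfolding rat_L_def scalars_def
      by (auto simp: LA.scale_mult_left LA.one_mult simp flip: LA.scale_scale)
    moreover have "rat_L (of_nat p ^ (k + l)) \<otimes>\<^bsub>L\<^esub> w \<in> ?Z" if "w \<in> set us" for w
    proof -
      have w: "w \<in> carrier L" using Cons.prems SL that by auto
      have "rat_L (of_nat p ^ l) \<in> ?Z"
        unfolding rat_L_def scalars_def using emb_of_nat_Zp[of "p ^ l"] by simp
      then have "rat_L (of_nat p ^ l) \<otimes>\<^bsub>L\<^esub> (rat_L (of_nat p ^ k) \<otimes>\<^bsub>L\<^esub> w) \<in> ?Z"
        using k that scalars_Zp_mult by blast
      then show ?thesis using w by (simp add: power_add rat_L_mult L.m_ac)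
    qed
    ultimately show ?case by auto
  qed auto
  then obtain k where k: "\<forall>u\<in>set g. rat_L (of_nat p ^ k) \<otimes>\<^bsub>L\<^esub> u \<in> ?Z" ..
  define t where "t = rat_L (of_nat p ^ k)"
  have tL: "t \<in> carrier L" "t \<noteq> \<zero>\<^bsub>L\<^esub>" using p_pos rat_L_neq_0[of "of_nat p ^ k"] by (auto simp: t_def)
  have tZ: "t \<in> ?Z"
    unfolding t_def rat_L_def scalars_def using emb_of_nat_Zp[of "p ^ k"] by simp
  have gZ: "set (map (\<lambda>u. t \<otimes>\<^bsub>L\<^esub> u) (stretch t g)) \<subseteq> ?Z"
    using k unfolding t_def[symmetric]
  proof (induction g)
    case (Cons u us)
    then show ?case using scalars_Zp_mult[OF tZ] by auto
  qed auto
  define h where "h = stretch t (\<one>\<^bsub>L\<^esub> # g)"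
  have gL: "set (\<one>\<^bsub>L\<^esub> # g) \<subseteq> carrier L" using gS SL by auto
  have "t \<otimes>\<^bsub>L\<^esub> L.eval h (t \<otimes>\<^bsub>L\<^esub> x) = \<zero>\<^bsub>L\<^esub>"
    unfolding h_def using eval_stretch[OF tL(1) x gL] eg tL by simp
  then have "L.eval h (t \<otimes>\<^bsub>L\<^esub> x) = \<zero>\<^bsub>L\<^esub>"
    using tL x gL stretch_closed[OF tL(1) gL] L.eval_in_carrier[of h "t \<otimes>\<^bsub>L\<^esub> x"]
    by (simp add: h_def L.integral_iff del: L.eval.simps stretch.simps)
  moreover have "\<one>\<^bsub>L\<^esub> \<in> ?Z" unfolding scalars_def using Zp_one by (intro image_eqI[of _ _ "\<one>\<^bsub>Qp p\<^esub>"]) auto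
  ultimately have "t \<otimes>\<^bsub>L\<^esub> x \<in> OL"
    unfolding OL_iff using gZ tL x by (intro conjI exI[of _ h]) (auto simp: h_def)
  then show ?thesis unfolding t_def ..
qed

text \<open>This is where unramifiedness enters: the maximal ideal is generated by \<open>p\<close>
  itself, so an integral element can be divided by \<open>p\<close> until it leaves the maximal ideal.
  The denominator of the inverse bounds the number of divisions.\<close>

lemma p_power_times_unit:
  assumes x: "x \<in> carrier L" "x \<noteq> \<zero>\<^bsub>L\<^esub>"
  obtains s :: int and y where "y \<in> OL" "y \<notin> PL" "x = rat_L (of_nat p powi s) \<otimes>\<^bsub>L\<^esub> y"
proof -
  let ?pw = "\<lambda>s. rat_L (of_nat p powi s)"
  have p0: "(of_nat p :: rat) \<noteq> 0" using p_pos by simp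
  have pw_add: "?pw (s + t) = ?pw s \<otimes>\<^bsub>L\<^esub> ?pw t" for s t
    using p0 by (simp add: power_int_add rat_L_mult)
  have pw_nat: "?pw (int k) \<in> OL" for k using rat_L_p_OL[of k] by simp
  define D where "D = {s :: int. ?pw (- s) \<otimes>\<^bsub>L\<^esub> x \<in> OL}"
  obtain k where "rat_L (of_nat p ^ k) \<otimes>\<^bsub>L\<^esub> x \<in> OL" using integral_multiple[OF x(1)] ..
  then have nonempty: "- int k \<in> D" by (simp add: D_def)
  obtain y where y: "y \<in> carrier L" "x \<otimes>\<^bsub>L\<^esub> y = \<one>\<^bsub>L\<^esub>"
    using x by (metis L.Units_inv_closed L.Units_r_inv L.field_Units DiffI singletonD)
  obtain t where t: "rat_L (of_nat p ^ t) \<otimes>\<^bsub>L\<^esub> y \<in> OL" using integral_multiple[OF y(1)] ..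
  have bound: "s \<le> int t" if "s \<in> D" for s
  proof (rule ccontr)
    assume "\<not> s \<le> int t"
    define k where "k = nat (s - int t)"
    then have k: "k > 0" "s = int t + int k" using \<open>\<not> s \<le> int t\<close> by auto
    have "(?pw (- s) \<otimes>\<^bsub>L\<^esub> x) \<otimes>\<^bsub>L\<^esub> (?pw (int t) \<otimes>\<^bsub>L\<^esub> y) \<in> OL"
      using that t OL_mult by (simp add: D_def)
    moreover have "(?pw (- s) \<otimes>\<^bsub>L\<^esub> x) \<otimes>\<^bsub>L\<^esub> (?pw (int t) \<otimes>\<^bsub>L\<^esub> y) =
        (?pw (- s) \<otimes>\<^bsub>L\<^esub> ?pw (int t)) \<otimes>\<^bsub>L\<^esub> (x \<otimes>\<^bsub>L\<^esub> y)"
      using x(1) y(1) by (simp add: L.m_ac)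
    moreover have "?pw (- s) \<otimes>\<^bsub>L\<^esub> ?pw (int t) = ?pw (- int k)"
      unfolding pw_add[symmetric] using k(2) by simp
    ultimately show False
      using rat_L_p_inv_notin_OL[OF k(1)] y(2) by (simp add: power_int_minus field_simps)
  qed
  define s where "s = int t - int (LEAST j. int t - int j \<in> D)"
  have ex: "int t - int (nat (int t + int k)) \<in> D" using nonempty bound by auto
  have sD: "s \<in> D" unfolding s_def by (rule LeastI[of "\<lambda>j. int t - int j \<in> D", OF ex])
  have "s + 1 \<notin> D"
  proof
    assume s1: "s + 1 \<in> D"
    define j where "j = nat (int t - (s + 1))"
    have "s + 1 = int t - int j" using bound[OF s1] by (simp add: j_def)
    then have "(LEAST j. int t - int j \<in> D) \<le> j" using s1 by (intro Least_le) simp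
    then show False using \<open>s + 1 = int t - int j\<close> unfolding s_def by simp
  qed
  show ?thesis
  proof (rule that[of "?pw (- s) \<otimes>\<^bsub>L\<^esub> x" s])
    show "?pw (- s) \<otimes>\<^bsub>L\<^esub> x \<in> OL" using sD by (simp add: D_def)
    show "x = ?pw s \<otimes>\<^bsub>L\<^esub> (?pw (- s) \<otimes>\<^bsub>L\<^esub> x)"
    proof -
      have "?pw s \<otimes>\<^bsub>L\<^esub> ?pw (- s) = \<one>\<^bsub>L\<^esub>" using pw_add[of s "- s"] by simp
      then show ?thesis using x(1) by (simp flip: L.m_assoc)
    qed
    show "?pw (- s) \<otimes>\<^bsub>L\<^esub> x \<notin> PL"
    proof
      assume "?pw (- s) \<otimes>\<^bsub>L\<^esub> x \<in> PL"
      then obtain z where z: "z \<in> OL" "?pw (- s) \<otimes>\<^bsub>L\<^esub> x = ?pw 1 \<otimes>\<^bsub>L\<^esub> z" by (auto simp: PL_iff)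
      have "- (s + 1) = -1 + - s" by simp
      then have "?pw (- (s + 1)) = ?pw (-1) \<otimes>\<^bsub>L\<^esub> ?pw (- s)" by (simp only: pw_add)
      then have "?pw (- (s + 1)) \<otimes>\<^bsub>L\<^esub> x = ?pw (-1) \<otimes>\<^bsub>L\<^esub> (?pw (- s) \<otimes>\<^bsub>L\<^esub> x)"
        using x(1) by (simp add: L.m_assoc)
      also have "\<dots> = z"
      proof -
        have "?pw (-1) \<otimes>\<^bsub>L\<^esub> ?pw 1 = \<one>\<^bsub>L\<^esub>" using pw_add[of "-1" 1] by simp
        then show ?thesis unfolding z(2) using OL_closed[OF z(1)] by (simp flip: L.m_assoc)
      qed
      finally show False using z(1) \<open>s + 1 \<notin> D\<close> by (simp add: D_def)
    qed
  qed
qed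

text \<open>The product of the \<open>\<sigma>\<^sup>j x\<close> for \<open>j < i\<close>, which for
  \<open>i = n\<close> is the norm of \<open>x\<close>.\<close>

primrec partial_norm :: "'b \<Rightarrow> nat \<Rightarrow> 'b" where
  "partial_norm x 0 = \<one>\<^bsub>L\<^esub>"
| "partial_norm x (Suc i) = \<sigma> (partial_norm x i) \<otimes>\<^bsub>L\<^esub> x"

lemma partial_norm_closed [simp]: "x \<in> carrier L \<Longrightarrow> partial_norm x i \<in> carrier L"
  by (induction i) (auto simp: \<sigma>D)

lemma partial_norm_unit:
  assumes "x \<in> OL" "x \<notin> PL"
  shows "partial_norm x i \<in> OL \<and> partial_norm x i \<notin> PL"
proof (induction i)
  case 0
  show ?case using OL_one one_notin_PL by simp
next
  case (Suc i)
  interpret P: primeideal PL "integer_ring p L" by (rule PL_prime)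
  have "\<sigma> (partial_norm x i) \<in> OL" "\<sigma> (partial_norm x i) \<notin> PL"
    using Suc \<sigma>_OL \<sigma>_notin_PL by auto
  then show ?case using P.I_prime[of "\<sigma> (partial_norm x i)" x] assms OL_mult by auto
qed

lemma partial_norm_mult_rat:
  assumes "x \<in> carrier L"
  shows "partial_norm (rat_L q \<otimes>\<^bsub>L\<^esub> x) i = rat_L (q ^ i) \<otimes>\<^bsub>L\<^esub> partial_norm x i"
proof (induction i)
  case (Suc i)
  have "\<sigma> (partial_norm x i) \<in> carrier L" using assms \<sigma>D(2) by simp
  then show ?case using Suc assms by (simp add: \<sigma>D \<sigma>_rat_L rat_L_mult L.m_ac)
qed simp

text \<open>Writing \<open>x = p\<^sup>s y\<close> with \<open>y\<close> outside the maximal ideal, the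
  conjugates of \<open>y\<close> and hence its norm are outside of it as well. So the norm of
  \<open>x\<close> is \<open>p\<^sup>n\<^sup>s\<close> times an element outside the maximal ideal, and
  \<open>r = n s\<close>.\<close>

theorem norm_p_power_dvd:
  assumes x: "x \<in> carrier L" and norm: "partial_norm x n = rat_L (of_nat p ^ r)"
  shows "n dvd r"
proof -
  have p0: "(of_nat p :: rat) \<noteq> 0" using p_pos by simp
  have "x \<noteq> \<zero>\<^bsub>L\<^esub>"
  proof
    assume "x = \<zero>\<^bsub>L\<^esub>"
    then have "partial_norm x n = \<zero>\<^bsub>L\<^esub>" using n_pos x by (cases n) (auto simp: \<sigma>D)
    then show False using norm rat_L_neq_0 p0 by auto
  qed
  then obtain s y where y: "y \<in> OL" "y \<notin> PL" "x = rat_L (of_nat p powi s) \<otimes>\<^bsub>L\<^esub> y"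
    using p_power_times_unit[OF x] by blast
  define z where "z = partial_norm y n"
  have z: "z \<in> OL" "z \<notin> PL" "z \<in> carrier L"
    using partial_norm_unit[OF y(1,2)] OL_closed by (auto simp: z_def)
  have "rat_L ((of_nat p powi s) ^ n) \<otimes>\<^bsub>L\<^esub> z = rat_L (of_nat p ^ r)"
    using norm partial_norm_mult_rat[OF OL_closed[OF y(1)]] by (simp add: y(3) z_def)
  moreover have "(of_nat p powi s) ^ n = (of_nat p powi (s * int n) :: rat)"
    by (simp add: power_int_mult)
  ultimately have scaled: "rat_L (of_nat p powi (- (s * int n))) \<otimes>\<^bsub>L\<^esub> (rat_L (of_nat p powi (s * int n)) \<otimes>\<^bsub>L\<^esub> z) =
      rat_L (of_nat p powi (- (s * int n))) \<otimes>\<^bsub>L\<^esub> rat_L (of_nat p powi (int r))"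
    by simp
  then have zr: "z = rat_L (of_nat p powi (int r - s * int n))"
  proof -
    have "(of_nat p :: rat) powi (- (s * int n)) * of_nat p powi (s * int n) = 1"
      "(of_nat p :: rat) powi (- (s * int n)) * of_nat p powi (int r) = of_nat p powi (int r - s * int n)"
      using p0 power_int_add[of "of_nat p :: rat" "- (s * int n)" "s * int n"]
        power_int_add[of "of_nat p :: rat" "- (s * int n)" "int r"] by auto
    then show ?thesis using z(3) scaled by (simp del: power_int_of_nat flip: L.m_assoc rat_L_mult)
  qed
  have "int r = s * int n"
  proof (rule linorder_cases[of "int r" "s * int n"])
    assume lt: "int r < s * int n"
    define k where "k = nat (s * int n - int r)"
    have k: "int r - s * int n = - int k" "k > 0" using lt by (auto simp: k_def)
    have "rat_L (1 / of_nat p ^ k) \<in> OL"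
      using z(1)[unfolded zr k(1)] by (simp add: power_int_minus inverse_eq_divide)
    then show ?thesis using rat_L_p_inv_notin_OL[OF k(2)] by contradiction
  next
    assume gt: "int r > s * int n"
    define k where "k = nat (int r - s * int n - 1)"
    have k: "int r - s * int n = 1 + int k" using gt by (auto simp: k_def)
    have "z \<in> PL"
      unfolding zr k PL_iff using p0 rat_L_p_OL[of k]
      by (intro bexI[of _ "rat_L (of_nat p ^ k)"]) (auto simp: power_int_add simp flip: rat_L_mult)
    then show ?thesis using z(2) by simp
  qed
  then have "int n dvd int r" by simp
  then show ?thesis by simp
qed

end

section \<open>Cyclic algebras over unramified extensions\<close>

context unramified
begin

lemma \<sigma>_pow_iso: "\<sigma> ^^ i \<in> algebra_iso (Qp p) L L"
proof (induction i)
  case 0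
  show ?case by (rule algebra_isoI) (auto simp: bij_betw_def)
next
  case (Suc i)
  then show ?case using algebra_iso_comp[OF Suc \<sigma>_iso] by (simp only: funpow.simps)
qed

lemmas \<sigma>_powD = algebra_isoD[OF \<sigma>_pow_iso]

lemma \<sigma>_pow_closed [simp]: "x \<in> carrier L \<Longrightarrow> (\<sigma> ^^ i) x \<in> carrier L"
  by (rule \<sigma>_powD(2))

lemma \<sigma>_pow_zero [simp]: "(\<sigma> ^^ i) \<zero>\<^bsub>L\<^esub> = \<zero>\<^bsub>L\<^esub>"
  by (induction i) auto

lemma \<sigma>_pow_rat_L [simp]: "(\<sigma> ^^ i) (rat_L q) = rat_L q"
  by (induction i) (auto simp: \<sigma>_rat_L)

definition pairs :: "nat \<Rightarrow> (nat \<times> nat) set" where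
  "pairs m = {(i, j). i < n \<and> j < n \<and> (i + j) mod n = m}"

lemma finite_pairs [simp]: "finite (pairs m)"
  by (rule finite_subset[of _ "{..<n} \<times> {..<n}"]) (auto simp: pairs_def)

definition cyc_term :: "'b \<Rightarrow> (nat \<Rightarrow> 'b) \<Rightarrow> (nat \<Rightarrow> 'b) \<Rightarrow> nat \<times> nat \<Rightarrow> 'b" where
  "cyc_term a f g = (\<lambda>(i, j). f i \<otimes>\<^bsub>L\<^esub> (\<sigma> ^^ i) (g j) \<otimes>\<^bsub>L\<^esub> (if i + j < n then \<one>\<^bsub>L\<^esub> else a))"

abbreviation cyc :: "'b \<Rightarrow> (padic, nat \<Rightarrow> 'b) module" where "cyc \<equiv> cyclic_algebra L n \<sigma>"

lemma cyc_simps: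
  "carrier (cyc a) = {..<n} \<rightarrow>\<^sub>E carrier L"
  "f \<otimes>\<^bsub>cyc a\<^esub> g = (\<lambda>m\<in>{..<n}. finsum L (cyc_term a f g) (pairs m))"
  "\<one>\<^bsub>cyc a\<^esub> = (\<lambda>m\<in>{..<n}. if m = 0 then \<one>\<^bsub>L\<^esub> else \<zero>\<^bsub>L\<^esub>)"
  "\<zero>\<^bsub>cyc a\<^esub> = (\<lambda>m\<in>{..<n}. \<zero>\<^bsub>L\<^esub>)"
  "f \<oplus>\<^bsub>cyc a\<^esub> g = (\<lambda>m\<in>{..<n}. f m \<oplus>\<^bsub>L\<^esub> g m)"
  "c \<odot>\<^bsub>cyc a\<^esub> f = (\<lambda>m\<in>{..<n}. c \<odot>\<^bsub>L\<^esub> f m)"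
  by (simp_all add: cyclic_algebra_def cyc_term_def[abs_def] pairs_def)

lemma cyc_term_closed:
  assumes "a \<in> carrier L" "f \<in> {..<n} \<rightarrow>\<^sub>E carrier L" "g \<in> {..<n} \<rightarrow>\<^sub>E carrier L"
  shows "cyc_term a f g \<in> pairs m \<rightarrow> carrier L"
  using assms by (auto simp: cyc_term_def pairs_def PiE_iff)

lemma coeff_closed: "f \<in> {..<n} \<rightarrow>\<^sub>E carrier L \<Longrightarrow> i < n \<Longrightarrow> f i \<in> carrier L"
  by auto

lemma coeff_eqI:
  "f \<in> {..<n} \<rightarrow>\<^sub>E carrier L \<Longrightarrow> g \<in> {..<n} \<rightarrow>\<^sub>E carrier L \<Longrightarrow> (\<And>m. m < n \<Longrightarrow> f m = g m) \<Longrightarrow> f = g"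
  by (rule PiE_ext) auto

lemma abelian_group_cyc: "abelian_group (cyc a)"
proof (rule abelian_groupI)
  fix f assume "f \<in> carrier (cyc a)"
  then have f: "f \<in> {..<n} \<rightarrow>\<^sub>E carrier L" by (simp add: cyc_simps)
  define g where "g = (\<lambda>m\<in>{..<n}. \<ominus>\<^bsub>L\<^esub> f m)"
  have "g \<in> carrier (cyc a)" using coeff_closed[OF f] by (auto simp: g_def cyc_simps)
  moreover have "g \<oplus>\<^bsub>cyc a\<^esub> f = \<zero>\<^bsub>cyc a\<^esub>"
    using coeff_closed[OF f] by (auto simp: g_def cyc_simps fun_eq_iff L.l_neg)
  ultimately show "\<exists>g\<in>carrier (cyc a). g \<oplus>\<^bsub>cyc a\<^esub> f = \<zero>\<^bsub>cyc a\<^esub>" by blast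
  show "\<zero>\<^bsub>cyc a\<^esub> \<oplus>\<^bsub>cyc a\<^esub> f = f"
    unfolding cyc_simps by (rule coeff_eqI) (use f coeff_closed[OF f] in auto)
  fix g assume "g \<in> carrier (cyc a)"
  then have g: "g \<in> {..<n} \<rightarrow>\<^sub>E carrier L" by (simp add: cyc_simps)
  show "f \<oplus>\<^bsub>cyc a\<^esub> g \<in> carrier (cyc a)" using f g by (auto simp: cyc_simps)
  show "f \<oplus>\<^bsub>cyc a\<^esub> g = g \<oplus>\<^bsub>cyc a\<^esub> f"
    using coeff_closed[OF f] coeff_closed[OF g] by (auto simp: cyc_simps fun_eq_iff L.a_comm)
  fix h assume "h \<in> carrier (cyc a)"
  then have h: "h \<in> {..<n} \<rightarrow>\<^sub>E carrier L" by (simp add: cyc_simps)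
  show "f \<oplus>\<^bsub>cyc a\<^esub> g \<oplus>\<^bsub>cyc a\<^esub> h = f \<oplus>\<^bsub>cyc a\<^esub> (g \<oplus>\<^bsub>cyc a\<^esub> h)"
    using coeff_closed[OF f] coeff_closed[OF g] coeff_closed[OF h]
    by (auto simp: cyc_simps fun_eq_iff L.a_assoc)
qed (auto simp: cyc_simps)

lemma pre_algebra_cyc:
  assumes a: "a \<in> carrier L" shows "pre_algebra (Qp p) (cyc a)"
proof -
  interpret C: abelian_group "cyc a" by (rule abelian_group_cyc)
  have cC: "f \<in> carrier (cyc a) \<longleftrightarrow> f \<in> {..<n} \<rightarrow>\<^sub>E carrier L" for f by (simp add: cyc_simps)
  have dist: "finsum L (cyc_term a f g) (pairs m) = finsum L (cyc_term a f1 g1) (pairs m) \<oplus>\<^bsub>L\<^esub> finsum L (cyc_term a f2 g2) (pairs m)"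
    if "f1 \<in> {..<n} \<rightarrow>\<^sub>E carrier L" "g1 \<in> {..<n} \<rightarrow>\<^sub>E carrier L" "f2 \<in> {..<n} \<rightarrow>\<^sub>E carrier L" "g2 \<in> {..<n} \<rightarrow>\<^sub>E carrier L"
      "\<And>i j. i < n \<Longrightarrow> j < n \<Longrightarrow> cyc_term a f g (i, j) = cyc_term a f1 g1 (i, j) \<oplus>\<^bsub>L\<^esub> cyc_term a f2 g2 (i, j)"
    for f g f1 g1 f2 g2 m
  proof -
    note cl = cyc_term_closed[OF a that(1,2)] cyc_term_closed[OF a that(3,4)]
    have "finsum L (cyc_term a f g) (pairs m) = (\<Oplus>\<^bsub>L\<^esub>t\<in>pairs m. cyc_term a f1 g1 t \<oplus>\<^bsub>L\<^esub> cyc_term a f2 g2 t)"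
      using that(5) cl by (intro L.finsum_cong') (auto simp: pairs_def Pi_def)
    also have "\<dots> = finsum L (cyc_term a f1 g1) (pairs m) \<oplus>\<^bsub>L\<^esub> finsum L (cyc_term a f2 g2) (pairs m)"
      using cl by (intro L.finsum_addf)
    finally show ?thesis .
  qed
  have scale: "finsum L (cyc_term a f g) (pairs m) = c \<odot>\<^bsub>L\<^esub> finsum L (cyc_term a f1 g1) (pairs m)"
    if "c \<in> carrier (Qp p)" "f1 \<in> {..<n} \<rightarrow>\<^sub>E carrier L" "g1 \<in> {..<n} \<rightarrow>\<^sub>E carrier L"
      "\<And>i j. i < n \<Longrightarrow> j < n \<Longrightarrow> cyc_term a f g (i, j) = c \<odot>\<^bsub>L\<^esub> cyc_term a f1 g1 (i, j)"
    for c f g f1 g1 m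
  proof -
    note cl = cyc_term_closed[OF a that(2,3)]
    have "finsum L (cyc_term a f g) (pairs m) = (\<Oplus>\<^bsub>L\<^esub>t\<in>pairs m. c \<odot>\<^bsub>L\<^esub> cyc_term a f1 g1 t)"
      using that(1,4) cl by (intro L.finsum_cong') (auto simp: pairs_def Pi_def)
    also have "\<dots> = c \<odot>\<^bsub>L\<^esub> finsum L (cyc_term a f1 g1) (pairs m)"
      using cl that(1)
      by (intro additive_finsum[where f="\<lambda>x. c \<odot>\<^bsub>L\<^esub> x", symmetric] L.abelian_monoid_axioms)
        (auto simp: LA.scale_add_right)
    finally show ?thesis .
  qed
  show ?thesis
  proof (unfold_locales, unfold cC)
    fix f g assume f: "f \<in> {..<n} \<rightarrow>\<^sub>E carrier L" and g: "g \<in> {..<n} \<rightarrow>\<^sub>E carrier L"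
    show "f \<otimes>\<^bsub>cyc a\<^esub> g \<in> {..<n} \<rightarrow>\<^sub>E carrier L"
      unfolding cyc_simps using cyc_term_closed[OF a f g] by (auto intro!: L.finsum_closed)
    fix h assume h: "h \<in> {..<n} \<rightarrow>\<^sub>E carrier L"
    have fg: "(\<lambda>m\<in>{..<n}. f m \<oplus>\<^bsub>L\<^esub> g m) \<in> {..<n} \<rightarrow>\<^sub>E carrier L" using f g by auto
    show "(f \<oplus>\<^bsub>cyc a\<^esub> g) \<otimes>\<^bsub>cyc a\<^esub> h = f \<otimes>\<^bsub>cyc a\<^esub> h \<oplus>\<^bsub>cyc a\<^esub> g \<otimes>\<^bsub>cyc a\<^esub> h"
      unfolding cyc_simps
    proof (rule restrict_ext)
      fix m assume m: "m \<in> {..<n}"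
      have "finsum L (cyc_term a (\<lambda>m\<in>{..<n}. f m \<oplus>\<^bsub>L\<^esub> g m) h) (pairs m) =
          finsum L (cyc_term a f h) (pairs m) \<oplus>\<^bsub>L\<^esub> finsum L (cyc_term a g h) (pairs m)"
      proof (rule dist[OF f h g h])
        fix i j assume ij: "i < n" "j < n"
        then show "cyc_term a (\<lambda>m\<in>{..<n}. f m \<oplus>\<^bsub>L\<^esub> g m) h (i, j) = cyc_term a f h (i, j) \<oplus>\<^bsub>L\<^esub> cyc_term a g h (i, j)"
          using coeff_closed[OF f] coeff_closed[OF g] coeff_closed[OF h] a
          by (simp add: cyc_term_def L.l_distr)
      qed
      then show "finsum L (cyc_term a (\<lambda>m\<in>{..<n}. f m \<oplus>\<^bsub>L\<^esub> g m) h) (pairs m) =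
          (\<lambda>m\<in>{..<n}. finsum L (cyc_term a f h) (pairs m)) m \<oplus>\<^bsub>L\<^esub> (\<lambda>m\<in>{..<n}. finsum L (cyc_term a g h) (pairs m)) m"
        using m by simp
    qed
    show "h \<otimes>\<^bsub>cyc a\<^esub> (f \<oplus>\<^bsub>cyc a\<^esub> g) = h \<otimes>\<^bsub>cyc a\<^esub> f \<oplus>\<^bsub>cyc a\<^esub> h \<otimes>\<^bsub>cyc a\<^esub> g"
      unfolding cyc_simps
    proof (rule restrict_ext)
      fix m assume m: "m \<in> {..<n}"
      have "finsum L (cyc_term a h (\<lambda>m\<in>{..<n}. f m \<oplus>\<^bsub>L\<^esub> g m)) (pairs m) =
          finsum L (cyc_term a h f) (pairs m) \<oplus>\<^bsub>L\<^esub> finsum L (cyc_term a h g) (pairs m)"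
      proof (rule dist[OF h f h g])
        fix i j assume ij: "i < n" "j < n"
        then show "cyc_term a h (\<lambda>m\<in>{..<n}. f m \<oplus>\<^bsub>L\<^esub> g m) (i, j) = cyc_term a h f (i, j) \<oplus>\<^bsub>L\<^esub> cyc_term a h g (i, j)"
          using coeff_closed[OF f] coeff_closed[OF g] coeff_closed[OF h] a
          by (simp add: cyc_term_def L.l_distr L.r_distr \<sigma>_powD(4))
      qed
      then show "finsum L (cyc_term a h (\<lambda>m\<in>{..<n}. f m \<oplus>\<^bsub>L\<^esub> g m)) (pairs m) =
          (\<lambda>m\<in>{..<n}. finsum L (cyc_term a h f) (pairs m)) m \<oplus>\<^bsub>L\<^esub> (\<lambda>m\<in>{..<n}. finsum L (cyc_term a h g) (pairs m)) m"
        using m by simp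
    qed
  next
    show "\<one>\<^bsub>cyc a\<^esub> \<in> {..<n} \<rightarrow>\<^sub>E carrier L" by (auto simp: cyc_simps)
    have "\<one>\<^bsub>cyc a\<^esub> 0 \<noteq> \<zero>\<^bsub>cyc a\<^esub> 0" using n_pos by (simp add: cyc_simps)
    then show "\<one>\<^bsub>cyc a\<^esub> \<noteq> \<zero>\<^bsub>cyc a\<^esub>" by metis
  next
    fix c f assume c: "c \<in> carrier (Qp p)" and f: "f \<in> {..<n} \<rightarrow>\<^sub>E carrier L"
    have cf: "(\<lambda>m\<in>{..<n}. c \<odot>\<^bsub>L\<^esub> f m) \<in> {..<n} \<rightarrow>\<^sub>E carrier L" using c f by auto
    show "c \<odot>\<^bsub>cyc a\<^esub> f \<in> {..<n} \<rightarrow>\<^sub>E carrier L" using cf by (simp add: cyc_simps)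
    show "(c \<oplus>\<^bsub>Qp p\<^esub> d) \<odot>\<^bsub>cyc a\<^esub> f = c \<odot>\<^bsub>cyc a\<^esub> f \<oplus>\<^bsub>cyc a\<^esub> d \<odot>\<^bsub>cyc a\<^esub> f" if "d \<in> carrier (Qp p)" for d
      unfolding cyc_simps using that c coeff_closed[OF f]
      by (intro restrict_ext) (simp add: LA.scale_add_left)
    show "(c \<otimes>\<^bsub>Qp p\<^esub> d) \<odot>\<^bsub>cyc a\<^esub> f = c \<odot>\<^bsub>cyc a\<^esub> (d \<odot>\<^bsub>cyc a\<^esub> f)" if "d \<in> carrier (Qp p)" for d
      unfolding cyc_simps using that c coeff_closed[OF f]
      by (intro restrict_ext) (simp add: LA.scale_scale)
    fix g assume g: "g \<in> {..<n} \<rightarrow>\<^sub>E carrier L"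
    show "c \<odot>\<^bsub>cyc a\<^esub> (f \<oplus>\<^bsub>cyc a\<^esub> g) = c \<odot>\<^bsub>cyc a\<^esub> f \<oplus>\<^bsub>cyc a\<^esub> c \<odot>\<^bsub>cyc a\<^esub> g"
      unfolding cyc_simps using c coeff_closed[OF f] coeff_closed[OF g]
      by (intro restrict_ext) (simp add: LA.scale_add_right)
    show "(c \<odot>\<^bsub>cyc a\<^esub> f) \<otimes>\<^bsub>cyc a\<^esub> g = c \<odot>\<^bsub>cyc a\<^esub> (f \<otimes>\<^bsub>cyc a\<^esub> g)"
      unfolding cyc_simps
    proof (rule restrict_ext)
      fix m assume m: "m \<in> {..<n}"
      have "finsum L (cyc_term a (\<lambda>m\<in>{..<n}. c \<odot>\<^bsub>L\<^esub> f m) g) (pairs m) = c \<odot>\<^bsub>L\<^esub> finsum L (cyc_term a f g) (pairs m)"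
      proof (rule scale[OF c f g])
        fix i j assume ij: "i < n" "j < n"
        then show "cyc_term a (\<lambda>m\<in>{..<n}. c \<odot>\<^bsub>L\<^esub> f m) g (i, j) = c \<odot>\<^bsub>L\<^esub> cyc_term a f g (i, j)"
          using coeff_closed[OF f] coeff_closed[OF g] a c by (simp add: cyc_term_def LA.scale_mult_left)
      qed
      then show "finsum L (cyc_term a (\<lambda>m\<in>{..<n}. c \<odot>\<^bsub>L\<^esub> f m) g) (pairs m) =
          c \<odot>\<^bsub>L\<^esub> (\<lambda>m\<in>{..<n}. finsum L (cyc_term a f g) (pairs m)) m" using m by simp
    qed
    show "f \<otimes>\<^bsub>cyc a\<^esub> (c \<odot>\<^bsub>cyc a\<^esub> g) = c \<odot>\<^bsub>cyc a\<^esub> (f \<otimes>\<^bsub>cyc a\<^esub> g)"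
      unfolding cyc_simps
    proof (rule restrict_ext)
      fix m assume m: "m \<in> {..<n}"
      have "finsum L (cyc_term a f (\<lambda>m\<in>{..<n}. c \<odot>\<^bsub>L\<^esub> g m)) (pairs m) = c \<odot>\<^bsub>L\<^esub> finsum L (cyc_term a f g) (pairs m)"
      proof (rule scale[OF c f g])
        fix i j assume ij: "i < n" "j < n"
        then show "cyc_term a f (\<lambda>m\<in>{..<n}. c \<odot>\<^bsub>L\<^esub> g m) (i, j) = c \<odot>\<^bsub>L\<^esub> cyc_term a f g (i, j)"
          using coeff_closed[OF f] coeff_closed[OF g] a c
          by (simp add: cyc_term_def LA.scale_mult_left LA.scale_mult_right \<sigma>_powD(6))
      qed
      then show "finsum L (cyc_term a f (\<lambda>m\<in>{..<n}. c \<odot>\<^bsub>L\<^esub> g m)) (pairs m) =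
          c \<odot>\<^bsub>L\<^esub> (\<lambda>m\<in>{..<n}. finsum L (cyc_term a f g) (pairs m)) m" using m by simp
    qed
  next
    fix f assume f: "f \<in> {..<n} \<rightarrow>\<^sub>E carrier L"
    show "\<one>\<^bsub>Qp p\<^esub> \<odot>\<^bsub>cyc a\<^esub> f = f"
      unfolding cyc_simps by (rule coeff_eqI) (use f coeff_closed[OF f] in auto)
  qed
qed

text \<open>This is \<open>x u\<^sup>i\<close>.\<close>

definition delta :: "nat \<Rightarrow> 'b \<Rightarrow> nat \<Rightarrow> 'b" where
  "delta i x = (\<lambda>m\<in>{..<n}. if m = i then x else \<zero>\<^bsub>L\<^esub>)"

lemma delta_closed [simp]: "x \<in> carrier L \<Longrightarrow> delta i x \<in> {..<n} \<rightarrow>\<^sub>E carrier L"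
  by (auto simp: delta_def)

lemma delta_entry: "m < n \<Longrightarrow> delta i x m = (if m = i then x else \<zero>\<^bsub>L\<^esub>)"
  by (simp add: delta_def)

lemma delta_mult:
  assumes a: "a \<in> carrier L" and ij: "i < n" "j < n" and xy: "x \<in> carrier L" "y \<in> carrier L"
  shows "delta i x \<otimes>\<^bsub>cyc a\<^esub> delta j y =
    delta ((i + j) mod n) (x \<otimes>\<^bsub>L\<^esub> (\<sigma> ^^ i) y \<otimes>\<^bsub>L\<^esub> (if i + j < n then \<one>\<^bsub>L\<^esub> else a))"
    (is "_ = delta _ ?z")
  unfolding cyc_simps delta_def[of "(i + j) mod n"]
proof (rule restrict_ext)
  fix m assume m: "m \<in> {..<n}"
  have z: "?z \<in> carrier L" using assms by simp
  have 0: "cyc_term a (delta i x) (delta j y) t = \<zero>\<^bsub>L\<^esub>" if "t \<in> pairs m" "t \<noteq> (i, j)" for t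
    using that assms by (auto simp: cyc_term_def pairs_def delta_entry split: if_split_asm)
  have 1: "cyc_term a (delta i x) (delta j y) (i, j) = ?z"
    using assms by (simp add: cyc_term_def delta_entry)
  show "finsum L (cyc_term a (delta i x) (delta j y)) (pairs m) =
      (if m = (i + j) mod n then ?z else \<zero>\<^bsub>L\<^esub>)"
  proof (cases "m = (i + j) mod n")
    case True
    then have "(i, j) \<in> pairs m" using ij by (simp add: pairs_def)
    then show ?thesis using True z 0 1 L.finsum_delta[of "pairs m" "(i, j)" ?z] by simp
  next
    case False
    then have "(i, j) \<notin> pairs m" by (simp add: pairs_def)
    then have "finsum L (cyc_term a (delta i x) (delta j y)) (pairs m) = (\<Oplus>\<^bsub>L\<^esub>t\<in>pairs m. \<zero>\<^bsub>L\<^esub>)"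
      using 0 by (intro L.finsum_cong') auto
    then show ?thesis using False by simp
  qed
qed

lemma delta_add: "x \<in> carrier L \<Longrightarrow> y \<in> carrier L \<Longrightarrow> delta i (x \<oplus>\<^bsub>L\<^esub> y) = delta i x \<oplus>\<^bsub>cyc a\<^esub> delta i y"
  unfolding cyc_simps delta_def[of _ "_ \<oplus>\<^bsub>L\<^esub> _"] by (intro restrict_ext) (simp add: delta_entry)

lemma delta_scale: "c \<in> carrier (Qp p) \<Longrightarrow> x \<in> carrier L \<Longrightarrow> delta i (c \<odot>\<^bsub>L\<^esub> x) = c \<odot>\<^bsub>cyc a\<^esub> delta i x"
  unfolding cyc_simps delta_def[of _ "_ \<odot>\<^bsub>L\<^esub> _"] by (intro restrict_ext) (simp add: delta_entry)

lemma delta_one: "delta 0 \<one>\<^bsub>L\<^esub> = \<one>\<^bsub>cyc a\<^esub>"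
  unfolding cyc_simps delta_def by simp

lemma dim_cyc:
  assumes "assoc_algebra (Qp p) (cyc a)"
  shows "alg_dim (Qp p) (cyc a) (n * n) (carrier (cyc a))"
proof -
  interpret C: assoc_algebra "Qp p" "cyc a" by fact
  have cC: "f \<in> carrier (cyc a) \<longleftrightarrow> f \<in> {..<n} \<rightarrow>\<^sub>E carrier L" for f by (simp add: cyc_simps)
  have inj: "inj_on (delta i) (carrier L)" if "i < n" for i
  proof (rule inj_onI)
    fix x y assume "delta i x = delta i y"
    then have "delta i x i = delta i y i" by simp
    then show "x = y" using that by (simp add: delta_entry)
  qed
  have "alg_dim (Qp p) (cyc a) (card {..<n} * n) (carrier (cyc a))"
  proof (rule C.dim_direct_sum[where W="\<lambda>i. delta i ` carrier L" and \<pi>="\<lambda>i f. delta i (f i)"])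
    show "is_subspace (Qp p) (cyc a) (carrier (cyc a))" by (rule is_subspaceI) auto
    fix i assume "i \<in> {..<n}"
    then have i: "i < n" by simp
    show "alg_dim (Qp p) (cyc a) n (delta i ` carrier L)"
      by (rule dim_image[OF assoc_L assms dim_L])
        (simp_all add: cC delta_add delta_scale inj[OF i])
    show "delta i ` carrier L \<subseteq> carrier (cyc a)" by (rule image_subsetI) (simp only: cC delta_closed)
    show "delta i (f i) = f" if "f \<in> delta i ` carrier L" for f
      using that i by (auto simp: delta_entry)
    show "delta i (f i) = \<zero>\<^bsub>cyc a\<^esub>" if "j \<in> {..<n}" "i \<noteq> j" "f \<in> delta j ` carrier L" for f j
      using that i by (auto simp: delta_entry cyc_simps delta_def)
    fix f assume f: "f \<in> carrier (cyc a)"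
    then show "delta i (f i) \<in> delta i ` carrier L" using i by (auto simp: cyc_simps)
    show "delta i ((f \<oplus>\<^bsub>cyc a\<^esub> g) i) = delta i (f i) \<oplus>\<^bsub>cyc a\<^esub> delta i (g i)"
      if "g \<in> carrier (cyc a)" for g
    proof -
      have "(f \<oplus>\<^bsub>cyc a\<^esub> g) i = f i \<oplus>\<^bsub>L\<^esub> g i" using i by (simp add: cyc_simps)
      then show ?thesis using f that i by (simp add: cC delta_add coeff_closed)
    qed
    show "delta i ((c \<odot>\<^bsub>cyc a\<^esub> f) i) = c \<odot>\<^bsub>cyc a\<^esub> delta i (f i)" if "c \<in> carrier (Qp p)" for c
    proof -
      have "(c \<odot>\<^bsub>cyc a\<^esub> f) i = c \<odot>\<^bsub>L\<^esub> f i" using i by (simp add: cyc_simps)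
      then show ?thesis using f that i by (simp add: cC delta_scale coeff_closed)
    qed
  next
    fix f assume f: "f \<in> carrier (cyc a)" and 0: "\<And>i. i \<in> {..<n} \<Longrightarrow> delta i (f i) = \<zero>\<^bsub>cyc a\<^esub>"
    show "f = \<zero>\<^bsub>cyc a\<^esub>"
    proof (rule coeff_eqI)
      fix m assume m: "m < n"
      then have "delta m (f m) m = \<zero>\<^bsub>cyc a\<^esub> m" using 0[of m] by simp
      then show "f m = \<zero>\<^bsub>cyc a\<^esub> m" using m by (simp add: delta_entry)
    qed (use f C.zero_closed in \<open>simp_all only: cC\<close>)
  qed auto
  then show ?thesis by simp
qed

text \<open>A module of minimal dimension is one-dimensional over \<open>L\<close>, so the generator \<open>u\<close> of the cyclic
  algebra acts on a basis vector through some \<open>x\<close> in \<open>L\<close>, and \<open>u\<^sup>n = p\<^sup>r\<close> says that the norm of \<open>x\<close>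
  is \<open>p\<^sup>r\<close>. The valuation of a norm from an unramified extension is divisible by \<open>n\<close>.\<close>

theorem minimal_module_imp_dvd:
  fixes R :: "(padic, 'r, 's) module_scheme" and r :: nat
  assumes R: "assoc_algebra (Qp p) R" and W: "alg_dim (Qp p) R n W"
  defines "C \<equiv> cyc (rat_L (of_nat p ^ r))"
  assumes \<phi>: "\<And>f. f \<in> carrier C \<Longrightarrow> \<phi> f \<in> carrier R"
    and \<phi>_mult: "\<And>f g. f \<in> carrier C \<Longrightarrow> g \<in> carrier C \<Longrightarrow> \<phi> (f \<otimes>\<^bsub>C\<^esub> g) = \<phi> f \<otimes>\<^bsub>R\<^esub> \<phi> g"
    and \<phi>_add: "\<And>f g. f \<in> carrier C \<Longrightarrow> g \<in> carrier C \<Longrightarrow> \<phi> (f \<oplus>\<^bsub>C\<^esub> g) = \<phi> f \<oplus>\<^bsub>R\<^esub> \<phi> g"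
    and \<phi>_scale: "\<And>c f. c \<in> carrier (Qp p) \<Longrightarrow> f \<in> carrier C \<Longrightarrow> \<phi> (c \<odot>\<^bsub>C\<^esub> f) = c \<odot>\<^bsub>R\<^esub> \<phi> f"
    and act: "\<And>f w. f \<in> carrier C \<Longrightarrow> w \<in> W \<Longrightarrow> \<phi> f \<otimes>\<^bsub>R\<^esub> w \<in> W"
    and act_one: "\<And>w. w \<in> W \<Longrightarrow> \<phi> \<one>\<^bsub>C\<^esub> \<otimes>\<^bsub>R\<^esub> w = w"
  shows "n dvd r"
proof (cases "n = 1")
  case False
  then have n1: "1 < n" using n_pos by simp
  interpret R: assoc_algebra "Qp p" R by fact
  let ?a = "rat_L (of_nat p ^ r)"
  have a: "?a \<in> carrier L" by simp
  have d: "delta i x \<in> carrier C" if "x \<in> carrier L" for i x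
    using that by (simp add: C_def cyc_simps)
  note WD = is_subspaceD[OF R.dim_subspace[OF W]]
  obtain w where w: "w \<in> W" "w \<noteq> \<zero>\<^bsub>R\<^esub>"
  proof -
    have "W \<noteq> {\<zero>\<^bsub>R\<^esub>}" using R.dim_unique[OF W] R.dim_zero n_pos by auto
    then show ?thesis using WD(2) that by blast
  qed
  have wR: "w \<in> carrier R" using WD(1) w by blast
  define e where "e = (\<lambda>x. \<phi> (delta 0 x) \<otimes>\<^bsub>R\<^esub> w)"
  have eW: "e x \<in> W" if "x \<in> carrier L" for x using that w act d by (simp add: e_def)
  have e_add: "e (x \<oplus>\<^bsub>L\<^esub> y) = e x \<oplus>\<^bsub>R\<^esub> e y" if "x \<in> carrier L" "y \<in> carrier L" for x y
    using that d \<phi> wR by (simp add: e_def delta_add[of _ _ _ ?a, folded C_def] \<phi>_add R.mult_add_left)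
  have e_scale: "e (c \<odot>\<^bsub>L\<^esub> x) = c \<odot>\<^bsub>R\<^esub> e x" if "c \<in> carrier (Qp p)" "x \<in> carrier L" for c x
    using that d \<phi> wR by (simp add: e_def delta_scale[of _ _ _ ?a, folded C_def] \<phi>_scale R.scale_mult_left)
  have move: "\<phi> (delta i y) \<otimes>\<^bsub>R\<^esub> (\<phi> (delta j x) \<otimes>\<^bsub>R\<^esub> w) = \<phi> (delta i y \<otimes>\<^bsub>C\<^esub> delta j x) \<otimes>\<^bsub>R\<^esub> w"
    if "x \<in> carrier L" "y \<in> carrier L" for i j x y
    using that d \<phi> wR by (simp add: \<phi>_mult R.mult_assoc)
  have e_one: "e \<one>\<^bsub>L\<^esub> = w" using act_one[OF w(1)] delta_one[of ?a] by (simp add: e_def C_def)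
  have e_mult: "\<phi> (delta 0 y) \<otimes>\<^bsub>R\<^esub> e x = e (y \<otimes>\<^bsub>L\<^esub> x)" if "x \<in> carrier L" "y \<in> carrier L" for x y
    using that move[of x y 0 0] delta_mult[OF a n_pos n_pos] n_pos by (simp add: e_def C_def)
  have e_inj0: "x = \<zero>\<^bsub>L\<^esub>" if x: "x \<in> carrier L" "e x = \<zero>\<^bsub>R\<^esub>" for x
  proof (rule ccontr)
    assume "x \<noteq> \<zero>\<^bsub>L\<^esub>"
    then have u: "x \<in> Units L" using x by (simp add: L.field_Units)
    then have "w = \<phi> (delta 0 (inv\<^bsub>L\<^esub> x)) \<otimes>\<^bsub>R\<^esub> e x" using e_mult[of x "inv\<^bsub>L\<^esub> x"] x e_one by simp
    then show False using x(2) w(2) \<phi>[OF d] u by simp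
  qed
  have e_inj: "inj_on e (carrier L)"
  proof (rule inj_onI)
    fix x y assume xy: "x \<in> carrier L" "y \<in> carrier L" "e x = e y"
    define d where "d = x \<ominus>\<^bsub>L\<^esub> y"
    have dL: "d \<in> carrier L" using xy by (simp add: d_def)
    have cl: "e d \<in> carrier R" "e y \<in> carrier R" using WD(1) eW dL xy by blast+
    have "d \<oplus>\<^bsub>L\<^esub> y = x" using xy by (simp add: d_def L.minus_eq L.a_assoc L.l_neg)
    then have "e d \<oplus>\<^bsub>R\<^esub> e y = \<zero>\<^bsub>R\<^esub> \<oplus>\<^bsub>R\<^esub> e y"
      using e_add[OF dL xy(2)] xy(3) cl by simp
    then have "e d = \<zero>\<^bsub>R\<^esub>" using cl R.add.right_cancel[of "e y" "e d" "\<zero>\<^bsub>R\<^esub>"] by simp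
    then have "d = \<zero>\<^bsub>L\<^esub>" by (rule e_inj0[OF dL])
    then show "x = y" using xy by (simp add: d_def)
  qed
  have "alg_dim (Qp p) R n (e ` carrier L)"
    by (rule dim_image[OF assoc_L R dim_L]) (use eW WD(1) e_add e_scale e_inj in auto)
  then have surj: "e ` carrier L = W" by (rule R.dim_full_subspace[OF W]) (use eW in auto)
  have "\<phi> (delta 1 \<one>\<^bsub>L\<^esub>) \<otimes>\<^bsub>R\<^esub> w \<in> W" using act[OF d w(1)] by simp
  then obtain x where x: "x \<in> carrier L" "\<phi> (delta 1 \<one>\<^bsub>L\<^esub>) \<otimes>\<^bsub>R\<^esub> w = e x" using surj by blast
  have step: "\<phi> (delta 1 \<one>\<^bsub>L\<^esub>) \<otimes>\<^bsub>R\<^esub> e y = e (\<sigma> y \<otimes>\<^bsub>L\<^esub> x)" if y: "y \<in> carrier L" for y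
  proof -
    have \<sigma>y: "\<sigma> y \<in> carrier L" using y \<sigma>D(2) by simp
    have "\<phi> (delta 1 \<one>\<^bsub>L\<^esub>) \<otimes>\<^bsub>R\<^esub> e y = \<phi> (delta 1 (\<sigma> y)) \<otimes>\<^bsub>R\<^esub> w"
      using move[of y "\<one>\<^bsub>L\<^esub>" 1 0] delta_mult[OF a n1 n_pos, of "\<one>\<^bsub>L\<^esub>" y] y \<sigma>y n1 by (simp add: e_def C_def)
    also have "\<dots> = \<phi> (delta 0 (\<sigma> y)) \<otimes>\<^bsub>R\<^esub> (\<phi> (delta 1 \<one>\<^bsub>L\<^esub>) \<otimes>\<^bsub>R\<^esub> w)"
      using move[of "\<one>\<^bsub>L\<^esub>" "\<sigma> y" 0 1] delta_mult[OF a n_pos n1, of "\<sigma> y" "\<one>\<^bsub>L\<^esub>"] \<sigma>y n1 by (simp add: C_def)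
    also have "\<dots> = e (\<sigma> y \<otimes>\<^bsub>L\<^esub> x)" unfolding x(2) by (rule e_mult[OF x(1) \<sigma>y])
    finally show ?thesis .
  qed
  have powers: "\<phi> (delta i \<one>\<^bsub>L\<^esub>) \<otimes>\<^bsub>R\<^esub> w = e (partial_norm x i)" if "i < n" for i
    using that
  proof (induction i)
    case 0
    then show ?case by (simp add: e_def)
  next
    case (Suc i)
    have "\<phi> (delta 1 \<one>\<^bsub>L\<^esub>) \<otimes>\<^bsub>R\<^esub> (\<phi> (delta i \<one>\<^bsub>L\<^esub>) \<otimes>\<^bsub>R\<^esub> w) = \<phi> (delta (Suc i) \<one>\<^bsub>L\<^esub>) \<otimes>\<^bsub>R\<^esub> w"
      using move[of "\<one>\<^bsub>L\<^esub>" "\<one>\<^bsub>L\<^esub>" 1 i] delta_mult[OF a n1, of i "\<one>\<^bsub>L\<^esub>" "\<one>\<^bsub>L\<^esub>"] Suc.prems \<sigma>D(5)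
      by (simp add: C_def)
    then show ?case using Suc step[of "partial_norm x i"] x(1) by simp
  qed
  have "\<phi> (delta 1 \<one>\<^bsub>L\<^esub>) \<otimes>\<^bsub>R\<^esub> (\<phi> (delta (n - 1) \<one>\<^bsub>L\<^esub>) \<otimes>\<^bsub>R\<^esub> w) = e ?a"
    using move[of "\<one>\<^bsub>L\<^esub>" "\<one>\<^bsub>L\<^esub>" 1 "n - 1"] delta_mult[OF a n1, of "n - 1" "\<one>\<^bsub>L\<^esub>" "\<one>\<^bsub>L\<^esub>"] n1 \<sigma>D(5)
    by (simp add: C_def e_def)
  moreover have "\<phi> (delta 1 \<one>\<^bsub>L\<^esub>) \<otimes>\<^bsub>R\<^esub> (\<phi> (delta (n - 1) \<one>\<^bsub>L\<^esub>) \<otimes>\<^bsub>R\<^esub> w) = e (partial_norm x n)"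
    using powers[of "n - 1"] step[of "partial_norm x (n - 1)"] x(1) n1
      partial_norm.simps(2)[of x "n - 1"] by simp
  ultimately have "partial_norm x n = ?a"
    using e_inj x(1) a by (metis inj_onD partial_norm_closed)
  then show ?thesis by (rule norm_p_power_dvd[OF x(1)])
qed simp

text \<open>Conversely, if \<open>r = n * s\<close> then \<open>u\<close> can act on \<open>L\<close> as \<open>p\<^sup>s \<sigma>\<close>; this module is the left ideal
  generated by the sum of the \<open>p\<^sup>-\<^sup>s\<^sup>i u\<^sup>i\<close>.\<close>

lemma split_left_ideal:
  fixes s :: nat
  defines "C \<equiv> cyc (rat_L (of_nat p ^ (n * s)))"
  defines "g \<equiv> (\<lambda>x. \<lambda>m\<in>{..<n}. x \<otimes>\<^bsub>L\<^esub> rat_L (1 / of_nat p ^ (s * m)))"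
  assumes C: "assoc_algebra (Qp p) C"
  shows "alg_dim (Qp p) C n (g ` carrier L)"
    and "\<And>f h. f \<in> carrier C \<Longrightarrow> h \<in> g ` carrier L \<Longrightarrow> f \<otimes>\<^bsub>C\<^esub> h \<in> g ` carrier L"
proof -
  interpret C: assoc_algebra "Qp p" C by fact
  let ?a = "rat_L (of_nat p ^ (n * s))"
  have cC: "f \<in> carrier C \<longleftrightarrow> f \<in> {..<n} \<rightarrow>\<^sub>E carrier L" for f by (simp add: C_def cyc_simps)
  show "alg_dim (Qp p) C n (g ` carrier L)"
  proof (rule dim_image[OF assoc_L C dim_L])
    fix x assume x: "x \<in> carrier L"
    show "g x \<in> carrier C" using x by (auto simp: cC g_def)
    show "g (x \<oplus>\<^bsub>L\<^esub> y) = g x \<oplus>\<^bsub>C\<^esub> g y" if "y \<in> carrier L" for y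
      unfolding C_def cyc_simps g_def by (rule restrict_ext) (use x that in \<open>simp add: L.l_distr\<close>)
    show "g (c \<odot>\<^bsub>L\<^esub> x) = c \<odot>\<^bsub>C\<^esub> g x" if "c \<in> carrier (Qp p)" for c
      unfolding C_def cyc_simps g_def by (rule restrict_ext) (use x that in \<open>simp add: LA.scale_mult_left\<close>)
  next
    show "inj_on g (carrier L)"
    proof (rule inj_onI)
      fix x y assume xy: "x \<in> carrier L" "y \<in> carrier L" "g x = g y"
      then have "g x 0 = g y 0" by simp
      then show "x = y" using xy n_pos by (simp add: g_def)
    qed
  qed
  fix f h assume "f \<in> carrier C" "h \<in> g ` carrier L"
  then obtain x where f: "f \<in> {..<n} \<rightarrow>\<^sub>E carrier L" and x: "x \<in> carrier L" "h = g x" by (auto simp: cC)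
  define y where "y = (\<Oplus>\<^bsub>L\<^esub>i\<in>{..<n}. f i \<otimes>\<^bsub>L\<^esub> (\<sigma> ^^ i) x \<otimes>\<^bsub>L\<^esub> rat_L (of_nat p ^ (s * i)))"
  have yL: "y \<in> carrier L" unfolding y_def using x(1) coeff_closed[OF f] by (intro L.finsum_closed) auto
  have gy: "g y = (\<lambda>m\<in>{..<n}. y \<otimes>\<^bsub>L\<^esub> rat_L (1 / of_nat p ^ (s * m)))" by (simp only: g_def)
  have "f \<otimes>\<^bsub>C\<^esub> h = g y"
    unfolding C_def cyc_simps gy
  proof (rule restrict_ext)
    fix m assume m: "m \<in> {..<n}"
    define j where "j = (\<lambda>i. if i \<le> m then m - i else m + n - i)"
    have pairs: "pairs m = (\<lambda>i. (i, j i)) ` {..<n}"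
    proof (intro equalityI subsetI)
      fix t assume "t \<in> pairs m"
      then obtain i l where t: "t = (i, l)" "i < n" "l < n" "(i + l) mod n = m" by (auto simp: pairs_def)
      have "l = j i"
      proof (cases "i + l < n")
        case False
        then have "(i + l) mod n = i + l - n" using t(2,3) by (subst mod_if) auto
        then have "m = i + l - n" using t(4) by simp
        then show ?thesis using False t by (auto simp: j_def)
      qed (use t in \<open>auto simp: j_def\<close>)
      then show "t \<in> (\<lambda>i. (i, j i)) ` {..<n}" using t by auto
    qed (use m in \<open>auto simp: pairs_def j_def\<close>)
    have jn: "j i < n" if "i < n" for i using m that by (auto simp: j_def)
    have q: "cyc_term ?a f h (i, j i) =
        (f i \<otimes>\<^bsub>L\<^esub> (\<sigma> ^^ i) x \<otimes>\<^bsub>L\<^esub> rat_L (of_nat p ^ (s * i))) \<otimes>\<^bsub>L\<^esub> rat_L (1 / of_nat p ^ (s * m))" if i: "i < n" for i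
    proof -
      have fi: "f i \<in> carrier L" using coeff_closed[OF f i] .
      let ?b = "if i + j i < n then \<one>\<^bsub>L\<^esub> else ?a"
      let ?q = "(1 / of_nat p ^ (s * j i)) * (if i + j i < n then 1 else of_nat p ^ (n * s)) :: rat"
      have "?q = of_nat p ^ (s * i) * (1 / of_nat p ^ (s * m))"
      proof (cases "i \<le> m")
        case True
        then have "s * m = s * i + s * j i" by (simp add: j_def flip: distrib_left)
        then show ?thesis using True m p_pos by (simp add: j_def power_add)
      next
        case False
        then have "j i + i = m + n" using i by (simp add: j_def)
        then have "s * j i + s * i = s * m + n * s" by (metis distrib_left mult.commute)
        then have "(of_nat p :: rat) ^ (s * j i) * of_nat p ^ (s * i) = of_nat p ^ (s * m) * of_nat p ^ (n * s)"
          by (simp flip: power_add)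
        then show ?thesis using False p_pos by (simp add: j_def field_simps)
      qed
      then have "rat_L (1 / of_nat p ^ (s * j i)) \<otimes>\<^bsub>L\<^esub> ?b = rat_L (of_nat p ^ (s * i)) \<otimes>\<^bsub>L\<^esub> rat_L (1 / of_nat p ^ (s * m))"
        by (simp flip: rat_L_mult split: if_splits)
      moreover have "cyc_term ?a f h (i, j i) = f i \<otimes>\<^bsub>L\<^esub> (\<sigma> ^^ i) x \<otimes>\<^bsub>L\<^esub> (rat_L (1 / of_nat p ^ (s * j i)) \<otimes>\<^bsub>L\<^esub> ?b)"
        unfolding x(2) using fi x(1) jn[OF i] by (simp add: cyc_term_def g_def \<sigma>_powD(3) L.m_assoc)
      ultimately show ?thesis using fi x(1) by (simp add: L.m_assoc)
    qed
    have "finsum L (cyc_term ?a f h) (pairs m) = (\<Oplus>\<^bsub>L\<^esub>i\<in>{..<n}. cyc_term ?a f h (i, j i))"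
      unfolding pairs
    proof (rule L.finsum_reindex)
      have "h \<in> {..<n} \<rightarrow>\<^sub>E carrier L" unfolding x(2) g_def using x(1) by auto
      then show "cyc_term ?a f h \<in> (\<lambda>i. (i, j i)) ` {..<n} \<rightarrow> carrier L"
        using cyc_term_closed[OF rat_L_closed f, of h "of_nat p ^ (n * s)" m] pairs by simp
    qed (auto intro: inj_onI)
    also have "\<dots> = (\<Oplus>\<^bsub>L\<^esub>i\<in>{..<n}. (f i \<otimes>\<^bsub>L\<^esub> (\<sigma> ^^ i) x \<otimes>\<^bsub>L\<^esub> rat_L (of_nat p ^ (s * i))) \<otimes>\<^bsub>L\<^esub> rat_L (1 / of_nat p ^ (s * m)))"
      using q x(1) coeff_closed[OF f] by (intro L.finsum_cong') auto
    also have "\<dots> = y \<otimes>\<^bsub>L\<^esub> rat_L (1 / of_nat p ^ (s * m))"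
      unfolding y_def using x(1) coeff_closed[OF f] by (intro L.finsum_ldistr[symmetric]) auto
    finally show "finsum L (cyc_term ?a f h) (pairs m) = y \<otimes>\<^bsub>L\<^esub> rat_L (1 / of_nat p ^ (s * m))" .
  qed
  then show "f \<otimes>\<^bsub>C\<^esub> h \<in> g ` carrier L" using yL by blast
qed

end

section \<open>Construction of unramified extensions\<close>

text \<open>The subring \<open>R\<close> is a candidate for the ring of integers. Up to a power of
  \<open>p\<close> every element is a unit of \<open>R\<close>, so an element outside \<open>R\<close>
  has an inverse that \<open>p\<close> divides in \<open>R\<close>. A monic equation with coefficients
  in \<open>R\<close> for such an element would make \<open>p\<close> invertible in \<open>R\<close>.
  Moreover everything in \<open>R\<close> outside \<open>p R\<close> is a unit of \<open>R\<close>,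
  whence the maximality.\<close>

lemma (in rational_prime) unramified_criterion:
  fixes L :: "(padic, 'b) module"
  assumes alg: "algebra (Qp p) L" and field: "field L"
    and sub: "subring R L" and int: "R \<subseteq> carrier (integer_ring p L)"
    and Z: "scalars L (carrier (Zp p)) \<subseteq> R"
    and p_inv: "emb (1 / of_nat p) \<odot>\<^bsub>L\<^esub> \<one>\<^bsub>L\<^esub> \<notin> R"
    and unit: "\<And>x. x \<in> carrier L \<Longrightarrow> x \<noteq> \<zero>\<^bsub>L\<^esub> \<Longrightarrow>
      \<exists>s::int. \<exists>u\<in>R. \<exists>v\<in>R. u \<otimes>\<^bsub>L\<^esub> v = \<one>\<^bsub>L\<^esub> \<and> x = emb (of_nat p powi s) \<odot>\<^bsub>L\<^esub> u"
  shows "carrier (integer_ring p L) = R"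
    and "maximalideal (prime_ideal_over p L) (integer_ring p L)"
    and "prime_ideal_over p L = (\<lambda>y. emb (of_nat p) \<odot>\<^bsub>L\<^esub> y) ` R"
proof -
  interpret L: field L by fact
  interpret LA: assoc_algebra "Qp p" L by (rule algebra_imp_assoc_algebra[OF field_Qp alg]) simp
  define q where "q = (\<lambda>r. emb r \<odot>\<^bsub>L\<^esub> \<one>\<^bsub>L\<^esub>)"
  have qL [simp]: "q r \<in> carrier L" for r by (simp add: q_def)
  have q_mult: "q (r * s) = q r \<otimes>\<^bsub>L\<^esub> q s" for r s by (simp add: q_def emb_mult LA.scale_scale)
  have q_scale: "emb r \<odot>\<^bsub>L\<^esub> x = q r \<otimes>\<^bsub>L\<^esub> x" if "x \<in> carrier L" for r x using that by (simp add: q_def)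
  have q_1: "q 1 = \<one>\<^bsub>L\<^esub>" by (simp add: q_def emb_1)
  have q_nat: "[(k::nat)] \<cdot>\<^bsub>L\<^esub> \<one>\<^bsub>L\<^esub> = q (of_nat k)" for k
    by (induction k) (simp_all add: q_def emb_0 emb_1 emb_add LA.scale_add_left L.a_comm)
  have p0: "(of_nat p :: rat) \<noteq> 0" using p_pos by simp
  note RE = subringE[OF sub]
  have q_pow: "q (of_nat p ^ k) \<in> R" for k
    using Z emb_of_nat_Zp[of "p ^ k"] by (auto simp: scalars_def q_def)
  have p_not_unit: False if x: "x \<in> R" "q (of_nat p) \<otimes>\<^bsub>L\<^esub> x = \<one>\<^bsub>L\<^esub>" for x
  proof -
    have xL: "x \<in> carrier L" using x(1) RE(1) by auto
    have "q (1 / of_nat p) = q (1 / of_nat p) \<otimes>\<^bsub>L\<^esub> (q (of_nat p) \<otimes>\<^bsub>L\<^esub> x)" using x(2) by simp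
    also have "\<dots> = q (1 / of_nat p * of_nat p) \<otimes>\<^bsub>L\<^esub> x" using xL by (simp only: q_mult L.m_assoc qL)
    also have "\<dots> = x" using xL p0 q_1 by simp
    finally show False using p_inv x(1) by (simp add: q_def)
  qed
  have unit_or: "(\<exists>y\<in>R. x \<otimes>\<^bsub>L\<^esub> y = \<one>\<^bsub>L\<^esub>) \<or> (\<exists>y\<in>R. x = q (of_nat p) \<otimes>\<^bsub>L\<^esub> y)" if x: "x \<in> R" for x
  proof (cases "x = \<zero>\<^bsub>L\<^esub>")
    case True
    then show ?thesis using RE(2) by (intro disjI2 bexI[of _ "\<zero>\<^bsub>L\<^esub>"]) auto
  next
    case False
    have xL: "x \<in> carrier L" using x RE(1) by auto
    obtain s u v where suv: "u \<in> R" "v \<in> R" "u \<otimes>\<^bsub>L\<^esub> v = \<one>\<^bsub>L\<^esub>" "x = emb (of_nat p powi s) \<odot>\<^bsub>L\<^esub> u"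
      using unit[OF xL False] by blast
    have uvL: "u \<in> carrier L" "v \<in> carrier L" using suv RE(1) by auto
    have xq: "x = q (of_nat p powi s) \<otimes>\<^bsub>L\<^esub> u" using suv(4) q_scale uvL by simp
    consider "s = 0" | "s > 0" | "s < 0" by linarith
    then show ?thesis
    proof cases
      case 1
      then have "x = u" using xq uvL q_1 by simp
      then show ?thesis using suv by blast
    next
      case 2
      define k where "k = nat (s - 1)"
      have "s = 1 + int k" using 2 by (simp add: k_def)
      then have "(of_nat p :: rat) powi s = of_nat p * of_nat p ^ k" using p0 by (simp add: power_int_add)
      then have "x = q (of_nat p) \<otimes>\<^bsub>L\<^esub> (q (of_nat p ^ k) \<otimes>\<^bsub>L\<^esub> u)"
        using xq uvL by (simp add: q_mult L.m_assoc)
      then show ?thesis using RE(6)[OF q_pow suv(1)] by blast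
    next
      case 3
      define k where "k = nat (- s - 1)"
      have "s + (1 + int k) = 0" using 3 by (simp add: k_def)
      then have "(of_nat p :: rat) powi s * (of_nat p * of_nat p ^ k) = 1"
        using p0 power_int_add[of "of_nat p :: rat" s "1 + int k"] by (simp add: power_int_add)
      then have "q (of_nat p powi s) \<otimes>\<^bsub>L\<^esub> (q (of_nat p) \<otimes>\<^bsub>L\<^esub> q (of_nat p ^ k)) = \<one>\<^bsub>L\<^esub>"
        using q_1 by (simp only: q_mult[symmetric])
      moreover have "(q (of_nat p powi s) \<otimes>\<^bsub>L\<^esub> u) \<otimes>\<^bsub>L\<^esub> (q (of_nat p) \<otimes>\<^bsub>L\<^esub> q (of_nat p ^ k)) =
          (q (of_nat p powi s) \<otimes>\<^bsub>L\<^esub> (q (of_nat p) \<otimes>\<^bsub>L\<^esub> q (of_nat p ^ k))) \<otimes>\<^bsub>L\<^esub> u"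
        using uvL by (simp add: L.m_ac)
      ultimately have "x \<otimes>\<^bsub>L\<^esub> (q (of_nat p) \<otimes>\<^bsub>L\<^esub> q (of_nat p ^ k)) = u" using xq uvL by simp
      then have "(x \<otimes>\<^bsub>L\<^esub> (q (of_nat p) \<otimes>\<^bsub>L\<^esub> q (of_nat p ^ k))) \<otimes>\<^bsub>L\<^esub> v = \<one>\<^bsub>L\<^esub>" using suv(3) by simp
      then have "q (of_nat p) \<otimes>\<^bsub>L\<^esub> (x \<otimes>\<^bsub>L\<^esub> q (of_nat p ^ k) \<otimes>\<^bsub>L\<^esub> v) = \<one>\<^bsub>L\<^esub>"
        using xL uvL by (simp add: L.m_ac)
      then show ?thesis using p_not_unit RE(6) x q_pow suv(2) by blast
    qed
  qed
  have sup: "x \<in> R" if x: "x \<in> carrier (integer_ring p L)" for x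
  proof (rule ccontr)
    assume notin: "x \<notin> R"
    obtain f where f: "f \<noteq> []" "set f \<subseteq> scalars L (carrier (Zp p))" "hd f = \<one>\<^bsub>L\<^esub>" "L.eval f x = \<zero>\<^bsub>L\<^esub>"
      and xL: "x \<in> carrier L" using x by (auto simp: integer_ring_def)
    obtain g where g: "f = \<one>\<^bsub>L\<^esub> # g" using f by (cases f) auto
    have gR: "set g \<subseteq> R" using f g Z by auto
    have x0: "x \<noteq> \<zero>\<^bsub>L\<^esub>" using notin RE(2) by auto
    obtain s u v where suv: "u \<in> R" "v \<in> R" "u \<otimes>\<^bsub>L\<^esub> v = \<one>\<^bsub>L\<^esub>" "x = emb (of_nat p powi s) \<odot>\<^bsub>L\<^esub> u"
      using unit[OF xL x0] by blast
    have uvL: "u \<in> carrier L" "v \<in> carrier L" using suv RE(1) by auto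
    have xq: "x = q (of_nat p powi s) \<otimes>\<^bsub>L\<^esub> u" using suv(4) q_scale uvL by simp
    have "s < 0"
    proof (rule ccontr)
      assume "\<not> s < 0"
      then have "(of_nat p :: rat) powi s = of_nat p ^ nat s" by (simp add: power_int_def)
      then show False using xq RE(6)[OF q_pow suv(1)] notin by simp
    qed
    define k where "k = nat (- s - 1)"
    have "s + (1 + int k) = 0" using \<open>s < 0\<close> by (simp add: k_def)
    then have "(of_nat p :: rat) powi s * (of_nat p * of_nat p ^ k) = 1"
      using p0 power_int_add[of "of_nat p :: rat" s "1 + int k"] by (simp add: power_int_add)
    then have qq: "q (of_nat p powi s) \<otimes>\<^bsub>L\<^esub> (q (of_nat p) \<otimes>\<^bsub>L\<^esub> q (of_nat p ^ k)) = \<one>\<^bsub>L\<^esub>"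
      using q_1 by (simp only: q_mult[symmetric])
    define y where "y = q (of_nat p) \<otimes>\<^bsub>L\<^esub> (q (of_nat p ^ k) \<otimes>\<^bsub>L\<^esub> v)"
    have yR: "y \<in> R" unfolding y_def using RE(6) q_pow[of k] q_pow[of 1] suv(2) by simp
    have yL: "y \<in> carrier L" using yR RE(1) by auto
    have "x \<otimes>\<^bsub>L\<^esub> y = (q (of_nat p powi s) \<otimes>\<^bsub>L\<^esub> (q (of_nat p) \<otimes>\<^bsub>L\<^esub> q (of_nat p ^ k))) \<otimes>\<^bsub>L\<^esub> (u \<otimes>\<^bsub>L\<^esub> v)"
      unfolding xq y_def using uvL by (simp add: L.m_ac)
    then have xy: "x \<otimes>\<^bsub>L\<^esub> y = \<one>\<^bsub>L\<^esub>" using qq suv(3) by simp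
    have pows: "x [^]\<^bsub>L\<^esub> l \<otimes>\<^bsub>L\<^esub> y [^]\<^bsub>L\<^esub> l = \<one>\<^bsub>L\<^esub>" for l :: nat
      using xL yL xy by (simp flip: L.nat_pow_distrib)
    have "\<exists>z\<in>R. L.eval g x \<otimes>\<^bsub>L\<^esub> y [^]\<^bsub>L\<^esub> length g = y \<otimes>\<^bsub>L\<^esub> z"
      using gR
    proof (induction g)
      case Nil
      then show ?case using RE(2) yL by (intro bexI[of _ "\<zero>\<^bsub>L\<^esub>"]) auto
    next
      case (Cons c cs)
      then obtain z where z: "z \<in> R" "L.eval cs x \<otimes>\<^bsub>L\<^esub> y [^]\<^bsub>L\<^esub> length cs = y \<otimes>\<^bsub>L\<^esub> z" by auto
      define e where "e = L.eval cs x"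
      define l where "l = length cs"
      have cl: "c \<in> carrier L" "z \<in> carrier L" "e \<in> carrier L"
        using Cons.prems z RE(1) xL by (auto simp: e_def intro!: L.eval_in_carrier)
      define a where "a = x [^]\<^bsub>L\<^esub> l"
      define b where "b = y [^]\<^bsub>L\<^esub> l"
      have ab: "a \<in> carrier L" "b \<in> carrier L" "a \<otimes>\<^bsub>L\<^esub> b = \<one>\<^bsub>L\<^esub>" "e \<otimes>\<^bsub>L\<^esub> b = y \<otimes>\<^bsub>L\<^esub> z"
        using xL yL pows z(2) by (auto simp: a_def b_def e_def l_def)
      have "L.eval (c # cs) x \<otimes>\<^bsub>L\<^esub> y [^]\<^bsub>L\<^esub> length (c # cs) = (c \<otimes>\<^bsub>L\<^esub> a \<oplus>\<^bsub>L\<^esub> e) \<otimes>\<^bsub>L\<^esub> (b \<otimes>\<^bsub>L\<^esub> y)"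
        by (simp add: a_def b_def e_def l_def)
      also have "\<dots> = c \<otimes>\<^bsub>L\<^esub> (a \<otimes>\<^bsub>L\<^esub> b) \<otimes>\<^bsub>L\<^esub> y \<oplus>\<^bsub>L\<^esub> (e \<otimes>\<^bsub>L\<^esub> b) \<otimes>\<^bsub>L\<^esub> y"
        using cl ab(1,2) yL by algebra
      also have "\<dots> = y \<otimes>\<^bsub>L\<^esub> (c \<oplus>\<^bsub>L\<^esub> z \<otimes>\<^bsub>L\<^esub> y)"
        unfolding ab(3,4) using cl yL by algebra
      finally show ?case using Cons.prems z(1) yR RE(6,7) by (intro bexI[of _ "c \<oplus>\<^bsub>L\<^esub> z \<otimes>\<^bsub>L\<^esub> y"]) auto
    qed
    then obtain z where z: "z \<in> R" "L.eval g x \<otimes>\<^bsub>L\<^esub> y [^]\<^bsub>L\<^esub> length g = y \<otimes>\<^bsub>L\<^esub> z" ..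
    have zL: "z \<in> carrier L" using z RE(1) by auto
    have eL: "L.eval g x \<in> carrier L" using gR RE(1) xL by (intro L.eval_in_carrier) auto
    have "\<zero>\<^bsub>L\<^esub> = (x [^]\<^bsub>L\<^esub> length g \<oplus>\<^bsub>L\<^esub> L.eval g x) \<otimes>\<^bsub>L\<^esub> y [^]\<^bsub>L\<^esub> length g"
      using f(4) xL yL by (simp add: g)
    also have "\<dots> = \<one>\<^bsub>L\<^esub> \<oplus>\<^bsub>L\<^esub> y \<otimes>\<^bsub>L\<^esub> z" using xL yL eL z(2) pows by (simp add: L.l_distr)
    finally have "\<one>\<^bsub>L\<^esub> = y \<otimes>\<^bsub>L\<^esub> (\<ominus>\<^bsub>L\<^esub> z)"
      using yL zL by (metis L.add.inv_equality L.m_closed L.minus_minus L.one_closed L.r_minus)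
    then have yz: "y \<otimes>\<^bsub>L\<^esub> (\<ominus>\<^bsub>L\<^esub> z) = \<one>\<^bsub>L\<^esub>" by (rule sym)
    have "q (of_nat p) \<otimes>\<^bsub>L\<^esub> (q (of_nat p ^ k) \<otimes>\<^bsub>L\<^esub> v \<otimes>\<^bsub>L\<^esub> (\<ominus>\<^bsub>L\<^esub> z)) = y \<otimes>\<^bsub>L\<^esub> (\<ominus>\<^bsub>L\<^esub> z)"
      unfolding y_def using uvL zL by (simp only: L.m_assoc L.m_closed L.a_inv_closed qL)
    then show False
      using p_not_unit[OF RE(6)[OF RE(6)[OF q_pow suv(2)] RE(5)[OF z(1)]]] yz by simp
  qed
  show OR: "carrier (integer_ring p L) = R" using int sup by blast
  have I: "integer_ring p L = L\<lparr>carrier := R\<rparr>"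
    using OR by (simp add: integer_ring_def)
  interpret O: ring "integer_ring p L" unfolding I by (rule L.subring_is_ring[OF sub])
  have RL: "x \<in> carrier L" if "x \<in> R" for x using that RE(1) by auto
  interpret O: cring "integer_ring p L"
    by unfold_locales (simp add: I L.m_comm RL)
  have P: "prime_ideal_over p L = (\<lambda>y. q (of_nat p) \<otimes>\<^bsub>L\<^esub> y) ` R"
    unfolding prime_ideal_over_def cgenideal_def q_nat
    using RL by (auto simp: I L.m_comm)
  show "prime_ideal_over p L = (\<lambda>y. emb (of_nat p) \<odot>\<^bsub>L\<^esub> y) ` R"
    unfolding P using q_scale RL by auto
  show "maximalideal (prime_ideal_over p L) (integer_ring p L)"
  proof (rule maximalidealI)
    show "ideal (prime_ideal_over p L) (integer_ring p L)"
      unfolding prime_ideal_over_def q_nat using q_pow[of 1] by (intro O.cgenideal_ideal) (simp add: I)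
    show "carrier (integer_ring p L) \<noteq> prime_ideal_over p L"
      using RE(3) p_not_unit unfolding OR P by (metis imageE)
    fix J assume J: "ideal J (integer_ring p L)" "prime_ideal_over p L \<subseteq> J" "J \<subseteq> carrier (integer_ring p L)"
    interpret J: ideal J "integer_ring p L" by fact
    show "J = prime_ideal_over p L \<or> J = carrier (integer_ring p L)"
    proof (cases "J \<subseteq> prime_ideal_over p L")
      case False
      then obtain x where x: "x \<in> J" "x \<notin> prime_ideal_over p L" by blast
      then have "x \<in> R" using J(3) OR by auto
      then obtain y where y: "y \<in> R" "x \<otimes>\<^bsub>L\<^esub> y = \<one>\<^bsub>L\<^esub>" using unit_or x(2) P by blast
      then have "\<one>\<^bsub>integer_ring p L\<^esub> \<in> J" using J.I_r_closed[OF x(1), of y] by (simp add: I)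
      then show ?thesis using J.one_imp_carrier by simp
    qed (use J(2) in blast)
  qed
qed

subsection \<open>Degree one\<close>

text \<open>The trivial extension is realized on constant functions, because the invariant ranges over
  extensions whose elements are functions from \<^typ>\<open>nat\<close> to \<^typ>\<open>padic\<close>.\<close>

definition unit_ext :: "nat \<Rightarrow> (padic, nat \<Rightarrow> padic) module" where
  "unit_ext p =
     \<lparr>carrier = (\<lambda>x _. x) ` carrier (Qp p), monoid.mult = (\<lambda>f g _. f 0 \<otimes>\<^bsub>Qp p\<^esub> g 0),
      monoid.one = (\<lambda>_. \<one>\<^bsub>Qp p\<^esub>), ring.zero = (\<lambda>_. \<zero>\<^bsub>Qp p\<^esub>),
      ring.add = (\<lambda>f g _. f 0 \<oplus>\<^bsub>Qp p\<^esub> g 0), module.smult = (\<lambda>c f _. c \<otimes>\<^bsub>Qp p\<^esub> f 0)\<rparr>"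

context rational_prime
begin

lemma unit_ext_simps [simp]:
  "carrier (unit_ext p) = (\<lambda>x _. x) ` carrier (Qp p)"
  "f \<otimes>\<^bsub>unit_ext p\<^esub> g = (\<lambda>_. f 0 \<otimes>\<^bsub>Qp p\<^esub> g 0)" "f \<oplus>\<^bsub>unit_ext p\<^esub> g = (\<lambda>_. f 0 \<oplus>\<^bsub>Qp p\<^esub> g 0)"
  "\<one>\<^bsub>unit_ext p\<^esub> = (\<lambda>_. \<one>\<^bsub>Qp p\<^esub>)" "\<zero>\<^bsub>unit_ext p\<^esub> = (\<lambda>_. \<zero>\<^bsub>Qp p\<^esub>)"
  "c \<odot>\<^bsub>unit_ext p\<^esub> f = (\<lambda>_. c \<otimes>\<^bsub>Qp p\<^esub> f 0)"
  by (simp_all add: unit_ext_def)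

lemma cring_unit_ext: "cring (unit_ext p)"
proof (rule cringI)
  show "abelian_group (unit_ext p)"
  proof (rule abelian_groupI)
    fix f assume "f \<in> carrier (unit_ext p)"
    then obtain x where x: "x \<in> carrier (Qp p)" "f = (\<lambda>_. x)" by auto
    then show "\<exists>g\<in>carrier (unit_ext p). g \<oplus>\<^bsub>unit_ext p\<^esub> f = \<zero>\<^bsub>unit_ext p\<^esub>"
      by (intro bexI[of _ "\<lambda>_. \<ominus>\<^bsub>Qp p\<^esub> x"]) (auto simp: Q.l_neg)
  qed (auto simp: Q.a_ac)
  show "Group.comm_monoid (unit_ext p)"
    by (rule comm_monoidI) (auto simp: Q.m_ac)
qed (auto simp: Q.l_distr)

lemma field_unit_ext: "field (unit_ext p)"
proof (rule cring.cring_fieldI2[OF cring_unit_ext])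
  show "\<zero>\<^bsub>unit_ext p\<^esub> \<noteq> \<one>\<^bsub>unit_ext p\<^esub>" by (auto dest: fun_cong)
  fix f assume "f \<in> carrier (unit_ext p)" "f \<noteq> \<zero>\<^bsub>unit_ext p\<^esub>"
  then obtain x where x: "x \<in> carrier (Qp p)" "x \<noteq> \<zero>\<^bsub>Qp p\<^esub>" "f = (\<lambda>_. x)" by auto
  then have "x \<in> Units (Qp p)" by (simp add: Q.field_Units)
  then show "\<exists>g\<in>carrier (unit_ext p). f \<otimes>\<^bsub>unit_ext p\<^esub> g = \<one>\<^bsub>unit_ext p\<^esub>"
    using x by (intro bexI[of _ "\<lambda>_. inv\<^bsub>Qp p\<^esub> x"]) auto
qed

lemma algebra_unit_ext: "algebra (Qp p) (unit_ext p)"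
  by (rule algebraI[OF cring_Qp cring_unit_ext]) (auto simp: Q.l_distr Q.r_distr Q.m_assoc)

lemma vabs_powi: "vabs (of_nat p powi s) = real p powi (- s)"
proof (cases "s \<ge> 0")
  case True
  then have "(of_nat p :: rat) powi s = of_nat p ^ nat s" by (simp add: power_int_def)
  then show ?thesis using True by (simp add: vabs_power vabs_p power_int_def power_one_over inverse_eq_divide)
next
  case False
  then have "(of_nat p :: rat) powi s = inverse (of_nat p ^ nat (- s))"
    by (simp add: power_int_def power_inverse)
  then show ?thesis using False by (simp add: vabs_power vabs_inverse vabs_p power_int_def power_one_over power_inverse)
qed

lemma Qp_normalize:
  assumes "x \<in> carrier (Qp p)" "x \<noteq> \<zero>\<^bsub>Qp p\<^esub>"
  obtains s :: int where "qnorm (emb (of_nat p powi (- s)) \<otimes>\<^bsub>Qp p\<^esub> x) = 1" "qnorm x = real p powi (- s)"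
proof -
  obtain v where v: "qnorm x = real p powi v" using qnorm_discrete[OF assms] .
  have "real p powi (- v) * real p powi v = 1"
    using p_pos by (simp flip: power_int_add)
  then have "qnorm (emb (of_nat p powi (- (- v))) \<otimes>\<^bsub>Qp p\<^esub> x) = 1"
    using assms v by (simp add: qnorm_mult vabs_powi)
  then show ?thesis using that[of "- v"] v by simp
qed

lemma emb_powi_cancel: "x \<in> carrier (Qp p) \<Longrightarrow> emb (of_nat p powi s) \<otimes>\<^bsub>Qp p\<^esub> (emb (of_nat p powi (- s)) \<otimes>\<^bsub>Qp p\<^esub> x) = x"
proof -
  have "(of_nat p :: rat) powi s * of_nat p powi (- s) = 1" using p_pos by (simp flip: power_int_add)
  then have "emb (of_nat p powi s) \<otimes>\<^bsub>Qp p\<^esub> emb (of_nat p powi (- s)) = \<one>\<^bsub>Qp p\<^esub>"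
    by (simp only: emb_mult[symmetric] emb_1)
  then show "x \<in> carrier (Qp p) \<Longrightarrow> ?thesis" by (simp flip: Q.m_assoc)
qed

lemma Zp_inverse:
  assumes "x \<in> carrier (Qp p)" "qnorm x = 1"
  shows "x \<in> carrier (Zp p)" "inv\<^bsub>Qp p\<^esub> x \<in> carrier (Zp p)" "x \<otimes>\<^bsub>Qp p\<^esub> inv\<^bsub>Qp p\<^esub> x = \<one>\<^bsub>Qp p\<^esub>"
proof -
  have x0: "x \<noteq> \<zero>\<^bsub>Qp p\<^esub>" using assms(2) by auto
  then have u: "x \<in> Units (Qp p)" using assms(1) by (simp add: Q.field_Units)
  show "x \<in> carrier (Zp p)" using assms by (intro ZpI) auto
  show "inv\<^bsub>Qp p\<^esub> x \<in> carrier (Zp p)"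
    using qnorm_inv[OF assms(1) x0] assms(2) u by (intro ZpI) auto
  show "x \<otimes>\<^bsub>Qp p\<^esub> inv\<^bsub>Qp p\<^esub> x = \<one>\<^bsub>Qp p\<^esub>" using u by simp
qed

lemma emb_p_inv_notin_Zp: "emb (1 / of_nat p) \<notin> carrier (Zp p)"
  using Zp_norm[of "emb (1 / of_nat p)"] p_gt_1 by (auto simp: vabs_divide vabs_p)

lemma scalars_unit_ext: "scalars (unit_ext p) S = (\<lambda>x _. x) ` S" if "S \<subseteq> carrier (Qp p)"
  using that by (force simp: scalars_def)

lemma unramified_unit_ext: "unramified p 1 (unit_ext p) id"
proof -
  let ?L = "unit_ext p" and ?R = "(\<lambda>x _. x) ` carrier (Zp p) :: (nat \<Rightarrow> padic) set"
  interpret L: field ?L by (rule field_unit_ext)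
  have ZQ: "carrier (Zp p) \<subseteq> carrier (Qp p)" by auto
  have a_inv: "\<ominus>\<^bsub>?L\<^esub> (\<lambda>_. x) = (\<lambda>_. \<ominus>\<^bsub>Qp p\<^esub> x)" if "x \<in> carrier (Qp p)" for x
    using that by (intro L.minus_equality) (auto simp: Q.l_neg)
  have sub: "subring ?R ?L"
  proof (rule L.subringI)
    show "?R \<subseteq> carrier ?L" using ZQ by auto
    show "\<one>\<^bsub>?L\<^esub> \<in> ?R" using Zp_one by auto
    fix f g assume "f \<in> ?R" "g \<in> ?R"
    then show "f \<otimes>\<^bsub>?L\<^esub> g \<in> ?R" "f \<oplus>\<^bsub>?L\<^esub> g \<in> ?R" using Zp_mult Zp_add by auto
  next
    fix f assume "f \<in> ?R"
    then show "\<ominus>\<^bsub>?L\<^esub> f \<in> ?R" using Zp_a_inv a_inv by auto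
  qed
  have int: "?R \<subseteq> carrier (integer_ring p ?L)"
  proof
    fix f :: "nat \<Rightarrow> padic" assume "f \<in> ?R"
    then obtain x where x: "x \<in> carrier (Zp p)" "f = (\<lambda>_. x)" by auto
    have "L.eval [\<one>\<^bsub>?L\<^esub>, \<ominus>\<^bsub>?L\<^esub> f] f = \<zero>\<^bsub>?L\<^esub>"
      using x by (simp add: a_inv Q.r_neg)
    moreover have "set [\<one>\<^bsub>?L\<^esub>, \<ominus>\<^bsub>?L\<^esub> f] \<subseteq> scalars ?L (carrier (Zp p))"
      using x Zp_one Zp_a_inv by (auto simp: scalars_unit_ext[OF ZQ] a_inv)
    ultimately show "f \<in> carrier (integer_ring p ?L)"
      using x unfolding integer_ring_def by (auto intro!: exI[of _ "[\<one>\<^bsub>?L\<^esub>, \<ominus>\<^bsub>?L\<^esub> f]"] simp del: L.eval.simps)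
  qed
  have Z: "scalars ?L (carrier (Zp p)) \<subseteq> ?R" by (simp add: scalars_unit_ext[OF ZQ])
  have p_inv: "emb (1 / of_nat p) \<odot>\<^bsub>?L\<^esub> \<one>\<^bsub>?L\<^esub> \<notin> ?R"
    using emb_p_inv_notin_Zp by (auto dest: fun_cong)
  have unit: "\<exists>s::int. \<exists>u\<in>?R. \<exists>v\<in>?R. u \<otimes>\<^bsub>?L\<^esub> v = \<one>\<^bsub>?L\<^esub> \<and> f = emb (of_nat p powi s) \<odot>\<^bsub>?L\<^esub> u"
    if f: "f \<in> carrier ?L" "f \<noteq> \<zero>\<^bsub>?L\<^esub>" for f
  proof -
    obtain x where "x \<in> carrier (Qp p)" "f = (\<lambda>_. x)" using f(1) by auto
    then have x: "x \<in> carrier (Qp p)" "x \<noteq> \<zero>\<^bsub>Qp p\<^esub>" "f = (\<lambda>_. x)" using f(2) by auto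
    obtain s where s: "qnorm (emb (of_nat p powi (- s)) \<otimes>\<^bsub>Qp p\<^esub> x) = 1" using Qp_normalize[OF x(1,2)] .
    let ?u = "emb (of_nat p powi (- s)) \<otimes>\<^bsub>Qp p\<^esub> x"
    have "?u \<in> carrier (Qp p)" using x by simp
    note u = Zp_inverse[OF this s]
    show ?thesis
      using u emb_powi_cancel[OF x(1), of s] x(3)
      by (intro exI[of _ s] bexI[of _ "\<lambda>_. ?u"] bexI[of _ "\<lambda>_. inv\<^bsub>Qp p\<^esub> ?u"]) auto
  qed
  have crit: "carrier (integer_ring p ?L) = ?R" "maximalideal (prime_ideal_over p ?L) (integer_ring p ?L)"
    "prime_ideal_over p ?L = (\<lambda>y. emb (of_nat p) \<odot>\<^bsub>?L\<^esub> y) ` ?R"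
    by (rule unramified_criterion[OF algebra_unit_ext field_unit_ext sub int Z p_inv unit]; assumption)+
  have "ring.dimension ?L 1 (scalars ?L (carrier (Qp p))) (carrier ?L)"
    using L.dimension_one[OF L.carrier_is_subfield] by (simp add: scalars_unit_ext)
  then have ram: "unramified_extension p 1 ?L"
    unfolding unramified_extension_def
    using algebra_unit_ext field_unit_ext crit(2) by blast
  have pow: "(\<lambda>_. x) [^]\<^bsub>?L\<^esub> (k::nat) = (\<lambda>_. x [^]\<^bsub>Qp p\<^esub> k)" for x k
    by (induction k) (auto simp: nat_pow_def)
  have "id f \<ominus>\<^bsub>?L\<^esub> f [^]\<^bsub>?L\<^esub> p \<in> prime_ideal_over p ?L" if "f \<in> carrier (integer_ring p ?L)" for f
  proof -
    have "f \<in> ?R" using that by (simp only: crit(1))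
    then obtain x where x: "x \<in> carrier (Zp p)" "f = (\<lambda>_. x)" by blast
    obtain y where y: "y \<in> carrier (Zp p)" "x \<ominus>\<^bsub>Qp p\<^esub> x [^]\<^bsub>Qp p\<^esub> p = emb (of_nat p) \<otimes>\<^bsub>Qp p\<^esub> y"
      using Zp_fermat[OF x(1)] qnorm_less_1_dvd[of "x \<ominus>\<^bsub>Qp p\<^esub> x [^]\<^bsub>Qp p\<^esub> p"] x(1) by auto
    have "id f \<ominus>\<^bsub>?L\<^esub> f [^]\<^bsub>?L\<^esub> p = emb (of_nat p) \<odot>\<^bsub>?L\<^esub> (\<lambda>_. y)"
      using x y by (simp add: pow a_minus_def a_inv)
    then show ?thesis unfolding crit(3) using y(1) by blast
  qed
  moreover have "id \<in> algebra_iso (Qp p) ?L ?L" by (rule algebra_isoI) (auto simp: bij_betw_def)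
  ultimately have "is_frobenius p ?L id" unfolding is_frobenius_def by blast
  then show ?thesis using ram by unfold_locales auto
qed

end

subsection \<open>Degree two over the dyadic numbers\<close>

context rational_prime
begin

definition pair :: "padic \<Rightarrow> padic \<Rightarrow> nat \<Rightarrow> padic" where
  "pair x y = (\<lambda>i. if i = 0 then x else y)"

lemma pair_simps [simp]: "pair x y 0 = x" "pair x y (Suc 0) = y"
  by (simp_all add: pair_def)

lemma pair_eq_iff [simp]: "pair x y = pair x' y' \<longleftrightarrow> x = x' \<and> y = y'"
  by (metis pair_simps)

text \<open>The pair of \<open>x\<close> and \<open>y\<close> stands for \<open>x + y \<theta>\<close> where \<open>\<theta>\<^sup>2 = \<theta> - c\<close>. For odd \<open>c\<close> and \<open>p = 2\<close>
  the polynomial is irreducible modulo 2, so \<open>\<theta>\<close> generates the unramified quadratic extension.\<close>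

definition quad_ext :: "int \<Rightarrow> (padic, nat \<Rightarrow> padic) module" where
  "quad_ext c =
     \<lparr>carrier = (\<lambda>(x, y). pair x y) ` (carrier (Qp p) \<times> carrier (Qp p)),
      monoid.mult = (\<lambda>f g. pair (f 0 \<otimes>\<^bsub>Qp p\<^esub> g 0 \<ominus>\<^bsub>Qp p\<^esub> emb (of_int c) \<otimes>\<^bsub>Qp p\<^esub> (f 1 \<otimes>\<^bsub>Qp p\<^esub> g 1))
        (f 0 \<otimes>\<^bsub>Qp p\<^esub> g 1 \<oplus>\<^bsub>Qp p\<^esub> f 1 \<otimes>\<^bsub>Qp p\<^esub> g 0 \<oplus>\<^bsub>Qp p\<^esub> f 1 \<otimes>\<^bsub>Qp p\<^esub> g 1)),
      monoid.one = pair \<one>\<^bsub>Qp p\<^esub> \<zero>\<^bsub>Qp p\<^esub>, ring.zero = pair \<zero>\<^bsub>Qp p\<^esub> \<zero>\<^bsub>Qp p\<^esub>,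
      ring.add = (\<lambda>f g. pair (f 0 \<oplus>\<^bsub>Qp p\<^esub> g 0) (f 1 \<oplus>\<^bsub>Qp p\<^esub> g 1)),
      module.smult = (\<lambda>a f. pair (a \<otimes>\<^bsub>Qp p\<^esub> f 0) (a \<otimes>\<^bsub>Qp p\<^esub> f 1))\<rparr>"

lemma quad_ext_simps:
  "carrier (quad_ext c) = (\<lambda>(x, y). pair x y) ` (carrier (Qp p) \<times> carrier (Qp p))"
  "pair x y \<otimes>\<^bsub>quad_ext c\<^esub> pair x' y' =
     pair (x \<otimes>\<^bsub>Qp p\<^esub> x' \<ominus>\<^bsub>Qp p\<^esub> emb (of_int c) \<otimes>\<^bsub>Qp p\<^esub> (y \<otimes>\<^bsub>Qp p\<^esub> y'))
       (x \<otimes>\<^bsub>Qp p\<^esub> y' \<oplus>\<^bsub>Qp p\<^esub> y \<otimes>\<^bsub>Qp p\<^esub> x' \<oplus>\<^bsub>Qp p\<^esub> y \<otimes>\<^bsub>Qp p\<^esub> y')"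
  "\<one>\<^bsub>quad_ext c\<^esub> = pair \<one>\<^bsub>Qp p\<^esub> \<zero>\<^bsub>Qp p\<^esub>" "\<zero>\<^bsub>quad_ext c\<^esub> = pair \<zero>\<^bsub>Qp p\<^esub> \<zero>\<^bsub>Qp p\<^esub>"
  "pair x y \<oplus>\<^bsub>quad_ext c\<^esub> pair x' y' = pair (x \<oplus>\<^bsub>Qp p\<^esub> x') (y \<oplus>\<^bsub>Qp p\<^esub> y')"
  "a \<odot>\<^bsub>quad_ext c\<^esub> pair x y = pair (a \<otimes>\<^bsub>Qp p\<^esub> x) (a \<otimes>\<^bsub>Qp p\<^esub> y)"
  by (simp_all add: quad_ext_def)

lemma pair_closed [simp]:
  "x \<in> carrier (Qp p) \<Longrightarrow> y \<in> carrier (Qp p) \<Longrightarrow> pair x y \<in> carrier (quad_ext c)"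
  by (auto simp: quad_ext_simps)

lemma quad_ext_cases:
  assumes "f \<in> carrier (quad_ext c)"
  obtains x y where "x \<in> carrier (Qp p)" "y \<in> carrier (Qp p)" "f = pair x y"
  using assms by (auto simp: quad_ext_simps)

lemma quad_ext_reps:
  assumes "f \<in> carrier (quad_ext c)"
  obtains s t where "is_cauchy s" "is_cauchy t" "f = pair (cls s) (cls t)"
  using assms by (auto simp: quad_ext_simps elim!: Qp_cases)

lemmas quad_rep_simps = quad_ext_simps(2-) cls_simps emb_def

lemma cring_quad_ext: "cring (quad_ext c)"
proof (rule cringI)
  show "abelian_group (quad_ext c)"
  proof (rule abelian_groupI)
    fix f assume f: "f \<in> carrier (quad_ext c)"
    then obtain x y where xy: "x \<in> carrier (Qp p)" "y \<in> carrier (Qp p)" "f = pair x y" by (rule quad_ext_cases)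
    then show "\<exists>g\<in>carrier (quad_ext c). g \<oplus>\<^bsub>quad_ext c\<^esub> f = \<zero>\<^bsub>quad_ext c\<^esub>"
      by (intro bexI[of _ "pair (\<ominus>\<^bsub>Qp p\<^esub> x) (\<ominus>\<^bsub>Qp p\<^esub> y)"]) (auto simp: quad_ext_simps(2-) Q.l_neg)
    show "\<zero>\<^bsub>quad_ext c\<^esub> \<oplus>\<^bsub>quad_ext c\<^esub> f = f" using xy by (simp add: quad_ext_simps(2-))
    fix g assume g: "g \<in> carrier (quad_ext c)"
    show "f \<oplus>\<^bsub>quad_ext c\<^esub> g \<in> carrier (quad_ext c)" "f \<oplus>\<^bsub>quad_ext c\<^esub> g = g \<oplus>\<^bsub>quad_ext c\<^esub> f"
      using f g by (auto elim!: quad_ext_cases simp: quad_ext_simps(2-) Q.a_comm)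
    fix h assume h: "h \<in> carrier (quad_ext c)"
    show "f \<oplus>\<^bsub>quad_ext c\<^esub> g \<oplus>\<^bsub>quad_ext c\<^esub> h = f \<oplus>\<^bsub>quad_ext c\<^esub> (g \<oplus>\<^bsub>quad_ext c\<^esub> h)"
      using f g h by (auto elim!: quad_ext_cases simp: quad_ext_simps(2-) Q.a_assoc)
  qed (simp add: quad_ext_simps(4))
  show "Group.comm_monoid (quad_ext c)"
  proof (rule comm_monoidI)
    fix f g assume f: "f \<in> carrier (quad_ext c)" and g: "g \<in> carrier (quad_ext c)"
    show "f \<otimes>\<^bsub>quad_ext c\<^esub> g \<in> carrier (quad_ext c)"
      using f g by (auto elim!: quad_ext_cases simp: quad_ext_simps(2-))
    show "f \<otimes>\<^bsub>quad_ext c\<^esub> g = g \<otimes>\<^bsub>quad_ext c\<^esub> f"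
      using f g by (auto elim!: quad_ext_reps simp: quad_rep_simps algebra_simps)
    show "\<one>\<^bsub>quad_ext c\<^esub> \<otimes>\<^bsub>quad_ext c\<^esub> f = f"
      using f by (auto elim!: quad_ext_reps simp: quad_rep_simps)
    fix h assume h: "h \<in> carrier (quad_ext c)"
    show "f \<otimes>\<^bsub>quad_ext c\<^esub> g \<otimes>\<^bsub>quad_ext c\<^esub> h = f \<otimes>\<^bsub>quad_ext c\<^esub> (g \<otimes>\<^bsub>quad_ext c\<^esub> h)"
      using f g h by (auto elim!: quad_ext_reps simp: quad_rep_simps algebra_simps)
  qed (simp add: quad_ext_simps(3))
  fix f g h assume "f \<in> carrier (quad_ext c)" "g \<in> carrier (quad_ext c)" "h \<in> carrier (quad_ext c)"
  then show "(f \<oplus>\<^bsub>quad_ext c\<^esub> g) \<otimes>\<^bsub>quad_ext c\<^esub> h = f \<otimes>\<^bsub>quad_ext c\<^esub> h \<oplus>\<^bsub>quad_ext c\<^esub> g \<otimes>\<^bsub>quad_ext c\<^esub> h"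
    by (auto elim!: quad_ext_reps simp: quad_rep_simps algebra_simps)
qed

lemma algebra_quad_ext: "algebra (Qp p) (quad_ext c)"
proof (rule algebraI[OF cring_Qp cring_quad_ext])
  fix a f assume a: "a \<in> carrier (Qp p)" and f: "f \<in> carrier (quad_ext c)"
  show "a \<odot>\<^bsub>quad_ext c\<^esub> f \<in> carrier (quad_ext c)"
    using a f by (auto elim!: quad_ext_cases simp: quad_ext_simps(2-))
  fix b assume b: "b \<in> carrier (Qp p)"
  show "(a \<oplus>\<^bsub>Qp p\<^esub> b) \<odot>\<^bsub>quad_ext c\<^esub> f = a \<odot>\<^bsub>quad_ext c\<^esub> f \<oplus>\<^bsub>quad_ext c\<^esub> b \<odot>\<^bsub>quad_ext c\<^esub> f"
    "(a \<otimes>\<^bsub>Qp p\<^esub> b) \<odot>\<^bsub>quad_ext c\<^esub> f = a \<odot>\<^bsub>quad_ext c\<^esub> (b \<odot>\<^bsub>quad_ext c\<^esub> f)"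
    using a b f by (auto elim!: quad_ext_cases simp: quad_ext_simps(2-) Q.l_distr Q.m_assoc)
next
  fix f assume "f \<in> carrier (quad_ext c)"
  then show "\<one>\<^bsub>Qp p\<^esub> \<odot>\<^bsub>quad_ext c\<^esub> f = f"
    by (auto elim!: quad_ext_cases simp: quad_ext_simps(2-))
next
  fix a f g assume a: "a \<in> carrier (Qp p)" and fg: "f \<in> carrier (quad_ext c)" "g \<in> carrier (quad_ext c)"
  show "a \<odot>\<^bsub>quad_ext c\<^esub> (f \<oplus>\<^bsub>quad_ext c\<^esub> g) = a \<odot>\<^bsub>quad_ext c\<^esub> f \<oplus>\<^bsub>quad_ext c\<^esub> a \<odot>\<^bsub>quad_ext c\<^esub> g"
    using a fg by (auto elim!: quad_ext_cases simp: quad_ext_simps(2-) Q.r_distr)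
  show "a \<odot>\<^bsub>quad_ext c\<^esub> f \<otimes>\<^bsub>quad_ext c\<^esub> g = a \<odot>\<^bsub>quad_ext c\<^esub> (f \<otimes>\<^bsub>quad_ext c\<^esub> g)"
    using a fg by (auto elim!: quad_ext_reps Qp_cases simp: quad_rep_simps algebra_simps)
qed

definition quad_norm :: "int \<Rightarrow> padic \<Rightarrow> padic \<Rightarrow> padic" where
  "quad_norm c x y = x \<otimes>\<^bsub>Qp p\<^esub> x \<oplus>\<^bsub>Qp p\<^esub> x \<otimes>\<^bsub>Qp p\<^esub> y \<oplus>\<^bsub>Qp p\<^esub> emb (of_int c) \<otimes>\<^bsub>Qp p\<^esub> (y \<otimes>\<^bsub>Qp p\<^esub> y)"

lemma quad_norm_closed [simp]:
  "x \<in> carrier (Qp p) \<Longrightarrow> y \<in> carrier (Qp p) \<Longrightarrow> quad_norm c x y \<in> carrier (Qp p)"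
  by (simp add: quad_norm_def)

definition quad_conj :: "(nat \<Rightarrow> padic) \<Rightarrow> nat \<Rightarrow> padic" where
  "quad_conj f = pair (f 0 \<oplus>\<^bsub>Qp p\<^esub> f 1) (\<ominus>\<^bsub>Qp p\<^esub> f 1)"

lemma quad_conj_pair [simp]: "quad_conj (pair x y) = pair (x \<oplus>\<^bsub>Qp p\<^esub> y) (\<ominus>\<^bsub>Qp p\<^esub> y)"
  by (simp add: quad_conj_def)

lemma quad_conj_iso: "quad_conj \<in> algebra_iso (Qp p) (quad_ext c) (quad_ext c)"
proof (rule algebra_isoI)
  have cl: "quad_conj f \<in> carrier (quad_ext c)" "quad_conj (quad_conj f) = f" if "f \<in> carrier (quad_ext c)" for f
    using that by (auto elim!: quad_ext_reps simp: quad_rep_simps)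
  then show "bij_betw quad_conj (carrier (quad_ext c)) (carrier (quad_ext c))"
    by (intro bij_betw_byWitness[where f'=quad_conj]) auto
  fix f g assume "f \<in> carrier (quad_ext c)" "g \<in> carrier (quad_ext c)"
  then show "quad_conj (f \<otimes>\<^bsub>quad_ext c\<^esub> g) = quad_conj f \<otimes>\<^bsub>quad_ext c\<^esub> quad_conj g"
    "quad_conj (f \<oplus>\<^bsub>quad_ext c\<^esub> g) = quad_conj f \<oplus>\<^bsub>quad_ext c\<^esub> quad_conj g"
    by (auto elim!: quad_ext_reps simp: quad_rep_simps algebra_simps)
next
  show "quad_conj \<one>\<^bsub>quad_ext c\<^esub> = \<one>\<^bsub>quad_ext c\<^esub>" by (simp add: quad_rep_simps)
  fix a f assume "a \<in> carrier (Qp p)" "f \<in> carrier (quad_ext c)"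
  then show "quad_conj (a \<odot>\<^bsub>quad_ext c\<^esub> f) = a \<odot>\<^bsub>quad_ext c\<^esub> quad_conj f"
    by (auto elim!: quad_ext_reps Qp_cases simp: quad_rep_simps algebra_simps)
qed

lemma quad_mult_conj:
  assumes "x \<in> carrier (Qp p)" "y \<in> carrier (Qp p)"
  shows "pair x y \<otimes>\<^bsub>quad_ext c\<^esub> quad_conj (pair x y) = pair (quad_norm c x y) \<zero>\<^bsub>Qp p\<^esub>"
  using assms by (auto elim!: Qp_cases simp: quad_norm_def quad_rep_simps algebra_simps)

lemma qnorm_add_eq:
  assumes "x \<in> carrier (Qp p)" "y \<in> carrier (Qp p)" "qnorm y < qnorm x"
  shows "qnorm (x \<oplus>\<^bsub>Qp p\<^esub> y) = qnorm x"
proof -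
  have "(x \<oplus>\<^bsub>Qp p\<^esub> y) \<oplus>\<^bsub>Qp p\<^esub> (\<ominus>\<^bsub>Qp p\<^esub> y) = x" using assms by (simp add: Q.a_assoc Q.r_neg)
  then have "qnorm x \<le> max (qnorm (x \<oplus>\<^bsub>Qp p\<^esub> y)) (qnorm y)"
    using assms qnorm_add_max[of "x \<oplus>\<^bsub>Qp p\<^esub> y" "\<ominus>\<^bsub>Qp p\<^esub> y"] by simp
  then show ?thesis using assms(3) qnorm_add_max[OF assms(1,2)] by auto
qed

text \<open>Modulo 2 every unit is 1, so for odd \<open>c\<close> the norm form \<open>x\<^sup>2 + x y + c y\<^sup>2\<close> is anisotropic modulo 2.\<close>

lemma dyadic_unit:
  assumes p2: "p = 2" and x: "x \<in> carrier (Qp p)" "qnorm x = 1"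
  shows "qnorm (x \<ominus>\<^bsub>Qp p\<^esub> \<one>\<^bsub>Qp p\<^esub>) < 1"
proof -
  have "x \<in> carrier (Zp p)" using x by (intro ZpI) auto
  then obtain a :: int where a: "qnorm (x \<ominus>\<^bsub>Qp p\<^esub> emb (of_int a)) < 1" using Zp_residue by blast
  have "\<not> int p dvd a"
  proof
    assume "int p dvd a"
    then have "qnorm (emb (of_int a)) < 1" using vabs_of_int_lt_1_iff by simp
    then have "qnorm ((x \<ominus>\<^bsub>Qp p\<^esub> emb (of_int a)) \<oplus>\<^bsub>Qp p\<^esub> emb (of_int a)) < 1"
      using a x by (intro qnorm_less_1_add) auto
    moreover have "(x \<ominus>\<^bsub>Qp p\<^esub> emb (of_int a)) \<oplus>\<^bsub>Qp p\<^esub> emb (of_int a) = x"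
      using x by (simp add: a_minus_def Q.a_assoc Q.l_neg)
    ultimately show False using x by simp
  qed
  then have "int p dvd a - 1" using p2 by presburger
  then have "vabs (of_int (a - 1)) < 1" by (simp only: vabs_of_int_lt_1_iff)
  then have "qnorm (emb (of_int (a - 1))) < 1" by simp
  then have "qnorm ((x \<ominus>\<^bsub>Qp p\<^esub> emb (of_int a)) \<oplus>\<^bsub>Qp p\<^esub> emb (of_int (a - 1))) < 1"
    using a x by (intro qnorm_less_1_add) auto
  moreover have "(x \<ominus>\<^bsub>Qp p\<^esub> emb (of_int a)) \<oplus>\<^bsub>Qp p\<^esub> emb (of_int (a - 1)) = x \<ominus>\<^bsub>Qp p\<^esub> \<one>\<^bsub>Qp p\<^esub>"
    using x(1) by (auto elim!: Qp_cases simp: emb_def cls_simps)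
  ultimately show ?thesis by simp
qed

lemma quad_norm_unit:
  assumes p2: "p = 2" and c: "odd c" and xy: "x \<in> carrier (Zp p)" "y \<in> carrier (Zp p)" "qnorm x = 1 \<or> qnorm y = 1"
  shows "qnorm (quad_norm c x y) = 1"
proof -
  have Q: "x \<in> carrier (Qp p)" "y \<in> carrier (Qp p)" using xy by auto
  have le: "qnorm x \<le> 1" "qnorm y \<le> 1" "qnorm x \<ge> 0" "qnorm y \<ge> 0" using xy Zp_norm qnorm_nonneg[OF Q(1)] qnorm_nonneg[OF Q(2)] by auto
  have c1: "vabs (of_int c) = 1" using c p2 by (intro vabs_of_int_coprime) auto
  let ?E = "emb (of_int c) \<otimes>\<^bsub>Qp p\<^esub> (y \<otimes>\<^bsub>Qp p\<^esub> y)"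
  have E: "qnorm ?E = qnorm y * qnorm y" using Q c1 by (simp add: qnorm_mult)
  have lt: "a * b < 1" if "a < 1" "0 \<le> a" "0 \<le> b" "b \<le> 1" for a b :: real
    using that mult_mono[of a a b 1] by auto
  show ?thesis
  proof (cases "qnorm y < 1")
    case True
    then have x1: "qnorm x = 1" using xy(3) by auto
    have "qnorm (x \<otimes>\<^bsub>Qp p\<^esub> y \<oplus>\<^bsub>Qp p\<^esub> ?E) < 1"
      using Q True le x1 lt[of "qnorm y" "qnorm y"] E by (intro qnorm_less_1_add) (auto simp: qnorm_mult[OF Q])
    then have "qnorm (x \<otimes>\<^bsub>Qp p\<^esub> x \<oplus>\<^bsub>Qp p\<^esub> (x \<otimes>\<^bsub>Qp p\<^esub> y \<oplus>\<^bsub>Qp p\<^esub> ?E)) = 1"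
      using qnorm_add_eq[of "x \<otimes>\<^bsub>Qp p\<^esub> x" "x \<otimes>\<^bsub>Qp p\<^esub> y \<oplus>\<^bsub>Qp p\<^esub> ?E"] Q x1 by (simp add: qnorm_mult)
    then show ?thesis using Q by (simp add: quad_norm_def Q.a_assoc)
  next
    case False
    then have y1: "qnorm y = 1" using le by auto
    have "qnorm (x \<otimes>\<^bsub>Qp p\<^esub> (x \<oplus>\<^bsub>Qp p\<^esub> y)) < 1"
    proof (cases "qnorm x < 1")
      case True
      have "qnorm (x \<oplus>\<^bsub>Qp p\<^esub> y) \<le> 1" using Zp_norm[OF Zp_add[OF xy(1,2)]] .
      then show ?thesis using Q True le lt[of "qnorm x" "qnorm (x \<oplus>\<^bsub>Qp p\<^esub> y)"] qnorm_nonneg[of "x \<oplus>\<^bsub>Qp p\<^esub> y"]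
        by (simp add: qnorm_mult)
    next
      case False
      then have x1: "qnorm x = 1" using le by auto
      have "vabs (of_int 2) < 1" using vabs_of_int_lt_1_iff[of 2] p2 by simp
      then have "qnorm (emb 2) < 1" by simp
      then have "qnorm (((x \<ominus>\<^bsub>Qp p\<^esub> \<one>\<^bsub>Qp p\<^esub>) \<oplus>\<^bsub>Qp p\<^esub> (y \<ominus>\<^bsub>Qp p\<^esub> \<one>\<^bsub>Qp p\<^esub>)) \<oplus>\<^bsub>Qp p\<^esub> emb 2) < 1"
        using dyadic_unit[OF p2 Q(1) x1] dyadic_unit[OF p2 Q(2) y1] Q
        by (intro qnorm_less_1_add[OF Q.a_closed] qnorm_less_1_add) auto
      moreover have "((x \<ominus>\<^bsub>Qp p\<^esub> \<one>\<^bsub>Qp p\<^esub>) \<oplus>\<^bsub>Qp p\<^esub> (y \<ominus>\<^bsub>Qp p\<^esub> \<one>\<^bsub>Qp p\<^esub>)) \<oplus>\<^bsub>Qp p\<^esub> emb 2 = x \<oplus>\<^bsub>Qp p\<^esub> y"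
        using Q by (auto elim!: Qp_cases simp: emb_def cls_simps)
      ultimately show ?thesis using Q x1 by (simp add: qnorm_mult)
    qed
    then have "qnorm (?E \<oplus>\<^bsub>Qp p\<^esub> x \<otimes>\<^bsub>Qp p\<^esub> (x \<oplus>\<^bsub>Qp p\<^esub> y)) = 1"
      using qnorm_add_eq[of ?E "x \<otimes>\<^bsub>Qp p\<^esub> (x \<oplus>\<^bsub>Qp p\<^esub> y)"] Q y1 E by simp
    moreover have "?E \<oplus>\<^bsub>Qp p\<^esub> x \<otimes>\<^bsub>Qp p\<^esub> (x \<oplus>\<^bsub>Qp p\<^esub> y) = quad_norm c x y"
      using Q by (auto elim!: Qp_cases simp: emb_def cls_simps quad_norm_def algebra_simps)
    ultimately show ?thesis by simp
  qed
qed

abbreviation quad_int :: "(nat \<Rightarrow> padic) set" where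
  "quad_int \<equiv> (\<lambda>(x, y). pair x y) ` (carrier (Zp p) \<times> carrier (Zp p))"

lemma pair_in_quad_int [simp]:
  "pair x y \<in> quad_int \<longleftrightarrow> x \<in> carrier (Zp p) \<and> y \<in> carrier (Zp p)"
  by auto

lemma quad_unit:
  assumes p2: "p = 2" and c: "odd c" and f: "f \<in> carrier (quad_ext c)" "f \<noteq> \<zero>\<^bsub>quad_ext c\<^esub>"
  shows "\<exists>s::int. \<exists>u\<in>quad_int. \<exists>v\<in>quad_int. u \<otimes>\<^bsub>quad_ext c\<^esub> v = \<one>\<^bsub>quad_ext c\<^esub> \<and>
    f = emb (of_nat p powi s) \<odot>\<^bsub>quad_ext c\<^esub> u"
proof -
  obtain x y where xy: "x \<in> carrier (Qp p)" "y \<in> carrier (Qp p)" "f = pair x y" using f(1) by (rule quad_ext_cases)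
  have "\<exists>s. qnorm (emb (of_nat p powi (- s)) \<otimes>\<^bsub>Qp p\<^esub> x) \<le> 1 \<and> qnorm (emb (of_nat p powi (- s)) \<otimes>\<^bsub>Qp p\<^esub> y) \<le> 1 \<and>
    (qnorm (emb (of_nat p powi (- s)) \<otimes>\<^bsub>Qp p\<^esub> x) = 1 \<or> qnorm (emb (of_nat p powi (- s)) \<otimes>\<^bsub>Qp p\<^esub> y) = 1)"
  proof -
    have *: "\<exists>s. qnorm (emb (of_nat p powi (- s)) \<otimes>\<^bsub>Qp p\<^esub> z) = 1 \<and> qnorm (emb (of_nat p powi (- s)) \<otimes>\<^bsub>Qp p\<^esub> w) \<le> 1"
      if zw: "z \<in> carrier (Qp p)" "w \<in> carrier (Qp p)" "z \<noteq> \<zero>\<^bsub>Qp p\<^esub>" "qnorm w \<le> qnorm z" for z w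
    proof -
      obtain s where s: "qnorm (emb (of_nat p powi (- s)) \<otimes>\<^bsub>Qp p\<^esub> z) = 1" using Qp_normalize[OF zw(1,3)] .
      have "qnorm (emb (of_nat p powi (- s)) \<otimes>\<^bsub>Qp p\<^esub> w) \<le> qnorm (emb (of_nat p powi (- s)) \<otimes>\<^bsub>Qp p\<^esub> z)"
        using zw by (simp add: qnorm_mult mult_left_mono)
      then show ?thesis using s by auto
    qed
    have "x \<noteq> \<zero>\<^bsub>Qp p\<^esub> \<or> y \<noteq> \<zero>\<^bsub>Qp p\<^esub>" using f(2) xy(3) by (auto simp: quad_ext_simps(4))
    then have "(qnorm y \<le> qnorm x \<and> x \<noteq> \<zero>\<^bsub>Qp p\<^esub>) \<or> (qnorm x \<le> qnorm y \<and> y \<noteq> \<zero>\<^bsub>Qp p\<^esub>)"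
      using qnorm_eq_0_iff[OF xy(1)] qnorm_eq_0_iff[OF xy(2)] qnorm_nonneg[OF xy(1)] qnorm_nonneg[OF xy(2)]
      by (metis linorder_linear order_antisym)
    then show ?thesis
    proof
      assume "qnorm y \<le> qnorm x \<and> x \<noteq> \<zero>\<^bsub>Qp p\<^esub>"
      then show ?thesis using *[OF xy(1,2)] by (metis order_refl)
    next
      assume "qnorm x \<le> qnorm y \<and> y \<noteq> \<zero>\<^bsub>Qp p\<^esub>"
      then show ?thesis using *[OF xy(2,1)] by (metis order_refl)
    qed
  qed
  then obtain s where s: "qnorm (emb (of_nat p powi (- s)) \<otimes>\<^bsub>Qp p\<^esub> x) \<le> 1" "qnorm (emb (of_nat p powi (- s)) \<otimes>\<^bsub>Qp p\<^esub> y) \<le> 1"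
    "qnorm (emb (of_nat p powi (- s)) \<otimes>\<^bsub>Qp p\<^esub> x) = 1 \<or> qnorm (emb (of_nat p powi (- s)) \<otimes>\<^bsub>Qp p\<^esub> y) = 1" by blast
  define x' where "x' = emb (of_nat p powi (- s)) \<otimes>\<^bsub>Qp p\<^esub> x"
  define y' where "y' = emb (of_nat p powi (- s)) \<otimes>\<^bsub>Qp p\<^esub> y"
  have Z: "x' \<in> carrier (Zp p)" "y' \<in> carrier (Zp p)"
    using s(1,2) xy by (auto simp: x'_def y'_def intro!: ZpI)
  have Q: "x' \<in> carrier (Qp p)" "y' \<in> carrier (Qp p)" using Z by auto
  define N where "N = quad_norm c x' y'"
  have "qnorm N = 1" unfolding N_def using quad_norm_unit[OF p2 c Z] s(3) by (simp add: x'_def y'_def)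
  moreover have NQ: "N \<in> carrier (Qp p)" using Q by (simp add: N_def)
  ultimately have N: "inv\<^bsub>Qp p\<^esub> N \<in> carrier (Zp p)" "N \<otimes>\<^bsub>Qp p\<^esub> inv\<^bsub>Qp p\<^esub> N = \<one>\<^bsub>Qp p\<^esub>" using Zp_inverse by auto
  interpret L: algebra "Qp p" "quad_ext c" by (rule algebra_quad_ext)
  interpret L: cring "quad_ext c" by (rule cring_quad_ext)
  define v where "v = inv\<^bsub>Qp p\<^esub> N \<odot>\<^bsub>quad_ext c\<^esub> quad_conj (pair x' y')"
  have "pair x' y' \<otimes>\<^bsub>quad_ext c\<^esub> v = inv\<^bsub>Qp p\<^esub> N \<odot>\<^bsub>quad_ext c\<^esub> (pair x' y' \<otimes>\<^bsub>quad_ext c\<^esub> quad_conj (pair x' y'))"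
    unfolding v_def using L.smult_assoc2[of "inv\<^bsub>Qp p\<^esub> N" "quad_conj (pair x' y')" "pair x' y'"] N(1) Q
    by (simp add: L.m_comm)
  also have "\<dots> = \<one>\<^bsub>quad_ext c\<^esub>"
    unfolding quad_mult_conj[OF Q] N_def[symmetric] using N NQ by (simp add: quad_ext_simps(3,6) Q.m_comm)
  finally have "pair x' y' \<otimes>\<^bsub>quad_ext c\<^esub> v = \<one>\<^bsub>quad_ext c\<^esub>" .
  moreover have "v \<in> quad_int"
    using N(1) Z by (auto simp: v_def quad_ext_simps(6) Zp_mult Zp_add Zp_a_inv)
  moreover have "f = emb (of_nat p powi s) \<odot>\<^bsub>quad_ext c\<^esub> pair x' y'"
    using xy by (simp add: quad_ext_simps(6) x'_def y'_def emb_powi_cancel)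
  ultimately show ?thesis using Z by blast
qed

lemma field_quad_ext:
  assumes "p = 2" "odd c" shows "field (quad_ext c)"
proof (rule cring.cring_fieldI2[OF cring_quad_ext])
  show "\<zero>\<^bsub>quad_ext c\<^esub> \<noteq> \<one>\<^bsub>quad_ext c\<^esub>" by (simp add: quad_ext_simps(3,4))
  fix f assume f: "f \<in> carrier (quad_ext c)" "f \<noteq> \<zero>\<^bsub>quad_ext c\<^esub>"
  interpret L: algebra "Qp p" "quad_ext c" by (rule algebra_quad_ext)
  obtain s u v where suv: "u \<in> quad_int" "v \<in> quad_int" "u \<otimes>\<^bsub>quad_ext c\<^esub> v = \<one>\<^bsub>quad_ext c\<^esub>"
    "f = emb (of_nat p powi s) \<odot>\<^bsub>quad_ext c\<^esub> u" using quad_unit[OF assms f] by blast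
  have uv: "u \<in> carrier (quad_ext c)" "v \<in> carrier (quad_ext c)" using suv(1,2) by auto
  have "v \<otimes>\<^bsub>quad_ext c\<^esub> f = emb (of_nat p powi s) \<odot>\<^bsub>quad_ext c\<^esub> (u \<otimes>\<^bsub>quad_ext c\<^esub> v)"
    unfolding suv(4) using uv L.m_comm[of v "emb (of_nat p powi s) \<odot>\<^bsub>quad_ext c\<^esub> u"] by (simp add: L.smult_assoc2)
  then have "(emb (of_nat p powi (- s)) \<odot>\<^bsub>quad_ext c\<^esub> v) \<otimes>\<^bsub>quad_ext c\<^esub> f = \<one>\<^bsub>quad_ext c\<^esub>"
    using uv f(1) suv(3) emb_powi_cancel[of "\<one>\<^bsub>Qp p\<^esub>" "- s"]
    by (simp add: L.smult_assoc2 flip: L.smult_assoc1)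
  then have "f \<otimes>\<^bsub>quad_ext c\<^esub> (emb (of_nat p powi (- s)) \<odot>\<^bsub>quad_ext c\<^esub> v) = \<one>\<^bsub>quad_ext c\<^esub>"
    using L.m_comm f(1) uv by simp
  then show "\<exists>g\<in>carrier (quad_ext c). f \<otimes>\<^bsub>quad_ext c\<^esub> g = \<one>\<^bsub>quad_ext c\<^esub>"
    using uv by (intro bexI[of _ "emb (of_nat p powi (- s)) \<odot>\<^bsub>quad_ext c\<^esub> v"]) auto
qed

lemma scalars_quad_ext: "S \<subseteq> carrier (Qp p) \<Longrightarrow> scalars (quad_ext c) S = (\<lambda>x. pair x \<zero>\<^bsub>Qp p\<^esub>) ` S"
  unfolding scalars_def by (rule image_cong) (auto simp: quad_ext_simps(3,6))

theorem unramified_quad_ext: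
  assumes p2: "p = 2" and c: "odd c"
  shows "unramified p 2 (quad_ext c) quad_conj"
proof -
  let ?L = "quad_ext c"
  interpret L: field ?L by (rule field_quad_ext[OF assms])
  interpret LA: assoc_algebra "Qp p" ?L
    by (rule algebra_imp_assoc_algebra[OF field_Qp algebra_quad_ext]) simp
  have ZQ: "carrier (Zp p) \<subseteq> carrier (Qp p)" by auto
  have a_inv: "\<ominus>\<^bsub>?L\<^esub> (pair x y) = pair (\<ominus>\<^bsub>Qp p\<^esub> x) (\<ominus>\<^bsub>Qp p\<^esub> y)"
    if "x \<in> carrier (Qp p)" "y \<in> carrier (Qp p)" for x y
    using that by (intro L.minus_equality) (auto simp: quad_ext_simps(2-) Q.l_neg)
  have sub: "subring quad_int ?L"
  proof (rule L.subringI)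
    show "quad_int \<subseteq> carrier ?L" by auto
    show "\<one>\<^bsub>?L\<^esub> \<in> quad_int" using Zp_one Zp_zero by (auto simp: quad_ext_simps(3))
    fix f g assume "f \<in> quad_int" "g \<in> quad_int"
    then show "f \<otimes>\<^bsub>?L\<^esub> g \<in> quad_int" "f \<oplus>\<^bsub>?L\<^esub> g \<in> quad_int"
      by (auto simp: quad_ext_simps(2,5) Zp_mult Zp_add Zp_minus simp del: image_iff)
  next
    fix f assume "f \<in> quad_int"
    then show "\<ominus>\<^bsub>?L\<^esub> f \<in> quad_int" by (auto simp: a_inv Zp_a_inv)
  qed
  have int: "quad_int \<subseteq> carrier (integer_ring p ?L)"
  proof
    fix f assume f: "f \<in> quad_int"
    then obtain x y where xy: "x \<in> carrier (Zp p)" "y \<in> carrier (Zp p)" "f = pair x y" by auto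
    then have Q: "x \<in> carrier (Qp p)" "y \<in> carrier (Qp p)" by auto
    let ?t = "\<ominus>\<^bsub>Qp p\<^esub> (x \<oplus>\<^bsub>Qp p\<^esub> x \<oplus>\<^bsub>Qp p\<^esub> y)" and ?N = "quad_norm c x y"
    let ?P = "[\<one>\<^bsub>?L\<^esub>, pair ?t \<zero>\<^bsub>Qp p\<^esub>, pair ?N \<zero>\<^bsub>Qp p\<^esub>]"
    have fL: "f \<in> carrier ?L" using xy Q by simp
    have "f \<otimes>\<^bsub>?L\<^esub> f \<oplus>\<^bsub>?L\<^esub> (pair ?t \<zero>\<^bsub>Qp p\<^esub> \<otimes>\<^bsub>?L\<^esub> f \<oplus>\<^bsub>?L\<^esub> pair ?N \<zero>\<^bsub>Qp p\<^esub>) = \<zero>\<^bsub>?L\<^esub>"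
      using Q unfolding xy(3) by (auto elim!: Qp_cases simp: quad_norm_def quad_rep_simps algebra_simps)
    then have "L.eval ?P f = \<zero>\<^bsub>?L\<^esub>" using fL Q by (simp add: numeral_2_eq_2)
    moreover have "?t \<in> carrier (Zp p)" "?N \<in> carrier (Zp p)"
      using xy(1,2) unfolding quad_norm_def by (auto intro!: Zp_a_inv Zp_add Zp_mult)
    then have "set ?P \<subseteq> scalars ?L (carrier (Zp p))"
      using Zp_one by (auto simp: scalars_quad_ext[OF ZQ] quad_ext_simps(3))
    ultimately show "f \<in> carrier (integer_ring p ?L)"
      using fL unfolding integer_ring_def by (auto intro!: exI[of _ ?P] simp del: L.eval.simps)
  qed
  have Z: "scalars ?L (carrier (Zp p)) \<subseteq> quad_int"
    using Zp_zero by (auto simp: scalars_quad_ext[OF ZQ])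
  have p_inv: "emb (1 / of_nat p) \<odot>\<^bsub>?L\<^esub> \<one>\<^bsub>?L\<^esub> \<notin> quad_int"
    using emb_p_inv_notin_Zp by (auto simp: quad_ext_simps(3,6))
  have crit: "carrier (integer_ring p ?L) = quad_int" "maximalideal (prime_ideal_over p ?L) (integer_ring p ?L)"
    "prime_ideal_over p ?L = (\<lambda>y. emb (of_nat p) \<odot>\<^bsub>?L\<^esub> y) ` quad_int"
    by (rule unramified_criterion[OF algebra_quad_ext field_quad_ext[OF assms] sub int Z p_inv quad_unit[OF assms]]; assumption)+
  have "alg_dim (Qp p) ?L (1 + 1) ({a \<odot>\<^bsub>?L\<^esub> pair \<one>\<^bsub>Qp p\<^esub> \<zero>\<^bsub>Qp p\<^esub> | a. a \<in> carrier (Qp p)} <+>\<^bsub>?L\<^esub>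
      {a \<odot>\<^bsub>?L\<^esub> pair \<zero>\<^bsub>Qp p\<^esub> \<one>\<^bsub>Qp p\<^esub> | a. a \<in> carrier (Qp p)})"
    by (intro LA.dim_add LA.dim_line)
      (auto simp: quad_ext_simps(4,6) intro!: exI[of _ "\<zero>\<^bsub>Qp p\<^esub>"])
  moreover have "{a \<odot>\<^bsub>?L\<^esub> pair \<one>\<^bsub>Qp p\<^esub> \<zero>\<^bsub>Qp p\<^esub> | a. a \<in> carrier (Qp p)} <+>\<^bsub>?L\<^esub>
      {a \<odot>\<^bsub>?L\<^esub> pair \<zero>\<^bsub>Qp p\<^esub> \<one>\<^bsub>Qp p\<^esub> | a. a \<in> carrier (Qp p)} = carrier ?L"
  proof (intro equalityI subsetI)
    fix f assume "f \<in> carrier ?L"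
    then obtain x y where xy: "x \<in> carrier (Qp p)" "y \<in> carrier (Qp p)" "f = pair x y" by (rule quad_ext_cases)
    then have "f = x \<odot>\<^bsub>?L\<^esub> pair \<one>\<^bsub>Qp p\<^esub> \<zero>\<^bsub>Qp p\<^esub> \<oplus>\<^bsub>?L\<^esub> y \<odot>\<^bsub>?L\<^esub> pair \<zero>\<^bsub>Qp p\<^esub> \<one>\<^bsub>Qp p\<^esub>"
      by (simp add: quad_ext_simps(5,6))
    then show "f \<in> {a \<odot>\<^bsub>?L\<^esub> pair \<one>\<^bsub>Qp p\<^esub> \<zero>\<^bsub>Qp p\<^esub> | a. a \<in> carrier (Qp p)} <+>\<^bsub>?L\<^esub>
      {a \<odot>\<^bsub>?L\<^esub> pair \<zero>\<^bsub>Qp p\<^esub> \<one>\<^bsub>Qp p\<^esub> | a. a \<in> carrier (Qp p)}"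
      unfolding set_add_def' using xy by blast
  qed (auto simp: set_add_def' quad_ext_simps(5,6))
  ultimately have "ring.dimension ?L 2 (scalars ?L (carrier (Qp p))) (carrier ?L)"
    by (simp add: alg_dim_def numeral_2_eq_2)
  then have ram: "unramified_extension p 2 ?L"
    unfolding unramified_extension_def
    using algebra_quad_ext field_quad_ext[OF assms] crit(2) by blast
  have "quad_conj f \<ominus>\<^bsub>?L\<^esub> f [^]\<^bsub>?L\<^esub> p \<in> prime_ideal_over p ?L" if "f \<in> carrier (integer_ring p ?L)" for f
  proof -
    have "f \<in> quad_int" using that by (simp only: crit(1))
    then obtain x y where xy: "x \<in> carrier (Zp p)" "y \<in> carrier (Zp p)" "f = pair x y" by auto
    then have Q: "x \<in> carrier (Qp p)" "y \<in> carrier (Qp p)" by auto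
    have fL: "f \<in> carrier ?L" using xy Q by simp
    have sq: "qnorm (z \<ominus>\<^bsub>Qp p\<^esub> z \<otimes>\<^bsub>Qp p\<^esub> z) < 1" if "z \<in> carrier (Zp p)" for z
    proof -
      have "z [^]\<^bsub>Qp p\<^esub> p = z [^]\<^bsub>Qp p\<^esub> (2::nat)" by (rule arg_cong[OF p2])
      also have "\<dots> = z \<otimes>\<^bsub>Qp p\<^esub> z" using that by (simp add: numeral_2_eq_2)
      finally show ?thesis using Zp_fermat[OF that] by simp
    qed
    have even: "qnorm (emb (of_int k) \<otimes>\<^bsub>Qp p\<^esub> z) < 1" if "even k" "z \<in> carrier (Zp p)" for k z
    proof (rule qnorm_less_1_mult_right)
      have "int p dvd k" using that(1) p2 by simp
      then show "qnorm (emb (of_int k)) < 1" using vabs_of_int_lt_1_iff[of k] by simp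
    qed (use that in auto)
    let ?a = "(x \<ominus>\<^bsub>Qp p\<^esub> x \<otimes>\<^bsub>Qp p\<^esub> x) \<oplus>\<^bsub>Qp p\<^esub> ((y \<ominus>\<^bsub>Qp p\<^esub> y \<otimes>\<^bsub>Qp p\<^esub> y) \<oplus>\<^bsub>Qp p\<^esub> emb (of_int (c + 1)) \<otimes>\<^bsub>Qp p\<^esub> (y \<otimes>\<^bsub>Qp p\<^esub> y))"
    let ?b = "(y \<ominus>\<^bsub>Qp p\<^esub> y \<otimes>\<^bsub>Qp p\<^esub> y) \<oplus>\<^bsub>Qp p\<^esub> emb (of_int (- 2)) \<otimes>\<^bsub>Qp p\<^esub> (y \<oplus>\<^bsub>Qp p\<^esub> x \<otimes>\<^bsub>Qp p\<^esub> y)"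
    have "qnorm ?a < 1"
      using xy(1,2) Q sq c by (intro qnorm_less_1_add even) (auto intro!: Zp_mult)
    then obtain a' where a': "a' \<in> carrier (Zp p)" "?a = emb (of_nat p) \<otimes>\<^bsub>Qp p\<^esub> a'"
      using qnorm_less_1_dvd[of ?a] Q by auto
    have "qnorm ?b < 1"
      using xy(1,2) Q sq by (intro qnorm_less_1_add even) (auto intro!: Zp_mult Zp_add)
    then obtain b' where b': "b' \<in> carrier (Zp p)" "?b = emb (of_nat p) \<otimes>\<^bsub>Qp p\<^esub> b'"
      using qnorm_less_1_dvd[of ?b] Q by auto
    have "quad_conj f \<ominus>\<^bsub>?L\<^esub> f [^]\<^bsub>?L\<^esub> p = quad_conj f \<oplus>\<^bsub>?L\<^esub> (\<ominus>\<^bsub>?L\<^esub> (f \<otimes>\<^bsub>?L\<^esub> f))"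
    proof -
      have "f [^]\<^bsub>?L\<^esub> p = f [^]\<^bsub>?L\<^esub> (2::nat)" by (rule arg_cong[OF p2])
      also have "\<dots> = f \<otimes>\<^bsub>?L\<^esub> f" using fL by (simp add: numeral_2_eq_2)
      finally show ?thesis by (simp add: a_minus_def)
    qed
    also have "\<dots> = pair ?a ?b"
      using Q unfolding xy(3) by (auto elim!: Qp_cases simp: a_inv quad_rep_simps algebra_simps)
    also have "\<dots> = emb (of_nat p) \<odot>\<^bsub>?L\<^esub> pair a' b'" unfolding a'(2) b'(2) by (simp add: quad_ext_simps(6))
    finally show ?thesis unfolding crit(3) using a'(1) b'(1) by blast
  qed
  then have "is_frobenius p ?L quad_conj" unfolding is_frobenius_def using quad_conj_iso by blast
  then show ?thesis using ram by unfold_locales auto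
qed

end

section \<open>Quaternion algebras\<close>

lemma mod_int_eq_0_iff: "mod_int x = 0 \<longleftrightarrow> x \<in> \<int>"
  by transfer simp

lemma (in assoc_algebra) dim_SucI:
  assumes V: "alg_dim K A n V" and v: "v \<in> carrier A" "v \<notin> V"
    and sub: "\<And>c w. c \<in> carrier K \<Longrightarrow> w \<in> V \<Longrightarrow> c \<odot> v \<oplus> w \<in> V'"
    and ex: "\<And>x. x \<in> V' \<Longrightarrow> \<exists>c\<in>carrier K. \<exists>w\<in>V. x = c \<odot> v \<oplus> w"
  shows "alg_dim K A (Suc n) V'"
proof -
  have "dimension (Suc n) S (line_extension S v V)"
    using V v by (intro Suc_dim) (auto simp: alg_dim_def)
  moreover have mem: "z \<in> line_extension S v V \<longleftrightarrow> (\<exists>c\<in>carrier K. \<exists>w\<in>V. z = c \<odot> v \<oplus> w)" for z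
    using v(1) unfolding line_extension_mem_iff by (auto simp: scalars_def)
  have "line_extension S v V = V'"
  proof (intro equalityI subsetI)
    fix z assume "z \<in> line_extension S v V"
    then obtain c w where "c \<in> carrier K" "w \<in> V" "z = c \<odot> v \<oplus> w" unfolding mem by auto
    then show "z \<in> V'" using sub[of c w] by simp
  qed (simp only: mem ex)
  ultimately show ?thesis by (simp add: alg_dim_def)
qed

lemma (in pre_algebra) matrix_algebra_one_iso:
  "(\<lambda>M. M (0, 0)) \<in> algebra_iso K (matrix_algebra 1 A) A"
proof (rule algebra_isoI)
  show "bij_betw (\<lambda>M. M (0, 0)) (carrier (matrix_algebra 1 A)) (carrier A)"
  proof (rule bij_betw_byWitness[where f'="single 1 A 0 0"])
    show "\<forall>M\<in>carrier (matrix_algebra 1 A). single 1 A 0 0 (M (0, 0)) = M"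
    proof
      fix M assume "M \<in> carrier (matrix_algebra 1 A)"
      then have M: "M \<in> square 1 \<rightarrow>\<^sub>E carrier A" by simp
      have M0: "M (0, 0) \<in> carrier A" by (rule entry_closed[OF M]) simp_all
      show "single 1 A 0 0 (M (0, 0)) = M"
        by (rule matrix_eq[OF single_closed[OF M0] M]) (simp add: single_entry)
    qed
    show "\<forall>x\<in>carrier A. single 1 A 0 0 x (0, 0) = x" by (simp add: single_entry)
    show "(\<lambda>M. M (0, 0)) ` carrier (matrix_algebra 1 A) \<subseteq> carrier A"
      by (rule image_subsetI) (simp add: entry_closed[of _ 1])
    show "single 1 A 0 0 ` carrier A \<subseteq> carrier (matrix_algebra 1 A)"
      by (rule image_subsetI) simp
  qed
  fix M N assume "M \<in> carrier (matrix_algebra 1 A)" "N \<in> carrier (matrix_algebra 1 A)"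
  then have MN: "M \<in> square 1 \<rightarrow>\<^sub>E carrier A" "N \<in> square 1 \<rightarrow>\<^sub>E carrier A" by simp_all
  have "(M \<otimes>\<^bsub>matrix_algebra 1 A\<^esub> N) (0, 0) = (\<Oplus>l\<in>{..<1::nat}. M (0, 0) \<otimes> N (0, 0))"
    using MN by (intro matrix_mult_entry) auto
  then show "(M \<otimes>\<^bsub>matrix_algebra 1 A\<^esub> N) (0, 0) = M (0, 0) \<otimes> N (0, 0)"
    using MN by (simp add: lessThan_Suc del: matrix_simps)
qed auto

context rational_prime
begin

abbreviation quat :: "padic \<Rightarrow> padic \<Rightarrow> (padic, padic \<times> padic \<times> padic \<times> padic) module" where
  "quat \<equiv> quaternion_algebra (Qp p)"

lemma quat_simps:
  "carrier (quat a b) = carrier (Qp p) \<times> carrier (Qp p) \<times> carrier (Qp p) \<times> carrier (Qp p)"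
  "(x0, x1, x2, x3) \<otimes>\<^bsub>quat a b\<^esub> (y0, y1, y2, y3) =
    (x0 \<otimes>\<^bsub>Qp p\<^esub> y0 \<oplus>\<^bsub>Qp p\<^esub> a \<otimes>\<^bsub>Qp p\<^esub> x1 \<otimes>\<^bsub>Qp p\<^esub> y1 \<oplus>\<^bsub>Qp p\<^esub> b \<otimes>\<^bsub>Qp p\<^esub> x2 \<otimes>\<^bsub>Qp p\<^esub> y2 \<ominus>\<^bsub>Qp p\<^esub> a \<otimes>\<^bsub>Qp p\<^esub> b \<otimes>\<^bsub>Qp p\<^esub> x3 \<otimes>\<^bsub>Qp p\<^esub> y3,
     x0 \<otimes>\<^bsub>Qp p\<^esub> y1 \<oplus>\<^bsub>Qp p\<^esub> x1 \<otimes>\<^bsub>Qp p\<^esub> y0 \<ominus>\<^bsub>Qp p\<^esub> b \<otimes>\<^bsub>Qp p\<^esub> x2 \<otimes>\<^bsub>Qp p\<^esub> y3 \<oplus>\<^bsub>Qp p\<^esub> b \<otimes>\<^bsub>Qp p\<^esub> x3 \<otimes>\<^bsub>Qp p\<^esub> y2,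
     x0 \<otimes>\<^bsub>Qp p\<^esub> y2 \<oplus>\<^bsub>Qp p\<^esub> x2 \<otimes>\<^bsub>Qp p\<^esub> y0 \<oplus>\<^bsub>Qp p\<^esub> a \<otimes>\<^bsub>Qp p\<^esub> x1 \<otimes>\<^bsub>Qp p\<^esub> y3 \<ominus>\<^bsub>Qp p\<^esub> a \<otimes>\<^bsub>Qp p\<^esub> x3 \<otimes>\<^bsub>Qp p\<^esub> y1,
     x0 \<otimes>\<^bsub>Qp p\<^esub> y3 \<oplus>\<^bsub>Qp p\<^esub> x3 \<otimes>\<^bsub>Qp p\<^esub> y0 \<oplus>\<^bsub>Qp p\<^esub> x1 \<otimes>\<^bsub>Qp p\<^esub> y2 \<ominus>\<^bsub>Qp p\<^esub> x2 \<otimes>\<^bsub>Qp p\<^esub> y1)"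
  "\<one>\<^bsub>quat a b\<^esub> = (\<one>\<^bsub>Qp p\<^esub>, \<zero>\<^bsub>Qp p\<^esub>, \<zero>\<^bsub>Qp p\<^esub>, \<zero>\<^bsub>Qp p\<^esub>)" "\<zero>\<^bsub>quat a b\<^esub> = (\<zero>\<^bsub>Qp p\<^esub>, \<zero>\<^bsub>Qp p\<^esub>, \<zero>\<^bsub>Qp p\<^esub>, \<zero>\<^bsub>Qp p\<^esub>)"
  "(x0, x1, x2, x3) \<oplus>\<^bsub>quat a b\<^esub> (y0, y1, y2, y3) =
    (x0 \<oplus>\<^bsub>Qp p\<^esub> y0, x1 \<oplus>\<^bsub>Qp p\<^esub> y1, x2 \<oplus>\<^bsub>Qp p\<^esub> y2, x3 \<oplus>\<^bsub>Qp p\<^esub> y3)"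
  "c \<odot>\<^bsub>quat a b\<^esub> (x0, x1, x2, x3) = (c \<otimes>\<^bsub>Qp p\<^esub> x0, c \<otimes>\<^bsub>Qp p\<^esub> x1, c \<otimes>\<^bsub>Qp p\<^esub> x2, c \<otimes>\<^bsub>Qp p\<^esub> x3)"
  by (simp_all add: quaternion_algebra_def)

lemma quat_cases:
  assumes "x \<in> carrier (quat a b)"
  obtains x0 x1 x2 x3 where "x = (x0, x1, x2, x3)" "x0 \<in> carrier (Qp p)" "x1 \<in> carrier (Qp p)"
    "x2 \<in> carrier (Qp p)" "x3 \<in> carrier (Qp p)"
  using assms by (auto simp: quat_simps(1))

lemma quat_reps:
  assumes "x \<in> carrier (quat a b)"
  obtains s0 s1 s2 s3 where "x = (cls s0, cls s1, cls s2, cls s3)" "is_cauchy s0" "is_cauchy s1"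
    "is_cauchy s2" "is_cauchy s3"
  using assms by (auto simp: quat_simps(1) elim!: Qp_cases)

lemma assoc_algebra_quat:
  assumes ab: "a \<in> carrier (Qp p)" "b \<in> carrier (Qp p)"
  shows "assoc_algebra (Qp p) (quat a b)"
proof -
  obtain sa where a: "is_cauchy sa" "a = cls sa" using ab(1) by (rule Qp_cases)
  obtain sb where b: "is_cauchy sb" "b = cls sb" using ab(2) by (rule Qp_cases)
  note rs = quat_simps(2-) cls_simps a b
  have "abelian_group (quat a b)"
  proof (rule abelian_groupI)
    fix x assume x: "x \<in> carrier (quat a b)"
    then obtain x0 x1 x2 x3 where x': "x = (x0, x1, x2, x3)" "x0 \<in> carrier (Qp p)" "x1 \<in> carrier (Qp p)"
      "x2 \<in> carrier (Qp p)" "x3 \<in> carrier (Qp p)" by (rule quat_cases)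
    then show "\<exists>y\<in>carrier (quat a b). y \<oplus>\<^bsub>quat a b\<^esub> x = \<zero>\<^bsub>quat a b\<^esub>"
      by (intro bexI[of _ "(\<ominus>\<^bsub>Qp p\<^esub> x0, \<ominus>\<^bsub>Qp p\<^esub> x1, \<ominus>\<^bsub>Qp p\<^esub> x2, \<ominus>\<^bsub>Qp p\<^esub> x3)"])
        (auto simp: quat_simps Q.l_neg)
    show "\<zero>\<^bsub>quat a b\<^esub> \<oplus>\<^bsub>quat a b\<^esub> x = x" using x' by (simp add: quat_simps(4,5))
    fix y assume y: "y \<in> carrier (quat a b)"
    show "x \<oplus>\<^bsub>quat a b\<^esub> y \<in> carrier (quat a b)" "x \<oplus>\<^bsub>quat a b\<^esub> y = y \<oplus>\<^bsub>quat a b\<^esub> x"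
      using x y by (auto elim!: quat_cases simp: quat_simps Q.a_comm)
    fix z assume z: "z \<in> carrier (quat a b)"
    show "x \<oplus>\<^bsub>quat a b\<^esub> y \<oplus>\<^bsub>quat a b\<^esub> z = x \<oplus>\<^bsub>quat a b\<^esub> (y \<oplus>\<^bsub>quat a b\<^esub> z)"
      using x y z by (auto elim!: quat_cases simp: quat_simps(5) Q.a_assoc)
  qed (simp add: quat_simps)
  then interpret A: abelian_group "quat a b" .
  show ?thesis
  proof unfold_locales
    show "\<one>\<^bsub>quat a b\<^esub> \<in> carrier (quat a b)" "\<one>\<^bsub>quat a b\<^esub> \<noteq> \<zero>\<^bsub>quat a b\<^esub>" by (simp_all add: quat_simps)
    fix x assume x: "x \<in> carrier (quat a b)"
    show "\<one>\<^bsub>Qp p\<^esub> \<odot>\<^bsub>quat a b\<^esub> x = x" using x by (auto elim!: quat_cases simp: quat_simps(6))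
    show "\<one>\<^bsub>quat a b\<^esub> \<otimes>\<^bsub>quat a b\<^esub> x = x" "x \<otimes>\<^bsub>quat a b\<^esub> \<one>\<^bsub>quat a b\<^esub> = x"
      using x a(1) b(1) by (auto elim!: quat_reps simp: rs)
    fix y assume y: "y \<in> carrier (quat a b)"
    show "x \<otimes>\<^bsub>quat a b\<^esub> y \<in> carrier (quat a b)" using x y ab by (auto elim!: quat_cases simp: quat_simps)
    fix z assume z: "z \<in> carrier (quat a b)"
    show "(x \<oplus>\<^bsub>quat a b\<^esub> y) \<otimes>\<^bsub>quat a b\<^esub> z = x \<otimes>\<^bsub>quat a b\<^esub> z \<oplus>\<^bsub>quat a b\<^esub> y \<otimes>\<^bsub>quat a b\<^esub> z"
      "z \<otimes>\<^bsub>quat a b\<^esub> (x \<oplus>\<^bsub>quat a b\<^esub> y) = z \<otimes>\<^bsub>quat a b\<^esub> x \<oplus>\<^bsub>quat a b\<^esub> z \<otimes>\<^bsub>quat a b\<^esub> y"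
      using x y z a(1) b(1) by (auto elim!: quat_reps simp: rs algebra_simps)
    show "x \<otimes>\<^bsub>quat a b\<^esub> y \<otimes>\<^bsub>quat a b\<^esub> z = x \<otimes>\<^bsub>quat a b\<^esub> (y \<otimes>\<^bsub>quat a b\<^esub> z)"
      using x y z a(1) b(1) by (auto elim!: quat_reps simp: rs algebra_simps)
  next
    fix c x assume c: "c \<in> carrier (Qp p)" and x: "x \<in> carrier (quat a b)"
    show "c \<odot>\<^bsub>quat a b\<^esub> x \<in> carrier (quat a b)" using c x by (auto elim!: quat_cases simp: quat_simps)
    show "(c \<oplus>\<^bsub>Qp p\<^esub> d) \<odot>\<^bsub>quat a b\<^esub> x = c \<odot>\<^bsub>quat a b\<^esub> x \<oplus>\<^bsub>quat a b\<^esub> d \<odot>\<^bsub>quat a b\<^esub> x"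
      "(c \<otimes>\<^bsub>Qp p\<^esub> d) \<odot>\<^bsub>quat a b\<^esub> x = c \<odot>\<^bsub>quat a b\<^esub> (d \<odot>\<^bsub>quat a b\<^esub> x)" if "d \<in> carrier (Qp p)" for d
      using c x that by (auto elim!: quat_cases simp: quat_simps(5,6) Q.l_distr Q.m_assoc)
    fix y assume y: "y \<in> carrier (quat a b)"
    show "c \<odot>\<^bsub>quat a b\<^esub> (x \<oplus>\<^bsub>quat a b\<^esub> y) = c \<odot>\<^bsub>quat a b\<^esub> x \<oplus>\<^bsub>quat a b\<^esub> c \<odot>\<^bsub>quat a b\<^esub> y"
      using c x y by (auto elim!: quat_cases simp: quat_simps(5,6) Q.r_distr)
    show "c \<odot>\<^bsub>quat a b\<^esub> x \<otimes>\<^bsub>quat a b\<^esub> y = c \<odot>\<^bsub>quat a b\<^esub> (x \<otimes>\<^bsub>quat a b\<^esub> y)"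
      "x \<otimes>\<^bsub>quat a b\<^esub> (c \<odot>\<^bsub>quat a b\<^esub> y) = c \<odot>\<^bsub>quat a b\<^esub> (x \<otimes>\<^bsub>quat a b\<^esub> y)"
      using c x y a(1) b(1) by (auto elim!: quat_reps Qp_cases simp: rs algebra_simps)
  qed
qed

lemma dim_quat:
  assumes ab: "a \<in> carrier (Qp p)" "b \<in> carrier (Qp p)"
  shows "alg_dim (Qp p) (quat a b) (2 * 2) (carrier (quat a b))"
proof -
  interpret A: assoc_algebra "Qp p" "quat a b" by (rule assoc_algebra_quat[OF ab])
  let ?z = "\<zero>\<^bsub>Qp p\<^esub>" and ?o = "\<one>\<^bsub>Qp p\<^esub>" and ?K = "carrier (Qp p)"
  have d1: "alg_dim (Qp p) (quat a b) (Suc 0) ({?z} \<times> {?z} \<times> {?z} \<times> ?K)"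
  proof (rule A.dim_SucI[OF A.dim_zero, of "(?z, ?z, ?z, ?o)"])
    fix x assume "x \<in> {?z} \<times> {?z} \<times> {?z} \<times> ?K"
    then obtain y3 where x: "x = (?z, ?z, ?z, y3)" "y3 \<in> ?K" by auto
    then show "\<exists>c\<in>?K. \<exists>w\<in>{\<zero>\<^bsub>quat a b\<^esub>}. x = c \<odot>\<^bsub>quat a b\<^esub> (?z, ?z, ?z, ?o) \<oplus>\<^bsub>quat a b\<^esub> w"
      by (intro bexI[of _ y3] bexI[of _ "\<zero>\<^bsub>quat a b\<^esub>"]) (auto simp: quat_simps)
  qed (auto simp: quat_simps)
  have d2: "alg_dim (Qp p) (quat a b) (Suc (Suc 0)) ({?z} \<times> {?z} \<times> ?K \<times> ?K)"
  proof (rule A.dim_SucI[OF d1, of "(?z, ?z, ?o, ?z)"])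
    fix x assume "x \<in> {?z} \<times> {?z} \<times> ?K \<times> ?K"
    then obtain y2 y3 where x: "x = (?z, ?z, y2, y3)" "y2 \<in> ?K" "y3 \<in> ?K" by auto
    then show "\<exists>c\<in>?K. \<exists>w\<in>{?z} \<times> {?z} \<times> {?z} \<times> ?K. x = c \<odot>\<^bsub>quat a b\<^esub> (?z, ?z, ?o, ?z) \<oplus>\<^bsub>quat a b\<^esub> w"
      by (intro bexI[of _ y2] bexI[of _ "(?z, ?z, ?z, y3)"]) (auto simp: quat_simps)
  qed (auto simp: quat_simps)
  have d3: "alg_dim (Qp p) (quat a b) (Suc (Suc (Suc 0))) ({?z} \<times> ?K \<times> ?K \<times> ?K)"
  proof (rule A.dim_SucI[OF d2, of "(?z, ?o, ?z, ?z)"])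
    fix x assume "x \<in> {?z} \<times> ?K \<times> ?K \<times> ?K"
    then obtain y1 y2 y3 where x: "x = (?z, y1, y2, y3)" "y1 \<in> ?K" "y2 \<in> ?K" "y3 \<in> ?K" by auto
    then show "\<exists>c\<in>?K. \<exists>w\<in>{?z} \<times> {?z} \<times> ?K \<times> ?K. x = c \<odot>\<^bsub>quat a b\<^esub> (?z, ?o, ?z, ?z) \<oplus>\<^bsub>quat a b\<^esub> w"
      by (intro bexI[of _ y1] bexI[of _ "(?z, ?z, y2, y3)"]) (auto simp: quat_simps)
  qed (auto simp: quat_simps)
  have d4: "alg_dim (Qp p) (quat a b) (Suc (Suc (Suc (Suc 0)))) (?K \<times> ?K \<times> ?K \<times> ?K)"
  proof (rule A.dim_SucI[OF d3, of "(?o, ?z, ?z, ?z)"])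
    fix x assume "x \<in> ?K \<times> ?K \<times> ?K \<times> ?K"
    then obtain y0 y1 y2 y3 where x: "x = (y0, y1, y2, y3)" "y0 \<in> ?K" "y1 \<in> ?K" "y2 \<in> ?K" "y3 \<in> ?K" by auto
    then show "\<exists>c\<in>?K. \<exists>w\<in>{?z} \<times> ?K \<times> ?K \<times> ?K. x = c \<odot>\<^bsub>quat a b\<^esub> (?o, ?z, ?z, ?z) \<oplus>\<^bsub>quat a b\<^esub> w"
      by (intro bexI[of _ y0] bexI[of _ "(?z, y1, y2, y3)"]) (auto simp: quat_simps)
  qed (auto simp: quat_simps)
  moreover have "2 * 2 = Suc (Suc (Suc (Suc 0)))" by simp
  ultimately show ?thesis by (simp only: quat_simps(1))
qed

subsection \<open>Split quaternion algebras\<close>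

text \<open>If \<open>b = P\<^sup>2 - a R\<^sup>2\<close>, then \<open>P + R i + j\<close> is a zero
  divisor. The ideal \<open>I\<close> is the left ideal that it generates; its products with 1 and
  \<open>i\<close> are a basis.\<close>

lemma split_quat_left_ideal:
  assumes K: "a \<in> carrier (Qp p)" "P \<in> carrier (Qp p)" "R \<in> carrier (Qp p)"
    and b: "b = P \<otimes>\<^bsub>Qp p\<^esub> P \<ominus>\<^bsub>Qp p\<^esub> a \<otimes>\<^bsub>Qp p\<^esub> (R \<otimes>\<^bsub>Qp p\<^esub> R)"
  defines "I \<equiv> (\<lambda>(x, y). (P \<otimes>\<^bsub>Qp p\<^esub> x \<oplus>\<^bsub>Qp p\<^esub> a \<otimes>\<^bsub>Qp p\<^esub> R \<otimes>\<^bsub>Qp p\<^esub> y, R \<otimes>\<^bsub>Qp p\<^esub> x \<oplus>\<^bsub>Qp p\<^esub> P \<otimes>\<^bsub>Qp p\<^esub> y, x, y)) ` (carrier (Qp p) \<times> carrier (Qp p))"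
  shows "alg_dim (Qp p) (quat a b) 2 I"
    and "\<And>x y. x \<in> carrier (quat a b) \<Longrightarrow> y \<in> I \<Longrightarrow> x \<otimes>\<^bsub>quat a b\<^esub> y \<in> I"
proof -
  have bK: "b \<in> carrier (Qp p)" using K by (simp add: b)
  interpret A: assoc_algebra "Qp p" "quat a b" by (rule assoc_algebra_quat[OF K(1) bK])
  let ?z = "\<zero>\<^bsub>Qp p\<^esub>" and ?o = "\<one>\<^bsub>Qp p\<^esub>" and ?K = "carrier (Qp p)"
  let ?u = "(P, R, ?o, ?z)" and ?v = "(a \<otimes>\<^bsub>Qp p\<^esub> R, P, ?z, ?o)"
  let ?V = "(\<lambda>y. (a \<otimes>\<^bsub>Qp p\<^esub> R \<otimes>\<^bsub>Qp p\<^esub> y, P \<otimes>\<^bsub>Qp p\<^esub> y, ?z, y)) ` ?K"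
  have d1: "alg_dim (Qp p) (quat a b) (Suc 0) ?V"
  proof (rule A.dim_SucI[OF A.dim_zero, of ?v])
    fix x assume "x \<in> ?V"
    then obtain y where "x = (a \<otimes>\<^bsub>Qp p\<^esub> R \<otimes>\<^bsub>Qp p\<^esub> y, P \<otimes>\<^bsub>Qp p\<^esub> y, ?z, y)" "y \<in> ?K" by auto
    then show "\<exists>c\<in>?K. \<exists>w\<in>{\<zero>\<^bsub>quat a b\<^esub>}. x = c \<odot>\<^bsub>quat a b\<^esub> ?v \<oplus>\<^bsub>quat a b\<^esub> w"
      using K by (intro bexI[of _ y] bexI[of _ "\<zero>\<^bsub>quat a b\<^esub>"]) (auto simp: quat_simps Q.m_ac)
  qed (use K in \<open>auto simp: quat_simps Q.m_ac\<close>)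
  have "alg_dim (Qp p) (quat a b) (Suc (Suc 0)) I"
  proof (rule A.dim_SucI[OF d1, of ?u])
    fix t assume "t \<in> I"
    then obtain x y where xy: "x \<in> ?K" "y \<in> ?K"
      "t = (P \<otimes>\<^bsub>Qp p\<^esub> x \<oplus>\<^bsub>Qp p\<^esub> a \<otimes>\<^bsub>Qp p\<^esub> R \<otimes>\<^bsub>Qp p\<^esub> y, R \<otimes>\<^bsub>Qp p\<^esub> x \<oplus>\<^bsub>Qp p\<^esub> P \<otimes>\<^bsub>Qp p\<^esub> y, x, y)"
      unfolding I_def by auto
    then have "t = x \<odot>\<^bsub>quat a b\<^esub> ?u \<oplus>\<^bsub>quat a b\<^esub> (a \<otimes>\<^bsub>Qp p\<^esub> R \<otimes>\<^bsub>Qp p\<^esub> y, P \<otimes>\<^bsub>Qp p\<^esub> y, ?z, y)"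
      using K by (simp add: quat_simps(5,6) Q.m_ac)
    then show "\<exists>c\<in>?K. \<exists>w\<in>?V. t = c \<odot>\<^bsub>quat a b\<^esub> ?u \<oplus>\<^bsub>quat a b\<^esub> w" using xy(1,2) by blast
  next
    fix x w assume x: "x \<in> ?K" and "w \<in> ?V"
    then obtain y where y: "y \<in> ?K" "w = (a \<otimes>\<^bsub>Qp p\<^esub> R \<otimes>\<^bsub>Qp p\<^esub> y, P \<otimes>\<^bsub>Qp p\<^esub> y, ?z, y)" by auto
    then have "x \<odot>\<^bsub>quat a b\<^esub> ?u \<oplus>\<^bsub>quat a b\<^esub> w =
        (P \<otimes>\<^bsub>Qp p\<^esub> x \<oplus>\<^bsub>Qp p\<^esub> a \<otimes>\<^bsub>Qp p\<^esub> R \<otimes>\<^bsub>Qp p\<^esub> y, R \<otimes>\<^bsub>Qp p\<^esub> x \<oplus>\<^bsub>Qp p\<^esub> P \<otimes>\<^bsub>Qp p\<^esub> y, x, y)"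
      using K x by (simp add: quat_simps(5,6) Q.m_ac)
    then show "x \<odot>\<^bsub>quat a b\<^esub> ?u \<oplus>\<^bsub>quat a b\<^esub> w \<in> I" unfolding I_def using x y(1) by auto
  qed (use K in \<open>auto simp: quat_simps\<close>)
  then show "alg_dim (Qp p) (quat a b) 2 I" by (simp add: numeral_2_eq_2)
  fix t u assume "t \<in> carrier (quat a b)" "u \<in> I"
  then obtain y0 y1 y2 y3 x2 x3 where y: "t = (y0, y1, y2, y3)" "y0 \<in> ?K" "y1 \<in> ?K" "y2 \<in> ?K" "y3 \<in> ?K"
    and x: "x2 \<in> ?K" "x3 \<in> ?K"
      "u = (P \<otimes>\<^bsub>Qp p\<^esub> x2 \<oplus>\<^bsub>Qp p\<^esub> a \<otimes>\<^bsub>Qp p\<^esub> R \<otimes>\<^bsub>Qp p\<^esub> x3, R \<otimes>\<^bsub>Qp p\<^esub> x2 \<oplus>\<^bsub>Qp p\<^esub> P \<otimes>\<^bsub>Qp p\<^esub> x3, x2, x3)"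
    unfolding I_def by (auto elim!: quat_cases)
  obtain z0 z1 z2 z3 where z: "t \<otimes>\<^bsub>quat a b\<^esub> u = (z0, z1, z2, z3)" by (cases "t \<otimes>\<^bsub>quat a b\<^esub> u") auto
  have zK: "z2 \<in> ?K" "z3 \<in> ?K" using z x y K by (auto simp: quat_simps)
  have "z0 = P \<otimes>\<^bsub>Qp p\<^esub> z2 \<oplus>\<^bsub>Qp p\<^esub> a \<otimes>\<^bsub>Qp p\<^esub> R \<otimes>\<^bsub>Qp p\<^esub> z3 \<and> z1 = R \<otimes>\<^bsub>Qp p\<^esub> z2 \<oplus>\<^bsub>Qp p\<^esub> P \<otimes>\<^bsub>Qp p\<^esub> z3"
    using x(1,2) y(2-) K z[symmetric] unfolding x(3) y(1) b
    by (auto elim!: Qp_cases simp: quat_simps(2) cls_simps algebra_simps)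
  then show "t \<otimes>\<^bsub>quat a b\<^esub> u \<in> I" unfolding z I_def using zK by auto
qed

lemma assoc_base_algebra: "assoc_algebra (Qp p) (base_algebra (Qp p))"
proof -
  have "abelian_group (base_algebra (Qp p))"
    by (rule abelian_groupI) (auto simp: base_algebra_def Q.a_ac intro: bexI[of _ "\<ominus>\<^bsub>Qp p\<^esub> _"] Q.l_neg)
  then interpret abelian_group "base_algebra (Qp p)" .
  show ?thesis
    by unfold_locales (auto simp: base_algebra_def Q.l_distr Q.r_distr Q.m_ac)
qed

text \<open>The base field is a cyclic algebra of degree one over the trivial extension, and thus
  represents the invariant 0.\<close>

definition coeff_emb :: "padic \<Rightarrow> nat \<Rightarrow> nat \<Rightarrow> padic" where
  "coeff_emb x = (\<lambda>m\<in>{..<1}. if m = 0 then (\<lambda>_. x) else \<zero>\<^bsub>unit_ext p\<^esub>)"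

abbreviation trivial_cyc :: "(padic, nat \<Rightarrow> nat \<Rightarrow> padic) module" where
  "trivial_cyc \<equiv> cyclic_algebra (unit_ext p) 1 id ([(p ^ 0)] \<cdot>\<^bsub>unit_ext p\<^esub> \<one>\<^bsub>unit_ext p\<^esub>)"

lemma coeff_emb_iso: "coeff_emb \<in> algebra_iso (Qp p) (base_algebra (Qp p)) trivial_cyc"
proof -
  interpret U: unramified p 1 "unit_ext p" id by (rule unramified_unit_ext)
  have delta: "coeff_emb x = U.delta 0 (\<lambda>_. x)" for x by (simp only: coeff_emb_def U.delta_def)
  have a: "[(p ^ 0)] \<cdot>\<^bsub>unit_ext p\<^esub> \<one>\<^bsub>unit_ext p\<^esub> = U.rat_L (of_nat (p ^ 0))" by (rule U.rat_L_of_nat)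
  have cl: "(\<lambda>_. x) \<in> carrier (unit_ext p)" if "x \<in> carrier (Qp p)" for x using that by simp
  have B: "carrier (base_algebra (Qp p)) = carrier (Qp p)" by (simp add: base_algebra_def)
  have CC: "carrier trivial_cyc = {..<1} \<rightarrow>\<^sub>E carrier (unit_ext p)" by (simp only: U.cyc_simps)
  have z: "(0::nat) < 1" by simp
  show ?thesis
  proof (rule algebra_isoI)
    show "bij_betw coeff_emb (carrier (base_algebra (Qp p))) (carrier trivial_cyc)"
      unfolding B CC
    proof (rule bij_betw_byWitness[where f'="\<lambda>f. f 0 0"])
      show "\<forall>x\<in>carrier (Qp p). coeff_emb x 0 0 = x" by (simp add: coeff_emb_def)
      show "\<forall>f\<in>{..<1} \<rightarrow>\<^sub>E carrier (unit_ext p). coeff_emb (f 0 0) = f"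
      proof
        fix f assume f: "f \<in> {..<1::nat} \<rightarrow>\<^sub>E carrier (unit_ext p)"
        then obtain x where x: "x \<in> carrier (Qp p)" "f 0 = (\<lambda>_. x)" by auto
        have "coeff_emb x = f"
        proof (rule U.coeff_eqI[OF _ f])
          show "coeff_emb x \<in> {..<1} \<rightarrow>\<^sub>E carrier (unit_ext p)"
            unfolding delta by (rule U.delta_closed[OF cl[OF x(1)]])
        qed (simp add: x(2) coeff_emb_def)
        then show "coeff_emb (f 0 0) = f" by (simp add: x(2))
      qed
      show "coeff_emb ` carrier (Qp p) \<subseteq> {..<1} \<rightarrow>\<^sub>E carrier (unit_ext p)"
        unfolding delta using U.delta_closed[OF cl] by blast
      show "(\<lambda>f. f 0 0) ` ({..<1::nat} \<rightarrow>\<^sub>E carrier (unit_ext p)) \<subseteq> carrier (Qp p)"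
      proof (rule image_subsetI)
        fix f assume f: "f \<in> {..<1::nat} \<rightarrow>\<^sub>E carrier (unit_ext p)"
        have "f 0 \<in> carrier (unit_ext p)" by (rule PiE_mem[OF f]) simp
        then show "f 0 0 \<in> carrier (Qp p)" by auto
      qed
    qed
    fix x y assume "x \<in> carrier (base_algebra (Qp p))" "y \<in> carrier (base_algebra (Qp p))"
    then have xy: "x \<in> carrier (Qp p)" "y \<in> carrier (Qp p)" by (simp_all only: B)
    have "coeff_emb x \<otimes>\<^bsub>trivial_cyc\<^esub> coeff_emb y = U.delta 0 ((\<lambda>_. x) \<otimes>\<^bsub>unit_ext p\<^esub> (\<lambda>_. y) \<otimes>\<^bsub>unit_ext p\<^esub> \<one>\<^bsub>unit_ext p\<^esub>)"
      unfolding delta a using U.delta_mult[OF U.rat_L_closed[of "of_nat (p ^ 0)"] z z cl[OF xy(1)] cl[OF xy(2)]] by simp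
    then show "coeff_emb (x \<otimes>\<^bsub>base_algebra (Qp p)\<^esub> y) = coeff_emb x \<otimes>\<^bsub>trivial_cyc\<^esub> coeff_emb y"
      using xy by (simp add: delta base_algebra_def)
    show "coeff_emb (x \<oplus>\<^bsub>base_algebra (Qp p)\<^esub> y) = coeff_emb x \<oplus>\<^bsub>trivial_cyc\<^esub> coeff_emb y"
      using U.delta_add[OF cl[OF xy(1)] cl[OF xy(2)], of 0] by (simp only: delta) (simp add: base_algebra_def)
  next
    show "coeff_emb \<one>\<^bsub>base_algebra (Qp p)\<^esub> = \<one>\<^bsub>trivial_cyc\<^esub>"
      using U.delta_one by (simp only: delta) (simp add: base_algebra_def)
    fix c x assume c: "c \<in> carrier (Qp p)" and "x \<in> carrier (base_algebra (Qp p))"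
    then have x: "x \<in> carrier (Qp p)" by (simp only: B)
    show "coeff_emb (c \<odot>\<^bsub>base_algebra (Qp p)\<^esub> x) = c \<odot>\<^bsub>trivial_cyc\<^esub> coeff_emb x"
      using U.delta_scale[OF c cl[OF x], of 0] by (simp only: delta) (simp add: base_algebra_def)
  qed
qed

end

context rational_prime
begin

text \<open>The entries of the matrix by which \<open>x0 + x1 i + x2 j + x3 ij\<close> acts on
  \<open>K(\<surd>a)\<close>, if \<open>b = P\<^sup>2 - a R\<^sup>2\<close>.\<close>

definition split_matrix :: "padic \<Rightarrow> padic \<Rightarrow> padic \<Rightarrow> padic \<times> padic \<times> padic \<times> padic \<Rightarrow> nat \<Rightarrow> nat \<Rightarrow> padic" where
  "split_matrix a P R = (\<lambda>(x0, x1, x2, x3) i j.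
     if i = 0 then (if j = 0 then x0 \<oplus>\<^bsub>Qp p\<^esub> (P \<otimes>\<^bsub>Qp p\<^esub> x2 \<oplus>\<^bsub>Qp p\<^esub> a \<otimes>\<^bsub>Qp p\<^esub> (R \<otimes>\<^bsub>Qp p\<^esub> x3))
       else a \<otimes>\<^bsub>Qp p\<^esub> (x1 \<ominus>\<^bsub>Qp p\<^esub> (R \<otimes>\<^bsub>Qp p\<^esub> x2 \<oplus>\<^bsub>Qp p\<^esub> P \<otimes>\<^bsub>Qp p\<^esub> x3)))
     else (if j = 0 then x1 \<oplus>\<^bsub>Qp p\<^esub> (R \<otimes>\<^bsub>Qp p\<^esub> x2 \<oplus>\<^bsub>Qp p\<^esub> P \<otimes>\<^bsub>Qp p\<^esub> x3)
       else x0 \<ominus>\<^bsub>Qp p\<^esub> (P \<otimes>\<^bsub>Qp p\<^esub> x2 \<oplus>\<^bsub>Qp p\<^esub> a \<otimes>\<^bsub>Qp p\<^esub> (R \<otimes>\<^bsub>Qp p\<^esub> x3))))"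

lemma double_eq_0: "x \<in> carrier (Qp p) \<Longrightarrow> x \<oplus>\<^bsub>Qp p\<^esub> x = \<zero>\<^bsub>Qp p\<^esub> \<Longrightarrow> x = \<zero>\<^bsub>Qp p\<^esub>"
proof -
  assume x: "x \<in> carrier (Qp p)" "x \<oplus>\<^bsub>Qp p\<^esub> x = \<zero>\<^bsub>Qp p\<^esub>"
  have "emb 2 \<otimes>\<^bsub>Qp p\<^esub> x = x \<oplus>\<^bsub>Qp p\<^esub> x"
    using x(1) by (auto elim!: Qp_cases simp: emb_def cls_simps)
  then show ?thesis using x Q.integral[of "emb 2" x] by auto
qed

lemma split_matrix_inj:
  assumes K: "a \<in> carrier (Qp p)" "P \<in> carrier (Qp p)" "R \<in> carrier (Qp p)" "a \<noteq> \<zero>\<^bsub>Qp p\<^esub>"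
    and b: "P \<otimes>\<^bsub>Qp p\<^esub> P \<ominus>\<^bsub>Qp p\<^esub> a \<otimes>\<^bsub>Qp p\<^esub> (R \<otimes>\<^bsub>Qp p\<^esub> R) \<noteq> \<zero>\<^bsub>Qp p\<^esub>"
    and x: "x0 \<in> carrier (Qp p)" "x1 \<in> carrier (Qp p)" "x2 \<in> carrier (Qp p)" "x3 \<in> carrier (Qp p)"
    and 0: "\<And>i j. i < 2 \<Longrightarrow> j < 2 \<Longrightarrow> split_matrix a P R (x0, x1, x2, x3) i j = \<zero>\<^bsub>Qp p\<^esub>"
  shows "(x0, x1, x2, x3) = (\<zero>\<^bsub>Qp p\<^esub>, \<zero>\<^bsub>Qp p\<^esub>, \<zero>\<^bsub>Qp p\<^esub>, \<zero>\<^bsub>Qp p\<^esub>)"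
proof -
  let ?z = "\<zero>\<^bsub>Qp p\<^esub>"
  define m where "m = P \<otimes>\<^bsub>Qp p\<^esub> x2 \<oplus>\<^bsub>Qp p\<^esub> a \<otimes>\<^bsub>Qp p\<^esub> (R \<otimes>\<^bsub>Qp p\<^esub> x3)"
  define l where "l = R \<otimes>\<^bsub>Qp p\<^esub> x2 \<oplus>\<^bsub>Qp p\<^esub> P \<otimes>\<^bsub>Qp p\<^esub> x3"
  have cl: "m \<in> carrier (Qp p)" "l \<in> carrier (Qp p)" using K x by (auto simp: m_def l_def)
  have e: "x0 \<oplus>\<^bsub>Qp p\<^esub> m = ?z" "a \<otimes>\<^bsub>Qp p\<^esub> (x1 \<ominus>\<^bsub>Qp p\<^esub> l) = ?z" "x1 \<oplus>\<^bsub>Qp p\<^esub> l = ?z" "x0 \<ominus>\<^bsub>Qp p\<^esub> m = ?z"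
    using 0[of 0 0] 0[of 0 1] 0[of 1 0] 0[of 1 1] by (simp_all add: split_matrix_def m_def l_def)
  have "x1 \<ominus>\<^bsub>Qp p\<^esub> l = ?z" using e(2) Q.integral[of a "x1 \<ominus>\<^bsub>Qp p\<^esub> l"] K x cl by auto
  then have x1l: "x1 = l" using x cl by simp
  have "l \<oplus>\<^bsub>Qp p\<^esub> l = ?z" using e(3) unfolding x1l .
  then have l0: "l = ?z" by (rule double_eq_0[OF cl(2)])
  have "x0 = m" using e(4) x cl by simp
  then have "m \<oplus>\<^bsub>Qp p\<^esub> m = ?z" using e(1) by (simp only:)
  then have m0: "m = ?z" by (rule double_eq_0[OF cl(1)])
  define b where "b = P \<otimes>\<^bsub>Qp p\<^esub> P \<ominus>\<^bsub>Qp p\<^esub> a \<otimes>\<^bsub>Qp p\<^esub> (R \<otimes>\<^bsub>Qp p\<^esub> R)"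
  have bK: "b \<in> carrier (Qp p)" "b \<noteq> ?z" using K b by (auto simp: b_def)
  have "b \<otimes>\<^bsub>Qp p\<^esub> x2 = P \<otimes>\<^bsub>Qp p\<^esub> m \<ominus>\<^bsub>Qp p\<^esub> a \<otimes>\<^bsub>Qp p\<^esub> (R \<otimes>\<^bsub>Qp p\<^esub> l)"
    using K(1-3) x by (auto elim!: Qp_cases simp: b_def m_def l_def cls_simps algebra_simps)
  then have "x2 = ?z" using m0 l0 K x bK Q.integral[of b x2] by (auto simp: a_minus_def)
  have "b \<otimes>\<^bsub>Qp p\<^esub> x3 = P \<otimes>\<^bsub>Qp p\<^esub> l \<ominus>\<^bsub>Qp p\<^esub> R \<otimes>\<^bsub>Qp p\<^esub> m"
    using K(1-3) x by (auto elim!: Qp_cases simp: b_def m_def l_def cls_simps algebra_simps)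
  then have "x3 = ?z" using m0 l0 K x bK Q.integral[of b x3] by (auto simp: a_minus_def)
  show ?thesis using x1l l0 \<open>x0 = m\<close> m0 \<open>x2 = ?z\<close> \<open>x3 = ?z\<close> by simp
qed

text \<open>If \<open>b\<close> is a norm from \<open>K(\<surd>a)\<close>, then \<open>i\<close> and \<open>j\<close> act on \<open>K(\<surd>a)\<close> as multiplication by \<open>\<surd>a\<close> and as
  conjugation followed by multiplication by an element of norm \<open>b\<close>. This is the regular matrix representation.\<close>

lemma split_quat_brauer_equiv:
  assumes K: "a \<in> carrier (Qp p)" "P \<in> carrier (Qp p)" "R \<in> carrier (Qp p)" "a \<noteq> \<zero>\<^bsub>Qp p\<^esub>"
    and b: "b = P \<otimes>\<^bsub>Qp p\<^esub> P \<ominus>\<^bsub>Qp p\<^esub> a \<otimes>\<^bsub>Qp p\<^esub> (R \<otimes>\<^bsub>Qp p\<^esub> R)" "b \<noteq> \<zero>\<^bsub>Qp p\<^esub>"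
  shows "brauer_equiv (Qp p) (quat a b) trivial_cyc"
proof -
  interpret U: unramified p 1 "unit_ext p" id by (rule unramified_unit_ext)
  have bK: "b \<in> carrier (Qp p)" using K by (simp add: b)
  interpret A: assoc_algebra "Qp p" "quat a b" by (rule assoc_algebra_quat[OF K(1) bK])
  have a1: "[(p ^ 0)] \<cdot>\<^bsub>unit_ext p\<^esub> \<one>\<^bsub>unit_ext p\<^esub> = U.rat_L (of_nat (p ^ 0))" by (rule U.rat_L_of_nat)
  have preC: "pre_algebra (Qp p) trivial_cyc" unfolding a1 by (rule U.pre_algebra_cyc[OF U.rat_L_closed])
  interpret C: assoc_algebra "Qp p" trivial_cyc
    by (rule pre_algebra.assoc_algebra_iso[OF preC assoc_base_algebra coeff_emb_iso])
  have dimC: "alg_dim (Qp p) trivial_cyc 1 (carrier trivial_cyc)"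
    using U.dim_cyc[of "U.rat_L (of_nat (p ^ 0))"] C.assoc_algebra_axioms unfolding a1 by simp
  let ?M = "matrix_algebra 2 trivial_cyc"
  interpret M: assoc_algebra "Qp p" ?M by (rule C.assoc_algebra_matrix) simp
  have dimM: "alg_dim (Qp p) ?M (2 * 2) (carrier ?M)"
    using C.dim_matrix_algebra[OF _ dimC, of 2] by (simp del: matrix_simps)
  note ED = algebra_isoD[OF coeff_emb_iso]
  have B: "carrier (base_algebra (Qp p)) = carrier (Qp p)" "monoid.mult (base_algebra (Qp p)) = monoid.mult (Qp p)"
    "ring.add (base_algebra (Qp p)) = ring.add (Qp p)" "module.smult (base_algebra (Qp p)) = monoid.mult (Qp p)"
    "\<one>\<^bsub>base_algebra (Qp p)\<^esub> = \<one>\<^bsub>Qp p\<^esub>"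
    by (simp_all add: base_algebra_def)
  note ED = ED[unfolded B]
  define e where "e = split_matrix a P R"
  have eK: "e x i j \<in> carrier (Qp p)" if "x \<in> carrier (quat a b)" for x i j
    using that K(1-3)
    by (cases "i = 0"; cases "j = 0") (auto elim!: quat_cases simp: e_def split_matrix_def)
  define \<rho> where "\<rho> = (\<lambda>x. \<lambda>(i, j)\<in>square 2. coeff_emb (e x i j))"
  have \<rho>_entry: "\<rho> x (i, j) = coeff_emb (e x i j)" if "i < 2" "j < 2" for x i j
    using that by (simp add: \<rho>_def)
  have \<rho>C: "\<rho> x \<in> square 2 \<rightarrow>\<^sub>E carrier trivial_cyc" if "x \<in> carrier (quat a b)" for x
    using ED(2)[OF eK[OF that]] by (auto simp: \<rho>_def)
  have e_add: "e (x \<oplus>\<^bsub>quat a b\<^esub> y) i j = e x i j \<oplus>\<^bsub>Qp p\<^esub> e y i j"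
    if "x \<in> carrier (quat a b)" "y \<in> carrier (quat a b)" for x y i j
    using that K(1-3) by (auto elim!: quat_reps Qp_cases simp: e_def split_matrix_def quat_simps(5) cls_simps algebra_simps)
  have e_scale: "e (c \<odot>\<^bsub>quat a b\<^esub> x) i j = c \<otimes>\<^bsub>Qp p\<^esub> e x i j"
    if "c \<in> carrier (Qp p)" "x \<in> carrier (quat a b)" for c x i j
    using that K(1-3) by (auto elim!: quat_reps Qp_cases simp: e_def split_matrix_def quat_simps(6) cls_simps algebra_simps)
  have e_mult: "e (x \<otimes>\<^bsub>quat a b\<^esub> y) i j = e x i 0 \<otimes>\<^bsub>Qp p\<^esub> e y 0 j \<oplus>\<^bsub>Qp p\<^esub> e x i 1 \<otimes>\<^bsub>Qp p\<^esub> e y 1 j"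
    if "x \<in> carrier (quat a b)" "y \<in> carrier (quat a b)" for x y i j
    using that K(1-3) unfolding b(1)
    by (auto elim!: quat_reps Qp_cases simp: e_def split_matrix_def quat_simps(2) cls_simps algebra_simps)
  have \<rho>_add: "\<rho> (x \<oplus>\<^bsub>quat a b\<^esub> y) = \<rho> x \<oplus>\<^bsub>?M\<^esub> \<rho> y"
    if "x \<in> carrier (quat a b)" "y \<in> carrier (quat a b)" for x y
  proof (rule C.matrix_eq)
    show "\<rho> (x \<oplus>\<^bsub>quat a b\<^esub> y) \<in> square 2 \<rightarrow>\<^sub>E carrier trivial_cyc" using \<rho>C A.a_closed that by blast
    show "\<rho> x \<oplus>\<^bsub>?M\<^esub> \<rho> y \<in> square 2 \<rightarrow>\<^sub>E carrier trivial_cyc"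
      using M.a_closed[of "\<rho> x" "\<rho> y"] \<rho>C that by (simp only: matrix_simps(1))
    fix i j :: nat assume ij: "i < 2" "j < 2"
    have "(\<rho> x \<oplus>\<^bsub>?M\<^esub> \<rho> y) (i, j) = \<rho> x (i, j) \<oplus>\<^bsub>trivial_cyc\<^esub> \<rho> y (i, j)" using ij by simp
    then show "\<rho> (x \<oplus>\<^bsub>quat a b\<^esub> y) (i, j) = (\<rho> x \<oplus>\<^bsub>?M\<^esub> \<rho> y) (i, j)"
      using ij that by (simp only: \<rho>_entry e_add ED(4) eK)
  qed
  have \<rho>_scale: "\<rho> (c \<odot>\<^bsub>quat a b\<^esub> x) = c \<odot>\<^bsub>?M\<^esub> \<rho> x"
    if "c \<in> carrier (Qp p)" "x \<in> carrier (quat a b)" for c x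
  proof (rule C.matrix_eq)
    show "\<rho> (c \<odot>\<^bsub>quat a b\<^esub> x) \<in> square 2 \<rightarrow>\<^sub>E carrier trivial_cyc" using \<rho>C A.scale_closed that by blast
    show "c \<odot>\<^bsub>?M\<^esub> \<rho> x \<in> square 2 \<rightarrow>\<^sub>E carrier trivial_cyc"
      using M.scale_closed[of c "\<rho> x"] \<rho>C that by (simp only: matrix_simps(1))
    fix i j :: nat assume ij: "i < 2" "j < 2"
    have "(c \<odot>\<^bsub>?M\<^esub> \<rho> x) (i, j) = c \<odot>\<^bsub>trivial_cyc\<^esub> \<rho> x (i, j)" using ij by simp
    then show "\<rho> (c \<odot>\<^bsub>quat a b\<^esub> x) (i, j) = (c \<odot>\<^bsub>?M\<^esub> \<rho> x) (i, j)"
      using ij that by (simp only: \<rho>_entry e_scale ED(6) eK)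
  qed
  have \<rho>_mult: "\<rho> (x \<otimes>\<^bsub>quat a b\<^esub> y) = \<rho> x \<otimes>\<^bsub>?M\<^esub> \<rho> y"
    if xy: "x \<in> carrier (quat a b)" "y \<in> carrier (quat a b)" for x y
  proof (rule C.matrix_eq)
    show "\<rho> (x \<otimes>\<^bsub>quat a b\<^esub> y) \<in> square 2 \<rightarrow>\<^sub>E carrier trivial_cyc" using \<rho>C A.mult_closed that by blast
    show "\<rho> x \<otimes>\<^bsub>?M\<^esub> \<rho> y \<in> square 2 \<rightarrow>\<^sub>E carrier trivial_cyc"
      by (rule C.matrix_mult_closed[OF \<rho>C \<rho>C]) (rule xy)+
    fix i j :: nat assume ij: "i < 2" "j < 2"
    let ?g = "\<lambda>l. coeff_emb (e x i l \<otimes>\<^bsub>Qp p\<^esub> e y l j)"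
    have gC: "?g l \<in> carrier trivial_cyc" for l by (rule ED(2)) (simp add: eK xy)
    have "(\<rho> x \<otimes>\<^bsub>?M\<^esub> \<rho> y) (i, j) = finsum trivial_cyc ?g {..<2}"
    proof (rule C.matrix_mult_entry[OF ij \<rho>C[OF xy(1)] \<rho>C[OF xy(2)]])
      fix l :: nat assume l: "l < 2"
      show "?g l = \<rho> x (i, l) \<otimes>\<^bsub>trivial_cyc\<^esub> \<rho> y (l, j)"
        using ij l xy by (simp only: \<rho>_entry ED(3) eK)
    qed
    also have "\<dots> = ?g 0 \<oplus>\<^bsub>trivial_cyc\<^esub> ?g 1"
    proof -
      have "{..<2::nat} = insert 0 (insert 1 {})" by auto
      then have "finsum trivial_cyc ?g {..<2} = finsum trivial_cyc ?g (insert 0 (insert 1 {}))" by (simp only:)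
      also have "\<dots> = ?g 0 \<oplus>\<^bsub>trivial_cyc\<^esub> finsum trivial_cyc ?g (insert 1 {})"
        using gC by (intro C.finsum_insert) auto
      also have "finsum trivial_cyc ?g (insert 1 {}) = ?g 1 \<oplus>\<^bsub>trivial_cyc\<^esub> finsum trivial_cyc ?g {}"
        using gC by (intro C.finsum_insert) auto
      also have "\<dots> = ?g 1" using gC[of 1] by (simp only: C.finsum_empty C.r_zero)
      finally show ?thesis .
    qed
    also have "\<dots> = coeff_emb (e x i 0 \<otimes>\<^bsub>Qp p\<^esub> e y 0 j \<oplus>\<^bsub>Qp p\<^esub> e x i 1 \<otimes>\<^bsub>Qp p\<^esub> e y 1 j)"
      using xy by (simp only: ED(4) eK Q.m_closed)
    finally show "\<rho> (x \<otimes>\<^bsub>quat a b\<^esub> y) (i, j) = (\<rho> x \<otimes>\<^bsub>?M\<^esub> \<rho> y) (i, j)"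
      using ij xy by (simp only: \<rho>_entry e_mult)
  qed
  have E0: "coeff_emb \<zero>\<^bsub>Qp p\<^esub> = \<zero>\<^bsub>trivial_cyc\<^esub>"
    using ED(4)[of "\<zero>\<^bsub>Qp p\<^esub>" "\<zero>\<^bsub>Qp p\<^esub>"] ED(2)[of "\<zero>\<^bsub>Qp p\<^esub>"] by (intro C.additive_zero) simp_all
  have \<rho>_one: "\<rho> \<one>\<^bsub>quat a b\<^esub> = \<one>\<^bsub>?M\<^esub>"
  proof (rule C.matrix_eq)
    show "\<rho> \<one>\<^bsub>quat a b\<^esub> \<in> square 2 \<rightarrow>\<^sub>E carrier trivial_cyc" by (rule \<rho>C[OF A.one_closed])
    show "\<one>\<^bsub>?M\<^esub> \<in> square 2 \<rightarrow>\<^sub>E carrier trivial_cyc" using M.one_closed by (simp only: matrix_simps(1))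
    fix i j :: nat assume ij: "i < 2" "j < 2"
    have "e \<one>\<^bsub>quat a b\<^esub> i j = (if i = j then \<one>\<^bsub>Qp p\<^esub> else \<zero>\<^bsub>Qp p\<^esub>)"
      using ij K(1-3) by (auto simp: e_def split_matrix_def quat_simps(3) a_minus_def)
    then have "\<rho> \<one>\<^bsub>quat a b\<^esub> (i, j) = (if i = j then \<one>\<^bsub>trivial_cyc\<^esub> else \<zero>\<^bsub>trivial_cyc\<^esub>)"
      using ij by (simp only: \<rho>_entry ED(5) E0 if_distrib[of coeff_emb] split: if_split)
    then show "\<rho> \<one>\<^bsub>quat a b\<^esub> (i, j) = \<one>\<^bsub>?M\<^esub> (i, j)" using ij by (simp add: matrix_simps(3))
  qed
  have E_inj: "x = y" if "x \<in> carrier (Qp p)" "y \<in> carrier (Qp p)" "coeff_emb x = coeff_emb y" for x y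
    using that ED(1) by (meson bij_betw_imp_inj_on inj_onD)
  have inj: "inj_on \<rho> (carrier (quat a b))"
  proof (rule inj_onI)
    fix x y assume xy: "x \<in> carrier (quat a b)" "y \<in> carrier (quat a b)" "\<rho> x = \<rho> y"
    define d where "d = x \<ominus>\<^bsub>quat a b\<^esub> y"
    have d: "d \<in> carrier (quat a b)" "d \<oplus>\<^bsub>quat a b\<^esub> y = x"
      using xy by (simp_all add: d_def a_minus_def A.a_assoc A.l_neg)
    have "e d i j = \<zero>\<^bsub>Qp p\<^esub>" if ij: "i < 2" "j < 2" for i j
    proof -
      have "coeff_emb (e x i j) = coeff_emb (e y i j)" using xy(3) ij by (metis \<rho>_entry)
      then have "e x i j = e y i j" using E_inj eK xy by blast
      then have "e d i j \<oplus>\<^bsub>Qp p\<^esub> e y i j = \<zero>\<^bsub>Qp p\<^esub> \<oplus>\<^bsub>Qp p\<^esub> e y i j"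
        using e_add[OF d(1) xy(2), of i j] d(2) eK[OF xy(2)] by simp
      then show ?thesis using Q.add.right_cancel[of "e y i j" "e d i j" "\<zero>\<^bsub>Qp p\<^esub>"] eK[OF xy(2)] eK[OF d(1)] by simp
    qed
    moreover obtain x0 x1 x2 x3 where d': "d = (x0, x1, x2, x3)" "x0 \<in> carrier (Qp p)" "x1 \<in> carrier (Qp p)"
      "x2 \<in> carrier (Qp p)" "x3 \<in> carrier (Qp p)" using d(1) by (rule quat_cases)
    ultimately have "d = \<zero>\<^bsub>quat a b\<^esub>"
      using split_matrix_inj[OF K b(2)[unfolded b(1)] d'(2-5)] by (simp add: e_def quat_simps(4))
    then show "x = y" using d(2) xy(2) by simp
  qed
  have "alg_dim (Qp p) ?M (2 * 2) (\<rho> ` carrier (quat a b))"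
  proof (rule dim_image[OF A.assoc_algebra_axioms M.assoc_algebra_axioms dim_quat[OF K(1) bK]])
    show "\<rho> x \<in> carrier ?M" if "x \<in> carrier (quat a b)" for x using \<rho>C[OF that] by (simp only: matrix_simps(1))
  qed (use \<rho>_add \<rho>_scale inj in blast)+
  then have "\<rho> ` carrier (quat a b) = carrier ?M"
    by (rule M.dim_full_subspace[OF dimM]) (rule image_subsetI, simp only: matrix_simps(1) \<rho>C)
  then have "bij_betw \<rho> (carrier (quat a b)) (carrier ?M)" using inj by (simp only: bij_betw_def simp_thms)
  then have "\<rho> \<in> algebra_iso (Qp p) (quat a b) ?M"
    using \<rho>_mult \<rho>_add \<rho>_one \<rho>_scale by (intro algebra_isoI)
  then have "\<rho> \<circ> (\<lambda>M. M (0, 0)) \<in> algebra_iso (Qp p) (matrix_algebra 1 (quat a b)) ?M"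
    by (rule algebra_iso_comp[OF A.matrix_algebra_one_iso])
  then have ne: "algebra_iso (Qp p) (matrix_algebra 1 (quat a b)) ?M \<noteq> {}" by blast
  show ?thesis unfolding brauer_equiv_def
    by (rule exI[of _ "1::nat"], rule conjI[OF zero_less_one], rule exI[of _ "2::nat"],
      rule conjI[OF zero_less_numeral], rule ne)
qed

text \<open>One presentation with \<open>r = 0\<close> is known by the previous lemma. The other ones
  have the same invariant: the left ideal of dimension 2 yields a module of dimension \<open>n\<close>
  over any equivalent cyclic algebra of degree \<open>n\<close>, and therefore \<open>n\<close> divides
  \<open>r\<close>.\<close>

theorem local_inv_split_quat:
  assumes K: "a \<in> carrier (Qp p)" "P \<in> carrier (Qp p)" "R \<in> carrier (Qp p)" "a \<noteq> \<zero>\<^bsub>Qp p\<^esub>"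
    and b: "b = P \<otimes>\<^bsub>Qp p\<^esub> P \<ominus>\<^bsub>Qp p\<^esub> a \<otimes>\<^bsub>Qp p\<^esub> (R \<otimes>\<^bsub>Qp p\<^esub> R)" "b \<noteq> \<zero>\<^bsub>Qp p\<^esub>"
  shows "local_inv p (quat a b) = 0"
  unfolding local_inv_def
proof (rule some_equality)
  interpret U: unramified p 1 "unit_ext p" id by (rule unramified_unit_ext)
  have "(0 :: rat_mod_int) = mod_int (of_nat 0 / of_nat 1)" using mod_int_eq_0_iff[of 0] by simp
  then show "\<exists>n r. \<exists>L :: (padic, nat \<Rightarrow> padic) module. \<exists>\<sigma>. 0 < n \<and> unramified_extension p n L \<and> is_frobenius p L \<sigma> \<and>
      brauer_equiv (Qp p) (quat a b) (cyclic_algebra L n \<sigma> ([(p ^ r)] \<cdot>\<^bsub>L\<^esub> \<one>\<^bsub>L\<^esub>)) \<and> 0 = mod_int (of_nat r / of_nat n)"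
    using U.n_pos U.unram U.frob split_quat_brauer_equiv[OF K b] by blast
next
  have bK: "b \<in> carrier (Qp p)" using K by (simp add: b)
  interpret A: assoc_algebra "Qp p" "quat a b" by (rule assoc_algebra_quat[OF K(1) bK])
  fix t assume "\<exists>n r. \<exists>L :: (padic, nat \<Rightarrow> padic) module. \<exists>\<sigma>. 0 < n \<and> unramified_extension p n L \<and> is_frobenius p L \<sigma> \<and>
      brauer_equiv (Qp p) (quat a b) (cyclic_algebra L n \<sigma> ([(p ^ r)] \<cdot>\<^bsub>L\<^esub> \<one>\<^bsub>L\<^esub>)) \<and> t = mod_int (of_nat r / of_nat n)"
  then obtain n r \<sigma> and L :: "(padic, nat \<Rightarrow> padic) module" where
    n: "0 < n" "unramified_extension p n L" "is_frobenius p L \<sigma>"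
    and br: "brauer_equiv (Qp p) (quat a b) (cyclic_algebra L n \<sigma> ([(p ^ r)] \<cdot>\<^bsub>L\<^esub> \<one>\<^bsub>L\<^esub>))"
    and t: "t = mod_int (of_nat r / of_nat n)" by blast
  interpret U: unramified p n L \<sigma> using n by unfold_locales
  define C where "C = U.cyc (U.rat_L (of_nat p ^ r))"
  have C: "cyclic_algebra L n \<sigma> ([(p ^ r)] \<cdot>\<^bsub>L\<^esub> \<one>\<^bsub>L\<^esub>) = C" by (simp add: C_def U.rat_L_of_nat)
  obtain m q h where mq: "m > 0" "q > 0" and h: "h \<in> algebra_iso (Qp p) (matrix_algebra m (quat a b)) (matrix_algebra q C)"
    using br unfolding C brauer_equiv_def by blast
  have preC: "pre_algebra (Qp p) C" unfolding C_def by (rule U.pre_algebra_cyc[OF U.rat_L_closed])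
  interpret C: pre_algebra "Qp p" C by (rule preC)
  have dimC: "alg_dim (Qp p) C (n * n) (carrier C)" if "assoc_algebra (Qp p) C"
    using U.dim_cyc that by (simp add: C_def)
  note I = split_quat_left_ideal[OF K(1-3) b(1)]
  obtain W where W: "assoc_algebra (Qp p) C" "assoc_algebra (Qp p) (matrix_algebra q C)"
    "alg_dim (Qp p) (matrix_algebra q C) n W"
    "\<And>b w. b \<in> carrier C \<Longrightarrow> w \<in> W \<Longrightarrow> single q C 0 0 b \<otimes>\<^bsub>matrix_algebra q C\<^esub> w \<in> W"
    "\<And>w. w \<in> W \<Longrightarrow> single q C 0 0 \<one>\<^bsub>C\<^esub> \<otimes>\<^bsub>matrix_algebra q C\<^esub> w = w"
    by (rule brauer_equiv_transfer_module[OF A.assoc_algebra_axioms preC mq h dim_quat[OF K(1) bK] dimC I(1) I(2)]; blast)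
  have "n dvd r"
  proof (rule U.minimal_module_imp_dvd[OF W(2,3), of r "single q C 0 0", folded C_def])
    show "single q C 0 0 f \<in> carrier (matrix_algebra q C)" if "f \<in> carrier C" for f
      using C.single_closed[OF that] by (simp only: matrix_simps(1))
    show "single q C 0 0 (f \<otimes>\<^bsub>C\<^esub> g) = single q C 0 0 f \<otimes>\<^bsub>matrix_algebra q C\<^esub> single q C 0 0 g"
      if "f \<in> carrier C" "g \<in> carrier C" for f g
      using C.single_mult_single[OF that mq(2) mq(2), of 0 0] by (simp only: simp_thms if_True)
    show "single q C 0 0 (f \<oplus>\<^bsub>C\<^esub> g) = single q C 0 0 f \<oplus>\<^bsub>matrix_algebra q C\<^esub> single q C 0 0 g"
      if "f \<in> carrier C" "g \<in> carrier C" for f g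
      by (rule C.single_add[OF that])
    show "single q C 0 0 (c \<odot>\<^bsub>C\<^esub> f) = c \<odot>\<^bsub>matrix_algebra q C\<^esub> single q C 0 0 f"
      if "c \<in> carrier (Qp p)" "f \<in> carrier C" for c f
      by (rule C.single_scale[OF that(2,1)])
    show "single q C 0 0 f \<otimes>\<^bsub>matrix_algebra q C\<^esub> w \<in> W" if "f \<in> carrier C" "w \<in> W" for f w
      by (rule W(4)[OF that])
    show "single q C 0 0 \<one>\<^bsub>C\<^esub> \<otimes>\<^bsub>matrix_algebra q C\<^esub> w = w" if "w \<in> W" for w
      by (rule W(5)[OF that])
  qed
  then obtain s where "r = n * s" by (rule dvdE)
  then have "(of_nat r / of_nat n :: rat) = of_nat s" using n(1) by simp
  then show "t = 0" unfolding t mod_int_eq_0_iff by simp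
qed

end

context rational_prime
begin

subsection \<open>A ramified quaternion algebra\<close>

text \<open>In \<open>(a, k)\<close> the element \<open>i + ij\<close> anticommutes with
  \<open>j\<close> and its square is \<open>a (1 - k)\<close>.\<close>

lemma quat_iso_change:
  assumes a: "a \<in> carrier (Qp p)" and k: "(k::int) \<noteq> 1"
  shows "(\<lambda>(x0, x1, x2, x3). (x0, x1 \<oplus>\<^bsub>Qp p\<^esub> emb (of_int k) \<otimes>\<^bsub>Qp p\<^esub> x3, x2, x1 \<oplus>\<^bsub>Qp p\<^esub> x3))
    \<in> algebra_iso (Qp p) (quat (a \<otimes>\<^bsub>Qp p\<^esub> emb (of_int (1 - k))) (emb (of_int k))) (quat a (emb (of_int k)))"
    (is "?g \<in> algebra_iso _ ?A ?B")
proof (rule algebra_isoI)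
  define u :: rat where "u = 1 / of_int (1 - k)"
  define g' where "g' = (\<lambda>(x0 :: padic, x1, x2 :: padic, x3). (x0, x3 \<ominus>\<^bsub>Qp p\<^esub> emb u \<otimes>\<^bsub>Qp p\<^esub> (x3 \<ominus>\<^bsub>Qp p\<^esub> x1), x2, emb u \<otimes>\<^bsub>Qp p\<^esub> (x3 \<ominus>\<^bsub>Qp p\<^esub> x1)))"
  have u: "u * (1 - of_int k) = 1" using k by (simp add: u_def)
  have inv: "emb (of_int (1 - k)) \<otimes>\<^bsub>Qp p\<^esub> (emb u \<otimes>\<^bsub>Qp p\<^esub> x) = x"
    "emb u \<otimes>\<^bsub>Qp p\<^esub> (emb (of_int (1 - k)) \<otimes>\<^bsub>Qp p\<^esub> x) = x" if "x \<in> carrier (Qp p)" for x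
  proof -
    have "emb (of_int (1 - k)) \<otimes>\<^bsub>Qp p\<^esub> emb u = \<one>\<^bsub>Qp p\<^esub>" "emb u \<otimes>\<^bsub>Qp p\<^esub> emb (of_int (1 - k)) = \<one>\<^bsub>Qp p\<^esub>"
      using u by (simp_all add: emb_mult[symmetric] emb_1 mult.commute)
    then show "emb (of_int (1 - k)) \<otimes>\<^bsub>Qp p\<^esub> (emb u \<otimes>\<^bsub>Qp p\<^esub> x) = x"
      "emb u \<otimes>\<^bsub>Qp p\<^esub> (emb (of_int (1 - k)) \<otimes>\<^bsub>Qp p\<^esub> x) = x"
      using that by (simp_all only: Q.m_assoc[symmetric] emb_closed Q.l_one)
  qed
  have r: "x \<oplus>\<^bsub>Qp p\<^esub> y \<ominus>\<^bsub>Qp p\<^esub> (x \<oplus>\<^bsub>Qp p\<^esub> emb (of_int k) \<otimes>\<^bsub>Qp p\<^esub> y) = emb (of_int (1 - k)) \<otimes>\<^bsub>Qp p\<^esub> y"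
    "x \<oplus>\<^bsub>Qp p\<^esub> y \<ominus>\<^bsub>Qp p\<^esub> y = x" "x \<ominus>\<^bsub>Qp p\<^esub> y \<oplus>\<^bsub>Qp p\<^esub> y = x" "x \<ominus>\<^bsub>Qp p\<^esub> (x \<ominus>\<^bsub>Qp p\<^esub> y) = y"
    "x \<ominus>\<^bsub>Qp p\<^esub> y \<oplus>\<^bsub>Qp p\<^esub> emb (of_int k) \<otimes>\<^bsub>Qp p\<^esub> y = x \<ominus>\<^bsub>Qp p\<^esub> emb (of_int (1 - k)) \<otimes>\<^bsub>Qp p\<^esub> y"
    if "x \<in> carrier (Qp p)" "y \<in> carrier (Qp p)" for x y
    using that by (auto elim!: Qp_cases simp: cls_simps emb_def algebra_simps)
  show "bij_betw ?g (carrier ?A) (carrier ?B)"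
  proof (rule bij_betw_byWitness[where f'=g'])
    show "\<forall>x\<in>carrier ?A. g' (?g x) = x" "\<forall>x\<in>carrier ?B. ?g (g' x) = x"
      by (auto elim!: quat_cases simp: g'_def r inv simp del: of_int_diff)
    show "?g ` carrier ?A \<subseteq> carrier ?B" "g' ` carrier ?B \<subseteq> carrier ?A"
      by (auto simp: quat_simps(1) g'_def)
  qed
  obtain sa where sa: "is_cauchy sa" "a = cls sa" using a by (rule Qp_cases)
  fix x y assume "x \<in> carrier ?A" "y \<in> carrier ?A"
  then show "?g (x \<otimes>\<^bsub>?A\<^esub> y) = ?g x \<otimes>\<^bsub>?B\<^esub> ?g y" "?g (x \<oplus>\<^bsub>?A\<^esub> y) = ?g x \<oplus>\<^bsub>?B\<^esub> ?g y"
    using sa(1) by (auto elim!: quat_reps simp: quat_simps(2-) cls_simps emb_def sa(2) algebra_simps)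
next
  show "?g \<one>\<^bsub>?A\<^esub> = \<one>\<^bsub>?B\<^esub>" by (simp add: quat_simps(3))
  fix c x assume "c \<in> carrier (Qp p)" "x \<in> carrier ?A"
  then show "?g (c \<odot>\<^bsub>?A\<^esub> x) = c \<odot>\<^bsub>?B\<^esub> ?g x"
    by (auto elim!: quat_reps Qp_cases simp: quat_simps(6) cls_simps emb_def algebra_simps)
qed

end

lemma (in unramified) cyc_mult_two:
  assumes n: "n = 2" and a: "a \<in> carrier L" and fg: "f \<in> carrier (cyc a)" "g \<in> carrier (cyc a)"
  shows "(f \<otimes>\<^bsub>cyc a\<^esub> g) 0 = f 0 \<otimes>\<^bsub>L\<^esub> g 0 \<oplus>\<^bsub>L\<^esub> f 1 \<otimes>\<^bsub>L\<^esub> \<sigma> (g 1) \<otimes>\<^bsub>L\<^esub> a"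
    and "(f \<otimes>\<^bsub>cyc a\<^esub> g) 1 = f 0 \<otimes>\<^bsub>L\<^esub> g 1 \<oplus>\<^bsub>L\<^esub> f 1 \<otimes>\<^bsub>L\<^esub> \<sigma> (g 0)"
proof -
  have f: "f i \<in> carrier L" and g: "g i \<in> carrier L" if "i < 2" for i
    using coeff_closed[OF fg(1)[unfolded cyc_simps(1)], of i] coeff_closed[OF fg(2)[unfolded cyc_simps(1)], of i] that n
    by simp_all
  have p0: "pairs 0 = {(0, 0), (1, 1)}" and p1: "pairs 1 = {(0, 1), (1, 0)}"
    unfolding pairs_def by (auto simp: n less_2_cases_iff)
  have n01: "0 < n" "1 < n" "\<not> Suc (Suc 0) < n" using n by simp_all
  note cl = f[of 0] f[of 1] g[of 0] g[of 1] a
  have two: "finsum L (cyc_term a f g) {s, s'} = cyc_term a f g s \<oplus>\<^bsub>L\<^esub> cyc_term a f g s'"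
    if "s \<noteq> s'" "cyc_term a f g s \<in> carrier L" "cyc_term a f g s' \<in> carrier L" for s s'
    using that by (simp add: L.finsum_insert)
  have e: "(f \<otimes>\<^bsub>cyc a\<^esub> g) 0 = finsum L (cyc_term a f g) (pairs 0)"
    "(f \<otimes>\<^bsub>cyc a\<^esub> g) 1 = finsum L (cyc_term a f g) (pairs 1)" using n01 by (simp_all add: cyc_simps(2))
  show "(f \<otimes>\<^bsub>cyc a\<^esub> g) 0 = f 0 \<otimes>\<^bsub>L\<^esub> g 0 \<oplus>\<^bsub>L\<^esub> f 1 \<otimes>\<^bsub>L\<^esub> \<sigma> (g 1) \<otimes>\<^bsub>L\<^esub> a"
    unfolding e p0 using cl n01 by (subst two) (simp_all add: cyc_term_def n[symmetric] \<sigma>D(2))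
  show "(f \<otimes>\<^bsub>cyc a\<^esub> g) 1 = f 0 \<otimes>\<^bsub>L\<^esub> g 1 \<oplus>\<^bsub>L\<^esub> f 1 \<otimes>\<^bsub>L\<^esub> \<sigma> (g 0)"
    unfolding e p1 using cl n01 by (subst two) (simp_all add: cyc_term_def n[symmetric] \<sigma>D(2))
qed

context rational_prime
begin

text \<open>This is \<open>x + y \<surd>d\<close> for \<open>d = 1 - 4 c\<close>, because \<open>(2
  \<theta> - 1)\<^sup>2 = 1 - 4 c\<close>.\<close>

definition sqrt_coords :: "padic \<Rightarrow> padic \<Rightarrow> nat \<Rightarrow> padic" where
  "sqrt_coords x y = pair (x \<ominus>\<^bsub>Qp p\<^esub> y) (y \<oplus>\<^bsub>Qp p\<^esub> y)"

text \<open>The isomorphism sends \<open>i\<close> to \<open>2 \<theta> - 1\<close> and \<open>j\<close>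
  to \<open>(t + \<theta>) u\<close>. The square of the latter is the norm of \<open>t +
  \<theta>\<close> times \<open>u\<^sup>2 = p\<close>.\<close>

lemma quat_cyclic_iso:
  assumes p: "p = 2" and c: "odd c" and t: "t \<in> carrier (Qp p)"
  shows "\<exists>h. h \<in> algebra_iso (Qp p)
    (quat (emb (of_int (1 - 4 * c))) (emb (of_nat p) \<otimes>\<^bsub>Qp p\<^esub> quad_norm c t \<one>\<^bsub>Qp p\<^esub>))
    (cyclic_algebra (quad_ext c) 2 quad_conj ([(p ^ 1)] \<cdot>\<^bsub>quad_ext c\<^esub> \<one>\<^bsub>quad_ext c\<^esub>))"
    (is "\<exists>h. h \<in> algebra_iso _ ?A (cyclic_algebra ?L _ _ _)")
proof -
  interpret U: unramified p 2 ?L quad_conj by (rule unramified_quad_ext[OF p c])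
  define q where "q = U.rat_L (of_nat p)"
  have q: "q = pair (emb (of_nat p)) \<zero>\<^bsub>Qp p\<^esub>"
    by (simp add: q_def U.rat_L_def quad_ext_simps(3,6))
  have a: "[(p ^ 1)] \<cdot>\<^bsub>?L\<^esub> \<one>\<^bsub>?L\<^esub> = q" by (simp add: q_def U.rat_L_of_nat)
  have qL: "q \<in> carrier ?L" by (simp add: q_def)
  let ?C = "U.cyc q"
  define \<mu> where "\<mu> = pair t \<one>\<^bsub>Qp p\<^esub>"
  have \<mu>: "\<mu> \<in> carrier ?L" "\<mu> \<noteq> \<zero>\<^bsub>?L\<^esub>" using t by (simp_all add: \<mu>_def quad_ext_simps(4))
  then have \<mu>U: "\<mu> \<in> Units ?L" by (simp add: U.L.field_Units)
  let ?e = sqrt_coords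
  define h where "h = (\<lambda>(x0, x1, x2, x3). \<lambda>m\<in>{..<2::nat}. if m = 0 then ?e x0 x1 else \<mu> \<otimes>\<^bsub>?L\<^esub> ?e x2 x3)"
  define d1 where "d1 = (\<lambda>f :: nat \<Rightarrow> padic. emb (1 / 2) \<otimes>\<^bsub>Qp p\<^esub> f 1)"
  define d0 where "d0 = (\<lambda>f :: nat \<Rightarrow> padic. f 0 \<oplus>\<^bsub>Qp p\<^esub> d1 f)"
  have eL: "?e x y \<in> carrier ?L" if "x \<in> carrier (Qp p)" "y \<in> carrier (Qp p)" for x y
    using that by (simp add: sqrt_coords_def)
  have de: "d0 (?e x y) = x" "d1 (?e x y) = y" if "x \<in> carrier (Qp p)" "y \<in> carrier (Qp p)" for x y
    using that by (auto elim!: Qp_cases simp: sqrt_coords_def d0_def d1_def cls_simps emb_def)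
  have half: "emb (1 / 2) \<otimes>\<^bsub>Qp p\<^esub> y \<oplus>\<^bsub>Qp p\<^esub> emb (1 / 2) \<otimes>\<^bsub>Qp p\<^esub> y = y" if "y \<in> carrier (Qp p)" for y
  proof -
    have "emb (1 / 2) \<oplus>\<^bsub>Qp p\<^esub> emb (1 / 2) = \<one>\<^bsub>Qp p\<^esub>" by (simp add: emb_add[symmetric] emb_1)
    then show ?thesis using that by (simp only: Q.l_distr[symmetric] emb_closed Q.l_one)
  qed
  have add_sub: "x \<oplus>\<^bsub>Qp p\<^esub> w \<ominus>\<^bsub>Qp p\<^esub> w = x" if "x \<in> carrier (Qp p)" "w \<in> carrier (Qp p)" for x w
    using that by (auto elim!: Qp_cases simp: cls_simps)
  have dK: "d0 f \<in> carrier (Qp p)" "d1 f \<in> carrier (Qp p)" and ed: "?e (d0 f) (d1 f) = f" if fL: "f \<in> carrier ?L" for f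
  proof -
    obtain x y where f: "x \<in> carrier (Qp p)" "y \<in> carrier (Qp p)" "f = pair x y" using fL by (rule quad_ext_cases)
    show "d0 f \<in> carrier (Qp p)" "d1 f \<in> carrier (Qp p)" using f by (simp_all add: d0_def d1_def)
    show "?e (d0 f) (d1 f) = f"
      using f half[OF f(2)] by (simp add: sqrt_coords_def d0_def d1_def add_sub)
  qed
  have h0: "h (x0, x1, x2, x3) 0 = ?e x0 x1" "h (x0, x1, x2, x3) 1 = \<mu> \<otimes>\<^bsub>?L\<^esub> ?e x2 x3" for x0 x1 x2 x3
    by (simp_all add: h_def)
  have hC: "h x \<in> carrier ?C" if "x \<in> carrier ?A" for x
    using that eL \<mu>(1) by (auto elim!: quat_cases simp: h_def U.cyc_simps(1))
  have eqI: "f = g" if "f \<in> carrier ?C" "g \<in> carrier ?C" "f 0 = g 0" "f 1 = g 1" for f g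
    using that by (intro U.coeff_eqI[of f g]) (auto simp: U.cyc_simps(1) less_2_cases_iff)
  interpret C: pre_algebra "Qp p" ?C by (rule U.pre_algebra_cyc[OF qL])
  have nK: "emb (of_nat p) \<otimes>\<^bsub>Qp p\<^esub> quad_norm c t \<one>\<^bsub>Qp p\<^esub> \<in> carrier (Qp p)" using t by simp
  interpret A: assoc_algebra "Qp p" ?A by (rule assoc_algebra_quat[OF emb_closed nK])
  obtain st where st: "is_cauchy st" "t = cls st" using t by (rule Qp_cases)
  define h' where "h' = (\<lambda>f :: nat \<Rightarrow> nat \<Rightarrow> padic. (d0 (f 0), d1 (f 0), d0 (inv\<^bsub>?L\<^esub> \<mu> \<otimes>\<^bsub>?L\<^esub> f 1), d1 (inv\<^bsub>?L\<^esub> \<mu> \<otimes>\<^bsub>?L\<^esub> f 1)))"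
  have fL: "f 0 \<in> carrier ?L" "inv\<^bsub>?L\<^esub> \<mu> \<otimes>\<^bsub>?L\<^esub> f 1 \<in> carrier ?L" "f 1 \<in> carrier ?L" if "f \<in> carrier ?C" for f
  proof -
    show "f 0 \<in> carrier ?L" "f 1 \<in> carrier ?L"
      using U.coeff_closed[OF that[unfolded U.cyc_simps(1)]] by simp_all
    then show "inv\<^bsub>?L\<^esub> \<mu> \<otimes>\<^bsub>?L\<^esub> f 1 \<in> carrier ?L" using \<mu>U by (simp only: U.L.m_closed U.L.Units_inv_closed)
  qed
  have "h \<in> algebra_iso (Qp p) ?A ?C"
  proof (rule algebra_isoI)
    show "bij_betw h (carrier ?A) (carrier ?C)"
    proof (rule bij_betw_byWitness[where f'=h'])
      show "\<forall>x\<in>carrier ?A. h' (h x) = x"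
      proof
        fix x assume "x \<in> carrier ?A"
        then obtain x0 x1 x2 x3 where x: "x = (x0, x1, x2, x3)" "x0 \<in> carrier (Qp p)" "x1 \<in> carrier (Qp p)"
          "x2 \<in> carrier (Qp p)" "x3 \<in> carrier (Qp p)" by (rule quat_cases)
        have "inv\<^bsub>?L\<^esub> \<mu> \<otimes>\<^bsub>?L\<^esub> (\<mu> \<otimes>\<^bsub>?L\<^esub> ?e x2 x3) = ?e x2 x3"
          using \<mu>U \<mu>(1) eL[OF x(4,5)] by (simp only: U.L.m_assoc[symmetric] U.L.Units_inv_closed U.L.Units_l_inv U.L.l_one)
        then show "h' (h x) = x" by (simp only: h'_def h0 x(1) de x(2-))
      qed
      show "\<forall>f\<in>carrier ?C. h (h' f) = f"
      proof
        fix f assume f: "f \<in> carrier ?C"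
        have "\<mu> \<otimes>\<^bsub>?L\<^esub> (inv\<^bsub>?L\<^esub> \<mu> \<otimes>\<^bsub>?L\<^esub> f 1) = f 1"
          using \<mu>U \<mu>(1) fL(3)[OF f] by (simp only: U.L.m_assoc[symmetric] U.L.Units_inv_closed U.L.Units_r_inv U.L.l_one)
        moreover have "h' f \<in> carrier ?A" using dK fL[OF f] by (simp add: h'_def quat_simps(1))
        ultimately show "h (h' f) = f"
          using fL[OF f] by (intro eqI[OF hC f]) (simp_all only: h'_def h0 ed)
      qed
      show "h ` carrier ?A \<subseteq> carrier ?C" using hC by blast
      show "h' ` carrier ?C \<subseteq> carrier ?A"
        using dK fL by (intro image_subsetI) (simp only: h'_def quat_simps(1) mem_Times_iff fst_conv snd_conv simp_thms)
    qed
    fix x y assume xy: "x \<in> carrier ?A" "y \<in> carrier ?A"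
    note \<sigma>eq = U.cyc_mult_two[OF refl qL hC[OF xy(1)] hC[OF xy(2)]]
    show "h (x \<otimes>\<^bsub>?A\<^esub> y) = h x \<otimes>\<^bsub>?C\<^esub> h y"
    proof (rule eqI)
      show "h (x \<otimes>\<^bsub>?A\<^esub> y) \<in> carrier ?C" by (rule hC[OF A.mult_closed[OF xy]])
      show "h x \<otimes>\<^bsub>?C\<^esub> h y \<in> carrier ?C" by (rule C.mult_closed[OF hC[OF xy(1)] hC[OF xy(2)]])
      show "h (x \<otimes>\<^bsub>?A\<^esub> y) 0 = (h x \<otimes>\<^bsub>?C\<^esub> h y) 0" "h (x \<otimes>\<^bsub>?A\<^esub> y) 1 = (h x \<otimes>\<^bsub>?C\<^esub> h y) 1"
        unfolding \<sigma>eq using xy st(1)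
        by (auto elim!: quat_reps simp: quat_simps(2) h0 sqrt_coords_def \<mu>_def q st(2) quad_norm_def quad_rep_simps algebra_simps
          simp del: One_nat_def)
    qed
    show "h (x \<oplus>\<^bsub>?A\<^esub> y) = h x \<oplus>\<^bsub>?C\<^esub> h y"
    proof (rule eqI)
      show "h (x \<oplus>\<^bsub>?A\<^esub> y) \<in> carrier ?C" by (rule hC[OF A.a_closed[OF xy]])
      show "h x \<oplus>\<^bsub>?C\<^esub> h y \<in> carrier ?C" by (rule C.a_closed[OF hC[OF xy(1)] hC[OF xy(2)]])
      have "(h x \<oplus>\<^bsub>?C\<^esub> h y) m = h x m \<oplus>\<^bsub>?L\<^esub> h y m" if "m < 2" for m using that by (simp add: U.cyc_simps(5))
      from this[of 0] this[of 1] show "h (x \<oplus>\<^bsub>?A\<^esub> y) 0 = (h x \<oplus>\<^bsub>?C\<^esub> h y) 0" "h (x \<oplus>\<^bsub>?A\<^esub> y) 1 = (h x \<oplus>\<^bsub>?C\<^esub> h y) 1"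
        using xy st(1)
        by (auto elim!: quat_reps simp: quat_simps(5) h0 sqrt_coords_def \<mu>_def st(2) quad_rep_simps algebra_simps
          simp del: One_nat_def)
    qed
  next
    show "h \<one>\<^bsub>?A\<^esub> = \<one>\<^bsub>?C\<^esub>"
    proof (rule eqI)
      show "h \<one>\<^bsub>?A\<^esub> \<in> carrier ?C" by (rule hC[OF A.one_closed])
      have "?e \<zero>\<^bsub>Qp p\<^esub> \<zero>\<^bsub>Qp p\<^esub> = \<zero>\<^bsub>?L\<^esub>" "?e \<one>\<^bsub>Qp p\<^esub> \<zero>\<^bsub>Qp p\<^esub> = \<one>\<^bsub>?L\<^esub>"
        by (simp_all add: sqrt_coords_def quad_rep_simps)
      then show "h \<one>\<^bsub>?A\<^esub> 0 = \<one>\<^bsub>?C\<^esub> 0" "h \<one>\<^bsub>?A\<^esub> 1 = \<one>\<^bsub>?C\<^esub> 1"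
        using \<mu>(1) by (simp_all only: quat_simps(3) h0) (simp_all add: U.cyc_simps(3))
    qed (rule C.one_closed)
    fix b x assume bx: "b \<in> carrier (Qp p)" "x \<in> carrier ?A"
    show "h (b \<odot>\<^bsub>?A\<^esub> x) = b \<odot>\<^bsub>?C\<^esub> h x"
    proof (rule eqI)
      show "h (b \<odot>\<^bsub>?A\<^esub> x) \<in> carrier ?C" by (rule hC[OF A.scale_closed[OF bx]])
      show "b \<odot>\<^bsub>?C\<^esub> h x \<in> carrier ?C" by (rule C.scale_closed[OF bx(1) hC[OF bx(2)]])
      have "(b \<odot>\<^bsub>?C\<^esub> h x) m = b \<odot>\<^bsub>?L\<^esub> h x m" if "m < 2" for m using that by (simp add: U.cyc_simps(6))
      from this[of 0] this[of 1] show "h (b \<odot>\<^bsub>?A\<^esub> x) 0 = (b \<odot>\<^bsub>?C\<^esub> h x) 0" "h (b \<odot>\<^bsub>?A\<^esub> x) 1 = (b \<odot>\<^bsub>?C\<^esub> h x) 1"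
        using bx st(1)
        by (auto elim!: quat_reps Qp_cases simp: quat_simps(6) h0 sqrt_coords_def \<mu>_def st(2) quad_rep_simps algebra_simps
          simp del: One_nat_def)
    qed
  qed
  then show ?thesis unfolding a by blast
qed

text \<open>If the invariant were 0, then some presentation of the class would have \<open>n\<close>
  dividing \<open>r\<close>. Its cyclic algebra has a left ideal of dimension \<open>n\<close>, which
  makes the cyclic algebra of degree 2 with \<open>u\<^sup>2 = p\<close> act on a space of dimension 2.
  Then 2 would divide 1.\<close>

theorem local_inv_degree_two:
  fixes A :: "(padic, 'a) module" and L :: "(padic, nat \<Rightarrow> padic) module"
  assumes U: "unramified p 2 L \<sigma>" and A: "assoc_algebra (Qp p) A" "alg_dim (Qp p) A (2 * 2) (carrier A)"
    and g: "g \<in> algebra_iso (Qp p) A (cyclic_algebra L 2 \<sigma> ([(p ^ 1)] \<cdot>\<^bsub>L\<^esub> \<one>\<^bsub>L\<^esub>))"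
  shows "local_inv p A \<noteq> 0"
proof
  assume z: "local_inv p A = 0"
  interpret U: unramified p 2 L \<sigma> by fact
  interpret A: assoc_algebra "Qp p" A by fact
  define C0 where "C0 = U.cyc (U.rat_L (of_nat p ^ 1))"
  have C0: "cyclic_algebra L 2 \<sigma> ([(p ^ 1)] \<cdot>\<^bsub>L\<^esub> \<one>\<^bsub>L\<^esub>) = C0" by (simp add: C0_def U.rat_L_of_nat)
  note g = g[unfolded C0]
  interpret C0: pre_algebra "Qp p" C0 unfolding C0_def by (rule U.pre_algebra_cyc[OF U.rat_L_closed])
  interpret M1: pre_algebra "Qp p" "matrix_algebra 1 C0" by (rule C0.pre_algebra_matrix[OF zero_less_one])
  have "algebra_iso (Qp p) (matrix_algebra 1 A) (matrix_algebra 1 C0) \<noteq> {}"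
    using algebra_iso_comp[OF algebra_iso_comp[OF A.matrix_algebra_one_iso g] M1.algebra_iso_inv[OF C0.matrix_algebra_one_iso]]
    by blast
  then have br1: "brauer_equiv (Qp p) A (cyclic_algebra L 2 \<sigma> ([(p ^ 1)] \<cdot>\<^bsub>L\<^esub> \<one>\<^bsub>L\<^esub>))"
    unfolding brauer_equiv_def C0 using zero_less_one by blast
  have "\<exists>n r. \<exists>L :: (padic, nat \<Rightarrow> padic) module. \<exists>\<sigma>. 0 < n \<and> unramified_extension p n L \<and> is_frobenius p L \<sigma> \<and>
      brauer_equiv (Qp p) A (cyclic_algebra L n \<sigma> ([(p ^ r)] \<cdot>\<^bsub>L\<^esub> \<one>\<^bsub>L\<^esub>)) \<and> mod_int (of_nat 1 / of_nat 2) = mod_int (of_nat r / of_nat n)"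
    using U.n_pos U.unram U.frob br1 by blast
  then have "\<exists>n r. \<exists>L :: (padic, nat \<Rightarrow> padic) module. \<exists>\<sigma>. 0 < n \<and> unramified_extension p n L \<and> is_frobenius p L \<sigma> \<and>
      brauer_equiv (Qp p) A (cyclic_algebra L n \<sigma> ([(p ^ r)] \<cdot>\<^bsub>L\<^esub> \<one>\<^bsub>L\<^esub>)) \<and> local_inv p A = mod_int (of_nat r / of_nat n)"
    unfolding local_inv_def by (rule someI)
  then obtain n r \<sigma>' and L' :: "(padic, nat \<Rightarrow> padic) module" where
    n: "0 < n" "unramified_extension p n L'" "is_frobenius p L' \<sigma>'"
    and br: "brauer_equiv (Qp p) A (cyclic_algebra L' n \<sigma>' ([(p ^ r)] \<cdot>\<^bsub>L'\<^esub> \<one>\<^bsub>L'\<^esub>))"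
    and t: "mod_int (of_nat r / of_nat n) = 0" unfolding z by metis
  obtain i where "(of_nat r / of_nat n :: rat) = of_int i" using t unfolding mod_int_eq_0_iff by (rule Ints_cases)
  then have "(of_int (int r) :: rat) = of_int (i * int n)" using n(1) by (simp add: field_simps)
  then have "int r = i * int n" by (simp only: of_int_eq_iff)
  then have "n dvd r" by (metis dvd_triv_right int_dvd_int_iff)
  then obtain s where s: "r = n * s" by (rule dvdE)
  interpret V: unramified p n L' \<sigma>' using n by unfold_locales
  define C where "C = V.cyc (V.rat_L (of_nat p ^ (n * s)))"
  have C: "cyclic_algebra L' n \<sigma>' ([(p ^ r)] \<cdot>\<^bsub>L'\<^esub> \<one>\<^bsub>L'\<^esub>) = C" by (simp add: C_def V.rat_L_of_nat s)
  obtain m q h where mq: "m > 0" "q > 0" and h: "h \<in> algebra_iso (Qp p) (matrix_algebra m A) (matrix_algebra q C)"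
    using br unfolding C brauer_equiv_def by blast
  interpret C0': pre_algebra "Qp p" C unfolding C_def by (rule V.pre_algebra_cyc[OF V.rat_L_closed])
  interpret MA: assoc_algebra "Qp p" "matrix_algebra m A" by (rule A.assoc_algebra_matrix[OF mq(1)])
  have "assoc_algebra (Qp p) (matrix_algebra q C)"
    by (rule pre_algebra.assoc_algebra_iso[OF C0'.pre_algebra_matrix[OF mq(2)] MA.assoc_algebra_axioms h])
  then interpret C: assoc_algebra "Qp p" C by (rule C0'.assoc_algebra_corner[OF mq(2)])
  have dimC: "alg_dim (Qp p) C (n * n) (carrier C)"
    using V.dim_cyc C.assoc_algebra_axioms by (simp add: C_def)
  note I = V.split_left_ideal[of s, folded C_def, OF C.assoc_algebra_axioms]
  note h' = MA.algebra_iso_inv[OF h]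
  obtain W where W: "assoc_algebra (Qp p) A" "assoc_algebra (Qp p) (matrix_algebra m A)"
    "alg_dim (Qp p) (matrix_algebra m A) 2 W"
    "\<And>b w. b \<in> carrier A \<Longrightarrow> w \<in> W \<Longrightarrow> single m A 0 0 b \<otimes>\<^bsub>matrix_algebra m A\<^esub> w \<in> W"
    "\<And>w. w \<in> W \<Longrightarrow> single m A 0 0 \<one>\<^bsub>A\<^esub> \<otimes>\<^bsub>matrix_algebra m A\<^esub> w = w"
    by (rule brauer_equiv_transfer_module[OF C.assoc_algebra_axioms A.pre_algebra_axioms mq(2,1) h' dimC A(2) I(1) I(2)]; blast)
  note \<psi> = algebra_isoD[OF A.algebra_iso_inv[OF g]]
  let ?\<psi> = "inv_into (carrier A) g"
  have "2 dvd (1::nat)"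
  proof (rule U.minimal_module_imp_dvd[OF W(2,3), of 1 "\<lambda>f. single m A 0 0 (?\<psi> f)", folded C0_def])
    show "single m A 0 0 (?\<psi> f) \<in> carrier (matrix_algebra m A)" if "f \<in> carrier C0" for f
      using A.single_closed[OF \<psi>(2)[OF that]] by (simp only: matrix_simps(1))
    show "single m A 0 0 (?\<psi> (f \<otimes>\<^bsub>C0\<^esub> f')) = single m A 0 0 (?\<psi> f) \<otimes>\<^bsub>matrix_algebra m A\<^esub> single m A 0 0 (?\<psi> f')"
      if "f \<in> carrier C0" "f' \<in> carrier C0" for f f'
      using A.single_mult_single[OF \<psi>(2)[OF that(1)] \<psi>(2)[OF that(2)] mq(1) mq(1), of 0 0]
      by (simp only: simp_thms if_True \<psi>(3)[OF that])
    show "single m A 0 0 (?\<psi> (f \<oplus>\<^bsub>C0\<^esub> f')) = single m A 0 0 (?\<psi> f) \<oplus>\<^bsub>matrix_algebra m A\<^esub> single m A 0 0 (?\<psi> f')"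
      if "f \<in> carrier C0" "f' \<in> carrier C0" for f f'
      using A.single_add[OF \<psi>(2)[OF that(1)] \<psi>(2)[OF that(2)]] by (simp only: \<psi>(4)[OF that])
    show "single m A 0 0 (?\<psi> (b \<odot>\<^bsub>C0\<^esub> f)) = b \<odot>\<^bsub>matrix_algebra m A\<^esub> single m A 0 0 (?\<psi> f)"
      if "b \<in> carrier (Qp p)" "f \<in> carrier C0" for b f
      using A.single_scale[OF \<psi>(2)[OF that(2)] that(1)] by (simp only: \<psi>(6)[OF that])
    show "single m A 0 0 (?\<psi> f) \<otimes>\<^bsub>matrix_algebra m A\<^esub> w \<in> W" if "f \<in> carrier C0" "w \<in> W" for f w
      by (rule W(4)[OF \<psi>(2)[OF that(1)] that(2)])
    show "single m A 0 0 (?\<psi> \<one>\<^bsub>C0\<^esub>) \<otimes>\<^bsub>matrix_algebra m A\<^esub> w = w" if "w \<in> W" for w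
      unfolding \<psi>(5) by (rule W(5)[OF that])
  qed
  then show False by simp
qed

text \<open>The discriminant \<open>a (1 - k)\<close> is \<open>1 - 4 c\<close> with odd
  \<open>c\<close>, and \<open>k = 2 (4 j + 1)\<close>. The odd number \<open>4 j + 1\<close> is the
  norm \<open>t\<^sup>2 + t + c\<close> of \<open>t + \<theta>\<close> for a solution of
  \<open>t\<^sup>2 + t = 4 j + 1 - c\<close>, which exists as the right hand side is even.\<close>

theorem local_inv_quat_dyadic:
  assumes p: "p = 2" and a: "[a = 3] (mod 8)" and k: "[k = 2] (mod 8)"
  shows "local_inv p (quat (emb (of_int a)) (emb (of_int k))) \<noteq> 0"
proof -
  obtain i where i: "a = 8 * i + 3" using a by (metis cong_iff_lin cong_sym mult.commute add.commute)
  obtain j where j: "k = 8 * j + 2" using k by (metis cong_iff_lin cong_sym mult.commute add.commute)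
  define c where "c = 16 * i * j + 2 * i + 6 * j + 1"
  have d: "a * (1 - k) = 1 - 4 * c" by (simp add: i j c_def algebra_simps)
  have c: "odd c" by (simp add: c_def)
  define e where "e = 4 * j + 1 - c"
  have "vabs (of_int e) < 1" using c p vabs_of_int_lt_1_iff[of e] by (simp add: e_def)
  then obtain t where "t \<in> carrier (Zp p)" and t2: "t = emb 1 \<otimes>\<^bsub>Qp p\<^esub> (emb (of_int e) \<ominus>\<^bsub>Qp p\<^esub> t \<otimes>\<^bsub>Qp p\<^esub> t)"
    using hensel_quadratic[of 1 "of_int e"] vabs_of_int_le_1[of 1] by auto
  then have t: "t \<in> carrier (Qp p)" by (rule_tac Zp_closed)
  have "t \<otimes>\<^bsub>Qp p\<^esub> t \<oplus>\<^bsub>Qp p\<^esub> t = t \<otimes>\<^bsub>Qp p\<^esub> t \<oplus>\<^bsub>Qp p\<^esub> (emb (of_int e) \<ominus>\<^bsub>Qp p\<^esub> t \<otimes>\<^bsub>Qp p\<^esub> t)"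
    using t t2 by (metis Q.l_one Q.m_closed Q.minus_closed emb_1 emb_closed)
  also have "\<dots> = emb (of_int e)"
    using t by (auto elim!: Qp_cases simp: cls_simps emb_def)
  finally have tt: "t \<otimes>\<^bsub>Qp p\<^esub> t \<oplus>\<^bsub>Qp p\<^esub> t = emb (of_int e)" .
  have norm: "quad_norm c t \<one>\<^bsub>Qp p\<^esub> = emb (of_int (4 * j + 1))"
    using t tt by (simp add: quad_norm_def emb_add[symmetric] e_def)
  have k': "emb (of_nat p) \<otimes>\<^bsub>Qp p\<^esub> quad_norm c t \<one>\<^bsub>Qp p\<^esub> = emb (of_int k)"
  proof -
    have "of_nat p * of_int (4 * j + 1) = (of_int k :: rat)" by (simp add: p j)
    then show ?thesis by (simp only: norm emb_mult[symmetric])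
  qed
  have d': "emb (of_int a) \<otimes>\<^bsub>Qp p\<^esub> emb (of_int (1 - k)) = emb (of_int (1 - 4 * c))"
    by (simp only: emb_mult[symmetric] of_int_mult[symmetric] d)
  obtain h where h: "h \<in> algebra_iso (Qp p) (quat (emb (of_int (1 - 4 * c))) (emb (of_int k)))
    (cyclic_algebra (quad_ext c) 2 quad_conj ([(p ^ 1)] \<cdot>\<^bsub>quad_ext c\<^esub> \<one>\<^bsub>quad_ext c\<^esub>))"
    using quat_cyclic_iso[OF p c t] unfolding k' by blast
  interpret A: assoc_algebra "Qp p" "quat (emb (of_int (1 - 4 * c))) (emb (of_int k))"
    by (rule assoc_algebra_quat[OF emb_closed emb_closed])
  have "k \<noteq> 1" using j by presburger
  note g = A.algebra_iso_inv[OF quat_iso_change[OF emb_closed this, of "of_int a", unfolded d']]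
  show ?thesis
    by (rule local_inv_degree_two[OF unramified_quad_ext[OF p c] assoc_algebra_quat[OF emb_closed emb_closed]
      dim_quat[OF emb_closed emb_closed] algebra_iso_comp[OF g h]])
qed

end

section \<open>Local invariants at integral points\<close>

context rational_prime
begin

text \<open>For \<open>z = q + d\<close> the equation becomes \<open>d = (e - d\<^sup>2) / (2
  q)\<close>.\<close>

lemma emb_square_root:
  assumes q: "q \<noteq> 0" "vabs (2 * q) = 1" and e: "vabs e < 1"
  obtains z where "z \<in> carrier (Qp p)" "z \<otimes>\<^bsub>Qp p\<^esub> z = emb (q * q + e)"
proof -
  have w: "vabs (1 / (2 * q)) \<le> 1" by (simp add: vabs_divide q(2))
  obtain d where d: "d \<in> carrier (Zp p)" "d = emb (1 / (2 * q)) \<otimes>\<^bsub>Qp p\<^esub> (emb e \<ominus>\<^bsub>Qp p\<^esub> d \<otimes>\<^bsub>Qp p\<^esub> d)"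
    using hensel_quadratic[OF w e] by metis
  have dK: "d \<in> carrier (Qp p)" by (rule Zp_closed[OF d(1)])
  have "emb (2 * q) \<otimes>\<^bsub>Qp p\<^esub> emb (1 / (2 * q)) = \<one>\<^bsub>Qp p\<^esub>"
    using q(1) by (simp add: emb_mult[symmetric] emb_1)
  moreover have "emb (2 * q) \<otimes>\<^bsub>Qp p\<^esub> d =
      emb (2 * q) \<otimes>\<^bsub>Qp p\<^esub> emb (1 / (2 * q)) \<otimes>\<^bsub>Qp p\<^esub> (emb e \<ominus>\<^bsub>Qp p\<^esub> d \<otimes>\<^bsub>Qp p\<^esub> d)"
    using dK by (subst d(2)) (simp only: Q.m_assoc emb_closed Q.minus_closed Q.m_closed)
  ultimately have 2: "emb (2 * q) \<otimes>\<^bsub>Qp p\<^esub> d = emb e \<ominus>\<^bsub>Qp p\<^esub> d \<otimes>\<^bsub>Qp p\<^esub> d"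
    using dK by (simp only: Q.l_one emb_closed Q.minus_closed Q.m_closed)
  have "(emb q \<oplus>\<^bsub>Qp p\<^esub> d) \<otimes>\<^bsub>Qp p\<^esub> (emb q \<oplus>\<^bsub>Qp p\<^esub> d) = emb (q * q) \<oplus>\<^bsub>Qp p\<^esub> (emb (2 * q) \<otimes>\<^bsub>Qp p\<^esub> d \<oplus>\<^bsub>Qp p\<^esub> d \<otimes>\<^bsub>Qp p\<^esub> d)"
    using dK by (auto elim!: Qp_cases simp: cls_simps emb_def algebra_simps)
  also have "\<dots> = emb (q * q + e)"
    unfolding 2 using dK by (auto elim!: Qp_cases simp: cls_simps emb_def)
  finally show ?thesis using that[of "emb q \<oplus>\<^bsub>Qp p\<^esub> d"] dK by simp
qed

lemma local_inv_norm_entry: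
  fixes a k :: int
  assumes "a \<noteq> 0" "k \<noteq> 0" "P \<in> carrier (Qp p)" "R \<in> carrier (Qp p)"
    "emb (of_int k) = P \<otimes>\<^bsub>Qp p\<^esub> P \<ominus>\<^bsub>Qp p\<^esub> emb (of_int a) \<otimes>\<^bsub>Qp p\<^esub> (R \<otimes>\<^bsub>Qp p\<^esub> R)"
  shows "local_inv p (quat (emb (of_int a)) (emb (of_int k))) = 0"
  by (rule local_inv_split_quat[OF emb_closed assms(3,4) _ assms(5)]) (use assms(1,2) in simp_all)

text \<open>A number that is 1 modulo 8 is a dyadic square, so \<open>a + k = w\<^sup>2\<close> and
  \<open>k = w\<^sup>2 - a\<close>. The root is found as \<open>w = 2 z\<close> with \<open>z\<close>
  close to \<open>1/2\<close>, since twice the approximate root has to be a unit.\<close>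

lemma local_inv_dyadic_split:
  fixes a k :: int
  assumes p: "p = 2" and ak: "[a + k = 1] (mod 8)" and nz: "a \<noteq> 0" "k \<noteq> 0"
  shows "local_inv p (quat (emb (of_int a)) (emb (of_int k))) = 0"
proof -
  obtain i where i: "a + k = 8 * i + 1" using ak by (metis cong_iff_lin cong_sym mult.commute add.commute)
  have "vabs (of_int (2 * i)) < 1" unfolding vabs_of_int_lt_1_iff by (simp add: p)
  then obtain z where z: "z \<in> carrier (Qp p)" "z \<otimes>\<^bsub>Qp p\<^esub> z = emb (1 / 2 * (1 / 2) + of_int (2 * i))"
    using emb_square_root[of "1 / 2" "of_int (2 * i)"] by auto
  have "emb 2 \<otimes>\<^bsub>Qp p\<^esub> z \<otimes>\<^bsub>Qp p\<^esub> (emb 2 \<otimes>\<^bsub>Qp p\<^esub> z) = emb 4 \<otimes>\<^bsub>Qp p\<^esub> (z \<otimes>\<^bsub>Qp p\<^esub> z)"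
    using z(1) by (auto elim!: Qp_cases simp: cls_simps emb_def algebra_simps)
  also have "\<dots> = emb (of_int (a + k))"
    unfolding z(2) emb_mult[symmetric] i by simp
  finally have sq: "emb 2 \<otimes>\<^bsub>Qp p\<^esub> z \<otimes>\<^bsub>Qp p\<^esub> (emb 2 \<otimes>\<^bsub>Qp p\<^esub> z) = emb (of_int (a + k))" .
  have "emb (of_int k) = emb (of_int (a + k)) \<ominus>\<^bsub>Qp p\<^esub> emb (of_int a) \<otimes>\<^bsub>Qp p\<^esub> (\<one>\<^bsub>Qp p\<^esub> \<otimes>\<^bsub>Qp p\<^esub> \<one>\<^bsub>Qp p\<^esub>)"
    by (simp add: emb_diff[symmetric])
  then show ?thesis
    unfolding sq[symmetric] using z(1) nz by (intro local_inv_norm_entry[of _ _ "emb 2 \<otimes>\<^bsub>Qp p\<^esub> z" "\<one>\<^bsub>Qp p\<^esub>"]) simp_all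
qed

text \<open>There are \<open>(p + 1) / 2\<close> squares modulo \<open>p\<close> and as many residues of
  the form \<open>a x\<^sup>2 + k\<close>, which is too many for them to be disjoint.\<close>

lemma quadratic_residue_pigeonhole:
  fixes a k :: int
  assumes p: "p \<noteq> 2" and a: "\<not> int p dvd a"
  obtains P R :: int where "int p dvd P * P - a * (R * R) - k"
proof -
  have odd: "odd p" using prime_p p primes_dvd_imp_eq two_is_prime_nat by blast
  define h where "h = int (p div 2)"
  have h: "int p = 2 * h + 1" "h \<ge> 0" using odd by (auto simp: h_def elim!: oddE)
  have pr: "Factorial_Ring.prime (int p)" using prime_p by simp
  have sq: "x = y" if "int p dvd x * x - y * y" "x \<in> {0..h}" "y \<in> {0..h}" for x y :: int
  proof (rule ccontr)
    assume ne: "x \<noteq> y"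
    have "int p dvd (x - y) * (x + y)" using that(1) by (simp add: algebra_simps)
    then consider "int p dvd x - y" | "int p dvd x + y" using prime_dvd_multD[OF pr] by blast
    then show False
    proof cases
      case 1
      then have "\<bar>int p\<bar> \<le> \<bar>x - y\<bar>" using ne by (intro dvd_imp_le_int) auto
      then show False using that(2,3) h by auto
    next
      case 2
      have "x + y \<noteq> 0" using ne that(2,3) by auto
      then have "\<bar>int p\<bar> \<le> \<bar>x + y\<bar>" using 2 by (intro dvd_imp_le_int) auto
      then show False using that(2,3) h by auto
    qed
  qed
  define f where "f x = (x * x) mod int p" for x
  define g where "g x = (a * (x * x) + k) mod int p" for x
  have "inj_on f {0..h}"
  proof (rule inj_onI)
    fix x y assume xy: "x \<in> {0..h}" "y \<in> {0..h}" "f x = f y"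
    then have "int p dvd x * x - y * y" by (simp add: f_def mod_eq_dvd_iff)
    then show "x = y" by (rule sq[OF _ xy(1,2)])
  qed
  moreover have "inj_on g {0..h}"
  proof (rule inj_onI)
    fix x y assume xy: "x \<in> {0..h}" "y \<in> {0..h}" "g x = g y"
    then have "int p dvd a * (x * x - y * y)" by (simp add: g_def mod_eq_dvd_iff algebra_simps)
    then have "int p dvd x * x - y * y" using prime_dvd_multD[OF pr] a by blast
    then show "x = y" by (rule sq[OF _ xy(1,2)])
  qed
  ultimately have "card (f ` {0..h}) = nat (h + 1)" "card (g ` {0..h}) = nat (h + 1)" by (simp_all add: card_image)
  moreover have "f ` {0..h} \<union> g ` {0..h} \<subseteq> {0..<int p}"
    using p_pos by (auto simp: f_def g_def)
  then have "card (f ` {0..h} \<union> g ` {0..h}) \<le> p" using card_mono[of "{0..<int p}"] by fastforce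
  ultimately have "f ` {0..h} \<inter> g ` {0..h} \<noteq> {}"
    using card_Un_disjoint[of "f ` {0..h}" "g ` {0..h}"] h by auto
  then obtain P R where "f P = g R" by auto
  then have "int p dvd P * P - (a * (R * R) + k)" by (simp add: f_def g_def mod_eq_dvd_iff)
  then show ?thesis using that[of P R] by (simp add: algebra_simps)
qed

text \<open>The solution of \<open>P\<^sup>2 - a R\<^sup>2 = k\<close> modulo \<open>p\<close> lifts to
  the p-adic numbers by adjusting \<open>P\<close> if \<open>p\<close> does not divide it. Otherwise
  \<open>p\<close> does not divide \<open>R\<close>, which can be adjusted instead.\<close>

lemma local_inv_unit_entries:
  fixes a k :: int
  assumes p: "p \<noteq> 2" and a: "\<not> int p dvd a" and k: "\<not> int p dvd k"
  shows "local_inv p (quat (emb (of_int a)) (emb (of_int k))) = 0"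
proof -
  obtain P R where PR: "int p dvd P * P - a * (R * R) - k" using quadratic_residue_pigeonhole[OF p a] .
  have pr: "Factorial_Ring.prime (int p)" using prime_p by simp
  have two: "\<not> int p dvd 2"
    using p prime_p by (metis int_dvd_int_iff of_nat_numeral primes_dvd_imp_eq two_is_prime_nat)
  have nz: "a \<noteq> 0" "k \<noteq> 0" using a k by auto
  have unit: "(of_int P :: rat) \<noteq> 0 \<and> vabs (2 * of_int P) = 1" if "\<not> int p dvd P" for P
  proof -
    have "\<not> int p dvd 2 * P" using that two prime_dvd_multD[OF pr] by blast
    then have "vabs (of_int (2 * P)) = 1" by (rule vabs_of_int_coprime)
    then show ?thesis using that by auto
  qed
  show ?thesis
  proof (cases "int p dvd P")
    case False
    define E where "E = k + a * (R * R) - P * P"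
    have "int p dvd - (P * P - a * (R * R) - k)" using PR by (simp only: dvd_minus_iff)
    moreover have "- (P * P - a * (R * R) - k) = E" by (simp add: E_def)
    ultimately have "vabs (of_int E) < 1" by (simp only: vabs_of_int_lt_1_iff)
    then obtain z where z: "z \<in> carrier (Qp p)" "z \<otimes>\<^bsub>Qp p\<^esub> z = emb (of_int P * of_int P + of_int E)"
      using unit[OF False] emb_square_root by metis
    have "emb (of_int k) = z \<otimes>\<^bsub>Qp p\<^esub> z \<ominus>\<^bsub>Qp p\<^esub> emb (of_int a) \<otimes>\<^bsub>Qp p\<^esub> (emb (of_int R) \<otimes>\<^bsub>Qp p\<^esub> emb (of_int R))"
      unfolding z(2) by (simp add: emb_diff[symmetric] emb_mult[symmetric] E_def)
    then show ?thesis using z(1) nz by (intro local_inv_norm_entry[of _ _ z "emb (of_int R)"]) simp_all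
  next
    case True
    have R: "\<not> int p dvd R"
    proof
      assume "int p dvd R"
      then have "int p dvd (P * P - a * (R * R)) - (P * P - a * (R * R) - k)"
        using True by (intro dvd_diff[OF _ PR] dvd_diff dvd_mult dvd_mult2)
      then show False using k by simp
    qed
    define e :: rat where "e = of_int (P * P - a * (R * R) - k) / of_int a"
    have "vabs e < 1"
      unfolding e_def vabs_divide vabs_of_int_coprime[OF a] using PR by (simp only: vabs_of_int_lt_1_iff div_by_1)
    then obtain z where z: "z \<in> carrier (Qp p)" "z \<otimes>\<^bsub>Qp p\<^esub> z = emb (of_int R * of_int R + e)"
      using unit[OF R] emb_square_root by metis
    have "of_int a * (of_int R * of_int R + e) = (of_int (P * P - k) :: rat)"
      using nz(1) by (simp add: e_def field_simps)
    then have "emb (of_int k) = emb (of_int P) \<otimes>\<^bsub>Qp p\<^esub> emb (of_int P) \<ominus>\<^bsub>Qp p\<^esub> emb (of_int a) \<otimes>\<^bsub>Qp p\<^esub> (z \<otimes>\<^bsub>Qp p\<^esub> z)"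
      unfolding z(2) by (simp add: emb_diff[symmetric] emb_mult[symmetric])
    then show ?thesis using z(1) nz by (intro local_inv_norm_entry[of _ _ "emb (of_int P)" z]) simp_all
  qed
qed

lemma A1_at_emb:
  "A1_at k (Qp p) (emb (of_int x), y, z) = quat (emb (of_int (4 * x^2 - 1))) (emb (of_int k))"
  unfolding A1_at_def by (simp add: add_pow_int_emb emb_power[symmetric] emb_1[symmetric] emb_diff[symmetric])

lemma ring_hom_emb: "(\<lambda>n. emb (of_int n)) \<in> ring_hom int_ring (Zp p)"
  by (rule ring_hom_memI) (simp_all add: emb_add emb_mult emb_1)

end

section \<open>Points of the surface\<close>

lemma U_points_hom:
  assumes R: "ring R" and S: "ring S" and h: "h \<in> ring_hom R S" and P: "(x, y, z) \<in> U_points k R"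
  shows "(h x, h y, h z) \<in> U_points k S"
proof -
  interpret h: ring_hom_ring R S h using R S h by (rule ring_hom_ringI2)
  interpret a: group_hom "add_monoid R" "add_monoid S" h by (rule h.a_group_hom)
  have ap: "[i] \<cdot>\<^bsub>S\<^esub> h u = h ([i] \<cdot>\<^bsub>R\<^esub> u)" if "u \<in> carrier R" for i :: int and u
    unfolding add_pow_def using that by (intro a.hom_int_pow[symmetric]) simp
  have apc: "[i] \<cdot>\<^bsub>R\<^esub> u \<in> carrier R" if "u \<in> carrier R" for i :: int and u
    using that by (rule h.R.add.int_pow_closed)
  have dm: "h u \<ominus>\<^bsub>S\<^esub> h v = h (u \<ominus>\<^bsub>R\<^esub> v)" if "u \<in> carrier R" "v \<in> carrier R" for u v
    using that by (simp add: a_minus_def)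
  have xyz: "x \<in> carrier R" "y \<in> carrier R" "z \<in> carrier R" and F: "F2 R k x y z = \<zero>\<^bsub>R\<^esub>"
    using P by (auto simp: U_points_def)
  have one: "\<one>\<^bsub>S\<^esub> = h \<one>\<^bsub>R\<^esub>" by simp
  have "F2 S k (h x) (h y) (h z) = h (F2 R k x y z)"
    unfolding F2_def one using xyz
    by (simp only: ap apc dm h.hom_nat_pow[symmetric] h.hom_mult[symmetric] h.hom_add[symmetric]
      h.R.nat_pow_closed h.R.m_closed h.R.a_closed h.R.minus_closed h.R.one_closed)
  then show ?thesis using xyz F by (simp add: U_points_def)
qed

lemma U_points_int:
  "(x, y, z) \<in> U_points k int_ring \<longleftrightarrow>
    x^2 + y^2 + z^2 - 4 * (x^2 * y^2 + y^2 * z^2 + z^2 * x^2) + 16 * (x^2 * y^2 * z^2) = k"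
proof -
  have Z: "abelian_group int_ring" using int_is_cring by (simp add: cring_def ring_def)
  have m: "\<ominus>\<^bsub>int_ring\<^esub> u = - u" for u :: int by (rule abelian_group.minus_equality[OF Z]) simp_all
  have n: "[(n::nat)] \<cdot>\<^bsub>int_ring\<^esub> u = int n * u" for n and u :: int
    by (induction n) (simp_all add: add_pow_def nat_pow_def algebra_simps)
  have ap: "[i] \<cdot>\<^bsub>int_ring\<^esub> u = i * u" for i u :: int
    by (cases "i \<ge> 0") (simp_all add: add_pow_int_ge add_pow_int_lt n m)
  have p: "u [^]\<^bsub>int_ring\<^esub> (2::nat) = u^2" for u :: int
    by (simp add: nat_pow_def numeral_2_eq_2)
  show ?thesis by (simp add: U_points_def F2_def ap p a_minus_def m algebra_simps)
qed

text \<open>If all coordinates were even then 4 would divide \<open>k\<close>, and if all were odd then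
  \<open>k\<close> would be odd.\<close>

lemma U_points_int_parity:
  assumes k: "[k = 2] (mod 8)" and ne: "U_points k int_ring \<noteq> {}"
  obtains x y z where "(x, y, z) \<in> U_points k int_ring" "(y, x, z) \<in> U_points k int_ring" "even x" "odd y"
proof -
  obtain x y z where P: "(x, y, z) \<in> U_points k int_ring" using ne by auto
  obtain j where j: "k = 8 * j + 2" using k by (metis cong_iff_lin cong_sym mult.commute add.commute)
  note F = P[unfolded U_points_int]
  have "even k" "\<not> 4 dvd k" using j by presburger+
  have "even x \<or> even y \<or> even z"
  proof (rule ccontr)
    assume "\<not> ?thesis"
    then have "odd k" unfolding F[symmetric] by simp
    then show False using \<open>even k\<close> by simp
  qed
  moreover have "odd x \<or> odd y \<or> odd z"
  proof (rule ccontr)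
    assume "\<not> ?thesis"
    then obtain r s t where "x = 2 * r" "y = 2 * s" "z = 2 * t" by (auto elim!: evenE)
    then have "k = 4 * (r^2 + s^2 + t^2 - (x^2 * y^2 + y^2 * z^2 + z^2 * x^2) + 4 * (x^2 * y^2 * z^2))"
      unfolding F[symmetric] by (simp add: power_mult_distrib)
    then show False using \<open>\<not> 4 dvd k\<close> by simp
  qed
  ultimately consider "even x" "odd y" | "even x" "odd z" | "even y" "odd x" | "even y" "odd z"
    | "even z" "odd x" | "even z" "odd y" by blast
  then show ?thesis
  proof cases
    case 1 then show ?thesis using P by (intro that[of x y z]) (simp_all add: U_points_int algebra_simps)
  next
    case 2 then show ?thesis using P by (intro that[of x z y]) (simp_all add: U_points_int algebra_simps)
  next
    case 3 then show ?thesis using P by (intro that[of y x z]) (simp_all add: U_points_int algebra_simps)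
  next
    case 4 then show ?thesis using P by (intro that[of y z x]) (simp_all add: U_points_int algebra_simps)
  next
    case 5 then show ?thesis using P by (intro that[of z x y]) (simp_all add: U_points_int algebra_simps)
  next
    case 6 then show ?thesis using P by (intro that[of z y x]) (simp_all add: U_points_int algebra_simps)
  qed
qed

definition padic_point :: "nat \<Rightarrow> int \<times> int \<times> int \<Rightarrow> padic \<times> padic \<times> padic" where
  "padic_point p = map_prod (rational_prime.emb p \<circ> of_int) (map_prod (rational_prime.emb p \<circ> of_int) (rational_prime.emb p \<circ> of_int))"

theorem proposition5p3:
  fixes k :: int
  assumes "[k = 2] (mod 8)"
    and "U_points k int_ring \<noteq> {}"
  shows "A1_orthogonal k \<noteq> adelic_points k"
proof
  assume eq: "A1_orthogonal k = adelic_points k"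
  obtain x y z where xyz: "(x, y, z) \<in> U_points k int_ring" "(y, x, z) \<in> U_points k int_ring"
    and par: "even x" "odd y" using U_points_int_parity[OF assms] .
  let ?primes = "{p :: nat. Factorial_Ring.prime p}"
  define a where "a = 4 * x^2 - 1"
  have k0: "k \<noteq> 0" using assms(1) by (auto simp: cong_def)
  have a0: "a \<noteq> 0" unfolding a_def by presburger
  have padic: "padic_point p (u, v, w) \<in> U_points k (Zp p)"
    if "Factorial_Ring.prime p" "(u, v, w) \<in> U_points k int_ring" for p u v w
  proof -
    interpret rational_prime p using that(1) by unfold_locales
    show ?thesis
      using U_points_hom[OF cring.axioms(1)[OF int_is_cring] cring.axioms(1)[OF cring_Zp] ring_hom_emb that(2)]
      by (simp add: padic_point_def)
  qed
  have "real_of_int \<in> ring_hom int_ring real_field"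
    by (rule ring_hom_memI) (simp_all add: ring_of_type_algebra_def)
  from U_points_hom[OF cring.axioms(1)[OF int_is_cring] ring_from_type_algebra this xyz(1)]
  have real: "(of_int x, of_int y, of_int z) \<in> U_points k real_field" .
  define inv_at where "inv_at p P = local_inv p (A1_at k (Qp p) (padic_point p P))" for p P
  have inv_at: "inv_at p (u, v, w) = local_inv p (quaternion_algebra (Qp p)
      (rational_prime.emb p (of_int (4 * u^2 - 1))) (rational_prime.emb p (of_int k)))"
    if "Factorial_Ring.prime p" for p u v w
  proof -
    interpret rational_prime p using that(1) by unfold_locales
    show ?thesis by (simp only: inv_at_def padic_point_def map_prod_simp comp_apply A1_at_emb)
  qed
  \<comment> \<open>Outside these primes both entries are units, so the sum defining the pairing may be taken over them.\<close>
  define S where "S = {p :: nat. Factorial_Ring.prime p \<and> (p = 2 \<or> int p dvd a \<or> int p dvd k)}"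
  have S: "finite S" "2 \<in> S"
  proof -
    have "S \<subseteq> {2} \<union> {p. p dvd nat \<bar>a\<bar>} \<union> {p. p dvd nat \<bar>k\<bar>}"
      by (auto simp: S_def dvd_nat_abs_iff)
    moreover have "finite ({2} \<union> {p. p dvd nat \<bar>a\<bar>} \<union> {p. p dvd nat \<bar>k\<bar>})"
      using a0 k0 by (intro finite_UnI finite_divisors_nat) auto
    ultimately show "finite S" by (rule finite_subset)
  qed (simp add: S_def)
  have outside: "inv_at p (x, y, z) = 0" if "Factorial_Ring.prime p" "p \<notin> S" for p
  proof -
    interpret rational_prime p using that(1) by unfold_locales
    show ?thesis using that local_inv_unit_entries[of a k] by (simp add: inv_at S_def a_def)
  qed
  \<comment> \<open>The first two coordinates are exchanged at the prime 2 only.\<close>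
  define T where "T p = (if p = 2 then (y, x, z) else (x, y, z))" for p :: nat
  define P0 where "P0 = (\<lambda>p\<in>?primes. padic_point p (x, y, z))"
  define P1 where "P1 = (\<lambda>p\<in>?primes. padic_point p (T p))"
  let ?r = "(real_of_int x, real_of_int y, real_of_int z)"
  have pairing: "A1_pairing k (\<lambda>p\<in>?primes. padic_point p (Q p), ?r) =
      (\<Sum>p\<in>S. inv_at p (Q p)) + real_inv (A1_at k real_field ?r)"
    if "\<And>p. Factorial_Ring.prime p \<Longrightarrow> p \<notin> S \<Longrightarrow> inv_at p (Q p) = 0" for Q
  proof -
    let ?Q = "\<lambda>p\<in>?primes. padic_point p (Q p)"
    have I: "local_inv p (A1_at k (Qp p) (?Q p)) = inv_at p (Q p)" if "Factorial_Ring.prime p" for p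
      using that by (simp add: inv_at_def)
    have "(\<Sum>p | Factorial_Ring.prime p \<and> local_inv p (A1_at k (Qp p) (?Q p)) \<noteq> 0. local_inv p (A1_at k (Qp p) (?Q p)))
        = (\<Sum>p\<in>S. inv_at p (Q p))"
    proof (rule sum.mono_neutral_cong_left[OF S(1)])
      show "{p. Factorial_Ring.prime p \<and> local_inv p (A1_at k (Qp p) (?Q p)) \<noteq> 0} \<subseteq> S"
        using that I by auto
      show "\<forall>p\<in>S - {p. Factorial_Ring.prime p \<and> local_inv p (A1_at k (Qp p) (?Q p)) \<noteq> 0}. inv_at p (Q p) = 0"
        using I by (auto simp: S_def)
    qed (use I in auto)
    then show ?thesis by (simp add: A1_pairing_def)
  qed
  have "(P0, ?r) \<in> adelic_points k" "(P1, ?r) \<in> adelic_points k"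
    using padic[OF _ xyz(1)] padic[OF _ xyz(2)] real by (auto simp: adelic_points_def P0_def P1_def T_def)
  then have "(P0, ?r) \<in> A1_orthogonal k" "(P1, ?r) \<in> A1_orthogonal k" unfolding eq .
  then have "A1_pairing k (P0, ?r) = 0" "A1_pairing k (P1, ?r) = 0"
    unfolding A1_orthogonal_def by blast+
  moreover have "inv_at p (T p) = 0" if "Factorial_Ring.prime p" "p \<notin> S" for p
    using outside[OF that] that S(2) by (auto simp: T_def)
  ultimately have "(\<Sum>p\<in>S. inv_at p (T p)) + real_inv (A1_at k real_field ?r) =
      (\<Sum>p\<in>S. inv_at p (x, y, z)) + real_inv (A1_at k real_field ?r)"
    using pairing[of T] pairing[of "\<lambda>_. (x, y, z)"] outside unfolding P0_def P1_def by simp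
  then have "(\<Sum>p\<in>S. inv_at p (T p)) = (\<Sum>p\<in>S. inv_at p (x, y, z))" by (rule add_right_imp_eq)
  moreover have "(\<Sum>p\<in>S - {2}. inv_at p (T p)) = (\<Sum>p\<in>S - {2}. inv_at p (x, y, z))"
    by (intro sum.cong) (auto simp: T_def)
  ultimately have eq2: "inv_at 2 (y, x, z) = inv_at 2 (x, y, z)"
    by (simp add: sum.remove[OF S] T_def)
  interpret rational_prime 2 by unfold_locales simp
  obtain j where j: "k = 8 * j + 2" using assms(1) by (metis cong_iff_lin cong_sym mult.commute add.commute)
  have "inv_at 2 (x, y, z) = 0"
  proof -
    obtain i where "x = 2 * i" using par(1) by (rule evenE)
    then have "a + k - 1 = 8 * (2 * i^2 + j)" by (simp add: a_def j power_mult_distrib)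
    then have "[a + k = 1] (mod 8)" by (simp only: cong_iff_dvd_diff dvd_triv_left)
    then show ?thesis using local_inv_dyadic_split[of a k] a0 k0 by (simp add: inv_at a_def)
  qed
  moreover have "inv_at 2 (y, x, z) \<noteq> 0"
  proof -
    obtain i where "y = 2 * i + 1" using par(2) by (rule oddE)
    then have "4 * y^2 - 1 - 3 = 8 * (2 * i^2 + 2 * i)" by (simp add: power2_eq_square algebra_simps)
    then have "[4 * y^2 - 1 = 3] (mod 8)" by (simp only: cong_iff_dvd_diff dvd_triv_left)
    then show ?thesis using local_inv_quat_dyadic[OF refl _ assms(1), of "4 * y^2 - 1"] by (simp add: inv_at)
  qed
  ultimately show False using eq2 by simp
qed

end
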